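(* Let $$X=\Big\{u:\mathbb{R}^2\to\mathbb{C}:\ \int_{\mathbb{R}^2}\big(|\nabla u|^2+|u|^2+\ln(1+|x|)\,|u|^2\big)\,dx<\infty\Big\}.$$ For every $u\in X$ with $u\neq 0$, setting $\lambda=\int_{\mathbb{R}^2}|u|^2dx$, $T(u)=\int_{\mathbb{R}^2}|\nabla u|^2dx$ and $V(u)=\frac{1}{2\pi}\int_{\mathbb{R}^2}\int_{\mathbb{R}^2}\ln(|x-y|)\,|u(x)|^2|u(y)|^2\,dx\,dy$, one has $$-V(u)\le\frac{\lambda^2}{4\pi}\ln\frac{8\pi\,T(u)}{N\lambda}-\Big(\frac{I+1}{N}-\frac{1}{8\pi}\Big)\lambda^2,$$ where $N$ and $I$ are the constants defined in the context.
   Context: Let $(u_0,W)$ be the unique radial solution of $\Delta u_0=(W-1)u_0$, $\Delta W=|u_0|^2$ on $\mathbb{R}^2$ with $W(0)=W'(0)=0$, $u_0>0$ decreasing and vanishing at infinity. Then $N=\int_{\mathbb{R}^2}|u_0|^2dx$ and $I=\frac{1}{2\pi}\int_{\mathbb{R}^2}\ln(|x|)|u_0(x)|^2dx$. *)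

theory Defs
  imports "HOL-Analysis.Analysis"
begin

definition partial :: "'n::finite \<Rightarrow> (real^'n \<Rightarrow> real) \<Rightarrow> real^'n \<Rightarrow> real" where
  "partial i f x = deriv (\<lambda>t. f (x + t *\<^sub>R axis i 1)) 0"

definition Ck :: "nat \<Rightarrow> (real^'n::finite \<Rightarrow> real) \<Rightarrow> bool" where
  "Ck k f \<longleftrightarrow>
     (\<forall>is. length is \<le> k \<longrightarrow> continuous_on UNIV (foldr partial is f)) \<and>
     (\<forall>is. length is < k \<longrightarrow>
        (\<forall>i x. (\<lambda>t. foldr partial is f (x + t *\<^sub>R axis i 1)) differentiable (at 0)))"

definition smooth :: "(real^'n::finite \<Rightarrow> real) \<Rightarrow> bool" where
  "smooth f \<longleftrightarrow> (\<forall>k. Ck k f)"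

definition test_function :: "(real^'n::finite \<Rightarrow> real) \<Rightarrow> bool" where
  "test_function \<phi> \<longleftrightarrow> smooth \<phi> \<and> (\<exists>R. \<forall>x. norm x > R \<longrightarrow> \<phi> x = 0)"

definition laplacian :: "(real^'n::finite \<Rightarrow> real) \<Rightarrow> real^'n \<Rightarrow> real" where
  "laplacian f x = (\<Sum>i\<in>UNIV. partial i (partial i f) x)"

definition weak_gradient :: "('n::finite \<Rightarrow> real^'n \<Rightarrow> complex) \<Rightarrow> (real^'n \<Rightarrow> complex) \<Rightarrow> bool" where
  "weak_gradient g u \<longleftrightarrow>
     (\<forall>i. g i \<in> borel_measurable lborel) \<and>
     (\<forall>i \<phi>. test_function \<phi> \<longrightarrow>
        (LINT x|lborel. u x * complex_of_real (partial i \<phi> x))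
          = - (LINT x|lborel. g i x * complex_of_real (\<phi> x)))"

definition ground_state :: "(real^2 \<Rightarrow> real) \<Rightarrow> (real^2 \<Rightarrow> real) \<Rightarrow> bool" where
  "ground_state u W \<longleftrightarrow>
     Ck 2 u \<and> Ck 2 W \<and>
     (\<forall>x. laplacian u x = (W x - 1) * u x) \<and>
     (\<forall>x. laplacian W x = (u x)\<^sup>2) \<and>
     (\<forall>x y. norm x = norm y \<longrightarrow> u x = u y \<and> W x = W y) \<and>
     W 0 = 0 \<and> (\<forall>i. partial i W 0 = 0) \<and>
     (\<forall>x. u x > 0) \<and>
     (\<forall>x y. norm x < norm y \<longrightarrow> u y < u x) \<and>
     (u \<longlongrightarrow> 0) at_infinity"

definition u0 :: "real^2 \<Rightarrow> real" where
  "u0 = fst (THE p. ground_state (fst p) (snd p))"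

definition N_const :: real where
  "N_const = (LINT x|lborel. (u0 x)\<^sup>2)"

definition I_const :: real where
  "I_const = (1 / (2 * pi)) * (LINT x|lborel. ln (norm x) * (u0 x)\<^sup>2)"

end

theory Submission
 imports Defs "HOL-Complex_Analysis.Complex_Analysis"
begin

text \<open>
 In the variable \<open>t = ln |x|\<close> the radial problem is one dimensional: minimise
 \<open>ln (D / M) / 2 + \<Lambda> / M\<^sup>2\<close>, where \<open>D\<close> bounds the Dirichlet integral, \<open>M\<close> is the mass of
 \<open>\<rho> = f\<^sup>2 e\<^sup>2\<^sup>t\<close> and \<open>\<Lambda>\<close> is the double integral of \<open>max t s\<close> against \<open>\<rho> \<rho>\<close>.
 The pointwise limit of a minimising sequence satisfies the Euler-Lagrange equation (tested against hat
 functions), which after rescaling is the equation of the ground state. Since the ground state is unique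
 (Wronskian and Gronwall arguments), the constant of the minimum is expressed through \<open>N\<close> and \<open>I\<close>;
 only the inequality between the first moments, given by Fatou, is needed, so the infimum need not be attained.

 For Lipschitz functions of compact support one reduces to the radial case: among all functions reachable by
 polarization, a minimiser of the second moment is radially decreasing, its logarithmic energy has not
 decreased and its nonlocal Dirichlet energies have not increased. A general \<open>u\<close> is approximated by
 mollification and truncation; the singular part \<open>ln (1 + 1 / |x - y|)\<close> of the kernel passes to the limit by
 Fatou and the part \<open>ln (1 + |x - y|)\<close> by Jensen's inequality.
\<close>

text \<open>Multiplying \<open>f\<close> by a constant and shifting \<open>t\<close> leave
  \<open>ln (D / M) / 2 + \<Lambda> / M^2\<close> unchanged, so one may take
  \<open>D = M = 1\<close> and minimise \<open>\<Lambda>\<close> alone. The obstacle is loss of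
  first moment at plus infinity: the moments of the minimising sequence tend to some
  \<open>w\<close>, and the limit \<open>g\<close> has at most \<open>w\<close>. With
  \<open>L0\<close> the infimum, the limit equation carries \<open>mu = 4 L0 + 1 - 4 w\<close>, and
  the ground state obtained from \<open>g\<close> yields the constant \<open>L0 + mom g - w\<close>,
  which errs in the harmless direction. For this reason variations are made along the sequence and
  not at \<open>g\<close>. The weak gradient enters only through a bound on the double integrals of
  \<open>|w x - w y|^2\<close> over \<open>|x - y| < e\<close>. Their kernel decreases with the
  distance, as \<open>- ln |x - y|\<close> does, so one four-point inequality for polarization
  serves both energies. Truncation is by \<open>max 0 (|w| - t)\<close>, a contraction of
  \<open>w\<close>, hence without cutoff error in the Dirichlet energy; that \<open>|w|\<close>
  falls below \<open>t\<close> far out is due to the logarithmic weight.\<close>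

abbreviation (input) nn_lborel :: "('a::euclidean_space \<Rightarrow> ennreal) \<Rightarrow> ennreal" (binder "NN " 10)
 where "nn_lborel f \<equiv> nn_integral lborel f"

abbreviation (input) lborel2 :: "('a::euclidean_space \<times> 'b::euclidean_space) measure"
 where "lborel2 \<equiv> lborel \<Otimes>\<^sub>M lborel"

abbreviation (input) borel_functions :: "('a::topological_space \<Rightarrow> 'b::topological_space) set" ("\<B>")
 where "\<B> \<equiv> borel_measurable borel"

notation (input) tendsto (infixr "--->" 55)
notation (input) LIMSEQ ("((_)/ ----> (_))" [60, 60] 60)

section \<open>One-dimensional Dirichlet bounds\<close>

lemma antiderivative_real:
 fixes f :: "real => real"
 assumes "continuous_on UNIV f"
 obtains F where "\<And>x. DERIV F x :> f x"
 using einterval_antiderivative[of "-\<infinity>" "\<infinity>" f] assms that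
 by (auto simp: continuous_on_eq_continuous_at has_real_derivative_iff_has_vector_derivative)

text \<open>Encodes a bound on the integral of the squared derivative that needs no differentiability and survives
 pointwise limits.\<close>

definition Dir_le :: "(real => real) => real => bool" where
 "Dir_le f D \<longleftrightarrow> (\<forall>k>0. (NN t. ennreal ((f (t + k) - f t)^2)) <= ennreal (D*k^2))"

lemma nn_integral_shift_real:
 fixes f :: "real => ennreal"
 assumes "f \<in> \<B>"
 shows "(NN t. f (t + k)) = (NN t. f t)"
 using nn_integral_real_affine[OF assms, of 1 k] by (simp add: add.commute)

lemma integral_shift_real:
 fixes f :: "real => 'a :: {banach, second_countable_topology}"
 shows "(LBINT t. f (t + k)) = (LBINT t. f t)"
 using lborel_integral_real_affine[of 1 f k] by (simp add: add.commute)

lemma integrable_shift_real: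
 fixes f :: "real => 'a :: {banach, second_countable_topology}"
 shows "integrable lborel (\<lambda>t. f (t + k)) \<longleftrightarrow> integrable lborel f"
 using lborel_integrable_real_affine_iff[of 1 f k] by (simp add: add.commute)

text \<open>Doubling the step at most quadruples the integral, so only small steps matter.\<close>

lemma Dir_leI_small:
 fixes f :: "real => real"
 assumes f: "continuous_on UNIV f" and "D >= 0"
  and small: "\<And>e. e > 0 ==> \<exists>k0>0. \<forall>k. 0 < k \<and> k < k0 \<longrightarrow>
    (NN t. ennreal ((f (t + k) - f t)^2)) <= ennreal ((D + e)*k^2)"
 shows "Dir_le f D"
 unfolding Dir_le_def
proof (intro allI impI)
 fix k :: real assume k: "k > 0"
 define A where "A = (\<lambda>k. NN t. ennreal ((f (t + k) - f t)^2))"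
 have [measurable]: "f \<in> \<B>"
  using f by (rule borel_measurable_continuous_onI)
 have double: "A (2*k) <= 4*A k" for k
 proof -
  have "A (2*k) <= (NN t. (2*ennreal ((f (t + k + k) - f (t + k))^2)
               + 2*ennreal ((f (t + k) - f t)^2)))"
   unfolding A_def
  proof (rule nn_integral_mono)
   fix t
   have "(f (t + 2*k) - f t)^2 <= 2*(f (t + k + k) - f (t + k))^2 + 2*(f (t + k) - f t)^2"
   proof -
    have eq: "t + 2*k = t + k + k" by simp
    have "0 <= ((f (t + k + k) - f (t + k)) - (f (t + k) - f t))^2" by simp
    then show ?thesis unfolding eq by (simp add: power2_eq_square algebra_simps)
   qed
   then have "ennreal ((f (t + 2*k) - f t)^2) <= ennreal (2*(f (t + k + k) - f (t + k))^2 + 2*(f (t + k) - f t)^2)"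
    by (rule ennreal_leI)
   also have "... = 2*ennreal ((f (t + k + k) - f (t + k))^2) + 2*ennreal ((f (t + k) - f t)^2)"
    by (simp add: ennreal_plus ennreal_mult')
   finally show "ennreal ((f (t + 2*k) - f t)^2) <= 2*ennreal ((f (t + k + k) - f (t + k))^2)
               + 2*ennreal ((f (t + k) - f t)^2)" .
  qed
  also have "... = 2*(NN t. ennreal ((f (t + k + k) - f (t + k))^2)) + 2*A k"
   unfolding A_def by (subst nn_integral_add) (auto simp: nn_integral_cmult)
  also have "(NN t. ennreal ((f (t + k + k) - f (t + k))^2)) = A k"
   unfolding A_def by (rule nn_integral_shift_real[of "\<lambda>t. ennreal ((f (t + k) - f t)^2)"]) simp
  also have "2*A k + 2*A k = 4*A k"
   by (simp add: distrib_right[symmetric])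
  finally show ?thesis .
 qed
 have iter: "A k <= 4^n*A (k/2^n)" for n
 proof (induction n)
  case (Suc n)
  have "A (k/2^n) <= 4*A (k/2^Suc n)"
   using double[of "k/2^Suc n"] by simp
  then have "4^n*A (k/2^n) <= 4^n*(4*A (k/2^Suc n))"
   by (rule mult_left_mono) simp
  with Suc show ?case by (simp add: mult_ac)
 qed simp
 have "A k <= ennreal (D*k^2) + ennreal e" if e: "e > 0" for e
 proof -
  \<comment> \<open>The slack \<open>e / k^2\<close> costs exactly \<open>e\<close> at step
    \<open>k\<close>: the factor \<open>4^n\<close> from \<open>n\<close> doublings cancels the one
    in \<open>(k / 2^n)^2\<close>.\<close>
  have "e/k^2 > 0" using e k by simp
  from small[OF this] obtain k0 where k0: "k0 > 0"
   and le: "\<And>k'. 0 < k' ==> k' < k0 ==> A k' <= ennreal ((D + e/k^2)*k'^2)"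
   unfolding A_def by blast
  obtain n where n: "(1/2)^n < k0/k"
   using real_arch_pow_inv[of "k0/k" "1/2"] k k0 by auto
  have "A k <= 4^n*A (k/2^n)" by (rule iter)
  also have "... <= 4^n*ennreal ((D + e/k^2)*(k/2^n)^2)"
   using n k by (intro mult_left_mono le) (auto simp: field_simps power_divide)
  also have "... = ennreal (4^n*((D + e/k^2)*(k/2^n)^2))"
  proof -
   have "ennreal (4^n) = 4^n" by (induction n) (simp_all add: ennreal_mult)
   moreover have "(D + e/k^2)*(k/2^n)^2 >= 0" using \<open>D \<ge> 0\<close> e by simp
   ultimately show ?thesis by (subst ennreal_mult) (simp_all only: zero_le_power zero_le_numeral)
  qed
  also have "4^n*((D + e/k^2)*(k/2^n)^2) = D*k^2 + e"
  proof -
   have "(2^n)^2 = (4::real)^n" by (simp add: power2_eq_square power_mult_distrib[symmetric])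
   then show ?thesis using k by (simp add: power_divide field_simps)
  qed
  also have "ennreal (D*k^2 + e) = ennreal (D*k^2) + ennreal e"
   using \<open>D \<ge> 0\<close> e by (intro ennreal_plus) auto
  finally show ?thesis .
 qed
 then have "A k <= ennreal (D*k^2)" by (rule ennreal_le_epsilon)
 then show "(NN t. ennreal ((f (t + k) - f t)^2)) <= ennreal (D*k^2)"
  unfolding A_def .
qed

text \<open>Cauchy-Schwarz against the constant 1: integrate the square of the deviation of
  \<open>g\<close> from its mean \<open>c\<close>.\<close>

lemma square_integral_le:
 fixes g :: "real => real"
 assumes g: "continuous_on {a..b} g" and "a <= b"
 shows "(integral {a..b} g)^2 <= (b - a)*integral {a..b} (\<lambda>x. (g x)^2)"
proof (cases "a = b")
 case False
 then have ab: "b - a > 0" using assms by simp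
 define c where "c = integral {a..b} g/(b - a)"
 have i: "g integrable_on {a..b}" "(\<lambda>x. (g x)^2) integrable_on {a..b}"
  using g by (auto intro!: integrable_continuous_real continuous_intros)
 have "0 <= integral {a..b} (\<lambda>x. (g x - c)^2)"
  using g by (intro integral_nonneg integrable_continuous_real continuous_intros) auto
 also have "(\<lambda>x. (g x - c)^2) = (\<lambda>x. (g x)^2 - 2*c*g x + c^2)"
  by (auto simp: power2_eq_square algebra_simps)
 also have "integral {a..b} ... = integral {a..b} (\<lambda>x. (g x)^2) - 2*c*integral {a..b} g + c^2*(b - a)"
 proof (rule integral_unique)
  show "((\<lambda>x. (g x)^2 - 2*c*g x + c^2) has_integral
    integral {a..b} (\<lambda>x. (g x)^2) - 2*c*integral {a..b} g + c^2*(b - a)) {a..b}"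
   using has_integral_const_real[of "c^2" a b] assms
   by (intro has_integral_add has_integral_diff has_integral_mult_right integrable_integral i) (simp add: mult.commute)
 qed
 finally have "0 <= (b - a)*(integral {a..b} (\<lambda>x. (g x)^2) - 2*c*integral {a..b} g + c^2*(b - a))"
  using ab by (metis less_eq_real_def mult_nonneg_nonneg)
 also have "... = (b - a)*integral {a..b} (\<lambda>x. (g x)^2) - (integral {a..b} g)^2"
 proof -
  have I: "integral {a..b} g = c*(b - a)" unfolding c_def using ab by simp
  show ?thesis unfolding I by (simp add: power2_eq_square algebra_simps)
 qed
 finally show ?thesis by simp
qed simp

lemma integral_square_le_nn:
 fixes g :: "real => real"
 assumes g: "continuous_on UNIV g" and C: "(NN t. ennreal ((g t)^2)) <= ennreal C" "C >= 0"
 shows "integral {a..b} (\<lambda>x. (g x)^2) <= C"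
proof -
 have c: "continuous_on {a..b} (\<lambda>x. (g x)^2)"
  using g by (auto intro!: continuous_intros elim: continuous_on_subset)
 have si: "set_integrable lborel {a..b} (\<lambda>x. (g x)^2)"
  by (rule borel_integrable_atLeastAtMost'[OF c])
 have eq: "integral {a..b} (\<lambda>x. (g x)^2) = (LINT x:{a..b}|lborel. (g x)^2)"
  by (rule set_borel_integral_eq_integral(2)[OF si, symmetric])
 have "ennreal (LINT x:{a..b}|lborel. (g x)^2) = (NN x. ennreal (indicator {a..b} x *\<^sub>R (g x)\<^sup>2))"
  using si unfolding set_lebesgue_integral_def set_integrable_def
  by (intro nn_integral_eq_integral[symmetric]) auto
 also have "... <= (NN t. ennreal ((g t)^2))"
  by (intro nn_integral_mono ennreal_leI) (auto simp: indicator_def)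
 also note C(1)
 finally show ?thesis using C(2) unfolding eq by simp
qed

text \<open>Since \<open>f\<close> is merely continuous, its increment is reached through an
  antiderivative \<open>F\<close>: over \<open>[a, b]\<close> the difference
  \<open>f (t + k) - f t\<close> integrates to \<open>k * G k\<close>, where \<open>G k\<close>
  tends to \<open>f b - f a\<close>, and Cauchy-Schwarz bounds every \<open>G k\<close>.\<close>

lemma Dir_le_Holder:
 fixes f :: "real => real"
 assumes f: "continuous_on UNIV f" and D: "Dir_le f D" "D >= 0"
 shows "(f b - f a)^2 <= D*\<bar>b - a\<bar>"
proof -
 obtain F where F: "\<And>x. DERIV F x :> f x"
  using antiderivative_real[OF f] by blast
 have main: "(f b - f a)^2 <= D*(b - a)" if "a <= b" for a b
 proof -
  define G where "G = (\<lambda>k. (F (b + k) - F b)/k - (F (a + k) - F a)/k)"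
  have "(G ---> f b - f a) (at_right 0)"
   unfolding G_def
   using F[of b] F[of a] by (intro tendsto_diff)
    (auto simp: DERIV_def intro: tendsto_mono[OF at_le])
  then have lim: "((\<lambda>k. (G k)^2) ---> (f b - f a)^2) (at_right 0)"
   by (rule tendsto_power)
  have "(G k)^2 <= D*(b - a)" if k: "k > 0" for k
  proof -
   have cg: "continuous_on UNIV (\<lambda>t. f (t + k) - f t)"
    by (intro continuous_intros continuous_on_compose2[OF f]) auto
   have "((\<lambda>t. f (t + k) - f t) has_integral (F (b + k) - F b) - (F (a + k) - F a)) {a..b}"
    using \<open>a \<le> b\<close>
   proof (rule fundamental_theorem_of_calculus)
    fix x assume "x \<in> {a..b}"
    have "DERIV (\<lambda>t. F (t + k) - F t) x :> f (x + k) - f x"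
     using F[of x] F[of "x + k"] by (auto intro!: derivative_eq_intros simp: DERIV_shift)
    then show "((\<lambda>t. F (t + k) - F t) has_vector_derivative f (x + k) - f x) (at x within {a..b})"
     by (simp add: has_real_derivative_iff_has_vector_derivative has_vector_derivative_at_within)
   qed
   then have I: "integral {a..b} (\<lambda>t. f (t + k) - f t) = k*G k"
    using k by (simp add: integral_unique G_def field_simps)
   have "(k*G k)^2 <= (b - a)*integral {a..b} (\<lambda>t. (f (t + k) - f t)^2)"
    unfolding I[symmetric] using \<open>a \<le> b\<close>
    by (intro square_integral_le continuous_on_subset[OF cg]) auto
   also have "... <= (b - a)*(D*k^2)"
    using \<open>a \<le> b\<close> D k cg by (intro mult_left_mono integral_square_le_nn) (auto simp: Dir_le_def)
   finally have "k^2*(G k)^2 <= k^2*(D*(b - a))"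
    by (simp add: power_mult_distrib mult_ac)
   then show ?thesis using k by (simp add: mult_le_cancel_left_pos)
  qed
  then have "\<forall>\<^sub>F k in at_right 0. (G k)^2 <= D*(b - a)"
   by (simp add: eventually_at_right_less eventually_at_filter)
  then show ?thesis using lim by (intro tendsto_upperbound) auto
 qed
 show ?thesis
  using main[of a b] main[of b a] by (cases "a <= b") (auto simp: power2_commute)
qed

lemma Dir_le_abs: "Dir_le f D ==> Dir_le (\<lambda>t. \<bar>f t\<bar>) D"
 unfolding Dir_le_def
proof (intro allI impI)
 fix k :: real assume *: "\<forall>k>0. (NN t. ennreal ((f (t + k) - f t)^2)) <= ennreal (D*k^2)" "k > 0"
 have "(NN t. ennreal ((\<bar>f (t + k)\<bar> - \<bar>f t\<bar>)^2)) <= (NN t. ennreal ((f (t + k) - f t)^2))"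
  by (intro nn_integral_mono ennreal_leI) (auto simp: abs_le_square_iff[symmetric])
 with * show "(NN t. ennreal ((\<bar>f (t + k)\<bar> - \<bar>f t\<bar>)^2)) <= ennreal (D*k^2)"
  by (meson order_trans)
qed

lemma Dir_le_scale:
 assumes f: "continuous_on UNIV f" and "Dir_le f D"
 shows "Dir_le (\<lambda>t. a*f (t + b)) (a^2*D)"
 unfolding Dir_le_def
proof (intro allI impI)
 fix k :: real assume k: "k > 0"
 have [measurable]: "f \<in> \<B>"
  using f by (rule borel_measurable_continuous_onI)
 have "(NN t. ennreal ((a*f (t + k + b) - a*f (t + b))^2))
   = (NN t. ennreal (a^2)*ennreal ((f ((t + b) + k) - f (t + b))^2))"
 proof (intro nn_integral_cong)
  fix t
  have "a*f (t + k + b) - a*f (t + b) = a*(f (t + b + k) - f (t + b))"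
   by (simp add: right_diff_distrib add.commute add.left_commute)
  then show "ennreal ((a*f (t + k + b) - a*f (t + b))^2) = ennreal (a^2)*ennreal ((f ((t + b) + k) - f (t + b))^2)"
   by (simp add: ennreal_mult'[symmetric] power_mult_distrib)
 qed
 also have "... = ennreal (a^2)*(NN t. ennreal ((f ((t + b) + k) - f (t + b))^2))"
  by (intro nn_integral_cmult) simp
 also have "(NN t. ennreal ((f ((t + b) + k) - f (t + b))^2)) = (NN t. ennreal ((f (t + k) - f t)^2))"
  by (rule nn_integral_shift_real[of "\<lambda>t. ennreal ((f (t + k) - f t)^2)"]) simp
 also have "ennreal (a^2)*... <= ennreal (a^2)*ennreal (D*k^2)"
  using assms k by (intro mult_left_mono) (auto simp: Dir_le_def)
 also have "... = ennreal (a^2*D*k^2)"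
  by (simp add: ennreal_mult'[symmetric] mult.assoc)
 finally show "(NN t. ennreal ((a*f (t + k + b) - a*f (t + b))^2)) <= ennreal (a^2*D*k^2)" .
qed

section \<open>Hat functions as test functions\<close>

definition hat :: "real => real => real => real" where
 "hat a h t = max 0 (h - \<bar>t - a\<bar>)"

lemma hat_nonneg: "hat a h t >= 0" by (simp add: hat_def)

lemma hat_le: "h >= 0 ==> hat a h t <= h" by (simp add: hat_def)

lemma hat_outside: "\<bar>t - a\<bar> >= h ==> hat a h t = 0" by (simp add: hat_def)

lemma hat_Lipschitz: "\<bar>hat a h s - hat a h t\<bar> <= \<bar>s - t\<bar>"
 by (auto simp: hat_def)

lemma continuous_hat [continuous_intros]: "continuous_on A (hat a h)"
 unfolding hat_def by (intro continuous_intros)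

lemma borel_measurable_hat [measurable]: "hat a h \<in> \<B>"
 by (intro borel_measurable_continuous_onI continuous_hat)

lemma hat_eq_abs: "h >= 0 ==> hat a h t = (\<bar>t - a - h\<bar> - 2*\<bar>t - a\<bar> + \<bar>t - a + h\<bar>)/2"
 by (auto simp: hat_def max_def abs_if field_simps)

text \<open>The second difference with step \<open>k\<close> of a hat of width \<open>h\<close> is symmetric in \<open>h\<close> and \<open>k\<close>,
 because a hat is itself a second difference of the absolute value.\<close>

lemma hat_second_difference:
 assumes "h >= 0" "k >= 0"
 shows "hat a h (t + k) - 2*hat a h t + hat a h (t - k)
   = hat (a + h) k t - 2*hat a k t + hat (a - h) k t"
 unfolding hat_eq_abs[OF assms(1)] hat_eq_abs[OF assms(2)]
 by (simp add: add_divide_distrib diff_divide_distrib algebra_simps)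

lemma integrable_continuous_hat:
 assumes g: "continuous_on UNIV g"
 shows "integrable lborel (\<lambda>t. g t*hat a h t)"
proof -
 have c: "continuous_on {a - h..a + h} (\<lambda>t. g t*hat a h t)"
  by (intro continuous_intros continuous_on_subset[OF g]) auto
 have "set_integrable lborel {a - h..a + h} (\<lambda>t. g t*hat a h t)"
  by (rule borel_integrable_atLeastAtMost'[OF c])
 also have "?this \<longleftrightarrow> integrable lborel (\<lambda>t. g t*hat a h t)"
  unfolding set_integrable_def
  by (rule arg_cong[where f = "integrable lborel"]) (auto simp: fun_eq_iff indicator_def hat_def)
 finally show ?thesis .
qed

text \<open>The second derivative of a hat consists of three point masses with weights 1, -2, 1, so
  two integrations by parts leave a second difference. \<open>G\<close> and \<open>K\<close> in the
  proof are the antiderivatives on the rising and on the falling slope.\<close>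

lemma integral_hat:
 assumes F: "\<And>x. DERIV F x :> F1 x" and F1: "\<And>x. DERIV F1 x :> g x"
  and g: "continuous_on UNIV g" and h: "h >= 0"
 shows "(LBINT t. g t*hat a h t) = F (a + h) - 2*F a + F (a - h)"
proof -
 have c: "continuous_on {a - h..a + h} (\<lambda>t. g t*hat a h t)"
  by (intro continuous_intros continuous_on_subset[OF g]) auto
 have "(LBINT t. g t*hat a h t) = (LINT t:{a - h..a + h}|lborel. g t*hat a h t)"
  unfolding set_lebesgue_integral_def
  by (intro Bochner_Integration.integral_cong refl) (auto simp: indicator_def hat_def)
 also have "... = integral {a - h..a + h} (\<lambda>t. g t*hat a h t)"
  by (rule set_borel_integral_eq_integral(2)[OF borel_integrable_atLeastAtMost'[OF c]])
 also have "... = (h*F1 a - F a + F (a - h)) + (F (a + h) - (h*F1 a + F a))"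
 proof (rule integral_unique, rule has_integral_combine[of "a - h" a "a + h"])
  define G where "G = (\<lambda>t. (h - a + t)*F1 t - F t)"
  have "((\<lambda>t. g t*hat a h t) has_integral G a - G (a - h)) {a - h..a}"
  proof (rule fundamental_theorem_of_calculus)
   fix x assume x: "x \<in> {a - h..a}"
   have "DERIV G x :> (h - a + x)*g x"
    unfolding G_def using F[of x] F1[of x] by (auto intro!: derivative_eq_intros)
   moreover have "g x*hat a h x = (h - a + x)*g x"
    using x h by (simp add: hat_def)
   ultimately show "(G has_vector_derivative g x*hat a h x) (at x within {a - h..a})"
    by (metis has_real_derivative_iff_has_vector_derivative has_vector_derivative_at_within)
  qed (use h in simp)
  then show "((\<lambda>t. g t*hat a h t) has_integral h*F1 a - F a + F (a - h)) {a - h..a}"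
   by (simp add: G_def)
  define K where "K = (\<lambda>t. (h + a - t)*F1 t + F t)"
  have "((\<lambda>t. g t*hat a h t) has_integral K (a + h) - K a) {a..a + h}"
  proof (rule fundamental_theorem_of_calculus)
   fix x assume x: "x \<in> {a..a + h}"
   have "DERIV K x :> (h + a - x)*g x"
    unfolding K_def using F[of x] F1[of x] by (auto intro!: derivative_eq_intros)
   moreover have "g x*hat a h x = (h + a - x)*g x"
    using x h by (simp add: hat_def)
   ultimately show "(K has_vector_derivative g x*hat a h x) (at x within {a..a + h})"
    by (metis has_real_derivative_iff_has_vector_derivative has_vector_derivative_at_within)
  qed (use h in simp)
  then show "((\<lambda>t. g t*hat a h t) has_integral F (a + h) - (h*F1 a + F a)) {a..a + h}"
   by (simp add: K_def)
 qed (use h in auto)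
 finally show ?thesis by simp
qed

lemma integral_hat_const: "h >= 0 ==> (LBINT t. hat a h t) = h^2"
proof -
 assume h: "h >= 0"
 have "DERIV (\<lambda>t. t^2/2) x :> x" for x :: real
  by (auto intro!: derivative_eq_intros)
 from integral_hat[OF this, of "\<lambda>_. 1" h a] h show ?thesis
  by (simp add: power2_eq_square field_simps)
qed

text \<open>\<open>hat c k / k^2\<close> has integral 1 and support shrinking to \<open>c\<close>,
  so it is an approximate identity.\<close>

lemma hat_approximates:
 assumes f: "continuous_on UNIV f" and "e > 0"
 shows "\<exists>k0>0. \<forall>k. 0 < k \<and> k < k0 \<longrightarrow> \<bar>(LBINT t. f t*hat c k t) - f c*k^2\<bar> <= e*k^2"
proof -
 have "isCont f c" using f by (simp add: continuous_on_eq_continuous_at)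
 then obtain k0 where k0: "k0 > 0" "\<And>t. \<bar>t - c\<bar> < k0 ==> \<bar>f t - f c\<bar> < e"
  using \<open>e > 0\<close> unfolding continuous_at_eps_delta by (auto simp: dist_real_def)
 have "\<bar>(LBINT t. f t*hat c k t) - f c*k^2\<bar> <= e*k^2" if k: "0 < k" "k < k0" for k
 proof -
  have i: "integrable lborel (\<lambda>t. f t*hat c k t)" "integrable lborel (\<lambda>t. x*hat c k t)" for x
   by (intro integrable_continuous_hat f continuous_intros)+
  have "(LBINT t. f t*hat c k t) - f c*k^2
    = (LBINT t. f t*hat c k t) - (LBINT t. f c*hat c k t)"
   using k by (simp add: integral_hat_const)
  also have "... = (LBINT t. (f t*hat c k t - f c*hat c k t))"
   using i by simp
  also have "\<bar>...\<bar> <= (LBINT t. \<bar>f t*hat c k t - f c*hat c k t\<bar>)"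
   by (rule integral_abs_bound)
  also have "... <= (LBINT t. e*hat c k t)"
  proof (intro integral_mono i integrable_abs Bochner_Integration.integrable_diff)
   fix t
   have "\<bar>f t*hat c k t - f c*hat c k t\<bar> = \<bar>f t - f c\<bar>*hat c k t"
    by (simp add: left_diff_distrib[symmetric] abs_mult hat_nonneg)
   also have "... <= e*hat c k t"
    using k0(2)[of t] k hat_outside[of k t c] hat_nonneg[of c k t]
    by (cases "\<bar>t - c\<bar> < k") (auto intro!: mult_right_mono)
   finally show "\<bar>f t*hat c k t - f c*hat c k t\<bar> <= e*hat c k t" .
  qed
  also have "... = e*k^2" using k by (simp add: integral_hat_const)
  finally show ?thesis .
 qed
 with k0(1) show ?thesis by blast
qed

text \<open>The difference is at most \<open>k\<close>, because a hat is 1-Lipschitz, and lives on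
  an interval of length \<open>2 * h + k\<close>; as \<open>k\<close> tends to 0 this gives the
  Dirichlet integral \<open>2 * h\<close>.\<close>

lemma hat_Dirichlet:
 assumes "h > 0" "k > 0"
 shows "integrable lborel (\<lambda>t. (hat a h (t + k) - hat a h t)^2)"
  and "(LBINT t. (hat a h (t + k) - hat a h t)^2) <= (2*h + k)*k^2"
proof -
 have *: "(hat a h (t + k) - hat a h t)^2 <= k^2*indicator {a - h - k..a + h} t" for t
 proof (cases "t \<in> {a - h - k..a + h}")
  case True
  have "\<bar>hat a h (t + k) - hat a h t\<bar> <= k"
   using hat_Lipschitz[of a h "t + k" t] assms by simp
  then have "\<bar>hat a h (t + k) - hat a h t\<bar>\<^sup>2 <= k^2" by (intro power_mono) auto
  then show ?thesis using True by simp
 next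
  case False
  then show ?thesis using assms by (auto simp: hat_def)
 qed
 have i: "integrable lborel (\<lambda>t. k^2*indicator {a - h - k..a + h} t :: real)"
  by (intro integrable_mult_right integrable_real_indicator) (auto simp: emeasure_lborel_Icc_eq)
 show *: "integrable lborel (\<lambda>t. (hat a h (t + k) - hat a h t)^2)"
  by (rule Bochner_Integration.integrable_bound[OF i]) (use * in auto)
 have "(LBINT t. (hat a h (t + k) - hat a h t)^2) <= (LBINT t. k^2*indicator {a - h - k..a + h} t)"
  by (rule integral_mono[OF * i]) (use \<open>\<And>t. (hat a h (t + k) - hat a h t)\<^sup>2 \<le> k\<^sup>2 * indicator {a - h - k..a + h} t\<close> in simp)
 also have "... = (2*h + k)*k^2" using assms by simp
 finally show "(LBINT t. (hat a h (t + k) - hat a h t)^2) <= (2*h + k)*k^2" .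
qed

text \<open>The expansion of the Dirichlet integral in \<open>e\<close>, without derivatives of
  \<open>f\<close>. Summation by parts moves the differences in the cross term onto the hat; its
  second difference with step \<open>k\<close> consists of hats of width \<open>k\<close>, which
  evaluate \<open>f\<close> at the three corners up to a small error.\<close>

lemma Dir_le_add_hat:
 fixes f :: "real => real"
 assumes f: "continuous_on UNIV f" and D: "Dir_le f D" and "D >= 0" and h: "h > 0"
  and D': "D' = D - 2*e*(f (a + h) - 2*f a + f (a - h)) + e^2*(2*h)" "D' >= 0"
 shows "Dir_le (\<lambda>t. f t + e*hat a h t) D'"
proof (rule Dir_leI_small)
 show "continuous_on UNIV (\<lambda>t. f t + e*hat a h t)" by (intro continuous_intros f)
 fix d :: real assume d: "d > 0"
 \<comment> \<open>The three approximations enter with weights 1, 2, 1 and the factor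
   \<open>2 * |e|\<close>, giving \<open>8 * |e| * d1\<close>; the condition \<open>k < d1\<close>
   costs another \<open>e^2 * d1\<close>. The \<open>+ 1\<close> keeps the denominator
   positive.\<close>
 define d1 where "d1 = d/(8*\<bar>e\<bar> + e^2 + 1)"
 have d1: "d1 > 0" using d by (simp add: d1_def add_nonneg_pos)
 from hat_approximates[OF f d1, of "a + h"] obtain k1 where k1: "k1 > 0"
  "\<And>k. 0 < k ==> k < k1 ==> \<bar>(LBINT t. f t*hat (a + h) k t) - f (a + h)*k^2\<bar> <= d1*k^2" by blast
 from hat_approximates[OF f d1, of a] obtain k2 where k2: "k2 > 0"
  "\<And>k. 0 < k ==> k < k2 ==> \<bar>(LBINT t. f t*hat a k t) - f a*k^2\<bar> <= d1*k^2" by blast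
 from hat_approximates[OF f d1, of "a - h"] obtain k3 where k3: "k3 > 0"
  "\<And>k. 0 < k ==> k < k3 ==> \<bar>(LBINT t. f t*hat (a - h) k t) - f (a - h)*k^2\<bar> <= d1*k^2" by blast
 have main: "(NN t. ennreal ((f (t + k) + e*hat a h (t + k) - (f t + e*hat a h t))^2))
   <= ennreal ((D' + d)*k^2)" if k: "0 < k" "k < k1" "k < k2" "k < k3" "k < d1" for k
 proof -
  define df where "df = (\<lambda>t. f (t + k) - f t)"
  define dp where "dp = (\<lambda>t. hat a h (t + k) - hat a h t)"
  have [measurable]: "f \<in> \<B>"
   using f by (rule borel_measurable_continuous_onI)
  have nn: "(NN t. ennreal ((df t)^2)) <= ennreal (D*k^2)"
   using D k by (auto simp: Dir_le_def df_def)
  have idf: "integrable lborel (\<lambda>t. (df t)^2)"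
   by (rule integrableI_bounded) (use nn in \<open>auto simp: df_def le_less_trans\<close>)
  have ldf: "(LBINT t. (df t)^2) <= D*k^2"
  proof -
   have "ennreal (LBINT t. (df t)^2) = (NN t. ennreal ((df t)^2))"
    by (rule nn_integral_eq_integral[symmetric]) (use idf in auto)
   with nn have "ennreal (LBINT t. (df t)^2) <= ennreal (D*k^2)" by metis
   then show ?thesis using \<open>D \<ge> 0\<close> by (subst (asm) ennreal_le_iff) auto
  qed
  have idp: "integrable lborel (\<lambda>t. (dp t)^2)" and ldp: "(LBINT t. (dp t)^2) <= (2*h + k)*k^2"
   unfolding dp_def using hat_Dirichlet[OF h k(1)] by auto
  have fs: "continuous_on UNIV (\<lambda>t. f (t + s))" for s
   by (intro continuous_on_compose2[OF f] continuous_intros) auto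
  have sh: "continuous_on UNIV f ==> integrable lborel (\<lambda>t. f t*hat a h (t + s))" for f s
  proof -
   assume "continuous_on UNIV f"
   then have "continuous_on UNIV (\<lambda>t. f (t - s))"
    by (rule continuous_on_compose2) (auto intro!: continuous_intros)
   from integrable_continuous_hat[OF this, of a h]
   have "integrable lborel (\<lambda>t. f (t + s - s)*hat a h (t + s))"
    using integrable_shift_real[of "\<lambda>t. f (t - s)*hat a h t" s] by blast
   then show ?thesis by simp
  qed
  have i4: "integrable lborel (\<lambda>t. f (t + k)*hat a h (t + k))" "integrable lborel (\<lambda>t. f (t + k)*hat a h t)"
   "integrable lborel (\<lambda>t. f t*hat a h (t + k))" "integrable lborel (\<lambda>t. f t*hat a h t)"
   "integrable lborel (\<lambda>t. f t*hat a h (t - k))"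
   using sh[OF fs[of k], of k] sh[OF fs[of k], of 0] sh[OF f, of k] sh[OF f, of 0] sh[OF f, of "-k"] by auto
  have dfdp: "(\<lambda>t. df t*dp t) = (\<lambda>t. f (t + k)*hat a h (t + k) - f (t + k)*hat a h t - f t*hat a h (t + k) + f t*hat a h t)"
   by (auto simp: df_def dp_def algebra_simps)
  have icr: "integrable lborel (\<lambda>t. df t*dp t)"
   unfolding dfdp by (intro Bochner_Integration.integrable_add Bochner_Integration.integrable_diff i4)
  have e1: "(LBINT t. f (t + k)*hat a h (t + k)) = (LBINT t. f t*hat a h t)"
   by (rule integral_shift_real[of "\<lambda>t. f t*hat a h t"])
  have e2: "(LBINT t. f (t + k)*hat a h t) = (LBINT t. f t*hat a h (t - k))"
   using integral_shift_real[of "\<lambda>t. f t*hat a h (t - k)" k] by simp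
  have "(LBINT t. df t*dp t) = 2*(LBINT t. f t*hat a h t) - (LBINT t. f t*hat a h (t - k))
    - (LBINT t. f t*hat a h (t + k))"
   unfolding dfdp using i4 e1 e2 by simp
  also have "... = - (LBINT t. f t*(hat a h (t + k) - 2*hat a h t + hat a h (t - k)))"
  proof -
   have "(LBINT t. f t*(hat a h (t + k) - 2*hat a h t + hat a h (t - k)))
     = (LBINT t. f t*hat a h (t + k) - 2*(f t*hat a h t) + f t*hat a h (t - k))"
    by (intro Bochner_Integration.integral_cong) (auto simp: algebra_simps)
   then show ?thesis using i4 by simp
  qed
  also have "... = - (LBINT t. f t*hat (a + h) k t - 2*(f t*hat a k t) + f t*hat (a - h) k t)"
   by (subst hat_second_difference) (use h k in \<open>auto simp: algebra_simps\<close>)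
  also have "... = - ((LBINT t. f t*hat (a + h) k t) - 2*(LBINT t. f t*hat a k t) + (LBINT t. f t*hat (a - h) k t))"
   using integrable_continuous_hat[OF f] by simp
  finally have cr: "\<bar>(LBINT t. df t*dp t) + (f (a + h) - 2*f a + f (a - h))*k^2\<bar> <= 4*d1*k^2"
   using k1(2)[OF k(1,2)] k2(2)[OF k(1,3)] k3(2)[OF k(1,4)] by (simp add: algebra_simps)
  let ?S = "f (a + h) - 2*f a + f (a - h)"
  have "(NN t. ennreal ((f (t + k) + e*hat a h (t + k) - (f t + e*hat a h t))^2))
    = (NN t. ennreal ((df t)^2 + 2*e*(df t*dp t) + e^2*(dp t)^2))"
   by (intro nn_integral_cong) (auto simp: df_def dp_def power2_eq_square algebra_simps)
  also have "... = ennreal (LBINT t. (df t)^2 + 2*e*(df t*dp t) + e^2*(dp t)^2)"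
  proof (rule nn_integral_eq_integral)
   show "integrable lborel (\<lambda>t. (df t)^2 + 2*e*(df t*dp t) + e^2*(dp t)^2)"
    using idf icr idp by simp
   have "(df t)^2 + 2*e*(df t*dp t) + e^2*(dp t)^2 = (df t + e*dp t)^2" for t
    by (simp add: power2_eq_square algebra_simps)
   then show "AE t in lborel. 0 <= (df t)^2 + 2*e*(df t*dp t) + e^2*(dp t)^2" by simp
  qed
  also have "(LBINT t. (df t)^2 + 2*e*(df t*dp t) + e^2*(dp t)^2)
   = (LBINT t. (df t)^2) + 2*e*(LBINT t. df t*dp t) + e^2*(LBINT t. (dp t)^2)"
   using idf icr idp by simp
  also have "... <= D*k^2 + (- (2*e*?S)*k^2 + 2*\<bar>e\<bar>*(4*d1*k^2)) + e^2*((2*h + d1)*k^2)"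
  proof (intro add_mono mult_left_mono ldf)
   have "2*e*(LBINT t. df t*dp t) + 2*e*(?S*k^2) <= \<bar>2*e*((LBINT t. df t*dp t) + ?S*k^2)\<bar>"
    by (simp add: algebra_simps)
   also have "... <= 2*\<bar>e\<bar>*(4*d1*k^2)"
    unfolding abs_mult using mult_left_mono[OF cr, of "2*\<bar>e\<bar>"] by simp
   finally show "2*e*(LBINT t. df t*dp t) <= - (2*e*?S)*k^2 + 2*\<bar>e\<bar>*(4*d1*k^2)"
    by (simp add: algebra_simps)
   show "(LBINT t. (dp t)^2) <= (2*h + d1)*k^2"
    using ldp k by (smt (verit) mult_right_mono zero_le_power2)
  qed auto
  also have "... = (D' + d1*(8*\<bar>e\<bar> + e^2))*k^2"
   unfolding D' by (simp add: algebra_simps)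
  also have "... <= (D' + d)*k^2"
  proof -
   have "d1*(8*\<bar>e\<bar> + e^2) <= d1*(8*\<bar>e\<bar> + e^2 + 1)" using d1 by (intro mult_left_mono) auto
   also have "... = d"
   proof -
    have "8*\<bar>e\<bar> + e^2 + 1 > 0" by (simp add: add_nonneg_pos)
    then show ?thesis unfolding d1_def by simp
   qed
   finally show ?thesis by (intro mult_right_mono) auto
  qed
  finally show ?thesis by (simp add: ennreal_leI)
 qed
 show "\<exists>k0>0. \<forall>k. 0 < k \<and> k < k0 \<longrightarrow>
  (NN t. ennreal ((f (t + k) + e*hat a h (t + k) - (f t + e*hat a h t))^2)) <= ennreal ((D' + d)*k^2)"
  using k1(1) k2(1) k3(1) d1 main by (intro exI[of _ "min (min k1 k2) (min k3 d1)"]) auto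
qed (use D' in auto)

section \<open>The one-dimensional logarithmic energy\<close>

text \<open>The weight is the one that integrates the kernel \<open>max t s\<close>, by
  \<open>max_prod_le\<close>.\<close>

definition wint :: "(real => real) => bool" where
 "wint r \<longleftrightarrow> r \<in> borel_measurable borel \<and> integrable lborel (\<lambda>t. (1 + \<bar>t\<bar>)*r t)"

definition wnorm :: "(real => real) => real" where
 "wnorm r = (LBINT t. (1 + \<bar>t\<bar>)*\<bar>r t\<bar>)"

text \<open>The logarithmic energy of radial densities: the mean of \<open>ln |x - y|\<close> over
  rotations of \<open>x\<close> is the larger of \<open>ln |x|\<close> and \<open>ln |y|\<close>,
  see \<open>circle_mean\<close>.\<close>

definition BB :: "(real => real) => (real => real) => real" where
 "BB r s = (LINT p|lborel2. max (fst p) (snd p)*(r (fst p) * s (snd p)))"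

definition mom :: "(real => real) => real" where
 "mom r = (LBINT t. t*r t)"

lemma wint_measurable [measurable_dest]: "wint r ==> r \<in> \<B>"
 by (simp add: wint_def)

lemma wint_integrable_abs: "wint r ==> integrable lborel (\<lambda>t. (1 + \<bar>t\<bar>)*\<bar>r t\<bar>)"
 unfolding wint_def using integrable_abs[of lborel "\<lambda>t. (1 + \<bar>t\<bar>)*r t"]
 by (simp add: abs_mult)

lemma wint_bound:
 assumes r: "wint r" and s: "s \<in> \<B>" and le: "\<And>t. \<bar>s t\<bar> <= C*\<bar>r t\<bar>"
 shows "wint s"
 unfolding wint_def
proof
 note s[measurable]
 have "integrable lborel (\<lambda>t. C*((1 + \<bar>t\<bar>)*\<bar>r t\<bar>))"
  by (intro integrable_mult_right wint_integrable_abs r)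
 then show "integrable lborel (\<lambda>t. (1 + \<bar>t\<bar>) * s t)"
 proof (rule Bochner_Integration.integrable_bound)
  show "AE t in lborel. norm ((1 + \<bar>t\<bar>) * s t) <= norm (C*((1 + \<bar>t\<bar>)*\<bar>r t\<bar>))"
  proof (rule AE_I2)
   fix t
   have "norm ((1 + \<bar>t\<bar>) * s t) = (1 + \<bar>t\<bar>)*\<bar>s t\<bar>" by (simp add: abs_mult)
   also have "... <= (1 + \<bar>t\<bar>)*(C*\<bar>r t\<bar>)" by (intro mult_left_mono le) simp
   also have "... <= norm (C*((1 + \<bar>t\<bar>)*\<bar>r t\<bar>))" by (simp add: mult_ac)
   finally show "norm ((1 + \<bar>t\<bar>) * s t) <= norm (C*((1 + \<bar>t\<bar>)*\<bar>r t\<bar>))" .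
  qed
 qed simp
qed (rule s)

lemma wint_add: "wint r ==> wint s ==> wint (\<lambda>t. r t + s t)"
 unfolding wint_def by (auto simp: distrib_left)

lemma wint_cmult: "wint r ==> wint (\<lambda>t. c*r t)"
 by (rule wint_bound[of r _ "\<bar>c\<bar>"]) (auto simp: abs_mult)

lemma wint_integrable:
 assumes "wint r"
 shows "integrable lborel r" "integrable lborel (\<lambda>t. t*r t)" "integrable lborel (\<lambda>t. \<bar>t\<bar>*r t)"
proof -
 note [measurable] = wint_measurable[OF assms]
 note i = wint_integrable_abs[OF assms]
 have "\<bar>r t\<bar> <= (1 + \<bar>t\<bar>)*\<bar>r t\<bar>" "\<bar>t\<bar>*\<bar>r t\<bar> <= (1 + \<bar>t\<bar>)*\<bar>r t\<bar>" for t
  by (auto simp: algebra_simps)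
 then show "integrable lborel r" "integrable lborel (\<lambda>t. t*r t)" "integrable lborel (\<lambda>t. \<bar>t\<bar>*r t)"
  by (auto intro!: Bochner_Integration.integrable_bound[OF i] simp: abs_mult)
qed

lemma wnorm_eq:
 assumes "wint r" and "\<And>t. r t >= 0"
 shows "wnorm r = (LBINT t. r t) + (LBINT t. \<bar>t\<bar>*r t)"
 using wint_integrable[OF assms(1)] assms(2) by (simp add: wnorm_def distrib_right)

lemma wnorm_nonneg: "wnorm r >= 0"
 unfolding wnorm_def by (rule integral_nonneg_AE) simp

lemma wprod_integrable:
 assumes r: "wint r" and s: "wint s"
 shows "integrable lborel2 (\<lambda>p. ((1 + \<bar>fst p\<bar>)*\<bar>r (fst p)\<bar>)*((1 + \<bar>snd p\<bar>)*\<bar>s (snd p)\<bar>))"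
proof -
 note [measurable] = wint_measurable[OF r] wint_measurable[OF s]
 let ?f = "\<lambda>p. ((1 + \<bar>fst p\<bar>)*\<bar>r (fst p)\<bar>)*((1 + \<bar>snd p\<bar>)*\<bar>s (snd p)\<bar>) :: real"
 show ?thesis
 proof (rule lborel_pair.Fubini_integrable)
  have "(LBINT y. norm (?f (x, y))) = ((1 + \<bar>x\<bar>)*\<bar>r x\<bar>)*wnorm s" for x
   unfolding wnorm_def using wint_integrable_abs[OF s] by (simp add: abs_mult)
  then show "integrable lborel (\<lambda>x. LBINT y. norm (?f (x, y)))"
   using wint_integrable_abs[OF r] by simp
  show "AE x in lborel. integrable lborel (\<lambda>y. ?f (x, y))"
   using wint_integrable_abs[OF s] by simp
 qed simp
qed

lemma wprod_integral:
 assumes r: "wint r" and s: "wint s"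
 shows "(LINT p|lborel2. ((1 + \<bar>fst p\<bar>)*\<bar>r (fst p)\<bar>)*((1 + \<bar>snd p\<bar>)*\<bar>s (snd p)\<bar>)) = wnorm r*wnorm s"
 by (subst lborel_pair.integral_fst'[symmetric, OF wprod_integrable[OF r s]]) (simp add: wnorm_def)

lemma max_prod_le:
 fixes t s :: real
 shows "\<bar>max t s\<bar> <= (1 + \<bar>t\<bar>)*(1 + \<bar>s\<bar>)"
proof -
 have "\<bar>max t s\<bar> <= \<bar>t\<bar> + \<bar>s\<bar>" by auto
 also have "... <= (1 + \<bar>t\<bar>)*(1 + \<bar>s\<bar>)" by (simp add: algebra_simps)
 finally show ?thesis .
qed

lemma BB_integrable:
 assumes r: "wint r" and s: "wint s"
 shows "integrable lborel2 (\<lambda>p. max (fst p) (snd p)*(r (fst p) * s (snd p)))"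
proof (rule Bochner_Integration.integrable_bound[OF wprod_integrable[OF r s]])
 note [measurable] = wint_measurable[OF r] wint_measurable[OF s]
 show "(\<lambda>p. max (fst p) (snd p)*(r (fst p) * s (snd p))) \<in> borel_measurable lborel2"
  by simp
 show "AE p in lborel2. norm (max (fst p) (snd p)*(r (fst p) * s (snd p)))
   <= norm (((1 + \<bar>fst p\<bar>)*\<bar>r (fst p)\<bar>)*((1 + \<bar>snd p\<bar>)*\<bar>s (snd p)\<bar>))"
 proof (rule AE_I2)
  fix p :: "real \<times> real"
  have "\<bar>max (fst p) (snd p)\<bar>*(\<bar>r (fst p)\<bar>*\<bar>s (snd p)\<bar>) <= ((1 + \<bar>fst p\<bar>)*(1 + \<bar>snd p\<bar>))*(\<bar>r (fst p)\<bar>*\<bar>s (snd p)\<bar>)"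
   by (intro mult_right_mono max_prod_le) simp
  then show "norm (max (fst p) (snd p)*(r (fst p) * s (snd p)))
   <= norm (((1 + \<bar>fst p\<bar>)*\<bar>r (fst p)\<bar>)*((1 + \<bar>snd p\<bar>)*\<bar>s (snd p)\<bar>))"
   by (simp add: abs_mult mult_ac)
 qed
qed

lemma BB_bound:
 assumes r: "wint r" and s: "wint s"
 shows "\<bar>BB r s\<bar> <= wnorm r*wnorm s"
proof -
 have "\<bar>BB r s\<bar> <= (LINT p|lborel2. \<bar>max (fst p) (snd p)*(r (fst p) * s (snd p))\<bar>)"
  unfolding BB_def by (rule integral_abs_bound)
 also have "... <= (LINT p|lborel2. ((1 + \<bar>fst p\<bar>)*\<bar>r (fst p)\<bar>)*((1 + \<bar>snd p\<bar>)*\<bar>s (snd p)\<bar>))"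
 proof (rule integral_mono[OF integrable_abs[OF BB_integrable[OF r s]] wprod_integrable[OF r s]])
  fix p :: "real \<times> real"
  have "\<bar>max (fst p) (snd p)\<bar>*(\<bar>r (fst p)\<bar>*\<bar>s (snd p)\<bar>) <= ((1 + \<bar>fst p\<bar>)*(1 + \<bar>snd p\<bar>))*(\<bar>r (fst p)\<bar>*\<bar>s (snd p)\<bar>)"
   by (intro mult_right_mono max_prod_le) simp
  then show "\<bar>max (fst p) (snd p)*(r (fst p) * s (snd p))\<bar>
   <= ((1 + \<bar>fst p\<bar>)*\<bar>r (fst p)\<bar>)*((1 + \<bar>snd p\<bar>)*\<bar>s (snd p)\<bar>)"
   by (simp add: abs_mult mult_ac)
 qed
 also have "... = wnorm r*wnorm s" by (rule wprod_integral[OF r s])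
 finally show ?thesis .
qed

lemma BB_commute:
 assumes r: "wint r" and s: "wint s"
 shows "BB r s = BB s r"
proof -
 note [measurable] = wint_measurable[OF r] wint_measurable[OF s]
 have "BB s r = (LINT p|lborel2. (case p of (x, y) => (\<lambda>p. max (fst p) (snd p)*(r (fst p) * s (snd p))) (y, x)))"
  unfolding BB_def by (intro Bochner_Integration.integral_cong) (auto simp: max.commute)
 also have "... = BB r s"
  unfolding BB_def by (rule lborel_pair.integral_product_swap) simp
 finally show ?thesis by simp
qed

lemma BB_add_left:
 assumes "wint r" "wint r'" "wint s"
 shows "BB (\<lambda>t. r t + r' t) s = BB r s + BB r' s"
 unfolding BB_def using BB_integrable[OF assms(1,3)] BB_integrable[OF assms(2,3)]
 by (simp add: distrib_left distrib_right)

lemma BB_square_add: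
 assumes r: "wint r" and s: "wint s"
 shows "BB (\<lambda>t. r t + s t) (\<lambda>t. r t + s t) = BB r r + 2*BB r s + BB s s"
proof -
 note rs = wint_add[OF r s]
 have "BB (\<lambda>t. r t + s t) (\<lambda>t. r t + s t) = BB r (\<lambda>t. r t + s t) + BB s (\<lambda>t. r t + s t)"
  by (rule BB_add_left[OF r s rs])
 also have "BB r (\<lambda>t. r t + s t) = BB r r + BB s r"
  using BB_commute[OF r rs] BB_add_left[OF r s r] by simp
 also have "BB s (\<lambda>t. r t + s t) = BB r s + BB s s"
  using BB_commute[OF s rs] BB_add_left[OF r s s] by simp
 finally show ?thesis using BB_commute[OF r s] by simp
qed

definition pot :: "(real => real) => real => real" where
 "pot r t = (LBINT s. max s t*r s)"

lemma BB_pot: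
 assumes r: "wint r" and s: "wint s"
 shows "BB r s = (LBINT t. pot r t * s t)" "integrable lborel (\<lambda>t. pot r t * s t)"
proof -
 note i = BB_integrable[OF s r]
 have "BB r s = BB s r" by (rule BB_commute[OF r s])
 also have "... = (LBINT t. LBINT x. max t x*(s t*r x))"
  unfolding BB_def by (subst lborel_pair.integral_fst'[symmetric, OF i]) simp
 also have eq: "(\<lambda>t. LBINT x. max t x*(s t*r x)) = (\<lambda>t. pot r t * s t)"
 proof
  fix t
  have "(LBINT x. max t x*(s t*r x)) = (LBINT x. (max x t*r x) * s t)"
   by (intro Bochner_Integration.integral_cong) (auto simp: max.commute)
  then show "(LBINT x. max t x*(s t*r x)) = pot r t * s t"
   by (simp add: pot_def)
 qed
 finally show "BB r s = (LBINT t. pot r t * s t)" .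
 show "integrable lborel (\<lambda>t. pot r t * s t)"
  using lborel_pair.integrable_fst'[OF i] by (simp add: eq)
qed

lemma integrable_max_mult:
 assumes r: "wint r"
 shows "integrable lborel (\<lambda>s. max 0 (t - s)*r s)" "integrable lborel (\<lambda>s. max s t*r s)"
proof -
 note [measurable] = wint_measurable[OF r]
 have i: "integrable lborel (\<lambda>s. (1 + \<bar>t\<bar>)*((1 + \<bar>s\<bar>)*\<bar>r s\<bar>))"
  by (intro integrable_mult_right wint_integrable_abs r)
 have a: "\<bar>max 0 (t - s)\<bar> <= (1 + \<bar>t\<bar>)*(1 + \<bar>s\<bar>)" for s
 proof -
  have "\<bar>max 0 (t - s)\<bar> <= \<bar>t\<bar> + \<bar>s\<bar>" by auto
  also have "... <= (1 + \<bar>t\<bar>)*(1 + \<bar>s\<bar>)" by (simp add: algebra_simps)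
  finally show ?thesis .
 qed
 have "\<bar>max 0 (t - s)\<bar>*\<bar>r s\<bar> <= ((1 + \<bar>t\<bar>)*(1 + \<bar>s\<bar>))*\<bar>r s\<bar>"
   "\<bar>max s t\<bar>*\<bar>r s\<bar> <= ((1 + \<bar>t\<bar>)*(1 + \<bar>s\<bar>))*\<bar>r s\<bar>" for s
  using mult_right_mono[OF a[of s], of "\<bar>r s\<bar>"] mult_right_mono[OF max_prod_le[of t s], of "\<bar>r s\<bar>"]
  by (auto simp: max.commute)
 then show "integrable lborel (\<lambda>s. max 0 (t - s)*r s)" "integrable lborel (\<lambda>s. max s t*r s)"
  by (auto intro!: Bochner_Integration.integrable_bound[OF i] simp: abs_mult mult_ac)
qed

text \<open>The splitting isolates what may be lost in a limit. The moment feels mass far to the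
  right, whereas the remaining kernel vanishes for \<open>s >= t\<close> and converges along the
  minimising sequence.\<close>

lemma pot_eq:
 assumes r: "wint r"
 shows "pot r t = mom r + (LBINT s. max 0 (t - s)*r s)"
proof -
 have "pot r t = (LBINT s. s*r s + max 0 (t - s)*r s)"
  unfolding pot_def by (intro Bochner_Integration.integral_cong) (auto simp: max_def algebra_simps)
 then show ?thesis
  using integrable_max_mult[OF r] wint_integrable[OF r] by (simp add: mom_def)
qed

text \<open>For a nonnegative density, \<open>pot r\<close> lies above the constant
  \<open>mom r\<close>. This is the coercivity of the problem: a bounded energy bounds the first
  moment from above.\<close>

lemma BB_ge_mom:
 assumes r: "wint r" and nn: "\<And>t. r t >= 0"
 shows "BB r r >= (LBINT t. r t)*mom r"
proof -
 have "(LBINT t. r t)*mom r = (LBINT t. mom r*r t)"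
  by simp
 also have "... <= (LBINT t. pot r t*r t)"
 proof (rule integral_mono)
  show "integrable lborel (\<lambda>t. mom r*r t)" using wint_integrable[OF r] by simp
  show "integrable lborel (\<lambda>t. pot r t*r t)" by (rule BB_pot(2)[OF r r])
  fix t
  have "0 <= (LBINT s. max 0 (t - s)*r s)"
   by (rule integral_nonneg_AE) (use nn in auto)
  then show "mom r*r t <= pot r t*r t"
   unfolding pot_eq[OF r] using nn by (intro mult_right_mono) auto
 qed
 also have "... = BB r r" by (rule BB_pot(1)[OF r r, symmetric])
 finally show ?thesis .
qed

section \<open>Admissible profiles, scaling and uniform bounds\<close>

definition dens :: "(real => real) => real => real" where
 "dens f t = (f t)^2*exp (2*t)"

definition mass :: "(real => real) => real" where
 "mass f = (LBINT t. dens f t)"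

lemma dens_nonneg: "dens f t >= 0" by (simp add: dens_def)

lemma dens_shift: "dens (\<lambda>t. a*f (t + b)) t = a^2*exp (- 2*b)*dens f (t + b)"
 by (simp add: dens_def power_mult_distrib exp_add[symmetric] exp_minus field_simps distrib_left)

lemma wint_shift:
 assumes r: "wint r" shows "wint (\<lambda>t. r (t + b))"
 unfolding wint_def
proof
 note [measurable] = wint_measurable[OF r]
 show "(\<lambda>t. r (t + b)) \<in> \<B>" by simp
 have i: "integrable lborel (\<lambda>t. (1 + \<bar>b\<bar>)*((1 + \<bar>t\<bar>)*\<bar>r t\<bar>))"
  by (intro integrable_mult_right wint_integrable_abs r)
 have "integrable lborel (\<lambda>t. (1 + \<bar>t - b\<bar>)*r t)"
 proof (rule Bochner_Integration.integrable_bound[OF i])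
  show "AE t in lborel. norm ((1 + \<bar>t - b\<bar>)*r t) <= norm ((1 + \<bar>b\<bar>)*((1 + \<bar>t\<bar>)*\<bar>r t\<bar>))"
  proof (rule AE_I2)
   fix t
   have "1 + \<bar>t - b\<bar> <= 1 + \<bar>t\<bar> + \<bar>b\<bar>" by simp
   also have "... <= (1 + \<bar>b\<bar>)*(1 + \<bar>t\<bar>)" by (simp add: algebra_simps)
   finally have "(1 + \<bar>t - b\<bar>)*\<bar>r t\<bar> <= ((1 + \<bar>b\<bar>)*(1 + \<bar>t\<bar>))*\<bar>r t\<bar>"
    by (rule mult_right_mono) simp
   then show "norm ((1 + \<bar>t - b\<bar>)*r t) <= norm ((1 + \<bar>b\<bar>)*((1 + \<bar>t\<bar>)*\<bar>r t\<bar>))"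
    by (simp add: abs_mult mult_ac)
  qed
 qed simp
 then show "integrable lborel (\<lambda>t. (1 + \<bar>t\<bar>)*r (t + b))"
  using integrable_shift_real[of "\<lambda>t. (1 + \<bar>t - b\<bar>)*r t" b] by simp
qed

lemma BB_shift:
 assumes r: "wint r"
 shows "BB (\<lambda>t. c*r (t + b)) (\<lambda>t. c*r (t + b)) = c^2*(BB r r - b*(LBINT t. r t)^2)"
proof -
 note rb = wint_shift[OF r, of b]
 have p: "pot (\<lambda>t. c*r (t + b)) t = c*(pot r (t + b) - b*(LBINT t. r t))" for t
 proof -
  have "pot (\<lambda>t. c*r (t + b)) t = c*(LBINT s. max s t*r (s + b))"
   unfolding pot_def by (simp add: mult.left_commute)
  also have "(LBINT s. max s t*r (s + b)) = (LBINT s. (max (s + b) (t + b) - b)*r (s + b))"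
   by (intro Bochner_Integration.integral_cong) (auto simp: max_def)
  also have "... = (LBINT s. (max s (t + b) - b)*r s)"
   by (rule integral_shift_real[of "\<lambda>s. (max s (t + b) - b)*r s"])
  also have "... = pot r (t + b) - b*(LBINT t. r t)"
   unfolding pot_def using integrable_max_mult(2)[OF r, of "t + b"] wint_integrable[OF r]
   by (simp add: left_diff_distrib)
  finally show ?thesis .
 qed
 have "BB (\<lambda>t. c*r (t + b)) (\<lambda>t. c*r (t + b))
   = (LBINT t. c*(pot r (t + b) - b*(LBINT t. r t))*(c*r (t + b)))"
  by (subst BB_pot(1)[OF wint_cmult[OF rb] wint_cmult[OF rb]]) (simp add: p)
 also have "... = (LBINT t. c*(pot r t - b*(LBINT t. r t))*(c*r t))"
  by (rule integral_shift_real[of "\<lambda>t. c*(pot r t - b*(LBINT t. r t))*(c*r t)"])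
 also have "... = (LBINT t. c^2*(pot r t*r t) - c^2*b*(LBINT t. r t)*r t)"
  by (intro Bochner_Integration.integral_cong) (auto simp: power2_eq_square algebra_simps)
 also have "... = c^2*(BB r r - b*(LBINT t. r t)^2)"
  using BB_pot[OF r r] wint_integrable[OF r] by (simp add: power2_eq_square algebra_simps)
 finally show ?thesis .
qed

definition adm :: "(real => real) => real => bool" where
 "adm f D \<longleftrightarrow> continuous_on UNIV f \<and> wint (dens f) \<and> Dir_le f D"

lemma dens_integrable: "adm f D ==> integrable lborel (dens f)"
 unfolding adm_def using wint_integrable(1) by blast

text \<open>The functional is invariant under amplitude and translation in \<open>t\<close> (a
  dilation of the plane). These two parameters are used up to make both the Dirichlet bound and the
  mass equal to 1, after which only the energy is left to minimise.\<close>

lemma adm_normalise: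
 assumes f: "adm f D" and "D > 0" and M: "mass f > 0"
 obtains f' where "adm f' 1" "mass f' = 1"
  "BB (dens f') (dens f') = BB (dens f) (dens f)/(mass f)^2 + ln (D/mass f)/2"
proof -
 \<comment> \<open>Solves \<open>a^2 * exp (- 2 * b) * mass f = 1\<close> once
   \<open>a^2 = 1 / D\<close>; the energy then changes by \<open>- b\<close>, which is the term
   \<open>ln (D / mass f) / 2\<close>.\<close>
 define b where "b = ln (mass f/D)/2"
 define a where "a = 1 / sqrt D"
 define f' where "f' = (\<lambda>t. a*f (t + b))"
 have a2: "a^2*D = 1" using \<open>D > 0\<close> by (simp add: a_def power_divide)
 have eb: "exp (- 2*b) = D/mass f"
  using assms by (simp add: b_def exp_minus)
 have c: "a^2*exp (- 2*b) = 1/mass f"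
  using a2 unfolding eb by (simp add: field_simps)
 have d: "dens f' = (\<lambda>t. (1/mass f)*dens f (t + b))"
  unfolding f'_def by (rule ext) (simp only: dens_shift c)
 have "continuous_on UNIV f'"
  unfolding f'_def using f by (auto simp: adm_def intro!: continuous_intros continuous_on_compose2[of UNIV f])
 moreover have "wint (dens f')"
  unfolding d using f by (intro wint_cmult wint_shift) (simp add: adm_def)
 moreover have "Dir_le f' 1"
  unfolding f'_def a2[symmetric] using f by (intro Dir_le_scale) (auto simp: adm_def)
 ultimately have "adm f' 1" by (simp add: adm_def)
 moreover have "mass f' = 1"
  unfolding mass_def d using integral_shift_real[of "dens f" b] M by (simp add: mass_def)
 moreover have "BB (dens f') (dens f') = (1/mass f)^2*(BB (dens f) (dens f) - b*(mass f)^2)"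
  unfolding d mass_def using f by (intro BB_shift) (simp add: adm_def)
 moreover have "(1/mass f)^2*(BB (dens f) (dens f) - b*(mass f)^2) = BB (dens f) (dens f)/(mass f)^2 + ln (D/mass f)/2"
  using assms by (simp add: b_def field_simps ln_div)
 ultimately show ?thesis using that by simp
qed

lemma adm_abs: "adm f D ==> adm (\<lambda>t. \<bar>f t\<bar>) D"
 by (auto simp: adm_def dens_def[abs_def] Dir_le_abs intro!: continuous_intros)

lemma wint_times_hat:
 assumes g: "continuous_on UNIV g"
 shows "wint (\<lambda>t. g t*hat a h t)"
 unfolding wint_def
proof
 have [measurable]: "g \<in> \<B>"
  using g by (rule borel_measurable_continuous_onI)
 show "(\<lambda>t. g t*hat a h t) \<in> \<B>" by simp
 have "integrable lborel (\<lambda>t. ((1 + \<bar>t\<bar>)*g t)*hat a h t)"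
  by (intro integrable_continuous_hat continuous_intros g)
 then show "integrable lborel (\<lambda>t. (1 + \<bar>t\<bar>)*(g t*hat a h t))" by (simp add: mult_ac)
qed

text \<open>Guarantees that the set over which the infimum is taken is not empty.\<close>

lemma adm_hat: "adm (hat 0 1) 2" "mass (hat 0 1) > 0"
proof -
 have "Dir_le (\<lambda>t. 0 + 1*hat 0 1 t) 2"
  by (rule Dir_le_add_hat[where D = 0]) (auto simp: Dir_le_def)
 moreover have w: "wint (\<lambda>t. (hat 0 1 t*exp (2*t))*hat 0 1 t)"
  by (intro wint_times_hat continuous_intros)
 ultimately show "adm (hat 0 1) 2"
  by (auto simp: adm_def dens_def[abs_def] power2_eq_square mult_ac intro!: continuous_intros)
 have "integrable lborel (dens (hat 0 1))"
  using wint_integrable(1)[OF w] by (simp add: dens_def[abs_def] power2_eq_square mult_ac)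
 moreover have "\<not> (AE t in lborel. dens (hat 0 1) t = 0)"
 proof
  assume "AE t in lborel. dens (hat 0 1) t = 0"
  then have "AE t in lborel. t \<notin> {-1/2..1/2::real}"
   by eventually_elim (auto simp: dens_def hat_def)
  then have "emeasure lborel {-1/2..1/2::real} = 0"
   by (subst (asm) AE_iff_measurable[where N = "{-1/2..1/2}"]) auto
  then show False by (simp add: emeasure_lborel_Icc_eq)
 qed
 ultimately have "mass (hat 0 1) \<noteq> 0"
  unfolding mass_def by (subst integral_nonneg_eq_0_iff_AE) (auto simp: dens_nonneg)
 moreover have "mass (hat 0 1) >= 0"
  unfolding mass_def by (rule integral_nonneg_AE) (simp add: dens_nonneg)
 ultimately show "mass (hat 0 1) > 0" by simp
qed

text \<open>The Dirichlet bound gives Hoelder continuity with exponent 1/2 and constant 1. If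
  \<open>|f 0|\<close> exceeded 2, then \<open>|f|\<close> would exceed 1 on \<open>[0, 1]\<close>,
  where the density is at least \<open>f^2\<close>, and the mass would exceed 1.\<close>

lemma adm_bound:
 assumes f: "adm f 1" and M: "mass f = 1"
 shows "\<bar>f t\<bar> <= 2 + sqrt \<bar>t\<bar>"
proof -
 have H: "\<bar>f s - f t\<bar> <= sqrt \<bar>s - t\<bar>" for s t
  using Dir_le_Holder[of f 1 s t] f by (auto simp: adm_def real_le_rsqrt abs_le_square_iff[symmetric])
 have "\<bar>f 0\<bar> <= 2"
 proof (rule ccontr)
  assume f0: "\<not> \<bar>f 0\<bar> <= 2"
  define c where "c = \<bar>f 0\<bar> - 1"
  have c: "c > 1" using f0 by (simp add: c_def)
  have "c^2*indicator {0..1} t <= dens f t" for t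
  proof (cases "t \<in> {0..1}")
   case True
   then have "sqrt \<bar>0 - t\<bar> <= 1" by simp
   with H[of 0 t] have "\<bar>f t\<bar> >= c" unfolding c_def by linarith
   then have "(f t)^2 >= c^2" using c power_mono[of c "\<bar>f t\<bar>" 2] by simp
   moreover have "exp (2*t) >= 1" using True by simp
   ultimately have "c^2*1 <= (f t)^2*exp (2*t)" by (intro mult_mono) auto
   then show ?thesis using True by (simp add: dens_def)
  qed (simp add: dens_nonneg)
  then have "(LBINT t. c^2*indicator {0..1::real} t) <= mass f"
   unfolding mass_def by (intro integral_mono dens_integrable[OF f]) (auto intro!: integrable_real_indicator simp: emeasure_lborel_Icc_eq)
  then have "c^2 <= 1" using M by simp
  with c show False by (simp add: power2_eq_square) (smt (verit) mult_less_cancel_left2)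
 qed
 then show ?thesis using H[of t 0] by (simp add: abs_if split: if_splits)
qed

lemma square_le_linear:
 assumes "\<bar>x\<bar> <= 2 + sqrt \<bar>t\<bar>" shows "x^2 <= 8 + 2*\<bar>t\<bar>"
proof -
 have "x^2 <= (2 + sqrt \<bar>t\<bar>)^2" using assms by (metis abs_ge_zero power2_abs power_mono)
 also have "... <= 2*2^2 + 2*(sqrt \<bar>t\<bar>)^2"
  using sum_squares_bound[of 2 "sqrt \<bar>t\<bar>"] by (simp add: power2_eq_square algebra_simps)
 finally show ?thesis by simp
qed

text \<open>A common majorant of \<open>(1 + |t|) * dens f t\<close> for all normalised profiles. It
  is integrable on left half lines only, so everything to the right must be controlled by
  moments.\<close>

definition dom :: "real => real" where
 "dom t = (1 + \<bar>t\<bar>)*((8 + 2*\<bar>t\<bar>)*exp (2*t))"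

lemma integrable_exp_atMost: "integrable lborel (\<lambda>t. indicator {..R} t*exp t :: real)"
proof -
 have "(NN x. ennreal (exp (- x))*indicator {- R..} x) = ennreal (0 - (- exp (- (- R))))"
 proof (rule nn_integral_FTC_atLeast)
  show "((\<lambda>x::real. - exp (- x)) ---> 0) at_top"
  proof -
   have "((\<lambda>x::real. exp (- x)) ---> 0) at_top"
    by (rule filterlim_compose[OF exp_at_bot filterlim_uminus_at_bot_at_top])
   then show ?thesis using tendsto_minus by fastforce
  qed
 qed (auto intro!: derivative_eq_intros)
 then have fin: "(NN x. ennreal (exp (- x))*indicator {- R..} x) < \<infinity>" by simp
 have "integrable lborel (\<lambda>x. indicator {- R..} x*exp (- x) :: real)"
 proof (rule integrableI_bounded)
  have "(NN x. ennreal (norm (indicator {- R..} x*exp (- x) :: real)))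
    = (NN x. ennreal (exp (- x))*indicator {- R..} x)"
   by (intro nn_integral_cong) (auto simp: indicator_def)
  with fin show "(NN x. ennreal (norm (indicator {- R..} x*exp (- x) :: real))) < \<infinity>" by simp
 qed simp
 then have "integrable lborel (\<lambda>x. indicator {- R..} (0 + (-1)*x)*exp (- (0 + (-1)*x)) :: real)"
  by (rule lborel_integrable_real_affine) simp
 also have "(\<lambda>x. indicator {- R..} (0 + (-1)*x)*exp (- (0 + (-1)*x)) :: real) = (\<lambda>t. indicator {..R} t*exp t)"
  by (auto simp: indicator_def)
 finally show ?thesis .
qed

text \<open>One factor of \<open>exp (2 * t) = exp t * exp t\<close> absorbs the polynomial, the
  other is integrable on a left half line.\<close>

lemma dom_integrable: "integrable lborel (\<lambda>t. indicator {..R} t*dom t)"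
proof -
 have "\<exists>C. \<forall>t\<le>R. (1 + \<bar>t\<bar>)*((8 + 2*\<bar>t\<bar>)*exp t) <= C"
 proof (intro exI allI impI)
  fix t assume t: "t <= R"
  have e: "(1 + \<bar>t\<bar>)*(8 + 2*\<bar>t\<bar>) <= 16*exp \<bar>t\<bar>"
  proof -
   define x where "x = \<bar>t\<bar>"
   have x: "x >= 0" "x*x >= 0" by (auto simp: x_def)
   have "exp x >= 1 + x + x^2/2"
    by (rule exp_lower_Taylor_quadratic) (rule x)
   then have "16*exp x >= 16 + 16*x + 8*(x*x)" by (simp add: power2_eq_square)
   moreover have "(1 + x)*(8 + 2*x) = 8 + 10*x + 2*(x*x)" by (simp add: algebra_simps)
   ultimately show ?thesis unfolding x_def[symmetric] using x by linarith
  qed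
  have "(1 + \<bar>t\<bar>)*((8 + 2*\<bar>t\<bar>)*exp t) = ((1 + \<bar>t\<bar>)*(8 + 2*\<bar>t\<bar>))*exp t" by (simp add: mult_ac)
  also have "... <= 16*exp \<bar>t\<bar>*exp t" using e by (intro mult_right_mono) auto
  also have "... = 16*exp (\<bar>t\<bar> + t)" by (simp add: exp_add)
  also have "... <= 16*exp (2*\<bar>R\<bar>)" using t by auto
  finally show "(1 + \<bar>t\<bar>)*((8 + 2*\<bar>t\<bar>)*exp t) <= 16*exp (2*\<bar>R\<bar>)" .
 qed
 then obtain C where C: "\<And>t. t <= R ==> (1 + \<bar>t\<bar>)*((8 + 2*\<bar>t\<bar>)*exp t) <= C" by blast
 have "integrable lborel (\<lambda>t. C*(indicator {..R} t*exp t))"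
  by (intro integrable_mult_right integrable_exp_atMost)
 then show ?thesis
 proof (rule Bochner_Integration.integrable_bound)
  show "AE t in lborel. norm (indicator {..R} t*dom t) <= norm (C*(indicator {..R} t*exp t))"
  proof (rule AE_I2)
   fix t
   show "norm (indicator {..R} t*dom t) <= norm (C*(indicator {..R} t*exp t))"
   proof (cases "t <= R")
    case True
    have "0 <= (1 + \<bar>t\<bar>)*((8 + 2*\<bar>t\<bar>)*exp t)" by simp
    with C[OF True] have "0 <= C" by linarith
    have "dom t = ((1 + \<bar>t\<bar>)*((8 + 2*\<bar>t\<bar>)*exp t))*exp t"
     by (simp add: dom_def exp_add[symmetric])
    also have "... <= C*exp t" using C[OF True] by (intro mult_right_mono) auto
    finally have "dom t <= C*exp t" .
    moreover have "dom t >= 0" by (simp add: dom_def)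
    ultimately show ?thesis using True \<open>0 \<le> C\<close> by (simp add: abs_mult)
   qed simp
  qed
 qed (simp add: dom_def)
qed

section \<open>Minimising sequences and the Euler-Lagrange equation\<close>

lemma liminf_le_const_ennreal:
 fixes X :: "nat => ennreal"
 assumes "\<And>n. X n <= C" shows "liminf X <= C"
 using Liminf_mono[of X "\<lambda>_. C" sequentially] assms by (simp add: Liminf_const)

text \<open>The part of \<open>pot (dens f)\<close> that vanishes at minus infinity; for the
  minimiser and after rescaling it is the potential \<open>W\<close> of the ground state.\<close>

definition zpot :: "(real => real) => real => real" where
 "zpot f t = (LBINT s. max 0 (t - s)*dens f s)"

lemma dens_measurable:
 assumes "continuous_on UNIV f" shows "dens f \<in> \<B>"
 unfolding dens_def[abs_def]
 by (intro borel_measurable_continuous_onI continuous_intros assms)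

text \<open>The limit \<open>w\<close> of the moments is kept apart from
  \<open>mom (dens g)\<close>, which may be smaller. Minimality is stated in scale-invariant form
  for all admissible \<open>F\<close>, so that it applies to perturbations without normalising them
  again.\<close>

locale minseq =
 fixes f :: "nat => real => real" and g :: "real => real" and w L0 C1 :: real
 assumes adm: "\<And>n. adm (f n) 1" and mass1: "\<And>n. mass (f n) = 1"
  and nonneg: "\<And>n t. f n t >= 0"
  and wn: "\<And>n. wnorm (dens (f n)) <= C1"
  and Lam_lim: "(\<lambda>n. BB (dens (f n)) (dens (f n))) ----> L0"
  and conv: "\<And>t. (\<lambda>n. f n t) ----> g t"
  and mom_lim: "(\<lambda>n. mom (dens (f n))) ----> w"
  and minim: "\<And>F D. adm F D ==> D > 0 ==> mass F > 0 ==>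
    L0 <= BB (dens F) (dens F)/(mass F)^2 + ln (D/mass F)/2"
begin

lemma f_cont: "continuous_on UNIV (f n)" using adm by (simp add: adm_def)

lemma f_wint: "wint (dens (f n))" using adm by (simp add: adm_def)

lemma f_Holder: "\<bar>f n s - f n t\<bar> <= sqrt \<bar>s - t\<bar>"
 using Dir_le_Holder[of "f n" 1 s t] adm[of n] by (auto simp: adm_def real_le_rsqrt abs_le_square_iff[symmetric])

lemma g_Holder: "\<bar>g s - g t\<bar> <= sqrt \<bar>s - t\<bar>"
 by (rule tendsto_upperbound[OF tendsto_rabs[OF tendsto_diff[OF conv conv]]]) (auto simp: f_Holder)

lemma g_nonneg: "g t >= 0"
 by (rule tendsto_lowerbound[OF conv]) (auto simp: nonneg)

lemma g_cont: "continuous_on UNIV g"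
 unfolding continuous_on_eq_continuous_at[OF open_UNIV]
proof
 fix t
 have "((\<lambda>s. sqrt \<bar>s - t\<bar>) ---> sqrt \<bar>t - t\<bar>) (at t)" by (intro tendsto_intros)
 then have "((\<lambda>s. sqrt \<bar>s - t\<bar>) ---> 0) (at t)" by simp
 then have "((\<lambda>s. g s - g t) ---> 0) (at t)"
  by (rule Lim_null_comparison[rotated]) (auto simp: g_Holder)
 then show "isCont g t" unfolding isCont_def by (simp add: LIM_zero_iff)
qed

lemma f_bound: "\<bar>f n t\<bar> <= 2 + sqrt \<bar>t\<bar>" by (rule adm_bound[OF adm mass1])

lemma g_bound: "\<bar>g t\<bar> <= 2 + sqrt \<bar>t\<bar>"
 by (rule tendsto_upperbound[OF tendsto_rabs[OF conv]]) (auto simp: f_bound)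

lemma measf [measurable]: "f n \<in> \<B>" "dens (f n) \<in> \<B>"
 using borel_measurable_continuous_onI[OF f_cont] dens_measurable[OF f_cont] by auto

lemma measg [measurable]: "g \<in> \<B>" "dens g \<in> \<B>"
 using borel_measurable_continuous_onI[OF g_cont] dens_measurable[OF g_cont] by auto

lemma dens_le: "(1 + \<bar>t\<bar>)*dens (f n) t <= dom t" "(1 + \<bar>t\<bar>)*dens g t <= dom t"
 unfolding dens_def dom_def
 using square_le_linear[OF f_bound, of n t] square_le_linear[OF g_bound, of t]
 by (auto intro!: mult_left_mono mult_right_mono)

lemma dens_conv: "(\<lambda>n. dens (f n) t) ----> dens g t"
 unfolding dens_def by (intro tendsto_intros conv)

text \<open>Dominated convergence with majorant \<open>dom\<close>, available because the kernel
  vanishes to the right of \<open>R\<close>.\<close>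

lemma conv_integral:
 assumes k [measurable]: "k \<in> \<B>" and le: "\<And>s. \<bar>k s\<bar> <= K*(1 + \<bar>s\<bar>)" and R: "\<And>s. s > R ==> k s = 0"
 shows "(\<lambda>n. LBINT s. k s*dens (f n) s) ----> (LBINT s. k s*dens g s)"
proof (rule integral_dominated_convergence[where w = "\<lambda>s. K*(indicator {..R} s*dom s)"])
 show "integrable lborel (\<lambda>s. K*(indicator {..R} s*dom s))"
  by (intro integrable_mult_right dom_integrable)
 show "AE s in lborel. (\<lambda>n. k s*dens (f n) s) ----> k s*dens g s"
  by (intro AE_I2 tendsto_intros dens_conv)
 have "0 <= \<bar>k 0\<bar>" by simp
 also have "... <= K" using le[of 0] by simp
 finally have K: "K >= 0" .
 show "AE s in lborel. norm (k s*dens (f n) s) <= K*(indicator {..R} s*dom s)" for n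
 proof (rule AE_I2)
  fix s
  show "norm (k s*dens (f n) s) <= K*(indicator {..R} s*dom s)"
  proof (cases "s <= R")
   case True
   have "norm (k s*dens (f n) s) = \<bar>k s\<bar>*dens (f n) s" by (simp add: abs_mult dens_nonneg)
   also have "... <= K*(1 + \<bar>s\<bar>)*dens (f n) s" by (intro mult_right_mono le dens_nonneg)
   also have "... = K*((1 + \<bar>s\<bar>)*dens (f n) s)" by simp
   also have "... <= K*dom s" by (intro mult_left_mono dens_le K)
   finally show ?thesis using True by simp
  qed (use R in simp)
 qed
qed simp_all

lemma C1_nonneg: "C1 >= 0" using wn[of 0] wnorm_nonneg[of "dens (f 0)"] by linarith

lemma g_wint: "wint (dens g)"
 unfolding wint_def
proof
 have "(NN t. ennreal ((1 + \<bar>t\<bar>)*dens g t))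
   = (NN t. liminf (\<lambda>n. ennreal ((1 + \<bar>t\<bar>)*dens (f n) t)))"
  by (intro nn_integral_cong lim_imp_Liminf[symmetric] tendsto_ennrealI tendsto_intros dens_conv) simp
 also have "... <= liminf (\<lambda>n. NN t. ennreal ((1 + \<bar>t\<bar>)*dens (f n) t))"
  by (rule nn_integral_liminf) simp
 also have "... <= ennreal C1"
 proof (rule liminf_le_const_ennreal)
  fix n
  have "(NN t. ennreal ((1 + \<bar>t\<bar>)*dens (f n) t)) = ennreal (wnorm (dens (f n)))"
   unfolding wnorm_def using f_wint[of n]
   by (subst nn_integral_eq_integral) (auto simp: wint_def dens_nonneg)
  also have "... <= ennreal C1" using wn by (rule ennreal_leI)
  finally show "(NN t. ennreal ((1 + \<bar>t\<bar>)*dens (f n) t)) <= ennreal C1" .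
 qed
 finally have le: "(NN t. ennreal ((1 + \<bar>t\<bar>)*dens g t)) <= ennreal C1" .
 show "integrable lborel (\<lambda>t. (1 + \<bar>t\<bar>)*dens g t)"
 proof (rule integrableI_nonneg)
  show "(NN t. ennreal ((1 + \<bar>t\<bar>)*dens g t)) < \<infinity>"
   using le by (rule le_less_trans) simp
 qed (auto simp: dens_nonneg)
qed simp

lemma indicator_limit:
 assumes h: "integrable lborel h"
 shows "(\<lambda>n. LBINT s. indicator {..real n} s*h s) ----> (LBINT s. h s :: real)"
proof (rule integral_dominated_convergence[where w = "\<lambda>s. \<bar>h s\<bar>"])
 show "AE s in lborel. (\<lambda>n. indicator {..real n} s*h s) ----> h s"
 proof (rule AE_I2)
  fix s
  have "eventually (\<lambda>n. indicator {..real n} s*h s = h s) sequentially"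
   using eventually_ge_at_top[of "nat \<lceil>s\<rceil>"] by eventually_elim (auto simp: indicator_def nat_le_iff ceiling_le_iff)
  then show "(\<lambda>n. indicator {..real n} s*h s) ----> h s"
   by (rule tendsto_eventually)
 qed
qed (use h in \<open>auto simp: indicator_def\<close>)

text \<open>No mass is lost: the uniform bound on \<open>wnorm\<close> leaves at most
  \<open>C1 / R\<close> beyond \<open>R\<close>, and on \<open>{..R}\<close> the densities converge
  with majorant \<open>dom\<close>.\<close>

lemma g_mass: "mass g = 1"
proof (rule antisym)
 have i: "integrable lborel (dens g)" by (rule wint_integrable(1)[OF g_wint])
 have il: "integrable lborel (dens (f n))" for n by (rule wint_integrable(1)[OF f_wint])
 have lim: "(\<lambda>n. LBINT s. indicator {..R} s*dens (f n) s) ----> (LBINT s. indicator {..R} s*dens g s)" for R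
  by (rule conv_integral[where K = 1 and R = R]) (auto simp: indicator_def)
 have "(LBINT s. indicator {..R} s*dens g s) <= 1" for R
 proof (rule tendsto_upperbound[OF lim])
  have "(LBINT s. indicator {..R} s*dens (f n) s) <= mass (f n)" for n
   unfolding mass_def
   using il[of n] integrable_mult_indicator[of "{..R}" lborel "dens (f n)"]
   by (intro integral_mono) (auto simp: indicator_def dens_nonneg)
  then show "\<forall>\<^sub>F n in sequentially. (LBINT s. indicator {..R} s*dens (f n) s) <= 1"
   by (simp add: mass1)
 qed simp
 then show "mass g <= 1"
  unfolding mass_def by (intro tendsto_upperbound[OF indicator_limit[OF i]]) auto
 have "1 - C1/R <= (LBINT s. indicator {..R} s*dens g s)" if R: "R > 0" for R
 proof (rule tendsto_lowerbound[OF lim])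
  have "1 - C1/R <= (LBINT s. indicator {..R} s*dens (f n) s)" for n
  proof -
   have "1 - (LBINT s. indicator {..R} s*dens (f n) s) = (LBINT s. dens (f n) s - indicator {..R} s*dens (f n) s)"
    using mass1[of n] il[of n] integrable_mult_indicator[of "{..R}" lborel "dens (f n)"]
    by (subst Bochner_Integration.integral_diff) (auto simp: mass_def)
   also have "... <= (LBINT s. (1/R)*((1 + \<bar>s\<bar>)*\<bar>dens (f n) s\<bar>))"
   proof (rule integral_mono)
    show "integrable lborel (\<lambda>s. dens (f n) s - indicator {..R} s*dens (f n) s)"
     using il[of n] integrable_mult_indicator[of "{..R}" lborel "dens (f n)"] by auto
    show "integrable lborel (\<lambda>s. (1/R)*((1 + \<bar>s\<bar>)*\<bar>dens (f n) s\<bar>))"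
     by (intro integrable_mult_right wint_integrable_abs f_wint)
    fix s
    show "dens (f n) s - indicator {..R} s*dens (f n) s <= (1/R)*((1 + \<bar>s\<bar>)*\<bar>dens (f n) s\<bar>)"
    proof (cases "s <= R")
     case False
     then have "1 <= (1/R)*(1 + \<bar>s\<bar>)" using R by (simp add: field_simps)
     then have "1*dens (f n) s <= (1/R)*(1 + \<bar>s\<bar>)*dens (f n) s"
      by (rule mult_right_mono) (rule dens_nonneg)
     then show ?thesis using False by (simp add: dens_nonneg mult_ac)
    qed (use R dens_nonneg in simp)
   qed
   also have "... = wnorm (dens (f n))/R" by (simp add: wnorm_def)
   also have "... <= C1/R" using wn R by (simp add: divide_right_mono)
   finally show ?thesis by simp
  qed
  then show "\<forall>\<^sub>F n in sequentially. 1 - C1/R <= (LBINT s. indicator {..R} s*dens (f n) s)" by simp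
 qed simp
 then have "\<forall>\<^sub>F n in sequentially. 1 - C1/real n <= (LBINT s. indicator {..real n} s*dens g s)"
  by (intro eventually_mono[OF eventually_gt_at_top[of "0::nat"]]) auto
 moreover have "(\<lambda>n. 1 - C1/real n) ----> 1 - 0"
  by (intro tendsto_intros lim_const_over_n)
 ultimately have "1 - 0 <= mass g"
  unfolding mass_def by (intro tendsto_le[OF sequentially_bot indicator_limit[OF i]])
 then show "1 <= mass g" by simp
qed

text \<open>Cutting at \<open>R >= 0\<close> discards only nonnegative contributions to the moment,
  so the limit of the cut moments stays below \<open>w\<close>. Equality may fail if moment escapes
  to plus infinity.\<close>

lemma g_mom: "mom (dens g) <= w"
proof -
 have i: "integrable lborel (\<lambda>s. s*dens g s)" by (rule wint_integrable(2)[OF g_wint])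
 have "(LBINT s. indicator {..R} s*(s*dens g s)) <= w" if R: "R >= 0" for R
 proof (rule tendsto_le[OF _ mom_lim])
  show "(\<lambda>n. LBINT s. indicator {..R} s*(s*dens (f n) s)) ----> (LBINT s. indicator {..R} s*(s*dens g s))"
   using conv_integral[of "\<lambda>s. indicator {..R} s * s" 1 R] by (auto simp: indicator_def mult_ac)
  have "(LBINT s. indicator {..R} s*(s*dens (f n) s)) <= mom (dens (f n))" for n
   unfolding mom_def
  proof (rule integral_mono)
   show "integrable lborel (\<lambda>s. s*dens (f n) s)" by (rule wint_integrable(2)[OF f_wint])
   then show "integrable lborel (\<lambda>s. indicator {..R} s*(s*dens (f n) s))"
    using integrable_mult_indicator[of "{..R}" lborel "\<lambda>s. s*dens (f n) s"] by simp
   show "indicator {..R} s*(s*dens (f n) s) <= s*dens (f n) s" for s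
    using R by (auto simp: indicator_def dens_nonneg)
  qed
  then show "\<forall>\<^sub>F n in sequentially. (LBINT s. indicator {..R} s*(s*dens (f n) s)) <= mom (dens (f n))" by simp
 qed simp
 then show ?thesis
  unfolding mom_def by (intro tendsto_upperbound[OF indicator_limit[OF i]]) auto
qed

lemma zpot_conv: "(\<lambda>n. zpot (f n) t) ----> zpot g t"
 unfolding zpot_def
proof (rule conv_integral[where K = "1 + \<bar>t\<bar>" and R = t])
 fix s
 have "\<bar>max 0 (t - s)\<bar> <= \<bar>t\<bar> + \<bar>s\<bar>" by auto
 also have "... <= (1 + \<bar>t\<bar>)*(1 + \<bar>s\<bar>)" by (simp add: algebra_simps)
 finally show "\<bar>max 0 (t - s)\<bar> <= (1 + \<bar>t\<bar>)*(1 + \<bar>s\<bar>)" .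
qed auto

lemma pot_conv: "(\<lambda>n. pot (dens (f n)) t) ----> w + zpot g t"
 using tendsto_add[OF mom_lim zpot_conv[of t]] by (simp add: pot_eq[OF f_wint] zpot_def)

lemma pot_bound: "\<bar>pot (dens (f n)) t\<bar> <= C1*(1 + \<bar>t\<bar>)"
proof -
 have "\<bar>pot (dens (f n)) t\<bar> <= (LBINT s. \<bar>max s t*dens (f n) s\<bar>)"
  unfolding pot_def by (rule integral_abs_bound)
 also have "... <= (LBINT s. (1 + \<bar>t\<bar>)*((1 + \<bar>s\<bar>)*\<bar>dens (f n) s\<bar>))"
 proof (rule integral_mono)
  show "integrable lborel (\<lambda>s. \<bar>max s t*dens (f n) s\<bar>)"
   by (intro integrable_abs integrable_max_mult f_wint)
  show "integrable lborel (\<lambda>s. (1 + \<bar>t\<bar>)*((1 + \<bar>s\<bar>)*\<bar>dens (f n) s\<bar>))"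
   by (intro integrable_mult_right wint_integrable_abs f_wint)
  fix s show "\<bar>max s t*dens (f n) s\<bar> <= (1 + \<bar>t\<bar>)*((1 + \<bar>s\<bar>)*\<bar>dens (f n) s\<bar>)"
   using mult_right_mono[OF max_prod_le[of s t], of "\<bar>dens (f n) s\<bar>"] by (simp add: abs_mult mult_ac)
 qed
 also have "... = (1 + \<bar>t\<bar>)*wnorm (dens (f n))" by (simp add: wnorm_def)
 also have "... <= (1 + \<bar>t\<bar>)*C1" by (intro mult_left_mono wn) simp
 finally show ?thesis by (simp add: mult.commute)
qed

lemma measpot [measurable]: "pot (dens (f n)) \<in> \<B>" "zpot g \<in> \<B>"
 unfolding pot_def[abs_def] zpot_def[abs_def] by measurable

text \<open>The perturbed functions are \<open>f n + e * hat a h\<close>, since \<open>g\<close>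
  itself might fail to attain \<open>L0\<close>. For fixed \<open>e\<close> the minimality
  inequality is passed to the limit in \<open>n\<close>; it becomes a polynomial inequality in
  \<open>e\<close> with equality at 0, and its derivative there is the equation, with
  \<open>w\<close> in place of the moment of \<open>g\<close>.\<close>

lemma Euler_Lagrange:
 assumes h: "h > 0"
 shows "g (a + h) - 2*g a + g (a - h)
  = (LBINT t. (4*zpot g t - (4*L0 + 1 - 4*w))*exp (2*t)*g t*hat a h t)"
proof -
 \<comment> \<open>A majorant, linear in \<open>e\<close> after multiplication by
   \<open>|e|\<close>, for the change \<open>tau\<close> of the density, uniform over all profiles
   obeying the bound of \<open>f_bound\<close>.\<close>
 define kap where "kap = (\<lambda>t. ((2*(2 + sqrt \<bar>t\<bar>) + h)*exp (2*t))*hat a h t)"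
 have kapw: "wint kap"
  unfolding kap_def by (intro wint_times_hat continuous_intros)
 have kap0: "kap t >= 0" for t using h by (simp add: kap_def hat_nonneg)
 define K where "K = wnorm kap"
 have K0: "K >= 0" unfolding K_def by (rule wnorm_nonneg)
 note [measurable] = wint_measurable[OF kapw]
 define tau where "tau = (\<lambda>e u t. (2*e*u t*hat a h t + e^2*(hat a h t)^2)*exp (2*t))"
 have dens_tau: "dens (\<lambda>t. u t + e*hat a h t) = (\<lambda>t. dens u t + tau e u t)" for e u
  by (auto simp: dens_def tau_def power2_eq_square algebra_simps)
 have tau_le: "\<bar>tau e u t\<bar> <= \<bar>e\<bar>*kap t" if e: "\<bar>e\<bar> <= 1" and u: "\<And>t. \<bar>u t\<bar> <= 2 + sqrt \<bar>t\<bar>" for e u t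
 proof -
  have "e^2 <= \<bar>e\<bar>" using e by (metis abs_ge_zero abs_mult mult_left_le power2_abs power2_eq_square)
  have "\<bar>2*e*u t*hat a h t + e^2*(hat a h t)^2\<bar> <= \<bar>2*e*u t*hat a h t\<bar> + \<bar>e\<^sup>2*(hat a h t)^2\<bar>"
   by (rule abs_triangle_ineq)
  also have "\<bar>2*e*u t*hat a h t\<bar> = \<bar>e\<bar>*(2*\<bar>u t\<bar>*hat a h t)"
   by (simp add: abs_mult hat_nonneg)
  also have "... <= \<bar>e\<bar>*(2*(2 + sqrt \<bar>t\<bar>)*hat a h t)"
   using u[of t] by (intro mult_left_mono mult_right_mono) (auto simp: hat_nonneg)
  also have "\<bar>e\<^sup>2*(hat a h t)^2\<bar> <= \<bar>e\<bar>*(h*hat a h t)"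
  proof -
   have "(hat a h t)^2 <= h*hat a h t"
    unfolding power2_eq_square using h by (intro mult_right_mono hat_le hat_nonneg) simp
   with \<open>e\<^sup>2 \<le> \<bar>e\<bar>\<close> show ?thesis by (simp add: mult_mono)
  qed
  finally have "\<bar>2*e*u t*hat a h t + e^2*(hat a h t)^2\<bar> <= \<bar>e\<bar>*((2*(2 + sqrt \<bar>t\<bar>) + h)*hat a h t)"
   by (simp add: algebra_simps)
  then have "\<bar>2*e*u t*hat a h t + e^2*(hat a h t)^2\<bar>*exp (2*t) <= \<bar>e\<bar>*((2*(2 + sqrt \<bar>t\<bar>) + h)*hat a h t)*exp (2*t)"
   by (intro mult_right_mono) auto
  then show ?thesis unfolding tau_def kap_def by (simp add: abs_mult mult_ac)
 qed
 have tauw: "wint (tau e u)" if "\<bar>e\<bar> <= 1" "\<And>t. \<bar>u t\<bar> <= 2 + sqrt \<bar>t\<bar>" "u \<in> \<B>" for e u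
 proof (rule wint_bound[OF kapw])
  note [measurable] = that(3)
  show "tau e u \<in> \<B>" unfolding tau_def by simp
  show "\<bar>tau e u t\<bar> <= \<bar>e\<bar>*\<bar>kap t\<bar>" for t using tau_le[of e u t, OF that(1,2)] kap0[of t] by simp
 qed
 have tauK: "wnorm (tau e u) <= \<bar>e\<bar>*K" if t: "\<bar>e\<bar> <= 1" "\<And>t. \<bar>u t\<bar> <= 2 + sqrt \<bar>t\<bar>" "u \<in> \<B>" for e u
 proof -
  have "wnorm (tau e u) <= (LBINT t. \<bar>e\<bar>*((1 + \<bar>t\<bar>)*\<bar>kap t\<bar>))"
   unfolding wnorm_def
  proof (rule integral_mono)
   show "integrable lborel (\<lambda>x. (1 + \<bar>x\<bar>)*\<bar>tau e u x\<bar>)" by (rule wint_integrable_abs[OF tauw[OF t]])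
   show "integrable lborel (\<lambda>t. \<bar>e\<bar>*((1 + \<bar>t\<bar>)*\<bar>kap t\<bar>))"
    by (intro integrable_mult_right wint_integrable_abs kapw)
   fix x show "(1 + \<bar>x\<bar>)*\<bar>tau e u x\<bar> <= \<bar>e\<bar>*((1 + \<bar>x\<bar>)*\<bar>kap x\<bar>)"
    using mult_left_mono[OF tau_le[of e u x, OF t(1,2)], of "1 + \<bar>x\<bar>"] kap0[of x] by (simp add: mult_ac)
  qed
  then show ?thesis by (simp add: K_def wnorm_def)
 qed
 have int_wnorm: "\<bar>LBINT t. r t\<bar> <= wnorm r" if "wint r" for r
 proof -
  have "\<bar>LBINT t. r t\<bar> <= (LBINT t. \<bar>r t\<bar>)" by (rule integral_abs_bound)
  also have "... <= wnorm r"
   unfolding wnorm_def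
   by (intro integral_mono integrable_abs wint_integrable that wint_integrable_abs) (auto simp: algebra_simps)
  finally show ?thesis .
 qed
 define S where "S = (\<lambda>u::real=>real. u (a + h) - 2*u a + u (a - h))"
 have S_lim: "(\<lambda>n. S (f n)) ----> S g" unfolding S_def by (intro tendsto_intros conv)
 have S_le: "\<bar>S (f n)\<bar> <= 2 * sqrt h" for n
  using f_Holder[of n "a + h" a] f_Holder[of n "a - h" a] h unfolding S_def by (simp add: abs_le_iff)
 define m where "m = (\<lambda>e. LBINT t. tau e g t)"
 define B1 where "B1 = (\<lambda>e. LBINT t. (w + zpot g t)*tau e g t)"
 have tau_lim: "(\<lambda>n. tau e (f n) t) ----> tau e g t" for e t
  unfolding tau_def by (intro tendsto_intros conv)
 have kap_dom: "integrable lborel (\<lambda>t. C*((1 + \<bar>t\<bar>)*kap t))" for C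
  using wint_integrable_abs[OF kapw] kap0 by simp
 have m_lim: "(\<lambda>n. LBINT t. tau e (f n) t) ----> m e" if e: "\<bar>e\<bar> <= 1" for e
  unfolding m_def
 proof (rule integral_dominated_convergence[where w = "\<lambda>t. 1*((1 + \<bar>t\<bar>)*kap t)"])
  show "AE t in lborel. norm (tau e (f n) t) <= 1*((1 + \<bar>t\<bar>)*kap t)" for n
  proof (rule AE_I2)
   fix t
   have "\<bar>tau e (f n) t\<bar> <= \<bar>e\<bar>*kap t" by (rule tau_le[OF e f_bound])
   also have "... <= 1*kap t" using e kap0 by (intro mult_right_mono) auto
   also have "... <= (1 + \<bar>t\<bar>)*kap t" using kap0 by (intro mult_right_mono) auto
   finally show "norm (tau e (f n) t) <= 1*((1 + \<bar>t\<bar>)*kap t)" by simp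
  qed
  show "integrable lborel (\<lambda>t. 1*((1 + \<bar>t\<bar>)*kap t))" by (rule kap_dom)
  show "tau e g \<in> borel_measurable lborel" unfolding tau_def by simp
  show "(\<lambda>t. tau e (f n) t) \<in> borel_measurable lborel" for n unfolding tau_def by simp
 qed (auto simp: tau_lim)
 have B1_dom: "\<bar>p\<bar>*\<bar>tau e u t\<bar> <= C1*((1 + \<bar>t\<bar>)*kap t)"
  if "\<bar>e\<bar> <= 1" "\<And>t. \<bar>u t\<bar> <= 2 + sqrt \<bar>t\<bar>" "\<bar>p\<bar> <= C1*(1 + \<bar>t\<bar>)" for p e u t
 proof -
  have "\<bar>tau e u t\<bar> <= \<bar>e\<bar>*kap t" by (rule tau_le[OF that(1,2)])
  also have "... <= 1*kap t" using that kap0 by (intro mult_right_mono) auto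
  finally have "\<bar>p\<bar>*\<bar>tau e u t\<bar> <= (C1*(1 + \<bar>t\<bar>))*kap t"
   using that by (intro mult_mono) auto
  then show ?thesis by (simp add: mult_ac)
 qed
 have B1_lim: "(\<lambda>n. LBINT t. pot (dens (f n)) t*tau e (f n) t) ----> B1 e" if e: "\<bar>e\<bar> <= 1" for e
  unfolding B1_def
 proof (rule integral_dominated_convergence[where w = "\<lambda>t. C1*((1 + \<bar>t\<bar>)*kap t)"])
  show "AE t in lborel. norm (pot (dens (f n)) t*tau e (f n) t) <= C1*((1 + \<bar>t\<bar>)*kap t)" for n
   using B1_dom[OF e f_bound pot_bound] by (auto simp: abs_mult)
  show "AE t in lborel. (\<lambda>n. pot (dens (f n)) t*tau e (f n) t) ----> (w + zpot g t)*tau e g t"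
   by (intro AE_I2 tendsto_mult pot_conv tau_lim)
  show "(\<lambda>t. (w + zpot g t)*tau e g t) \<in> borel_measurable lborel" unfolding tau_def by simp
  show "(\<lambda>t. pot (dens (f n)) t*tau e (f n) t) \<in> borel_measurable lborel" for n unfolding tau_def by simp
 qed (rule kap_dom)
 have wz: "\<bar>w + zpot g t\<bar> <= C1*(1 + \<bar>t\<bar>)" for t
  by (rule tendsto_upperbound[OF tendsto_rabs[OF pot_conv]]) (auto simp: pot_bound)
 define l where "l = (LBINT t. (w + zpot g t)*(2*g t*hat a h t*exp (2*t)))"
 define l2 where "l2 = (LBINT t. (w + zpot g t)*((hat a h t)^2*exp (2*t)))"
 define p where "p = (LBINT t. 2*g t*hat a h t*exp (2*t))"
 define q where "q = (LBINT t. (hat a h t)^2*exp (2*t))"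
 have ip: "integrable lborel (\<lambda>t. 2*g t*hat a h t*exp (2*t))"
 proof -
  have "continuous_on UNIV (\<lambda>t. 2*g t*exp (2*t))" by (intro continuous_intros g_cont)
  from integrable_continuous_hat[OF this, of a h] show ?thesis by (simp add: mult_ac)
 qed
 have iq: "integrable lborel (\<lambda>t. (hat a h t)^2*exp (2*t))"
 proof -
  have "continuous_on UNIV (\<lambda>t. hat a h t*exp (2*t))" by (intro continuous_intros)
  from integrable_continuous_hat[OF this, of a h] show ?thesis by (simp add: mult_ac power2_eq_square)
 qed
 have il: "integrable lborel (\<lambda>t. (w + zpot g t)*(2*g t*hat a h t*exp (2*t)))"
 proof (rule Bochner_Integration.integrable_bound[OF kap_dom[of C1]])
  have "\<bar>2*g t*hat a h t*exp (2*t)\<bar> <= kap t" for t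
  proof -
   have "\<bar>2*g t*hat a h t*exp (2*t)\<bar> = (2*\<bar>g t\<bar>)*(exp (2*t)*hat a h t)"
    by (simp add: abs_mult hat_nonneg)
   also have "... <= (2*(2 + sqrt \<bar>t\<bar>) + h)*(exp (2*t)*hat a h t)"
    using g_bound[of t] h by (intro mult_right_mono) (auto simp: hat_nonneg)
   finally show ?thesis by (simp add: kap_def mult_ac)
  qed
  then have "\<bar>w + zpot g t\<bar>*\<bar>2*g t*hat a h t*exp (2*t)\<bar> <= C1*(1 + \<bar>t\<bar>)*kap t" for t
   using wz C1_nonneg by (intro mult_mono) auto
  then show "AE t in lborel. norm ((w + zpot g t)*(2*g t*hat a h t*exp (2*t))) <= norm (C1*((1 + \<bar>t\<bar>)*kap t))"
   using C1_nonneg kap0 by (auto simp: abs_mult mult_ac)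
 qed simp
 have il2: "integrable lborel (\<lambda>t. (w + zpot g t)*((hat a h t)^2*exp (2*t)))"
 proof (rule Bochner_Integration.integrable_bound[OF kap_dom[of C1]])
  have "\<bar>(hat a h t)\<^sup>2*exp (2*t)\<bar> <= kap t" for t
  proof -
   have "\<bar>(hat a h t)\<^sup>2*exp (2*t)\<bar> = hat a h t*(exp (2*t)*hat a h t)"
    by (simp add: power2_eq_square mult_ac abs_mult hat_nonneg)
   also have "... <= (2*(2 + sqrt \<bar>t\<bar>) + h)*(exp (2*t)*hat a h t)"
    using hat_le[of h a t] h by (intro mult_right_mono) (auto simp: hat_nonneg intro: add_increasing)
   finally show ?thesis by (simp add: kap_def mult_ac)
  qed
  then have "\<bar>w + zpot g t\<bar>*\<bar>(hat a h t)\<^sup>2*exp (2*t)\<bar> <= C1*(1 + \<bar>t\<bar>)*kap t" for t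
   using wz C1_nonneg by (intro mult_mono) auto
  then show "AE t in lborel. norm ((w + zpot g t)*((hat a h t)^2*exp (2*t))) <= norm (C1*((1 + \<bar>t\<bar>)*kap t))"
   using C1_nonneg kap0 by (auto simp: abs_mult mult_ac)
 qed simp
 have m_eq: "m e = e*p + e^2*q" for e
 proof -
  have "m e = (LBINT t. e*(2*g t*hat a h t*exp (2*t)) + e^2*((hat a h t)^2*exp (2*t)))"
   unfolding m_def tau_def by (intro Bochner_Integration.integral_cong) (auto simp: algebra_simps)
  then show ?thesis using ip iq by (simp add: p_def q_def)
 qed
 have B1_eq: "B1 e = e*l + e^2*l2" for e
 proof -
  have "B1 e = (LBINT t. e*((w + zpot g t)*(2*g t*hat a h t*exp (2*t)))
    + e^2*((w + zpot g t)*((hat a h t)^2*exp (2*t))))"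
   unfolding B1_def tau_def by (intro Bochner_Integration.integral_cong) (auto simp: algebra_simps)
  then show ?thesis using il il2 by (simp add: l_def l2_def)
 qed
 \<comment> \<open>The minimality inequality multiplied by \<open>M^2\<close>: \<open>M\<close> is
   the perturbed mass, \<open>B\<close> the cross term of the energy, \<open>s\<close> the second
   difference from the Dirichlet term, and \<open>e^2 * K^2\<close> bounds the quadratic part of the
   energy.\<close>
 define Phi where "Phi = (\<lambda>M e B s. L0 + 2*B + e^2*K^2 - L0*M^2 - (M^2 - M)/2
   + M^2*(- 2*e * s + e^2*(2*h))/2)"
 \<comment> \<open>The two bounds keep \<open>|e| * K\<close> and \<open>4 * |e| * sqrt h\<close>
   below 1, hence the perturbed mass and the perturbed Dirichlet bound positive.\<close>
 define e0 where "e0 = min 1 (min (1/(2*K + 1)) (1/(8 * sqrt h + 1)))"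
 have e0: "e0 > 0" unfolding e0_def using K0 h by (simp add: add_nonneg_pos)
 have Phi_nonneg: "0 <= Phi (1 + m e) e (B1 e) (S g)" if e: "\<bar>e\<bar> < e0" for e
 proof -
  have e1: "\<bar>e\<bar> <= 1" using e by (simp add: e0_def)
  have eK: "\<bar>e\<bar>*K < 1"
  proof -
   have "\<bar>e\<bar> < 1/(2*K + 1)" using e by (simp add: e0_def)
   then have "\<bar>e\<bar>*(2*K + 1) < 1" using K0 by (simp add: pos_less_divide_eq add_nonneg_pos)
   moreover have "\<bar>e\<bar>*K <= \<bar>e\<bar>*(2*K + 1)" using K0 by (intro mult_left_mono) auto
   ultimately show ?thesis by linarith
  qed
  have eh: "4*(\<bar>e\<bar> * sqrt h) < 1"
  proof -
   have "\<bar>e\<bar> < 1/(8 * sqrt h + 1)" using e by (simp add: e0_def)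
   then have "\<bar>e\<bar>*(8 * sqrt h + 1) < 1" using h by (simp add: pos_less_divide_eq add_nonneg_pos)
   moreover have "\<bar>e\<bar>*(4 * sqrt h) <= \<bar>e\<bar>*(8 * sqrt h + 1)" using h by (intro mult_left_mono) auto
   ultimately show ?thesis by linarith
  qed
  have ineq: "0 <= (BB (dens (f n)) (dens (f n)) - L0) + Phi (1 + (LBINT t. tau e (f n) t)) e (LBINT t. pot (dens (f n)) t*tau e (f n) t) (S (f n))" for n
  proof -
   define F where "F = (\<lambda>t. f n t + e*hat a h t)"
   define D where "D = 1 - 2*e*S (f n) + e^2*(2*h)"
   define M where "M = 1 + (LBINT t. tau e (f n) t)"
   note tw = tauw[OF e1 f_bound measf(1)[of n]]
   have "\<bar>2*e*S (f n)\<bar> <= 4*(\<bar>e\<bar> * sqrt h)"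
    using mult_left_mono[OF S_le[of n], of "2*\<bar>e\<bar>"] by (simp add: abs_mult mult_ac)
   then have D: "D > 0" unfolding D_def using eh h by (smt (verit) mult_nonneg_nonneg zero_le_power2)
   have "Dir_le F D"
    unfolding F_def using D adm[of n] h
    by (intro Dir_le_add_hat[where D = 1]) (auto simp: D_def S_def adm_def)
   moreover have dF: "dens F = (\<lambda>t. dens (f n) t + tau e (f n) t)" unfolding F_def by (rule dens_tau)
   moreover have "wint (dens F)" unfolding dF by (intro wint_add f_wint tw)
   moreover have "continuous_on UNIV F" unfolding F_def by (intro continuous_intros f_cont)
   ultimately have aF: "adm F D" by (simp add: adm_def)
   have MF: "mass F = M"
    unfolding mass_def dF M_def using wint_integrable(1)[OF f_wint[of n]] wint_integrable(1)[OF tw] mass1[of n]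
    by (simp add: mass_def)
   have "\<bar>LBINT t. tau e (f n) t\<bar> <= \<bar>e\<bar>*K"
    using int_wnorm[OF tw] tauK[OF e1 f_bound measf(1)[of n]] by linarith
   then have M: "M > 0" unfolding M_def using eK by linarith
   have BF: "BB (dens F) (dens F) = BB (dens (f n)) (dens (f n)) + 2*(LBINT t. pot (dens (f n)) t*tau e (f n) t) + BB (tau e (f n)) (tau e (f n))"
    unfolding dF using BB_square_add[OF f_wint tw] BB_pot(1)[OF f_wint tw] by simp
   have "BB (tau e (f n)) (tau e (f n)) <= wnorm (tau e (f n))*wnorm (tau e (f n))"
    using BB_bound[OF tw tw] by linarith
   also have "... <= (\<bar>e\<bar>*K)*(\<bar>e\<bar>*K)"
    using tauK[OF e1 f_bound measf(1)[of n]] wnorm_nonneg K0 by (intro mult_mono) auto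
   finally have BT: "BB (tau e (f n)) (tau e (f n)) <= e^2*K^2" by (simp add: power2_eq_square mult_ac)
   have "L0 <= BB (dens F) (dens F)/M^2 + ln (D/M)/2"
    using minim[OF aF D] M by (simp add: MF)
   also have "ln (D/M)/2 = ln D/2 - ln M/2" using D M by (simp add: ln_div diff_divide_distrib)
   \<comment> \<open>Both logarithms are replaced by upper bounds that are exact to first order at
     \<open>D = M = 1\<close>, so nothing is lost in the derivative at \<open>e = 0\<close>.\<close>
   also have "ln D/2 - ln M/2 <= (D - 1)/2 - (1 - 1/M)/2"
   proof -
    have "- ln M <= 1/M - 1" using ln_le_minus_one[of "1/M"] M by (simp add: ln_div)
    with ln_le_minus_one[OF D] have "(ln D - ln M)/2 <= ((D - 1) - (1 - 1/M))/2"
     by (intro divide_right_mono) auto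
    then show ?thesis by (simp only: diff_divide_distrib)
   qed
   finally have "L0 <= BB (dens F) (dens F)/M^2 + ((D - 1)/2 - (1 - 1/M)/2)" by simp
   then have "L0*M^2 <= (BB (dens F) (dens F)/M^2 + ((D - 1)/2 - (1 - 1/M)/2))*M^2"
    by (rule mult_right_mono) simp
   also have "... = BB (dens F) (dens F) + M^2*(D - 1)/2 - (M^2 - M)/2"
    using M by (simp add: field_simps power2_eq_square)
   finally have "0 <= BB (dens F) (dens F) - L0*M^2 - (M^2 - M)/2 + M^2*(D - 1)/2" by simp
   moreover have "D - 1 = - 2*e*S (f n) + e^2*(2*h)" by (simp add: D_def)
   ultimately show ?thesis
    unfolding Phi_def M_def[symmetric] using BF BT by simp
  qed
  have "(\<lambda>n. (BB (dens (f n)) (dens (f n)) - L0) + Phi (1 + (LBINT t. tau e (f n) t)) e (LBINT t. pot (dens (f n)) t*tau e (f n) t) (S (f n)))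
   ----> (L0 - L0) + Phi (1 + m e) e (B1 e) (S g)"
   unfolding Phi_def by (intro tendsto_intros Lam_lim m_lim B1_lim S_lim e1) simp_all
  then have "0 <= (L0 - L0) + Phi (1 + m e) e (B1 e) (S g)"
   by (rule tendsto_lowerbound) (use ineq in auto)
  then show ?thesis by simp
 qed
 define Q where "Q = (\<lambda>e. Phi (1 + (e*p + e^2*q)) e (e*l + e^2*l2) (S g))"
 have Q0: "Q 0 = 0" by (simp add: Q_def Phi_def)
 have dQ: "DERIV Q 0 :> (2*l - 2*L0*p - p/2 - S g)"
  unfolding Q_def Phi_def by (rule derivative_eq_intros refl | simp)+
 \<comment> \<open>\<open>Q\<close> is nonnegative for small \<open>e\<close> of either sign and
   \<open>Q 0 = 0\<close>, so 0 is an interior minimum.\<close>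
 have "2*l - 2*L0*p - p/2 - S g = 0"
  using dQ e0
 proof (rule DERIV_local_min)
  show "\<forall>y. \<bar>0 - y\<bar> < e0 \<longrightarrow> Q 0 <= Q y"
   unfolding Q0 using Phi_nonneg by (auto simp: Q_def m_eq B1_eq)
 qed
 then have "S g = 2*l - (2*L0 + 1/2)*p" by (simp add: algebra_simps)
 also have "... = (LBINT t. 2*((w + zpot g t)*(2*g t*hat a h t*exp (2*t))) - (2*L0 + 1/2)*(2*g t*hat a h t*exp (2*t)))"
  unfolding l_def p_def
  by (subst Bochner_Integration.integral_diff)
   (simp_all only: il ip integrable_mult_right integral_mult_right_zero)
 also have "... = (LBINT t. (4*zpot g t - (4*L0 + 1 - 4*w))*exp (2*t)*g t*hat a h t)"
  by (intro Bochner_Integration.integral_cong) (auto simp: algebra_simps)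
 finally show "g (a + h) - 2*g a + g (a - h)
  = (LBINT t. (4*zpot g t - (4*L0 + 1 - 4*w))*exp (2*t)*g t*hat a h t)"
  by (simp add: S_def)
qed

end

text \<open>\<open>dom\<close> controls the negative half of the moment uniformly and the energy
  controls the moment from above; together they bound the weighted norm along a minimising
  sequence.\<close>

lemma normalised_bounds:
 assumes f: "adm f 1" and M: "mass f = 1"
 defines "C0 \<equiv> (LBINT t. indicator {..0} t*dom t)"
 shows "mom (dens f) >= - C0" "BB (dens f) (dens f) >= mom (dens f)"
  "wnorm (dens f) <= 1 + mom (dens f) + 2*C0"
proof -
 have w: "wint (dens f)" using f by (simp add: adm_def)
 have le: "(1 + \<bar>t\<bar>)*dens f t <= dom t" for t
  unfolding dens_def dom_def
  using square_le_linear[OF adm_bound[OF f M], of t] by (auto intro!: mult_left_mono mult_right_mono)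
 have neg: "- t*dens f t <= indicator {..0} t*dom t" for t
 proof (cases "t <= 0")
  case True
  have "- t*dens f t <= (1 + \<bar>t\<bar>)*dens f t" using True by (intro mult_right_mono dens_nonneg) auto
  also have "... <= dom t" by (rule le)
  finally show ?thesis using True by simp
 qed (simp add: dens_nonneg)
 have "- mom (dens f) = (LBINT t. - t*dens f t)"
  unfolding mom_def by simp
 also have "... <= C0"
  unfolding C0_def
  by (intro integral_mono dom_integrable neg) (use wint_integrable(2)[OF w] in simp)
 finally show "mom (dens f) >= - C0" by simp
 show "BB (dens f) (dens f) >= mom (dens f)"
  using BB_ge_mom[OF w dens_nonneg] M by (simp add: mass_def)
 have "(LBINT t. \<bar>t\<bar>*dens f t) <= (LBINT t. t*dens f t + 2*(indicator {..0} t*dom t))"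
 proof (rule integral_mono)
  show "integrable lborel (\<lambda>t. \<bar>t\<bar>*dens f t)" by (rule wint_integrable[OF w])
  show "integrable lborel (\<lambda>t. t*dens f t + 2*(indicator {..0} t*dom t))"
   by (intro Bochner_Integration.integrable_add integrable_mult_right dom_integrable wint_integrable w)
  fix t show "\<bar>t\<bar>*dens f t <= t*dens f t + 2*(indicator {..0} t*dom t)"
   using neg[of t] by (cases "t <= 0") (auto simp: algebra_simps)
 qed
 also have "... = mom (dens f) + 2*C0"
  using dom_integrable[of 0] wint_integrable(2)[OF w] by (simp add: mom_def C0_def)
 finally show "wnorm (dens f) <= 1 + mom (dens f) + 2*C0"
  using wnorm_eq[OF w dens_nonneg] M by (simp add: mass_def)
qed

text \<open>A diagonal subsequence converges at all rational points, and the common Hoelder bound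
  carries this over to every real point. Absolute values are taken at the start, which changes
  neither the densities nor the Dirichlet bound.\<close>

lemma minseq_exists: "\<exists>f g w L0 C1. minseq f g w L0 C1"
proof -
 define C0 where "C0 = (LBINT t. indicator {..0} t*dom t)"
 define X where "X = {BB (dens f) (dens f) | f. adm f 1 \<and> mass f = 1}"
 define L0 where "L0 = Inf X"
 have bdd: "bdd_below X"
  unfolding X_def bdd_below_def using normalised_bounds by (intro exI[of _ "- C0"]) (force simp: C0_def)
 have ne: "X \<noteq> {}"
 proof -
  obtain f' where "adm f' 1" "mass f' = 1"
   using adm_normalise[OF adm_hat(1) _ adm_hat(2)] by auto
  then show ?thesis unfolding X_def by blast
 qed
 have L0le: "L0 <= BB (dens F) (dens F)/(mass F)^2 + ln (D/mass F)/2"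
  if F: "adm F D" "D > 0" "mass F > 0" for F D
 proof -
  obtain f' where "adm f' 1" "mass f' = 1"
   "BB (dens f') (dens f') = BB (dens F) (dens F)/(mass F)^2 + ln (D/mass F)/2"
   using adm_normalise[OF F] by blast
  then have "BB (dens F) (dens F)/(mass F)^2 + ln (D/mass F)/2 \<in> X" unfolding X_def by force
  then show ?thesis unfolding L0_def using bdd by (rule cInf_lower)
 qed
 have "\<exists>f. adm f 1 \<and> mass f = 1 \<and> (\<forall>t. f t >= 0) \<and> BB (dens f) (dens f) < L0 + 1/real (Suc n)" for n
 proof -
  have "Inf X < L0 + 1/real (Suc n)" by (simp add: L0_def)
  then obtain f where f: "adm f 1" "mass f = 1" "BB (dens f) (dens f) < L0 + 1/real (Suc n)"
   using cInf_lessD[OF ne] unfolding X_def by blast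
  have "dens (\<lambda>t. \<bar>f t\<bar>) = dens f" by (auto simp: dens_def)
  then have "mass (\<lambda>t. \<bar>f t\<bar>) = 1" using f by (simp add: mass_def)
  with f \<open>dens (\<lambda>t. \<bar>f t\<bar>) = dens f\<close> show ?thesis
   by (intro exI[of _ "\<lambda>t. \<bar>f t\<bar>"]) (auto intro: adm_abs)
 qed
 then obtain f where f: "\<And>n. adm (f n) 1" "\<And>n. mass (f n) = 1" "\<And>n t. f n t >= 0"
  "\<And>n. BB (dens (f n)) (dens (f n)) < L0 + 1/real (Suc n)" by metis
 have L0ge: "L0 <= BB (dens (f n)) (dens (f n))" for n
  using L0le[OF f(1)] f(2) by simp
 have momle: "mom (dens (f n)) <= L0 + 1" "mom (dens (f n)) >= - C0" for n
 proof -
  have "1/real (Suc n) <= 1" by simp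
  with normalised_bounds(2)[OF f(1,2), of n] f(4)[of n] show "mom (dens (f n)) <= L0 + 1" by linarith
  show "mom (dens (f n)) >= - C0" using normalised_bounds(1)[OF f(1,2)] by (simp add: C0_def)
 qed
 define B where "B = 1 + \<bar>L0\<bar> + \<bar>C0\<bar>"
 have momB: "\<bar>mom (dens (f n))\<bar> <= B" for n using momle[of n] unfolding B_def by linarith
 \<comment> \<open>The index \<open>None\<close> adds the first moment as one more coordinate to the
   diagonal extraction. Dividing by the known bounds puts every coordinate into
   \<open>[-1, 1]\<close>.\<close>
 define G where "G = (\<lambda>n y. case y of None => mom (dens (f n))/B | Some t => f n t/(2 + sqrt \<bar>t\<bar>))"
 have Gb: "norm (G n y) <= 1" for n y
 proof (cases y)
  case None then show ?thesis using momB[of n] by (simp add: G_def B_def)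
 next
  case (Some t)
  have "2 + sqrt \<bar>t\<bar> > 0" by (simp add: add_pos_nonneg)
  then show ?thesis using adm_bound[OF f(1,2), of n t] Some by (simp add: G_def)
 qed
 have cS: "countable (insert None (Some ` (\<rat> :: real set)))" by (simp add: countable_rat)
 obtain k where k: "strict_mono (k :: nat => nat)"
  and kl: "\<And>y. y \<in> insert None (Some ` (\<rat> :: real set)) ==> \<exists>l. (\<lambda>n. G (k n) y) ----> l"
  using function_convergent_subsequence[OF cS, of G 1] Gb by blast
 obtain w where w: "(\<lambda>n. mom (dens (f (k n)))) ----> w"
 proof -
  obtain l where "(\<lambda>n. mom (dens (f (k n)))/B) ----> l" using kl[of None] by (auto simp: G_def)
  then have "(\<lambda>n. mom (dens (f (k n)))/B*B) ----> l*B" by (rule tendsto_mult_right)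
  moreover have "B \<noteq> 0" unfolding B_def by (smt (verit) abs_ge_zero)
  ultimately show ?thesis using that by simp
 qed
 have rat: "Cauchy (\<lambda>n. f (k n) q)" if q: "q \<in> \<rat>" for q
 proof -
  obtain l where "(\<lambda>n. f (k n) q/(2 + sqrt \<bar>q\<bar>)) ----> l" using kl[of "Some q"] q by (auto simp: G_def)
  then have "(\<lambda>n. f (k n) q/(2 + sqrt \<bar>q\<bar>)*(2 + sqrt \<bar>q\<bar>)) ----> l*(2 + sqrt \<bar>q\<bar>)" by (rule tendsto_mult_right)
  moreover have "2 + sqrt \<bar>q\<bar> \<noteq> 0" by (smt (verit) real_sqrt_ge_zero abs_ge_zero)
  ultimately show ?thesis by (auto intro: LIMSEQ_imp_Cauchy)
 qed
 have H: "\<bar>f n s - f n t\<bar> <= sqrt \<bar>s - t\<bar>" for n s t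
  using Dir_le_Holder[of "f n" 1 s t] f(1)[of n] by (auto simp: adm_def real_le_rsqrt abs_le_square_iff[symmetric])
 have "convergent (\<lambda>n. f (k n) t)" for t
 proof (rule Cauchy_convergent, rule CauchyI)
  fix e :: real assume e: "e > 0"
  obtain q where q: "q \<in> \<rat>" "\<bar>t - q\<bar> < (e/3)^2"
  proof -
   have "t < t + (e/3)^2" using e by simp
   then obtain q where "q \<in> \<rat>" "t < q" "q < t + (e/3)^2" using Rats_dense_in_real by blast
   then show ?thesis using that[of q] by auto
  qed
  have s: "sqrt \<bar>t - q\<bar> < e/3" "sqrt \<bar>q - t\<bar> < e/3"
   using real_sqrt_less_mono[OF q(2)] e by (auto simp: abs_minus_commute)
  obtain N where N: "\<And>m n. m >= N ==> n >= N ==> norm (f (k m) q - f (k n) q) < e/3"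
   using CauchyD[OF rat[OF q(1)], of "e/3"] e by auto
  have "norm (f (k m) t - f (k n) t) < e" if "m >= N" "n >= N" for m n
   using N[OF that] H[of "k m" t q] H[of "k n" q t] s by (simp add: abs_if split: if_splits)
  then show "\<exists>M. \<forall>m\<ge>M. \<forall>n\<ge>M. norm (f (k m) t - f (k n) t) < e" by blast
 qed
 then obtain g where g: "\<And>t. (\<lambda>n. f (k n) t) ----> g t"
  unfolding convergent_def by metis
 have lamL: "(\<lambda>n. BB (dens (f n)) (dens (f n))) ----> L0"
 proof (rule tendsto_sandwich[where f = "\<lambda>_. L0" and h = "\<lambda>n. L0 + 1/real (Suc n)"])
  show "(\<lambda>n. L0 + 1/real (Suc n)) ----> L0"
   using tendsto_add[OF tendsto_const[of L0] LIMSEQ_Suc[OF lim_const_over_n[of 1]]] by simp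
  show "(\<lambda>n. L0) ----> L0" by simp
  show "\<forall>\<^sub>F n in sequentially. BB (dens (f n)) (dens (f n)) <= L0 + 1/real (Suc n)"
   using f(4) by (auto intro!: always_eventually less_imp_le)
 qed (use L0ge in auto)
 have "minseq (\<lambda>n. f (k n)) g w L0 (1 + B + 2*C0)"
 proof (unfold_locales)
  show "wnorm (dens (f (k n))) <= 1 + B + 2*C0" for n
   using normalised_bounds(3)[OF f(1,2), of "k n"] momB[of "k n"] unfolding C0_def by linarith
  show "(\<lambda>n. BB (dens (f (k n))) (dens (f (k n)))) ----> L0"
   using LIMSEQ_subseq_LIMSEQ[OF lamL k] by (simp add: o_def)
 qed (use f g w L0le in auto)
 then show ?thesis by blast
qed

section \<open>Regularity of the limit profile and of its potential\<close>

lemma DERIV_continuous_UNIV: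
 "(\<And>x. DERIV F x :> F' x) ==> continuous_on UNIV F"
 by (meson DERIV_isCont continuous_at_imp_continuous_on)

lemma DERIV_comp_add:
 "DERIV F (a + s) :> D ==> DERIV (\<lambda>s. F (a + s)) (s::real) :> D"
proof -
 assume F: "DERIV F (a + s) :> D"
 have "DERIV (\<lambda>s. a + s) s :> 1" by (auto intro!: derivative_eq_intros)
 from DERIV_chain'[OF this F] show ?thesis by simp
qed

lemma DERIV_comp_diff:
 "DERIV F (a - s) :> D ==> DERIV (\<lambda>s. F (a - s)) (s::real) :> - D"
proof -
 assume F: "DERIV F (a - s) :> D"
 have "DERIV (\<lambda>s. a - s) s :> -1" by (auto intro!: derivative_eq_intros)
 from DERIV_chain'[OF this F] show ?thesis by simp
qed

text \<open>Integrating the hypothesis over \<open>h\<close> in \<open>[0, 1]\<close> writes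
  \<open>k a\<close> as half the increment of an antiderivative over \<open>[a - 1, a + 1]\<close>,
  so \<open>k\<close> is differentiable. Differentiating the hypothesis in \<open>h\<close> then
  shows that the derivative is constant.\<close>

lemma zero_second_difference_affine:
 fixes k :: "real => real"
 assumes k: "continuous_on UNIV k" and z: "\<And>a h. h > 0 ==> k (a + h) - 2*k a + k (a - h) = 0"
 obtains d where "\<And>t. DERIV k t :> d"
proof -
 obtain K where K: "\<And>x. DERIV K x :> k x"
  using antiderivative_real[OF k] by blast
 have z': "k (a + h) + k (a - h) = 2*k a" for a h
  using z[of h a] z[of "- h" a] by (cases "h > 0"; cases "h = 0") auto
 have eq: "K (a + 1) - K (a - 1) = 2*k a" for a
 proof -
  define P where "P = (\<lambda>s. K (a + s) - K (a - s) - 2 * s*k a)"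
  have "DERIV P s :> 0" for s
  proof -
   show ?thesis
    unfolding P_def using z'[of a s]
    by (auto intro!: derivative_eq_intros DERIV_comp_add[OF K] DERIV_comp_diff[OF K])
  qed
  then have "P 1 = P 0" by (rule DERIV_isconst_all[rule_format])
  then show ?thesis by (simp add: P_def)
 qed
 have dk: "DERIV k a :> (k (a + 1) - k (a - 1))/2" for a
 proof -
  have "k = (\<lambda>a. (K (a + 1) - K (a - 1))/2)" using eq by auto
  moreover have "DERIV (\<lambda>a. (K (a + 1) - K (a - 1))/2) a :> (k (a + 1) - k (a - 1))/2"
   using DERIV_comp_add[of K "k (1 + a)" 1 a] DERIV_comp_add[of K "k (- 1 + a)" "-1" a] K
   by (auto intro!: derivative_eq_intros simp: add.commute)
  ultimately show ?thesis by metis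
 qed
 define k' where "k' = (\<lambda>a. (k (a + 1) - k (a - 1))/2)"
 have "k' a = k' b" for a b
 proof -
  define c h where "c = (a + b)/2" and "h = (a - b)/2"
  have "DERIV (\<lambda>h. k (c + h) + k (c - h)) h :> k' (c + h) - k' (c - h)"
   using DERIV_add[OF DERIV_comp_add[OF dk] DERIV_comp_diff[OF dk]]
   unfolding k'_def by simp
  then have "DERIV (\<lambda>h. 2*k c) h :> k' (c + h) - k' (c - h)" unfolding z' .
  moreover have "DERIV (\<lambda>h. 2*k c) h :> 0" by simp
  ultimately have "k' (c + h) - k' (c - h) = 0" by (rule DERIV_unique)
  moreover have "c + h = a" "c - h = b" by (simp_all add: c_def h_def field_simps)
  ultimately show ?thesis by simp
 qed
 then have "DERIV k t :> k' 0" for t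
  using dk[of t] unfolding k'_def by metis
 then show ?thesis using that by blast
qed

definition cmass :: "(real => real) => real => real" where
 "cmass f t = (LBINT s. indicator {..t} s*dens f s)"

context
 fixes g :: "real => real"
 assumes gc: "continuous_on UNIV g" and gw: "wint (dens g)"
begin

lemma dens_cont: "continuous_on UNIV (dens g)"
 unfolding dens_def[abs_def] by (intro continuous_intros gc)

lemma integrable_indicator_dens: "integrable lborel (\<lambda>s. indicator {..t} s*dens g s)"
 using integrable_mult_indicator[of "{..t}" lborel "dens g"] wint_integrable(1)[OF gw] by simp

lemma cmass_deriv: "DERIV (cmass g) t :> dens g t"
proof -
 obtain F where F: "\<And>x. DERIV F x :> dens g x"
  using antiderivative_real[OF dens_cont] by blast
 have diff: "cmass g b - cmass g a = F b - F a" if "a <= b" for a b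
 proof -
  have c: "continuous_on {a..b} (dens g)" by (rule continuous_on_subset[OF dens_cont]) simp
  have "cmass g b - cmass g a = (LBINT s. indicator {..b} s*dens g s - indicator {..a} s*dens g s)"
   unfolding cmass_def using integrable_indicator_dens by simp
  also have "... = (LINT s:{a..b}|lborel. dens g s)"
   unfolding set_lebesgue_integral_def
  proof (rule integral_cong_AE)
   show "AE s in lborel. indicator {..b} s*dens g s - indicator {..a} s*dens g s = indicator {a..b} s *\<^sub>R dens g s"
    using AE_lborel_singleton[of a] by eventually_elim (use that in \<open>auto simp: indicator_def\<close>)
  qed (use dens_measurable[OF gc] in simp_all)
  also have "... = integral {a..b} (dens g)"
   by (rule set_borel_integral_eq_integral(2)[OF borel_integrable_atLeastAtMost'[OF c]])
  also have "... = F b - F a"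
   using that F by (intro integral_unique fundamental_theorem_of_calculus)
    (auto simp: has_real_derivative_iff_has_vector_derivative has_vector_derivative_at_within)
  finally show ?thesis .
 qed
 have "cmass g = (\<lambda>t. F t + (cmass g 0 - F 0))"
 proof
  fix t show "cmass g t = F t + (cmass g 0 - F 0)"
   using diff[of 0 t] diff[of t 0] by (cases "0 <= t") auto
 qed
 moreover have "DERIV (\<lambda>t. F t + (cmass g 0 - F 0)) t :> dens g t"
  using F[of t] by (auto intro!: derivative_eq_intros)
 ultimately show ?thesis by metis
qed

text \<open>The error of the linear approximation sees only mass between \<open>t\<close> and
  \<open>t + h\<close>, with a kernel of size at most \<open>|h|\<close>, and \<open>cmass\<close>
  is continuous.\<close>

lemma zpot_deriv: "DERIV (zpot g) t :> cmass g t"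
proof -
 have est: "\<bar>zpot g (t + h) - zpot g t - h*cmass g t\<bar> <= \<bar>h\<bar>*\<bar>cmass g (t + h) - cmass g t\<bar>" for h
 proof -
  let ?sg = "if h >= 0 then 1 else - 1 :: real"
  have "\<bar>zpot g (t + h) - zpot g t - h*cmass g t\<bar>
   = \<bar>LBINT s. max 0 (t + h - s)*dens g s - max 0 (t - s)*dens g s - h*(indicator {..t} s*dens g s)\<bar>"
   unfolding zpot_def cmass_def using integrable_indicator_dens integrable_max_mult(1)[OF gw] by simp
  also have "... <= (LBINT s. \<bar>max 0 (t + h - s)*dens g s - max 0 (t - s)*dens g s - h*(indicator {..t} s*dens g s)\<bar>)"
   by (rule integral_abs_bound)
  also have "... <= (LBINT s. \<bar>h\<bar>*(?sg*(indicator {..t + h} s*dens g s - indicator {..t} s*dens g s)))"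
  proof (rule integral_mono)
   show "integrable lborel (\<lambda>s. \<bar>max 0 (t + h - s)*dens g s - max 0 (t - s)*dens g s - h*(indicator {..t} s*dens g s)\<bar>)"
    by (intro integrable_abs Bochner_Integration.integrable_diff integrable_mult_right integrable_indicator_dens integrable_max_mult gw)
   show "integrable lborel (\<lambda>s. \<bar>h\<bar>*(?sg*(indicator {..t + h} s*dens g s - indicator {..t} s*dens g s)))"
    by (intro Bochner_Integration.integrable_diff integrable_mult_right integrable_indicator_dens)
   fix s
   have "max 0 (t + h - s)*dens g s - max 0 (t - s)*dens g s - h*(indicator {..t} s*dens g s)
    = (max 0 (t + h - s) - max 0 (t - s) - h*indicator {..t} s)*dens g s" by (simp add: algebra_simps)
   also have "\<bar>...\<bar> = \<bar>max 0 (t + h - s) - max 0 (t - s) - h*indicator {..t} s\<bar>*dens g s"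
    by (simp add: abs_mult dens_nonneg)
   also have "... <= (\<bar>h\<bar>*(?sg*(indicator {..t + h} s - indicator {..t} s)))*dens g s"
    by (intro mult_right_mono dens_nonneg) (auto simp: indicator_def max_def)
   finally show "\<bar>max 0 (t + h - s)*dens g s - max 0 (t - s)*dens g s - h*(indicator {..t} s*dens g s)\<bar>
    <= \<bar>h\<bar>*(?sg*(indicator {..t + h} s*dens g s - indicator {..t} s*dens g s))"
    by (simp add: algebra_simps)
  qed
  also have "... = \<bar>h\<bar>*(?sg*(cmass g (t + h) - cmass g t))"
   unfolding cmass_def using integrable_indicator_dens by simp
  also have "... <= \<bar>h\<bar>*\<bar>cmass g (t + h) - cmass g t\<bar>"
   by (intro mult_left_mono) auto
  finally show ?thesis .
 qed
 show ?thesis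
  unfolding DERIV_def
 proof (rule LIM_zero_cancel, rule Lim_null_comparison)
  have "isCont (cmass g) t" using cmass_deriv by (rule DERIV_isCont)
  then have "((\<lambda>h. cmass g (t + h)) ---> cmass g t) (at 0)" by (simp add: isCont_iff)
  then have "((\<lambda>h. \<bar>cmass g (t + h) - cmass g t\<bar>) ---> \<bar>cmass g t - cmass g t\<bar>) (at 0)" by (intro tendsto_intros)
  then show "((\<lambda>h. \<bar>cmass g (t + h) - cmass g t\<bar>) ---> 0) (at 0)" by simp
  show "\<forall>\<^sub>F h in at 0. norm ((zpot g (t + h) - zpot g t)/h - cmass g t) <= \<bar>cmass g (t + h) - cmass g t\<bar>"
   unfolding eventually_at_filter
  proof (rule always_eventually, intro allI impI)
   fix h :: real assume h: "h \<noteq> 0"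
   then have "norm ((zpot g (t + h) - zpot g t)/h - cmass g t) = \<bar>zpot g (t + h) - zpot g t - h*cmass g t\<bar>/\<bar>h\<bar>"
    by (simp add: abs_divide[symmetric] diff_divide_distrib)
   also have "... <= \<bar>cmass g (t + h) - cmass g t\<bar>"
    using est[of h] h by (simp add: pos_divide_le_eq mult.commute)
   finally show "norm ((zpot g (t + h) - zpot g t)/h - cmass g t) <= \<bar>cmass g (t + h) - cmass g t\<bar>" .
  qed
 qed
qed

lemma cmass_zpot_nonneg: "cmass g t >= 0" "zpot g t >= 0" "cmass g t <= mass g"
proof -
 show "cmass g t >= 0" "zpot g t >= 0"
  unfolding cmass_def zpot_def by (auto intro!: integral_nonneg_AE simp: dens_nonneg)
 show "cmass g t <= mass g"
  unfolding cmass_def mass_def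
  by (intro integral_mono integrable_indicator_dens wint_integrable gw) (auto simp: indicator_def dens_nonneg)
qed

lemma cmass_zpot_at_bot: "(cmass g ---> 0) at_bot" "(zpot g ---> 0) at_bot"
proof -
 note [measurable] = dens_measurable[OF gc]
 have ev: "\<forall>\<^sub>F t in at_top. t >= (0::real)" by (rule eventually_ge_at_top)
 have lt: "\<forall>\<^sub>F t in at_top. - t < s" for s :: real
  using eventually_gt_at_top[of "- s"] by eventually_elim simp
 have "((\<lambda>t. cmass g (- t)) ---> (LINT s::real|lborel. 0)) at_top"
  unfolding cmass_def
 proof (rule integral_dominated_convergence_at_top[where w = "dens g"])
  show "integrable lborel (dens g)" by (rule wint_integrable[OF gw])
  show "\<forall>\<^sub>F i in at_top. AE x in lborel. norm (indicator {..- i} x*dens g x) <= dens g x"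
   by (auto simp: indicator_def dens_nonneg)
  show "AE x in lborel. ((\<lambda>i. indicator {..- i} x*dens g x) ---> 0) at_top"
  proof (rule AE_I2)
   fix x :: real
   show "((\<lambda>i. indicator {..- i} x*dens g x) ---> 0) at_top"
    using lt[of x] by (intro tendsto_eventually) (auto elim!: eventually_mono)
  qed
 qed simp_all
 then show "(cmass g ---> 0) at_bot" by (subst filterlim_at_bot_mirror) simp
 have "((\<lambda>t. zpot g (- t)) ---> (LINT s::real|lborel. 0)) at_top"
  unfolding zpot_def
 proof (rule integral_dominated_convergence_at_top[where w = "\<lambda>s. \<bar>s\<bar>*dens g s"])
  show "integrable lborel (\<lambda>s. \<bar>s\<bar>*dens g s)" by (rule wint_integrable[OF gw])
  show "\<forall>\<^sub>F i in at_top. AE x in lborel. norm (max 0 (- i - x)*dens g x) <= \<bar>x\<bar>*dens g x"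
   using ev by eventually_elim (auto simp: abs_mult dens_nonneg intro!: mult_right_mono)
  show "AE x in lborel. ((\<lambda>i. max 0 (- i - x)*dens g x) ---> 0) at_top"
  proof (rule AE_I2)
   fix x :: real
   show "((\<lambda>i. max 0 (- i - x)*dens g x) ---> 0) at_top"
    using lt[of x] by (intro tendsto_eventually) (auto elim!: eventually_mono)
  qed
 qed simp_all
 then show "(zpot g ---> 0) at_bot" by (subst filterlim_at_bot_mirror) simp
qed

end

text \<open>By \<open>integral_hat\<close>, the tested equation says that \<open>g\<close> and a
  twofold antiderivative \<open>H\<close> of the right-hand side have the same second differences;
  so \<open>g - H\<close> is affine and \<open>g\<close> inherits the smoothness of
  \<open>H\<close>.\<close>

lemma (in minseq) g_ode:
 obtains g1 where "\<And>t. DERIV g t :> g1 t"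
  "\<And>t. DERIV g1 t :> (4*zpot g t - (4*L0 + 1 - 4*w))*exp (2*t)*g t"
proof -
 define q where "q = (\<lambda>t. (4*zpot g t - (4*L0 + 1 - 4*w))*exp (2*t)*g t)"
 have zc: "continuous_on UNIV (zpot g)"
  by (rule DERIV_continuous_UNIV[OF zpot_deriv[OF g_cont g_wint]])
 have qc: "continuous_on UNIV q"
  unfolding q_def by (intro continuous_intros zc g_cont)
 obtain H1 where H1: "\<And>x. DERIV H1 x :> q x"
  using antiderivative_real[OF qc] by blast
 have H1c: "continuous_on UNIV H1"
  by (rule DERIV_continuous_UNIV[OF H1])
 obtain H where H: "\<And>x. DERIV H x :> H1 x"
  using antiderivative_real[OF H1c] by blast
 have Hc: "continuous_on UNIV H"
  by (rule DERIV_continuous_UNIV[OF H])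
 have c: "continuous_on UNIV (\<lambda>t. g t - H t)" by (intro continuous_on_diff g_cont Hc)
 have sec: "(g (a + h) - H (a + h)) - 2*(g a - H a) + (g (a - h) - H (a - h)) = 0" if "h > 0" for a h
  using Euler_Lagrange[OF that, of a] integral_hat[OF H H1 qc, of h a] that
  unfolding q_def by simp
 obtain d where d: "\<And>t. DERIV (\<lambda>t. g t - H t) t :> d"
  using zero_second_difference_affine[OF c sec] by blast
 have "DERIV g t :> H1 t + d" for t
  using DERIV_add[OF d[of t] H[of t]] by (simp add: add.commute)
 moreover have "DERIV (\<lambda>t. H1 t + d) t :> q t" for t
  using H1[of t] by (auto intro!: derivative_eq_intros)
 ultimately show ?thesis using that[of "\<lambda>t. H1 t + d"] by (simp add: q_def)
qed

section \<open>The profile equation\<close>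

lemma DERIV_nonneg_mono:
 fixes K :: "real => real"
 assumes "\<And>t. t <= b ==> DERIV K t :> K' t" "\<And>t. t <= b ==> K' t >= 0" "a <= b"
 shows "K a <= K b"
 using assms by (intro DERIV_nonneg_imp_nondecreasing[OF assms(3)]) auto

text \<open>Replaces an initial condition: minus infinity in \<open>t\<close> is the origin of the
  plane.\<close>

lemma limit_at_bot_le:
 fixes K :: "real => real"
 assumes K: "\<And>t. t <= b ==> DERIV K t :> K' t" "\<And>t. t <= b ==> K' t >= 0"
  and lim: "(K ---> l) at_bot"
 shows "l <= K b"
proof (rule tendsto_upperbound[OF lim])
 show "\<forall>\<^sub>F t in at_bot. K t <= K b"
  using eventually_le_at_bot[of b] by eventually_elim (use DERIV_nonneg_mono[OF K] in blast)
qed simp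

lemma abs_le_from_at_bot:
 fixes F G :: "real => real"
 assumes F: "\<And>t. t <= b ==> DERIV F t :> F' t"
  and G: "\<And>t. t <= b ==> DERIV G t :> G' t"
  and le: "\<And>t. t <= b ==> \<bar>F' t\<bar> <= G' t"
  and lim: "(F ---> 0) at_bot" "(G ---> 0) at_bot"
 shows "\<bar>F b\<bar> <= G b"
proof -
 have "0 <= G b - F b"
 proof (rule limit_at_bot_le[where K = "\<lambda>t. G t - F t" and K' = "\<lambda>t. G' t - F' t" and b = b])
  show "t <= b ==> G' t - F' t >= 0" for t using le[of t] by auto
  show "((\<lambda>t. G t - F t) ---> 0) at_bot" using tendsto_diff[OF lim(2,1)] by simp
 qed (intro derivative_intros F G)
 moreover have "0 <= G b + F b"
 proof (rule limit_at_bot_le[where K = "\<lambda>t. G t + F t" and K' = "\<lambda>t. G' t + F' t" and b = b])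
  show "t <= b ==> G' t + F' t >= 0" for t using le[of t] by auto
  show "((\<lambda>t. G t + F t) ---> 0) at_bot" using tendsto_add[OF lim(2,1)] by simp
 qed (intro derivative_intros F G)
 ultimately show ?thesis by simp
qed

lemma exp_mult_at_bot: "c > 0 ==> ((\<lambda>t::real. exp (c*t)) ---> 0) at_bot"
 by (rule filterlim_compose[OF exp_at_bot]) (auto intro!: filterlim_tendsto_pos_mult_at_bot filterlim_ident)

text \<open>L'Hospital in integrated form. In the plane \<open>exp (2 * t)\<close> is
  \<open>|x|^2\<close>, and the factor 1/2 comes from its primitive
  \<open>exp (2 * t) / 2\<close>.\<close>

lemma deriv_ratio_at_bot:
 fixes F :: "real => real"
 assumes F: "\<And>t. DERIV F t :> p t*exp (2*t)"
  and p: "(p ---> c) at_bot" and F0: "(F ---> 0) at_bot"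
 shows "((\<lambda>t. F t*exp (- 2*t)) ---> c/2) at_bot"
proof (rule tendstoI)
 fix e :: real assume e: "e > 0"
 have "\<forall>\<^sub>F t in at_bot. dist (p t) c < e" using p e by (rule tendstoD)
 then obtain t0 where t0: "\<And>t. t <= t0 ==> \<bar>p t - c\<bar> < e"
  unfolding eventually_at_bot_linorder by (auto simp: dist_real_def)
 have "\<bar>F t*exp (- 2*t) - c/2\<bar> < e" if t: "t <= t0" for t
 proof -
  have "\<bar>F t - c/2*exp (2*t)\<bar> <= e/2*exp (2*t)"
  proof (rule abs_le_from_at_bot[where F = "\<lambda>t. F t - c/2*exp (2*t)" and F' = "\<lambda>t. (p t - c)*exp (2*t)"
    and G = "\<lambda>t. e/2*exp (2*t)" and G' = "\<lambda>t. e*exp (2*t)" and b = t])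
   fix s assume s: "s <= t"
   show "DERIV (\<lambda>t. F t - c/2*exp (2*t)) s :> (p s - c)*exp (2 * s)"
    using F[of s] by (auto intro!: derivative_eq_intros simp: algebra_simps)
   show "DERIV (\<lambda>t. e/2*exp (2*t)) s :> e*exp (2 * s)"
    by (auto intro!: derivative_eq_intros)
   show "\<bar>(p s - c)*exp (2 * s)\<bar> <= e*exp (2 * s)"
    using t0[of s] s t by (simp add: abs_mult)
  next
   have x: "((\<lambda>t::real. exp (2*t)) ---> 0) at_bot" by (rule exp_mult_at_bot) simp
   show "((\<lambda>t. F t - c/2*exp (2*t)) ---> 0) at_bot"
    using tendsto_diff[OF F0 tendsto_mult_left[OF x, of "c/2"]] by simp
   show "((\<lambda>t. e/2*exp (2*t)) ---> 0) at_bot"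
    using tendsto_mult_left[OF x, of "e/2"] by simp
  qed
  then have "\<bar>F t - c/2*exp (2*t)\<bar>*exp (- 2*t) <= e/2*exp (2*t)*exp (- 2*t)"
   by (intro mult_right_mono) auto
  also have "... = e/2" by (simp add: exp_minus)
  also have "\<bar>F t - c/2*exp (2*t)\<bar>*exp (- 2*t) = \<bar>(F t - c/2*exp (2*t))*exp (- 2*t)\<bar>"
   by (simp add: abs_mult)
  also have "(F t - c/2*exp (2*t))*exp (- 2*t) = F t*exp (- 2*t) - c/2"
   by (simp add: left_diff_distrib exp_minus)
  finally show ?thesis using e by linarith
 qed
 then show "\<forall>\<^sub>F t in at_bot. dist (F t*exp (- 2*t)) (c/2) < e"
  unfolding eventually_at_bot_linorder by (auto simp: dist_real_def)
qed

text \<open>The integrating factor is \<open>exp (- A)\<close> to the right of \<open>t0\<close> and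
  \<open>exp A\<close> to the left of it.\<close>

lemma Gronwall_zero:
 fixes E :: "real => real"
 assumes E: "\<And>t. DERIV E t :> E' t" "\<And>t. E t >= 0" "E t0 = 0"
  and K: "continuous_on UNIV K" and le: "\<And>t. \<bar>E' t\<bar> <= K t*E t"
 shows "E t = 0"
proof -
 obtain A where A: "\<And>x. DERIV A x :> K x"
  using antiderivative_real[OF K] by blast
 have "E t <= 0"
 proof (cases "t0 <= t")
  case True
  have "E t*exp (- A t) <= E t0*exp (- A t0)"
  proof (rule DERIV_nonpos_imp_nonincreasing[OF True])
   fix x
   have "DERIV (\<lambda>x. E x*exp (- A x)) x :> (E' x - K x*E x)*exp (- A x)"
    using E(1)[of x] A[of x] by (auto intro!: derivative_eq_intros simp: algebra_simps)
   moreover have "(E' x - K x*E x)*exp (- A x) <= 0"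
    using le[of x] by (intro mult_nonpos_nonneg) auto
   ultimately show "\<exists>y. DERIV (\<lambda>x. E x*exp (- A x)) x :> y \<and> y <= 0" by blast
  qed
  then show ?thesis using E(3) by (simp add: mult_le_0_iff)
 next
  case False
  then have "t <= t0" by simp
  have "E t*exp (A t) <= E t0*exp (A t0)"
  proof (rule DERIV_nonneg_imp_nondecreasing[OF \<open>t \<le> t0\<close>])
   fix x
   have "DERIV (\<lambda>x. E x*exp (A x)) x :> (E' x + K x*E x)*exp (A x)"
    using E(1)[of x] A[of x] by (auto intro!: derivative_eq_intros simp: algebra_simps)
   moreover have "(E' x + K x*E x)*exp (A x) >= 0"
    using le[of x] by (intro mult_nonneg_nonneg) auto
   ultimately show "\<exists>y. DERIV (\<lambda>x. E x*exp (A x)) x :> y \<and> 0 <= y" by blast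
  qed
  then show ?thesis using E(3) by (simp add: mult_le_0_iff)
 qed
 with E(2)[of t] show ?thesis by simp
qed

text \<open>A zero of a nonnegative solution is a minimum, so the derivative vanishes there too.\<close>

lemma ode_positive:
 fixes g :: "real => real"
 assumes g: "\<And>t. DERIV g t :> g1 t" and g1: "\<And>t. DERIV g1 t :> q t*g t"
  and q: "continuous_on UNIV q" and nn: "\<And>t. g t >= 0" and nz: "g s \<noteq> 0"
 shows "g t > 0"
proof (rule ccontr)
 assume "\<not> g t > 0"
 with nn[of t] have gt: "g t = 0" by simp
 have g1t: "g1 t = 0"
  by (rule DERIV_local_min[OF g[of t], of 1]) (use nn gt in auto)
 define E where "E = (\<lambda>t. (g t)^2 + (g1 t)^2)"
 have "E s = 0"
 proof (rule Gronwall_zero[where E = E and K = "\<lambda>t. 1 + \<bar>q t\<bar>" and ?t0.0 = t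
    and E' = "\<lambda>t. 2*g t*g1 t + 2*g1 t*(q t*g t)"])
  fix x
  show "DERIV E x :> 2*g x*g1 x + 2*g1 x*(q x*g x)"
   unfolding E_def using g[of x] g1[of x] by (auto intro!: derivative_eq_intros)
  show "E x >= 0" by (simp add: E_def)
  have "\<bar>2*g x*g1 x + 2*g1 x*(q x*g x)\<bar> = \<bar>1 + q x\<bar>*\<bar>2*g x*g1 x\<bar>"
   by (simp add: abs_mult[symmetric] algebra_simps)
  also have "... <= (1 + \<bar>q x\<bar>)*E x"
  proof (rule mult_mono)
   show "\<bar>2*g x*g1 x\<bar> <= E x"
    unfolding E_def using sum_squares_bound[of "g x" "g1 x"] sum_squares_bound[of "g x" "- g1 x"] by simp
  qed auto
  finally show "\<bar>2*g x*g1 x + 2*g1 x*(q x*g x)\<bar> <= (1 + \<bar>q x\<bar>)*E x" .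
 next
  show "E t = 0" by (simp add: E_def gt g1t)
  show "continuous_on UNIV (\<lambda>t. 1 + \<bar>q t\<bar>)" by (intro continuous_intros q)
 qed
 then show False using nz by (simp add: E_def sum_power2_eq_zero_iff)
qed

text \<open>For \<open>t >= 0\<close> the density is at least \<open>c^2\<close>, so over a length
  \<open>2 / c^2\<close> the function \<open>m\<close> would have to grow by 2 inside
  \<open>[0, 1]\<close>.\<close>

lemma no_lower_bound:
 fixes m :: "real => real"
 assumes m: "\<And>t. DERIV m t :> dens g t" "\<And>t. 0 <= m t" "\<And>t. m t <= 1"
  and c: "c > 0" and ge: "\<And>t. t >= t0 ==> g t >= c"
 shows False
proof -
 define a where "a = max t0 0"
 define b where "b = a + 2/c^2"
 have ab: "a <= b" using c by (simp add: b_def)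
 have "m a - c^2*a <= m b - c^2*b"
 proof (rule DERIV_nonneg_imp_nondecreasing[OF ab])
  fix x assume x: "a <= x"
  have "DERIV (\<lambda>x. m x - c^2*x) x :> dens g x - c^2"
   using m(1)[of x] by (auto intro!: derivative_eq_intros)
  moreover have "dens g x >= c^2*1"
   unfolding dens_def
  proof (rule mult_mono)
   show "c^2 <= (g x)^2" using ge[of x] x c by (intro power_mono) (auto simp: a_def)
   show "1 <= exp (2*x)" using x by (simp add: a_def)
  qed auto
  ultimately show "\<exists>y. DERIV (\<lambda>x. m x - c^2*x) x :> y \<and> 0 <= y" by force
 qed
 moreover have "c^2*b - c^2*a = 2" using c by (simp add: b_def field_simps)
 ultimately show False using m(2)[of a] m(3)[of b] by linarith
qed

text \<open>Near minus infinity the right-hand side is bounded by a multiple of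
  \<open>exp t\<close>, which gives \<open>g1\<close> and \<open>g\<close> limits there with that
  rate. The rest is convexity in \<open>t\<close>: the second derivative of \<open>g\<close> has the
  sign of \<open>4 * Z - mu\<close>, and a profile that stops decreasing would have infinite
  mass.\<close>

lemma ode_minimizer_profile:
 fixes g g1 Z m :: "real => real"
 assumes g: "\<And>t. DERIV g t :> g1 t"
  and g1: "\<And>t. DERIV g1 t :> (4*Z t - mu)*exp (2*t)*g t"
  and Z: "\<And>t. DERIV Z t :> m t"
  and m: "\<And>t. DERIV m t :> dens g t"
  and nn: "\<And>t. g t >= 0" and m0: "\<And>t. 0 <= m t" and m1: "\<And>t. m t <= 1" and Z0: "\<And>t. Z t >= 0"
  and lim: "(m ---> 0) at_bot" "(Z ---> 0) at_bot"
  and Hol: "\<And>s t. \<bar>g s - g t\<bar> <= sqrt \<bar>s - t\<bar>"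
  and bound: "\<And>t. \<bar>g t\<bar> <= 2 + sqrt \<bar>t\<bar>"
  and nz: "g s0 \<noteq> 0"
 obtains al where "mu > 0" "\<And>t. g t > 0" "\<And>t. g1 t < 0" "(g ---> 0) at_top"
  "(g ---> al) at_bot" "(g1 ---> 0) at_bot" "al > 0" "\<And>t. g t < al"
proof -
 have gc: "continuous_on UNIV g" by (rule DERIV_continuous_UNIV[OF g])
 have Zc: "continuous_on UNIV Z" by (rule DERIV_continuous_UNIV[OF Z])
 have pos: "g t > 0" for t
  by (rule ode_positive[OF g g1 _ nn nz]) (intro continuous_intros Zc)
 have dpos: "dens g t > 0" for t using pos[of t] by (simp add: dens_def)
 have mmono: "m a < m b" if "a < b" for a b
  using DERIV_pos_imp_increasing[OF that, of m] m dpos by blast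
 have mpos: "m t > 0" for t using mmono[of "t - 1" t] m0[of "t - 1"] by simp
 have Zmono: "Z a < Z b" if "a < b" for a b
  using DERIV_pos_imp_increasing[OF that, of Z] Z mpos by blast
 define C where "C = (4*Z 0 + \<bar>mu\<bar>)*4"
 have C0: "C >= 0" using Z0[of 0] by (simp add: C_def)
 have h_le: "\<bar>(4*Z t - mu)*exp (2*t)*g t\<bar> <= C*exp t" if t: "t <= 0" for t
 proof -
  have "Z t <= Z 0" using Zmono[of t 0] t by (cases "t = 0") auto
  then have 1: "\<bar>4*Z t - mu\<bar> <= 4*Z 0 + \<bar>mu\<bar>" using Z0[of t] by linarith
  have "sqrt \<bar>t\<bar> <= 1 + \<bar>t\<bar>" by (simp add: real_le_lsqrt power2_eq_square algebra_simps)
  then have "\<bar>g t\<bar> <= 3 + \<bar>t\<bar>" using bound[of t] by linarith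
  also have "... <= 4*exp (- t)" using exp_ge_add_one_self[of "- t"] t by simp
  finally have 2: "exp (2*t)*\<bar>g t\<bar> <= exp (2*t)*(4*exp (- t))" by (intro mult_left_mono) auto
  have "exp (2*t)*(4*exp (- t)) = 4*exp t" by (simp add: exp_minus field_simps exp_add[symmetric])
  with 2 have 3: "exp (2*t)*\<bar>g t\<bar> <= 4*exp t" by simp
  have "\<bar>(4*Z t - mu)*exp (2*t)*g t\<bar> = \<bar>4*Z t - mu\<bar>*(exp (2*t)*\<bar>g t\<bar>)"
   by (simp add: abs_mult)
  also have "... <= (4*Z 0 + \<bar>mu\<bar>)*(4*exp t)" by (rule mult_mono[OF 1 3]) (use Z0[of 0] in auto)
  finally show ?thesis unfolding C_def by (simp only: mult.assoc)
 qed
 have g1diff: "\<bar>g1 b - g1 a\<bar> <= C*exp b" if ab: "a <= b" "b <= 0" for a b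
 proof -
  have "C*exp a - g1 a <= C*exp b - g1 b"
  proof (rule DERIV_nonneg_imp_nondecreasing[OF ab(1)])
   fix x assume "a <= x" "x <= b"
   have "DERIV (\<lambda>x. C*exp x - g1 x) x :> C*exp x - (4*Z x - mu)*exp (2*x)*g x"
    using g1[of x] by (auto intro!: derivative_eq_intros)
   moreover have "0 <= C*exp x - (4*Z x - mu)*exp (2*x)*g x"
    using h_le[of x] ab \<open>x \<le> b\<close> by linarith
   ultimately show "\<exists>y. DERIV (\<lambda>x. C*exp x - g1 x) x :> y \<and> 0 <= y" by blast
  qed
  moreover have "C*exp a + g1 a <= C*exp b + g1 b"
  proof (rule DERIV_nonneg_imp_nondecreasing[OF ab(1)])
   fix x assume "a <= x" "x <= b"
   have "DERIV (\<lambda>x. C*exp x + g1 x) x :> C*exp x + (4*Z x - mu)*exp (2*x)*g x"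
    using g1[of x] by (auto intro!: derivative_eq_intros)
   moreover have "0 <= C*exp x + (4*Z x - mu)*exp (2*x)*g x"
    using h_le[of x] ab \<open>x \<le> b\<close> by linarith
   ultimately show "\<exists>y. DERIV (\<lambda>x. C*exp x + g1 x) x :> y \<and> 0 <= y" by blast
  qed
  moreover have "C*exp a >= 0" using C0 by simp
  ultimately show ?thesis by linarith
 qed
 have g1le: "\<bar>g1 t\<bar> <= C*exp t" if t: "t <= 0" for t
 proof (rule field_le_epsilon)
  fix e :: real assume e: "e > 0"
  \<comment> \<open>On \<open>[t - n, t]\<close> the Hoelder bound allows a mean slope of at most
    \<open>sqrt n / n = e\<close>, so \<open>g1\<close> is small at some point to the left, and
    \<open>g1diff\<close> carries this over to \<open>t\<close>.\<close>
  define n where "n = (1/e)^2"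
  have n: "n > 0" "sqrt n = 1/e" using e by (auto simp: n_def)
  have "t - n < t" using n by simp
  then obtain x where x: "t - n < x" "x < t" "g t - g (t - n) = (t - (t - n))*g1 x"
   using MVT2[of "t - n" t g g1] g by blast
  have "n*\<bar>g1 x\<bar> = \<bar>g t - g (t - n)\<bar>" using x n by (simp add: abs_mult)
  also have "... <= sqrt n" using Hol[of t "t - n"] n by simp
  finally have "n*\<bar>g1 x\<bar> <= 1/e" using n by simp
  then have "\<bar>g1 x\<bar> <= e" using e by (simp add: n_def power2_eq_square field_simps)
  moreover have "\<bar>g1 t - g1 x\<bar> <= C*exp t" using x t by (intro g1diff) auto
  ultimately show "\<bar>g1 t\<bar> <= C*exp t + e" by linarith
 qed
 have Ce: "((\<lambda>t. C*exp t) ---> 0) at_bot"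
  using tendsto_mult_left[OF exp_at_bot, of C] by simp
 have g1lim: "(g1 ---> 0) at_bot"
 proof (rule Lim_null_comparison[OF _ Ce])
  show "\<forall>\<^sub>F t in at_bot. norm (g1 t) <= C*exp t"
   using eventually_le_at_bot[of 0] by eventually_elim (use g1le in simp)
 qed
 \<comment> \<open>Otherwise \<open>g\<close> would be convex with slope 0 at minus infinity, hence
   nondecreasing.\<close>
 have mu: "mu > 0"
 proof (rule ccontr)
  assume "\<not> mu > 0"
  have "g1 t >= 0" for t
  proof (rule limit_at_bot_le[OF g1 _ g1lim])
   fix s show "(4*Z s - mu)*exp (2 * s)*g s >= 0"
    using Z0[of s] nn[of s] \<open>\<not> mu > 0\<close> by auto
  qed
  then have "g t >= g 0" if "t >= 0" for t
   using DERIV_nonneg_imp_nondecreasing[OF that, of g] g by blast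
  then show False using no_lower_bound[OF m m0 m1 pos[of 0], of 0] by blast
 qed
 \<comment> \<open>\<open>4 * Z - mu\<close> is strictly increasing, so \<open>g\<close> is concave
   first and convex later. A nonnegative slope cannot occur in the concave phase, and in the convex
   phase it would persist and keep \<open>g\<close> above \<open>g t\<close>.\<close>
 have neg: "g1 t < 0" for t
 proof (rule ccontr)
  assume "\<not> g1 t < 0"
  then have g1t: "g1 t >= 0" by simp
  have Zt: "4*Z t > mu"
  proof (rule ccontr)
   assume nZ: "\<not> 4*Z t > mu"
   have "g1 (t - 1) <= 0"
   proof -
    have "0 <= - g1 (t - 1)"
    proof (rule limit_at_bot_le[where K = "\<lambda>t. - g1 t" and K' = "\<lambda>s. - ((4*Z s - mu)*exp (2 * s)*g s)"])
     show "((\<lambda>t. - g1 t) ---> 0) at_bot" using tendsto_minus[OF g1lim] by simp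
     fix s assume "s <= t - 1"
     then have "4*Z s - mu <= 0" using Zmono[of s t] nZ by simp
     then show "0 <= - ((4*Z s - mu)*exp (2 * s)*g s)"
      using nn[of s] by (auto intro!: mult_nonpos_nonneg)
    qed (intro derivative_intros g1)
    then show ?thesis by simp
   qed
   moreover have "g1 t < g1 (t - 1)"
   proof (rule DERIV_neg_imp_decreasing_open[of "t - 1" t g1])
    fix x assume x: "t - 1 < x" "x < t"
    then have "4*Z x - mu < 0" using Zmono[of x t] nZ by simp
    then have "(4*Z x - mu)*exp (2*x)*g x < 0"
     using pos[of x] by (auto intro!: mult_neg_pos)
    then show "\<exists>y. DERIV g1 x :> y \<and> y < 0" using g1 by blast
   next
    show "continuous_on {t - 1..t} g1"
     by (rule continuous_on_subset[OF DERIV_continuous_UNIV[OF g1]]) simp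
   qed simp
   ultimately show False using g1t by simp
  qed
  have "g1 s >= 0" if "s >= t" for s
  proof -
   have "g1 t <= g1 s"
   proof (rule DERIV_nonneg_imp_nondecreasing[OF that])
    fix x assume "t <= x"
    then have "4*Z x - mu >= 0" using Zmono[of t x] Zt by (cases "t = x") auto
    then have "(4*Z x - mu)*exp (2*x)*g x >= 0" using nn[of x] by simp
    then show "\<exists>y. DERIV g1 x :> y \<and> 0 <= y" using g1 by blast
   qed
   then show ?thesis using g1t by simp
  qed
  then have "g s >= g t" if "s >= t" for s
   using DERIV_nonneg_imp_nondecreasing[OF that, of g] g by blast
  then show False using no_lower_bound[OF m m0 m1 pos[of t], of t] by blast
 qed
 have gdec: "g b < g a" if "a < b" for a b
  using DERIV_neg_imp_decreasing[OF that, of g] g neg by blast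
 have top: "(g ---> 0) at_top"
 proof (rule tendstoI)
  fix e :: real assume e: "e > 0"
  have "\<exists>t0. g t0 < e"
  proof (rule ccontr)
   assume "\<nexists>t0. g t0 < e"
   then have "\<And>t. g t >= e" by (simp add: not_less)
   then show False using no_lower_bound[OF m m0 m1 e, of 0] by blast
  qed
  then obtain t0 where t0: "g t0 < e" by blast
  show "\<forall>\<^sub>F t in at_top. dist (g t) 0 < e"
   using eventually_gt_at_top[of t0]
  proof eventually_elim
   case (elim t)
   with gdec[of t0 t] t0 pos[of t] show ?case by simp
  qed
 qed
 have gdiff: "\<bar>g b - g a\<bar> <= C*exp b" if ab: "a <= b" "b <= 0" for a b
 proof -
  have "g b <= g a" using gdec[of a b] ab by (cases "a = b") auto
  moreover have "C*exp a + g a <= C*exp b + g b"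
  proof (rule DERIV_nonneg_imp_nondecreasing[OF ab(1)])
   fix x assume "a <= x" "x <= b"
   have "DERIV (\<lambda>x. C*exp x + g x) x :> C*exp x + g1 x"
    using g[of x] by (auto intro!: derivative_eq_intros)
   moreover have "0 <= C*exp x + g1 x"
    using g1le[of x] ab \<open>x \<le> b\<close> by linarith
   ultimately show "\<exists>y. DERIV (\<lambda>x. C*exp x + g x) x :> y \<and> 0 <= y" by blast
  qed
  moreover have "C*exp a >= 0" using C0 by simp
  ultimately show ?thesis by linarith
 qed
 define X where "X = (\<lambda>n::nat. g (- real n))"
 have "incseq X"
  unfolding X_def incseq_def using gdec by (metis less_eq_real_def neg_le_iff_le of_nat_le_iff order_le_less)
 moreover have "X n <= g 0 + C" for n
  using gdiff[of "- real n" 0] unfolding X_def by simp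
 ultimately obtain al where al: "X ----> al" "\<And>n. X n <= al"
  using incseq_convergent[of X "g 0 + C"] by metis
 have al_diff: "\<bar>g b - al\<bar> <= C*exp b" if "b <= 0" for b
 proof (rule tendsto_upperbound[OF tendsto_rabs[OF tendsto_diff[OF tendsto_const[of "g b"] al(1)]]])
  show "\<forall>\<^sub>F n in sequentially. \<bar>g b - X n\<bar> <= C*exp b"
   using eventually_ge_at_top[of "nat \<lceil>- b\<rceil>"]
  proof eventually_elim
   case (elim n)
   then have "- b <= real n" by linarith
   then show ?case unfolding X_def using gdiff[of "- real n" b] that by simp
  qed
 qed simp
 have bot: "(g ---> al) at_bot"
 proof (rule LIM_zero_cancel, rule Lim_null_comparison[OF _ Ce])
  show "\<forall>\<^sub>F t in at_bot. norm (g t - al) <= C*exp t"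
   using eventually_le_at_bot[of 0] by eventually_elim (use al_diff in simp)
 qed
 have lt: "g t < al" for t
 proof -
  obtain n :: nat where n: "- t < real n" using reals_Archimedean2 by blast
  then have "g t < X n" unfolding X_def by (intro gdec) simp
  then show ?thesis using al(2)[of n] by simp
 qed
 show ?thesis
  using that[OF mu pos neg top bot g1lim _ lt] lt[of 0] pos[of 0] by simp
qed

section \<open>Radial functions and uniqueness of the ground state\<close>

definition rad :: "(real => real) => real => real^2 => real" where
 "rad f al x = (if x = 0 then al else f (ln (norm x)))"

lemma norm_add_axis:
 fixes x :: "real^'n::finite"
 shows "(norm (x + t *\<^sub>R axis i 1))^2 = (norm x)^2 + 2*t*x $ i + t^2"
 unfolding power2_norm_eq_inner
 by (simp add: inner_add_left inner_add_right inner_commute inner_axis inner_axis_axis power2_eq_square algebra_simps)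

lemma ln_norm_at_zero: "filterlim (\<lambda>x::'a::real_normed_vector. ln (norm x)) at_bot (at 0)"
proof (rule filterlim_compose[OF ln_at_0])
 show "filterlim (norm :: 'a => real) (at_right 0) (at 0)"
  unfolding filterlim_at by (auto simp: eventually_at_filter intro!: tendsto_norm_zero)
qed

lemma tendsto_ln_norm:
 "(p ---> c) at_bot ==> ((\<lambda>x::'a::real_normed_vector. p (ln (norm x))) ---> c) (at 0)"
 by (rule filterlim_compose[OF _ ln_norm_at_zero])

lemma continuous_rad:
 fixes p :: "real => real"
 assumes p: "continuous_on UNIV p" and lim: "(p ---> c) at_bot"
 shows "continuous_on UNIV (rad p c)"
 unfolding continuous_on_eq_continuous_at[OF open_UNIV]
proof
 fix x :: "real^2"
 show "isCont (rad p c) x"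
 proof (cases "x = 0")
  case True
  have "((\<lambda>x::real^2. p (ln (norm x))) ---> c) (at 0)" by (rule tendsto_ln_norm[OF lim])
  then have "(rad p c ---> c) (at 0)"
   by (rule Lim_transform_eventually) (auto simp: rad_def eventually_at_filter)
  then show ?thesis using True by (simp add: isCont_def rad_def[of p c 0])
 next
  case False
  have pc: "isCont p (ln (norm x))" using p by (simp add: continuous_on_eq_continuous_at)
  have "isCont (\<lambda>x. ln (norm x)) x" using False by (intro continuous_intros) auto
  then have "isCont (\<lambda>x. p (ln (norm x))) x"
   using pc by (rule isCont_o2)
  moreover have "0 < norm x" using False by simp
  ultimately show ?thesis
   by (rule continuous_transform_within) (auto simp: rad_def dist_norm)
 qed
qed

lemma rad_axis_deriv:
 fixes x :: "real^2"
 assumes f: "\<And>t. DERIV f t :> f1 t" and x: "x \<noteq> 0"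
 shows "DERIV (\<lambda>t. rad f al (x + t *\<^sub>R axis i 1)) 0 :> f1 (ln (norm x))*(x $ i/(norm x)^2)"
proof -
 define N where "N = (norm x)^2"
 have N: "N > 0" using x by (simp add: N_def)
 have lnN: "ln N/2 = ln (norm x)" using x by (simp add: N_def ln_realpow)
 have 1: "DERIV (\<lambda>t. ln (N + 2*t*x $ i + t^2)/2) 0 :> x $ i/N"
  using N by (auto intro!: derivative_eq_intros)
 have "DERIV f (ln (N + 2*0*x $ i + 0^2)/2) :> f1 (ln (norm x))"
  using f[of "ln (norm x)"] by (simp add: lnN)
 from DERIV_chain'[OF 1 this]
 have "DERIV (\<lambda>t. f (ln (N + 2*t*x $ i + t^2)/2)) 0 :> f1 (ln (norm x))*(x $ i/N)" .
 then show ?thesis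
  unfolding N_def[symmetric]
 proof (rule has_field_derivative_transform_within[where d = "norm x"])
  fix t :: real assume t: "dist t 0 < norm x"
  have "x + t *\<^sub>R axis i 1 \<noteq> 0"
  proof
   assume "x + t *\<^sub>R axis i 1 = 0"
   then have "x = - (t *\<^sub>R axis i 1)" by (simp add: add_eq_0_iff2)
   then have "norm x = \<bar>t\<bar>" by (simp add: norm_axis_1)
   then show False using t by simp
  qed
  moreover have "ln (N + 2*t*x $ i + t^2)/2 = ln (norm (x + t *\<^sub>R axis i 1))"
   using calculation unfolding N_def norm_add_axis[symmetric] by (simp add: ln_realpow)
  ultimately show "f (ln (N + 2*t*x $ i + t^2)/2) = rad f al (x + t *\<^sub>R axis i 1)"
   by (simp add: rad_def)
 qed (use x in auto)
qed

section \<open>Radial functions of class C^2 across the origin\<close>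

context
 fixes f f1 f2 :: "real => real" and al q0 :: real
 assumes f: "\<And>t. DERIV f t :> f1 t"
  and f1: "\<And>t. DERIV f1 t :> f2 t"
  and f2: "continuous_on UNIV f2"
  and l0: "(f ---> al) at_bot" and l1: "((\<lambda>t. f1 t*exp (- 2*t)) ---> q0) at_bot"
  and l2: "((\<lambda>t. f2 t*exp (- 2*t)) ---> 2*q0) at_bot"
begin

text \<open>With \<open>r = |x|\<close> and \<open>u r = f (ln r)\<close>, \<open>qq\<close> is
  \<open>u' / r\<close> and \<open>qr\<close> is \<open>u'' - u' / r\<close>. The gradient is
  \<open>x\<close> times the first; the Hessian \<open>H2\<close> is the first times the identity
  plus the second times the projection onto \<open>x\<close>. The assumed limits \<open>q0\<close>
  and 0 at minus infinity make these expressions continuous at the origin.\<close>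

definition qq :: "real => real" where "qq t = f1 t*exp (- 2*t)"

definition qr :: "real => real" where "qr t = (f2 t - 2*f1 t)*exp (- 2*t)"

lemma qq_deriv: "DERIV qq t :> qr t"
 unfolding qq_def[abs_def] qr_def using f1[of t] by (auto intro!: derivative_eq_intros simp: algebra_simps)

lemma qr_lim: "(qr ---> 0) at_bot"
 using tendsto_diff[OF l2 tendsto_mult_left[OF l1, of 2]] by (simp add: qr_def[abs_def] algebra_simps)

lemma f1cont: "continuous_on UNIV f1" by (rule DERIV_continuous_UNIV[OF f1])

lemma exp_ln_norm: "x \<noteq> 0 ==> exp (- 2*ln (norm x)) = 1/(norm x)^2"
 for x :: "'a::real_normed_vector"
proof -
 assume x: "x \<noteq> 0"
 have "exp (- 2*ln (norm x)) = 1/exp (ln (norm x) + ln (norm x))" by (simp add: exp_minus field_simps)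
 then show ?thesis using x by (simp only: exp_add) (simp add: power2_eq_square)
qed

lemma rad_deriv1: "DERIV (\<lambda>t. rad f al (x + t *\<^sub>R axis i 1)) 0 :> rad qq q0 x*x $ i"
proof (cases "x = 0")
 case False
 then have "f1 (ln (norm x))*(x $ i/(norm x)^2) = rad qq q0 x*x $ i"
  using exp_ln_norm[OF False] by (simp add: rad_def qq_def)
 with rad_axis_deriv[OF f False, of al i] show ?thesis by simp
next
 case True
 have F: "DERIV (\<lambda>t. f t - al) t :> qq t*exp (2*t)" for t
  using f[of t] by (auto intro!: derivative_eq_intros simp: qq_def exp_minus)
 have "((\<lambda>t. (f t - al)*exp (- 2*t)) ---> q0/2) at_bot"
  using l0 l1 by (intro deriv_ratio_at_bot[OF F]) (auto simp: qq_def[abs_def] LIM_zero)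
 then have "((\<lambda>t::real. (f (ln (norm t)) - al)*exp (- 2*ln (norm t))) ---> q0/2) (at 0)"
  by (rule tendsto_ln_norm)
 then have "((\<lambda>t::real. (f (ln (norm t)) - al)*exp (- 2*ln (norm t))*t) ---> q0/2*0) (at 0)"
  by (intro tendsto_intros)
 then have lim: "((\<lambda>t::real. (f (ln (norm t)) - al)*exp (- 2*ln (norm t))*t) ---> 0) (at 0)" by simp
 have "DERIV (\<lambda>t. rad f al (t *\<^sub>R axis i 1)) 0 :> 0"
  unfolding DERIV_def
 proof (rule Lim_transform_eventually[OF lim])
  show "\<forall>\<^sub>F h in at 0. (f (ln (norm h)) - al)*exp (- 2*ln (norm h))*h =
    (rad f al ((0 + h) *\<^sub>R axis i 1) - rad f al (0 *\<^sub>R axis i 1))/h"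
   unfolding eventually_at_filter
  proof (rule always_eventually, intro allI impI)
   fix h :: real assume h: "h \<noteq> 0"
   then have "exp (- 2*ln (norm h))*h = 1/h"
    by (subst exp_ln_norm) (auto simp: power2_eq_square)
   then have "(f (ln (norm h)) - al)*exp (- 2*ln (norm h))*h = (f (ln (norm h)) - al)/h"
    by (simp add: mult.assoc)
   then show "(f (ln (norm h)) - al)*exp (- 2*ln (norm h))*h =
    (rad f al ((0 + h) *\<^sub>R axis i 1) - rad f al (0 *\<^sub>R axis i 1))/h"
    using h by (simp add: rad_def norm_axis_1 axis_eq_0_iff)
  qed
 qed
 then show ?thesis using True by simp
qed

lemma rad_partial: "partial i (rad f al) = (\<lambda>x. rad qq q0 x*x $ i)"
 unfolding partial_def using rad_deriv1 by (auto intro!: DERIV_imp_deriv)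

definition H2 :: "2 => 2 => real^2 => real" where
 "H2 j i x = (if i = j then rad qq q0 x else 0) + rad qr 0 x*(x $ j/norm x)*(x $ i/norm x)"

lemma rad_deriv2: "DERIV (\<lambda>t. rad qq q0 (x + t *\<^sub>R axis j 1)*(x + t *\<^sub>R axis j 1) $ i) 0 :> H2 j i x"
proof (cases "x = 0")
 case False
 have c: "DERIV (\<lambda>t. (x + t *\<^sub>R axis j 1) $ i) 0 :> (if i = j then 1 else 0)"
  by (auto intro!: derivative_eq_intros simp: axis_def)
 show ?thesis
  by (rule DERIV_cong[OF DERIV_mult[OF rad_axis_deriv[OF qq_deriv False, of q0 j] c]])
   (use False in \<open>simp add: H2_def rad_def power2_eq_square mult_ac\<close>)
next
 case True
 show ?thesis
 proof (cases "i = j")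
  case False
  then show ?thesis using True by (simp add: H2_def axis_def)
 next
  case ij: True
  have "((\<lambda>t::real. qq (ln (norm t))) ---> q0) (at 0)"
   by (rule tendsto_ln_norm) (use l1 in \<open>simp add: qq_def[abs_def]\<close>)
  then have "((\<lambda>h. (rad qq q0 ((0 + h) *\<^sub>R axis j 1)*(0 + h) - rad qq q0 (0 *\<^sub>R axis j 1)*0)/h) ---> q0) (at 0)"
   by (rule Lim_transform_eventually) (auto simp: eventually_at_filter rad_def norm_axis_1 axis_eq_0_iff)
  then have "DERIV (\<lambda>t. rad qq q0 (t *\<^sub>R axis j 1)*t) 0 :> q0"
   unfolding DERIV_def .
  then show ?thesis using True ij by (simp add: H2_def rad_def axis_def)
 qed
qed

lemma rad_partial2: "partial j (\<lambda>x. rad qq q0 x*x $ i) = H2 j i"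
 unfolding partial_def using rad_deriv2 by (auto intro!: DERIV_imp_deriv)

lemma rad_qq_cont: "continuous_on UNIV (rad qq q0)"
 by (rule continuous_rad[OF DERIV_continuous_UNIV[OF qq_deriv]]) (use l1 in \<open>simp add: qq_def[abs_def]\<close>)

lemma rad_qr_cont: "continuous_on UNIV (rad qr 0)"
 by (rule continuous_rad[OF _ qr_lim]) (auto simp: qr_def[abs_def] intro!: continuous_intros f2 f1cont)

lemma H2_cont: "continuous_on UNIV (H2 j i)"
proof -
 have "continuous_on UNIV (\<lambda>x::real^2. rad qr 0 x*(x $ j/norm x)*(x $ i/norm x))"
  unfolding continuous_on_eq_continuous_at[OF open_UNIV]
 proof
  fix x :: "real^2"
  have qc: "isCont (rad qr 0) x" using rad_qr_cont by (simp add: continuous_on_eq_continuous_at)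
  show "isCont (\<lambda>x::real^2. rad qr 0 x*(x $ j/norm x)*(x $ i/norm x)) x"
  proof (cases "x = 0")
   case False
   then show ?thesis by (intro continuous_intros qc) auto
  next
   case True
   have "((\<lambda>x. \<bar>rad qr 0 x\<bar>) ---> \<bar>rad qr 0 0\<bar>) (at 0)"
    using qc True by (intro tendsto_rabs) (simp add: isCont_def)
   then have z: "((\<lambda>x. \<bar>rad qr 0 x\<bar>) ---> 0) (at 0)" by (simp add: rad_def)
   have "((\<lambda>x::real^2. rad qr 0 x*(x $ j/norm x)*(x $ i/norm x)) ---> 0) (at 0)"
   proof (rule Lim_null_comparison[OF _ z], rule always_eventually, rule allI)
    fix x :: "real^2"
    have b: "\<bar>x $ k/norm x\<bar> <= 1" for k
     using component_le_norm_cart[of x k] by (cases "x = 0") (auto simp: abs_divide)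
    have "\<bar>rad qr 0 x\<bar>*(\<bar>x $ j/norm x\<bar>*\<bar>x $ i/norm x\<bar>) <= \<bar>rad qr 0 x\<bar>*(1*1)"
     by (intro mult_left_mono mult_mono b) auto
    then show "norm (rad qr 0 x*(x $ j/norm x)*(x $ i/norm x)) <= \<bar>rad qr 0 x\<bar>"
     by (simp add: abs_mult mult_ac)
   qed
   then show ?thesis using True by (simp add: isCont_def)
  qed
 qed
 then show ?thesis
  unfolding H2_def by (cases "i = j") (auto intro!: continuous_intros rad_qq_cont)
qed

lemma rad_Ck2: "Ck 2 (rad f al)"
 unfolding Ck_def
proof (intro conjI allI impI)
 note c0 = continuous_rad[OF DERIV_continuous_UNIV[OF f] l0]
 have c1: "continuous_on UNIV (\<lambda>x. rad qq q0 x*x $ i)" for i by (intro continuous_intros rad_qq_cont)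
 fix js :: "2 list"
 show "continuous_on UNIV (foldr partial js (rad f al))" if "length js <= 2"
  using that
  by (cases js; cases "tl js"; cases "tl (tl js)") (auto simp: c0 rad_partial c1 rad_partial2 H2_cont)
 fix i x
 assume js: "length js < 2"
 show "(\<lambda>t. foldr partial js (rad f al) (x + t *\<^sub>R axis i 1)) differentiable at 0"
 proof (cases js)
  case Nil
  then show ?thesis using rad_deriv1[of x i] by (auto simp: real_differentiable_def)
 next
  case (Cons k ks)
  with js have "ks = []" by simp
  with Cons show ?thesis using rad_deriv2[of x i k] by (auto simp: rad_partial real_differentiable_def)
 qed
qed

lemma rad_laplacian: "laplacian (rad f al) x = rad (\<lambda>t. f2 t*exp (- 2*t)) (2*q0) x"
proof -
 have "laplacian (rad f al) x = H2 1 1 x + H2 2 2 x"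
  by (simp add: laplacian_def rad_partial rad_partial2 sum_2)
 also have "... = 2*rad qq q0 x + rad qr 0 x*((x $ 1/norm x)^2 + (x $ 2/norm x)^2)"
  by (simp add: H2_def power2_eq_square algebra_simps)
 also have "... = rad (\<lambda>t. f2 t*exp (- 2*t)) (2*q0) x"
 proof (cases "x = 0")
  case False
  have "(norm x)^2 = (x $ 1)^2 + (x $ 2)^2"
   by (simp add: norm_vec_def L2_set_def sum_2)
  then have "(x $ 1/norm x)^2 + (x $ 2/norm x)^2 = 1"
   unfolding power_divide add_divide_distrib[symmetric] using False by (metis divide_self_if norm_eq_zero power_not_zero)
  then show ?thesis using False by (simp add: rad_def qq_def qr_def algebra_simps)
 qed (simp add: rad_def)
 finally show ?thesis .
qed

lemma rad_partial_zero: "partial i (rad f al) 0 = 0"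
 by (simp add: rad_partial)

end

section \<open>Uniqueness of the ground state in the logarithmic variable\<close>

definition gs1 :: "(real => real) => (real => real) => (real => real) => (real => real) => real => bool" where
 "gs1 f f1 Z m al \<longleftrightarrow>
  (\<forall>t. DERIV f t :> f1 t) \<and>
  (\<forall>t. DERIV f1 t :> (Z t - 1)*exp (2*t)*f t) \<and>
  (\<forall>t. DERIV Z t :> m t) \<and>
  (\<forall>t. DERIV m t :> dens f t) \<and>
  (\<forall>t. f t > 0) \<and> (\<forall>t. f1 t <= 0) \<and> (f ---> 0) at_top \<and> (f ---> al) at_bot \<and>
  ((\<lambda>t. exp (- t)*f1 t) ---> 0) at_bot \<and> (Z ---> 0) at_bot \<and>
  ((\<lambda>t. exp (- t)*m t) ---> 0) at_bot"

text \<open>\<open>exp (- t) * f1 t\<close> is the radial derivative in the plane, so its limit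
  expresses the vanishing gradient at the origin; likewise for \<open>m\<close>. The signs follow by
  integrating from minus infinity.\<close>

lemma gs1_lims:
 assumes "gs1 f f1 Z m al"
 shows "(f1 ---> 0) at_bot" "(m ---> 0) at_bot" "\<And>t. f t <= al" "\<And>t. m t >= 0" "\<And>t. Z t >= 0" "al > 0"
proof -
 have e: "((\<lambda>t::real. exp t) ---> 0) at_bot" by (rule exp_at_bot)
 have a: "((\<lambda>t. exp (- t)*f1 t) ---> 0) at_bot" "((\<lambda>t. exp (- t)*m t) ---> 0) at_bot"
  using assms by (auto simp: gs1_def)
 from tendsto_mult[OF e a(1)] tendsto_mult[OF e a(2)] show f1: "(f1 ---> 0) at_bot" and m: "(m ---> 0) at_bot"
  by (simp_all add: mult.assoc[symmetric] exp_minus)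
 show fle: "f t <= al" for t
 proof -
  have "- al <= - f t"
   by (rule limit_at_bot_le[where K = "\<lambda>t. - f t" and K' = "\<lambda>t. - f1 t"])
    (use assms in \<open>auto simp: gs1_def intro!: derivative_intros tendsto_minus\<close>)
  then show ?thesis by simp
 qed
 show m0: "m t >= 0" for t
  by (rule limit_at_bot_le[OF _ _ m, where K' = "dens f"]) (use assms in \<open>auto simp: gs1_def dens_nonneg\<close>)
 show "Z t >= 0" for t
  by (rule limit_at_bot_le[where K = Z and K' = m]) (use assms m0 in \<open>auto simp: gs1_def\<close>)
 show "al > 0" using fle[of 0] assms by (auto simp: gs1_def intro: less_le_trans)
qed

text \<open>The Wronskian \<open>f1 * g - f * g1\<close> has derivative
  \<open>(Z - Y) * exp (2 * t) * f * g\<close>. If \<open>f\<close> dominates \<open>g\<close> from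
  minus infinity on, so do its mass and potential; then the Wronskian is nonnegative and
  \<open>f / g\<close> does not drop below its limit \<open>al / be\<close>.\<close>

lemma gs1_compare:
 assumes f: "gs1 f f1 Z m al" and g: "gs1 g g1 Y n be" and le: "\<And>t. t <= b ==> g t <= f t"
 shows "t <= b ==> n t <= m t" "t <= b ==> Y t <= Z t" "t <= b ==> 0 <= f1 t*g t - f t*g1 t"
  "al/be <= f b/g b"
proof -
 note F = f[unfolded gs1_def] and G = g[unfolded gs1_def]
 note lf = gs1_lims[OF f] and lg = gs1_lims[OF g]
 have 1: "n t <= m t" if "t <= b" for t
 proof -
  have "0 <= m t - n t"
  proof (rule limit_at_bot_le[where K = "\<lambda>t. m t - n t" and K' = "\<lambda>t. dens f t - dens g t"])
   show "DERIV (\<lambda>t. m t - n t) s :> dens f s - dens g s" for s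
    using F G by (intro derivative_intros) auto
   show "((\<lambda>t. m t - n t) ---> 0) at_bot" using tendsto_diff[OF lf(2) lg(2)] by simp
   fix s assume "s <= t"
   then have "g s <= f s" "g s >= 0" using le that G by (auto intro: less_imp_le)
   then show "0 <= dens f s - dens g s" by (auto simp: dens_def intro!: mult_right_mono power_mono)
  qed
  then show ?thesis by simp
 qed
 have 2: "Y t <= Z t" if "t <= b" for t
 proof -
  have "0 <= Z t - Y t"
  proof (rule limit_at_bot_le[where K = "\<lambda>t. Z t - Y t" and K' = "\<lambda>t. m t - n t"])
   show "DERIV (\<lambda>t. Z t - Y t) s :> m s - n s" for s
    using F G by (intro derivative_intros) auto
   show "((\<lambda>t. Z t - Y t) ---> 0) at_bot" using tendsto_diff[of Z 0 at_bot Y 0] F G by simp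
  qed (use 1 that in auto)
  then show ?thesis by simp
 qed
 have wd: "DERIV (\<lambda>t. f1 t*g t - f t*g1 t) t :> (Z t - Y t)*exp (2*t)*f t*g t" for t
 proof -
  have d: "DERIV f t :> f1 t" "DERIV f1 t :> (Z t - 1)*exp (2*t)*f t"
   "DERIV g t :> g1 t" "DERIV g1 t :> (Y t - 1)*exp (2*t)*g t"
   using F G by auto
  show ?thesis
   by (rule DERIV_cong[OF DERIV_diff[OF DERIV_mult[OF d(2,3)] DERIV_mult[OF d(1,4)]]]) (simp add: algebra_simps)
 qed
 have wl: "((\<lambda>t. f1 t*g t - f t*g1 t) ---> 0) at_bot"
  using tendsto_diff[OF tendsto_mult[OF lf(1), of g be] tendsto_mult[OF _ lg(1), of f al]] F G by simp
 have 3: "0 <= f1 t*g t - f t*g1 t" if "t <= b" for t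
 proof (rule limit_at_bot_le[OF wd _ wl])
  fix s assume "s <= t"
  moreover have "0 <= f s" "0 <= g s" using F G by (auto intro: less_imp_le)
  ultimately show "0 <= (Z s - Y s)*exp (2 * s)*f s*g s"
   using 2[of s] that by simp
 qed
 have "al/be <= f b/g b"
 proof (rule limit_at_bot_le[where K = "\<lambda>t. f t/g t" and K' = "\<lambda>t. (f1 t*g t - f t*g1 t)/(g t*g t)"])
  show "((\<lambda>t. f t/g t) ---> al/be) at_bot"
   using F G lg(6) by (intro tendsto_divide) auto
  fix t
  have "g t \<noteq> 0" using G by (metis less_irrefl)
  then show "DERIV (\<lambda>t. f t/g t) t :> (f1 t*g t - f t*g1 t)/(g t*g t)"
   using F G by (intro DERIV_divide) auto
  show "0 <= (f1 t*g t - f t*g1 t)/(g t*g t)" if "t <= b"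
   using 3[OF that] by simp
 qed
 then show "t <= b ==> n t <= m t" "t <= b ==> Y t <= Z t" "t <= b ==> 0 <= f1 t*g t - f t*g1 t"
  "al/be <= f b/g b" using 1 2 3 by auto
qed

text \<open>If \<open>al > be\<close>, the quotient \<open>f / g\<close> starts above 1 and cannot
  come down to 1, so \<open>f > g\<close> throughout. The Wronskian is then strictly increasing and
  eventually at least a positive constant; but it is at most \<open>- f * g1\<close>, which tends to
  0, because \<open>g1\<close> is bounded below where \<open>Y >= 1\<close>.\<close>

lemma gs1_central_value_le:
 assumes f: "gs1 f f1 Z m al" and g: "gs1 g g1 Y n be"
 shows "al <= be"
proof (rule ccontr)
 assume "\<not> al <= be"
 then have ab: "al > be" by simp
 note F = f[unfolded gs1_def] and G = g[unfolded gs1_def]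
 note lf = gs1_lims[OF f] and lg = gs1_lims[OF g]
 have fc: "continuous_on UNIV f" and gc: "continuous_on UNIV g"
  using F G by (auto intro: DERIV_continuous_UNIV)
 have fg: "g t < f t" for t
 proof (rule ccontr)
  assume neg: "\<not> g t < f t"
  \<comment> \<open>\<open>Inf S\<close> is the first contact. Up to and including it
    \<open>g <= f\<close>, so the quotient there is at least \<open>al / be > 1\<close>, while
    membership in \<open>S\<close> makes it at most 1.\<close>
  define S where "S = {s. f s <= g s}"
  have S: "t \<in> S" using neg by (simp add: S_def)
  have "((\<lambda>s. f s - g s) ---> al - be) at_bot" using F G by (intro tendsto_diff) auto
  then have "\<forall>\<^sub>F s in at_bot. f s - g s > 0" using ab by (intro order_tendstoD) auto
  then obtain b0 where b0: "\<And>s. s <= b0 ==> f s - g s > 0" unfolding eventually_at_bot_linorder by blast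
  have "b0 <= s" if "s \<in> S" for s
  proof (rule ccontr)
   assume "\<not> b0 <= s"
   then show False using b0[of s] that by (simp add: S_def)
  qed
  then have bdd: "bdd_below S" unfolding bdd_below_def by blast
  have "closed S" unfolding S_def by (intro closed_Collect_le fc gc)
  then have in_S: "Inf S \<in> S" using S bdd by (intro closed_contains_Inf) auto
  have "g s <= f s" if "s <= Inf S" for s
  proof (cases "s = Inf S")
   case True
   show ?thesis
   proof (rule ccontr)
    assume "\<not> g s <= f s"
    then have "f s < g s" by simp
    have "isCont (\<lambda>x. g x - f x) s" using fc gc by (auto intro!: continuous_intros simp: continuous_on_eq_continuous_at)
    then have "((\<lambda>x. g x - f x) ---> g s - f s) (at_left s)"
     by (auto simp: isCont_def intro: tendsto_mono[OF at_le])
    then have "\<forall>\<^sub>F x in at_left s. g x - f x > 0" using \<open>f s < g s\<close> by (intro order_tendstoD) auto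
    then have "\<forall>\<^sub>F x in at_left s. g x - f x > 0 \<and> x \<in> {s - 1<..<s}"
     by (intro eventually_conj eventually_at_left_real) auto
    from eventually_happens'[OF trivial_limit_at_left_real this]
    obtain x where "x < s" "g x - f x > 0" by auto
    then have "x \<in> S" by (simp add: S_def)
    then show False using cInf_lower[OF _ bdd, of x] \<open>x < s\<close> True by simp
   qed
  next
   case False
   then have "s < Inf S" using that by simp
   then have "s \<notin> S" using cInf_lower[OF _ bdd, of s] by auto
   then show ?thesis by (simp add: S_def)
  qed
  from gs1_compare(4)[OF f g this] have "al/be <= f (Inf S)/g (Inf S)" by blast
  also have "... <= 1" using in_S G by (auto simp: S_def divide_le_eq_1)
  finally show False using ab lg(6) by (simp add: divide_le_eq)
 qed
 then have le: "\<And>t. g t <= f t" by (simp add: less_imp_le)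
 note cmp = gs1_compare[OF f g le]
 have mlt: "n t < m t" for t
 proof -
  have "m (t - 1) - n (t - 1) < m t - n t"
  proof (rule DERIV_pos_imp_increasing[of "t - 1" t "\<lambda>t. m t - n t"])
   fix x
   have "DERIV (\<lambda>t. m t - n t) x :> dens f x - dens g x"
    using F G by (intro derivative_intros) auto
   moreover have "dens f x - dens g x > 0"
    using fg[of x] G by (auto simp: dens_def intro!: mult_strict_right_mono power_strict_mono less_imp_le)
   ultimately show "\<exists>y. DERIV (\<lambda>t. m t - n t) x :> y \<and> 0 < y" by blast
  qed simp
  then show ?thesis using cmp(1)[of "t - 1" "t - 1"] by simp
 qed
 have Zlt: "Y t < Z t" for t
 proof -
  have "Z (t - 1) - Y (t - 1) < Z t - Y t"
  proof (rule DERIV_pos_imp_increasing[of "t - 1" t "\<lambda>t. Z t - Y t"])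
   fix x
   have "DERIV (\<lambda>t. Z t - Y t) x :> m x - n x"
    using F G by (intro derivative_intros) auto
   then show "\<exists>y. DERIV (\<lambda>t. Z t - Y t) x :> y \<and> 0 < y" using mlt[of x] by (intro exI[of _ "m x - n x"]) simp
  qed simp
  then show ?thesis using cmp(2)[of "t - 1" "t - 1"] by simp
 qed
 define w where "w = (\<lambda>t. f1 t*g t - f t*g1 t)"
 have wd: "DERIV w t :> (Z t - Y t)*exp (2*t)*f t*g t" for t
 proof -
  have d: "DERIV f t :> f1 t" "DERIV f1 t :> (Z t - 1)*exp (2*t)*f t"
   "DERIV g t :> g1 t" "DERIV g1 t :> (Y t - 1)*exp (2*t)*g t"
   using F G by auto
  show ?thesis
   unfolding w_def
   by (rule DERIV_cong[OF DERIV_diff[OF DERIV_mult[OF d(2,3)] DERIV_mult[OF d(1,4)]]]) (simp add: algebra_simps)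
 qed
 have w'pos: "(Z t - Y t)*exp (2*t)*f t*g t > 0" for t using Zlt[of t] F G by auto
 have wmono: "w a < w b" if "a < b" for a b
  using DERIV_pos_imp_increasing[OF that, of w] wd w'pos by blast
 have w0: "w 0 > 0" using wmono[of "-1" 0] cmp(3)[of "-1" "-1"] by (simp add: w_def)
 have npos: "n 0 > 0"
 proof -
  have "n (-1) < n 0"
  proof (rule DERIV_pos_imp_increasing[of "-1" 0 n])
   fix x
   have "g x > 0" using G by blast
   then have "dens g x > 0" by (simp add: dens_def)
   then show "\<exists>y. DERIV n x :> y \<and> 0 < y" using G by blast
  qed simp
  then show ?thesis using lg(4)[of "-1"] by simp
 qed
 \<comment> \<open>For \<open>t >= 0\<close> the potential \<open>Y\<close> has slope at least
   \<open>n 0\<close>, so it has reached 1 at \<open>t1\<close>, and \<open>g\<close> is convex in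
   \<open>t\<close> from there on.\<close>
 define t1 where "t1 = 1/n 0"
 have Yge: "Y t >= 1" if t: "t >= t1" for t
 proof -
  have t0: "0 <= t" using t npos by (simp add: t1_def) (smt (verit) divide_pos_pos)
  have nmono: "n 0 <= n x" if "0 <= x" for x
   using DERIV_nonneg_imp_nondecreasing[OF that, of n] G dens_nonneg by blast
  have "Y 0 - n 0*0 <= Y t - n 0*t"
  proof (rule DERIV_nonneg_imp_nondecreasing[OF t0])
   fix x :: real assume x: "0 <= x"
   have "DERIV (\<lambda>t. Y t - n 0*t) x :> n x - n 0"
    using G by (auto intro!: derivative_eq_intros)
   then show "\<exists>y. DERIV (\<lambda>t. Y t - n 0*t) x :> y \<and> 0 <= y" using nmono[OF x] by force
  qed
  moreover have "n 0*t >= 1" using t npos by (simp add: t1_def field_simps)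
  ultimately show ?thesis using lg(5)[of 0] by simp
 qed
 have g1ge: "g1 t >= g1 t1" if t: "t >= t1" for t
 proof (rule DERIV_nonneg_imp_nondecreasing[OF t])
  fix x assume "t1 <= x"
  moreover have "0 <= g x" using G by (auto intro: less_imp_le)
  ultimately have "(Y x - 1)*exp (2*x)*g x >= 0" using Yge[of x] by simp
  then show "\<exists>y. DERIV g1 x :> y \<and> 0 <= y" using G by blast
 qed
 have "((\<lambda>t. f t*- g1 t1) ---> 0*- g1 t1) at_top" using F by (intro tendsto_intros) auto
 then have lim: "((\<lambda>t. f t*- g1 t1) ---> 0) at_top" by simp
 have "\<forall>\<^sub>F t in at_top. w 0 <= f t*- g1 t1"
  using eventually_ge_at_top[of t1] eventually_gt_at_top[of 0]
 proof eventually_elim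
  case (elim t)
  have "w 0 <= w t" using wmono[of 0 t] elim by simp
  also have "w t <= f t*- g1 t"
  proof -
   have "f1 t <= 0" "0 <= g t" using F G by (auto intro: less_imp_le)
   then have "f1 t*g t <= 0" by (rule mult_nonpos_nonneg)
   then show ?thesis by (simp add: w_def)
  qed
  also have "... <= f t*- g1 t1" using g1ge[OF elim(1)] F by (intro mult_left_mono) (auto intro: less_imp_le)
  finally show ?case .
 qed
 then have "w 0 <= 0" by (intro tendsto_lowerbound[OF lim]) auto
 with w0 show False by simp
qed

text \<open>Gronwall from minus infinity. The weights \<open>exp (- t)\<close> turn
  \<open>f1\<close> and \<open>m\<close> into derivatives in the plane; the differences then satisfy
  \<open>E' <= C * exp t * E\<close>, whose coefficient is integrable at minus infinity. The extra
  terms \<open>- 2 * p^2\<close> and \<open>- 2 * v^2\<close> created by the weights have a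
  favourable sign.\<close>

lemma gs1_unique_profile:
 assumes f: "gs1 f f1 Z m al" and g: "gs1 g g1 Y n al"
 shows "f b = g b" "Z b = Y b"
proof -
 note F = f[unfolded gs1_def] and G = g[unfolded gs1_def]
 note lf = gs1_lims[OF f] and lg = gs1_lims[OF g]
 define y where "y = (\<lambda>t. f t - g t)"
 define p where "p = (\<lambda>t. exp (- t)*f1 t - exp (- t)*g1 t)"
 define z where "z = (\<lambda>t. Z t - Y t)"
 define v where "v = (\<lambda>t. exp (- t)*m t - exp (- t)*n t)"
 define E where "E = (\<lambda>t. (y t)^2 + (p t)^2 + (z t)^2 + (v t)^2)"
 define E' where "E' = (\<lambda>t. 2*y t*(exp t*p t) + 2*p t*(- p t + exp t*((Z t - 1)*y t + z t*g t))
  + 2*z t*(exp t * v t) + 2 * v t*(- v t + exp t*((f t + g t)*y t)))"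
 define C where "C = (1 + (Z b + 1)) + al + 1 + 2*al"
 have yd: "DERIV y t :> exp t*p t" for t
 proof -
  have "exp t*p t = f1 t - g1 t" by (simp add: p_def right_diff_distrib mult.assoc[symmetric] exp_minus)
  moreover have "DERIV y t :> f1 t - g1 t" unfolding y_def using F G by (intro DERIV_diff) auto
  ultimately show ?thesis by simp
 qed
 have zd: "DERIV z t :> exp t * v t" for t
 proof -
  have "exp t * v t = m t - n t" by (simp add: v_def right_diff_distrib mult.assoc[symmetric] exp_minus)
  moreover have "DERIV z t :> m t - n t" unfolding z_def using F G by (intro DERIV_diff) auto
  ultimately show ?thesis by simp
 qed
 have ee: "exp (- t)*exp (2*t) = exp t" for t :: real by (simp add: exp_add[symmetric])
 have pd: "DERIV p t :> - p t + exp t*((Z t - 1)*y t + z t*g t)" for t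
 proof -
  have d: "DERIV f1 t :> (Z t - 1)*exp (2*t)*f t" "DERIV g1 t :> (Y t - 1)*exp (2*t)*g t"
   using F G by auto
  have e: "DERIV (\<lambda>t::real. exp (- t)) t :> - exp (- t)" by (auto intro!: derivative_eq_intros)
  have "DERIV p t :> (- exp (- t)*f1 t + (Z t - 1)*exp (2*t)*f t*exp (- t))
    - (- exp (- t)*g1 t + (Y t - 1)*exp (2*t)*g t*exp (- t))"
   unfolding p_def by (intro DERIV_diff DERIV_mult e d)
  moreover have "(- exp (- t)*f1 t + (Z t - 1)*exp (2*t)*f t*exp (- t))
    - (- exp (- t)*g1 t + (Y t - 1)*exp (2*t)*g t*exp (- t))
    = - p t + (exp (- t)*exp (2*t))*((Z t - 1)*y t + z t*g t)"
   by (simp add: p_def y_def z_def algebra_simps)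
  ultimately show ?thesis unfolding ee by simp
 qed
 have vd: "DERIV v t :> - v t + exp t*((f t + g t)*y t)" for t
 proof -
  have d: "DERIV m t :> dens f t" "DERIV n t :> dens g t"
   using F G by auto
  have e: "DERIV (\<lambda>t::real. exp (- t)) t :> - exp (- t)" by (auto intro!: derivative_eq_intros)
  have "DERIV v t :> (- exp (- t)*m t + dens f t*exp (- t))
    - (- exp (- t)*n t + dens g t*exp (- t))"
   unfolding v_def by (intro DERIV_diff DERIV_mult e d)
  moreover have "(- exp (- t)*m t + dens f t*exp (- t)) - (- exp (- t)*n t + dens g t*exp (- t))
    = - v t + (exp (- t)*exp (2*t))*((f t + g t)*y t)"
   by (simp add: v_def y_def dens_def power2_eq_square algebra_simps)
  ultimately show ?thesis unfolding ee by simp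
 qed
 have Ed: "DERIV E t :> E' t" for t
  unfolding E_def E'_def
  by (rule DERIV_cong, (rule DERIV_add DERIV_power yd pd zd vd)+) simp
 have E0: "(E ---> 0) at_bot"
 proof -
  have "(y ---> al - al) at_bot" "(p ---> 0 - 0) at_bot" "(z ---> 0 - 0) at_bot" "(v ---> 0 - 0) at_bot"
  proof -
   have L: "(f ---> al) at_bot" "(g ---> al) at_bot" "(Z ---> 0) at_bot" "(Y ---> 0) at_bot"
    "((\<lambda>t. exp (- t)*f1 t) ---> 0) at_bot" "((\<lambda>t. exp (- t)*g1 t) ---> 0) at_bot"
    "((\<lambda>t. exp (- t)*m t) ---> 0) at_bot" "((\<lambda>t. exp (- t)*n t) ---> 0) at_bot"
    using F G by auto
   show "(y ---> al - al) at_bot" unfolding y_def by (rule tendsto_diff[OF L(1,2)])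
   show "(p ---> 0 - 0) at_bot" unfolding p_def by (rule tendsto_diff[OF L(5,6)])
   show "(z ---> 0 - 0) at_bot" unfolding z_def by (rule tendsto_diff[OF L(3,4)])
   show "(v ---> 0 - 0) at_bot" unfolding v_def by (rule tendsto_diff[OF L(7,8)])
  qed
  then have "(E ---> (al - al)^2 + (0 - 0)^2 + (0 - 0)^2 + (0 - 0)^2) at_bot"
   unfolding E_def by (intro tendsto_intros)
  then show ?thesis by simp
 qed
 have E'le: "E' t <= C*exp t*E t" if t: "t <= b" for t
 proof -
  have Zb: "Z t <= Z b" using DERIV_nonneg_imp_nondecreasing[OF t, of Z] F lf(4) by blast
  have sq: "2*(\<bar>x\<bar>*\<bar>x'\<bar>) <= x^2 + x'^2" for x x' :: real
   using sum_squares_bound[of "\<bar>x\<bar>" "\<bar>x'\<bar>"] by simp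
  have b1: "2*(\<bar>y t\<bar>*\<bar>p t\<bar>) <= E t" using sq[of "y t" "p t"] unfolding E_def by (smt (verit) zero_le_power2)
  have b2: "2*(\<bar>p t\<bar>*\<bar>z t\<bar>) <= E t" using sq[of "p t" "z t"] unfolding E_def by (smt (verit) zero_le_power2)
  have b3: "2*(\<bar>z t\<bar>*\<bar>v t\<bar>) <= E t" using sq[of "z t" "v t"] unfolding E_def by (smt (verit) zero_le_power2)
  have b4: "2*(\<bar>v t\<bar>*\<bar>y t\<bar>) <= E t" using sq[of "v t" "y t"] unfolding E_def by (smt (verit) zero_le_power2)
  have E0: "E t >= 0" unfolding E_def by simp
  have m: "c*(2*(a*a')) <= \<bar>c\<bar>*(2*(\<bar>a\<bar>*\<bar>a'\<bar>))" for c a a' :: real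
   using abs_ge_self[of "c*(2*(a*a'))"] by (simp add: abs_mult)
  have cm: "c*(2*(a*a')) <= d*E t" if "\<bar>c\<bar> <= d" "2*(\<bar>a\<bar>*\<bar>a'\<bar>) <= E t" for c d a a'
  proof -
   have "c*(2*(a*a')) <= \<bar>c\<bar>*(2*(\<bar>a\<bar>*\<bar>a'\<bar>))" by (rule m)
   also have "... <= d*E t" using that by (intro mult_mono) auto
   finally show ?thesis .
  qed
  have g0: "0 < g t" "g t <= al" "0 < f t" "f t <= al" using F G lf lg by auto
  have 1: "(1 + (Z t - 1))*(2*(y t*p t)) <= (1 + (Z b + 1))*E t"
   using Zb lf(5)[of t] by (intro cm b1) auto
  have 2: "g t*(2*(p t*z t)) <= al*E t" using g0 by (intro cm b2) auto
  have 3: "1*(2*(z t * v t)) <= 1*E t" by (intro cm b3) auto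
  have 4: "(f t + g t)*(2*(v t*y t)) <= (2*al)*E t" using g0 by (intro cm b4) auto
  have "E' t = exp t*((1 + (Z t - 1))*(2*(y t*p t)) + g t*(2*(p t*z t)) + 1*(2*(z t * v t))
    + (f t + g t)*(2*(v t*y t))) - 2*(p t)^2 - 2*(v t)^2"
   unfolding E'_def by (simp add: power2_eq_square algebra_simps)
  also have "... <= exp t*((1 + (Z t - 1))*(2*(y t*p t)) + g t*(2*(p t*z t)) + 1*(2*(z t * v t))
    + (f t + g t)*(2*(v t*y t)))" by simp
  also have "... <= exp t*((1 + (Z b + 1))*E t + al*E t + 1*E t + (2*al)*E t)"
   by (intro mult_left_mono add_mono 1 2 3 4) auto
  also have "... = C*exp t*E t" by (simp add: C_def algebra_simps)
  finally show ?thesis .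
 qed
 define K where "K = (\<lambda>t. - (E t*exp (- (C*exp t))))"
 have "0 <= K b"
 proof (rule limit_at_bot_le[where K = K and K' = "\<lambda>t. - ((E' t - C*exp t*E t)*exp (- (C*exp t)))"])
  have "((\<lambda>t. exp (- (C*exp t))) ---> exp (- (C*0))) at_bot" by (intro tendsto_intros exp_at_bot)
  then have "((\<lambda>t. - (E t*exp (- (C*exp t)))) ---> - (0*exp (- (C*0)))) at_bot"
   by (intro tendsto_minus tendsto_mult E0)
  then show "(K ---> 0) at_bot" unfolding K_def by simp
  fix t
  show "DERIV K t :> - ((E' t - C*exp t*E t)*exp (- (C*exp t)))"
   unfolding K_def using Ed[of t] by (auto intro!: derivative_eq_intros simp: algebra_simps)
  show "0 <= - ((E' t - C*exp t*E t)*exp (- (C*exp t)))" if "t <= b"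
   using E'le[OF that] by (simp add: mult_le_0_iff)
 qed
 then have "E b <= 0" unfolding K_def by (simp add: mult_le_0_iff)
 then have "(y b)^2 <= 0" "(z b)^2 <= 0" unfolding E_def by (smt (verit) zero_le_power2)+
 then show "f b = g b" "Z b = Y b" by (auto simp: y_def z_def)
qed

section \<open>From the planar equation to the logarithmic variable\<close>

context
 fixes u :: "real^2 => real"
 assumes C2: "Ck 2 u" and radial: "\<And>x y. norm x = norm y ==> u x = u y"
begin

abbreviation e1 :: "real^2" where "e1 \<equiv> axis 1 1"

lemma ck_cont: "continuous_on UNIV u" "continuous_on UNIV (partial i u)" "continuous_on UNIV (partial j (partial i u))"
 using C2 unfolding Ck_def
 by (auto dest: spec[where x = "[]"] spec[where x = "[i]"] spec[where x = "[j, i]"])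

lemma ck_deriv0: "DERIV (\<lambda>t. u (x + t *\<^sub>R axis i 1)) 0 :> partial i u x"
proof -
 have "(\<lambda>t. foldr partial [] u (x + t *\<^sub>R axis i 1)) differentiable (at 0)"
  using C2 unfolding Ck_def by (metis list.size(3) pos2)
 then show ?thesis unfolding partial_def by (simp add: DERIV_deriv_iff_real_differentiable)
qed

lemma ck_deriv1: "DERIV (\<lambda>t. partial j u (x + t *\<^sub>R axis i 1)) 0 :> partial i (partial j u) x"
proof -
 have "(\<lambda>t. foldr partial [j] u (x + t *\<^sub>R axis i 1)) differentiable (at 0)"
  using C2 unfolding Ck_def by (metis length_Cons list.size(3) less_2_cases_iff One_nat_def)
 then show ?thesis unfolding partial_def[of i] by (simp add: DERIV_deriv_iff_real_differentiable)
qed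

lemma axis_line_deriv:
 assumes "DERIV (\<lambda>t. h (r *\<^sub>R e1 + t *\<^sub>R axis 1 1)) 0 :> d"
 shows "DERIV (\<lambda>r. h (r *\<^sub>R e1)) r :> d"
proof -
 have "DERIV (\<lambda>t. h ((r + t) *\<^sub>R e1)) 0 :> d"
  using assms by (simp add: scaleR_add_left)
 then show ?thesis using DERIV_shift[of "\<lambda>r. h (r *\<^sub>R e1)" d 0 r] by (simp add: add.commute)
qed

lemma ray_deriv: "DERIV (\<lambda>r. u (r *\<^sub>R e1)) r :> partial 1 u (r *\<^sub>R e1)"
 by (rule axis_line_deriv[OF ck_deriv0])

lemma ray_deriv2: "DERIV (\<lambda>r. partial 1 u (r *\<^sub>R e1)) r :> partial 1 (partial 1 u) (r *\<^sub>R e1)"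
 by (rule axis_line_deriv[OF ck_deriv1])

lemma partial_zero: "partial 1 u 0 = 0"
proof -
 have d: "DERIV (\<lambda>r. u (r *\<^sub>R e1)) 0 :> partial 1 u 0" using ray_deriv[of 0] by simp
 have d': "DERIV (\<lambda>r. u ((0 - r) *\<^sub>R e1)) 0 :> - partial 1 u 0"
  by (rule DERIV_comp_diff[where F = "\<lambda>r. u (r *\<^sub>R e1)"]) (use d in simp)
 have eq: "(\<lambda>r. u ((0 - r) *\<^sub>R e1)) = (\<lambda>r. u (r *\<^sub>R e1))"
  by (rule ext, rule radial) simp
 have "partial 1 u 0 = - partial 1 u 0" by (rule DERIV_unique[OF d d'[unfolded eq]])
 then show ?thesis by simp
qed

lemma radial_ray: "u x = u (norm x *\<^sub>R e1)"
 by (rule radial) (simp add: norm_axis_1)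

lemma norm_two_axes: "norm (r *\<^sub>R e1 + s *\<^sub>R axis 2 1) = sqrt (r^2 + s^2)"
 by (simp add: norm_vec_def L2_set_def sum_2 axis_def)

text \<open>On the line through \<open>r e1\<close> in direction 2, radiality gives the second
  partial derivative at height \<open>s\<close> as \<open>s\<close> times a function continuous in
  \<open>s\<close>; dividing by \<open>s\<close> and letting it tend to 0 leaves
  \<open>u' / r\<close>.\<close>

lemma transversal_partial:
 assumes r: "r > 0"
 shows "partial 2 (partial 2 u) (r *\<^sub>R e1) = partial 1 u (r *\<^sub>R e1)/r"
proof -
 define U1 where "U1 = (\<lambda>r. partial 1 u (r *\<^sub>R e1))"
 have pos: "r^2 + s^2 > 0" for s using r by (simp add: add_pos_nonneg)
 have p2: "partial 2 u (r *\<^sub>R e1 + s *\<^sub>R axis 2 1) = s*(U1 (sqrt (r^2 + s^2)) / sqrt (r^2 + s^2))" for s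
 proof -
  have "DERIV (\<lambda>t. sqrt (r^2 + (s + t)^2)) 0 :> s / sqrt (r^2 + s^2)"
   using pos[of s] by (auto intro!: derivative_eq_intros simp: field_simps)
  then have "DERIV (\<lambda>t. u (sqrt (r^2 + (s + t)^2) *\<^sub>R e1)) 0 :> U1 (sqrt (r^2 + (s + 0)^2))*(s / sqrt (r^2 + s^2))"
   unfolding U1_def by (rule DERIV_chain'[OF _ ray_deriv])
  moreover have "(\<lambda>t. u (r *\<^sub>R e1 + s *\<^sub>R axis 2 1 + t *\<^sub>R axis 2 1)) = (\<lambda>t. u (sqrt (r^2 + (s + t)^2) *\<^sub>R e1))"
  proof
   fix t
   have "u (r *\<^sub>R e1 + (s + t) *\<^sub>R axis 2 1) = u (norm (r *\<^sub>R e1 + (s + t) *\<^sub>R axis 2 1) *\<^sub>R e1)" by (rule radial_ray)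
   then show "u (r *\<^sub>R e1 + s *\<^sub>R axis 2 1 + t *\<^sub>R axis 2 1) = u (sqrt (r^2 + (s + t)^2) *\<^sub>R e1)"
    unfolding norm_two_axes by (simp add: scaleR_add_left add.assoc)
  qed
  ultimately have "DERIV (\<lambda>t. u (r *\<^sub>R e1 + s *\<^sub>R axis 2 1 + t *\<^sub>R axis 2 1)) 0 :> U1 (sqrt (r^2 + s^2))*(s / sqrt (r^2 + s^2))" by simp
  then show ?thesis
   using DERIV_unique[OF ck_deriv0[of "r *\<^sub>R e1 + s *\<^sub>R axis 2 1" 2]] by (simp add: mult_ac)
 qed
 have U1c: "isCont U1 x" for x unfolding U1_def using ray_deriv2 by (rule DERIV_isCont)
 have "((\<lambda>s. U1 (sqrt (r^2 + s^2)) / sqrt (r^2 + s^2)) ---> U1 (sqrt (r^2 + 0^2)) / sqrt (r^2 + 0^2)) (at 0)"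
  using pos[of 0] r by (intro tendsto_divide isCont_tendsto_compose[OF U1c] tendsto_intros) auto
 then have lim: "((\<lambda>s. U1 (sqrt (r^2 + s^2)) / sqrt (r^2 + s^2)) ---> U1 r/r) (at 0)" using r by simp
 have "DERIV (\<lambda>s. partial 2 u (r *\<^sub>R e1 + s *\<^sub>R axis 2 1)) 0 :> U1 r/r"
  unfolding DERIV_def
  using p2[of 0]
  by (intro Lim_transform_eventually[OF lim]) (auto simp: eventually_at_filter p2)
 then show ?thesis using DERIV_unique[OF ck_deriv1[of 2 "r *\<^sub>R e1" 2]] by (simp add: U1_def)
qed

lemma log_deriv: "DERIV (\<lambda>t. u (exp t *\<^sub>R e1)) t :> exp t*partial 1 u (exp t *\<^sub>R e1)"
 using DERIV_chain'[OF DERIV_exp ray_deriv, of t] by (simp add: mult.commute)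

text \<open>The variable \<open>t = ln r\<close> removes the first-order term \<open>u' / r\<close>
  of the radial Laplacian.\<close>

lemma log_deriv2: "DERIV (\<lambda>t. exp t*partial 1 u (exp t *\<^sub>R e1)) t :> exp (2*t)*laplacian u (exp t *\<^sub>R e1)"
proof -
 have d: "DERIV (\<lambda>t. partial 1 u (exp t *\<^sub>R e1)) t :> partial 1 (partial 1 u) (exp t *\<^sub>R e1)*exp t"
  using DERIV_chain'[OF DERIV_exp ray_deriv2, of t] by simp
 have "laplacian u (exp t *\<^sub>R e1) = partial 1 (partial 1 u) (exp t *\<^sub>R e1) + partial 1 u (exp t *\<^sub>R e1)/exp t"
  unfolding laplacian_def sum_2 by (simp add: transversal_partial)
 moreover have "exp (2*t) = exp t*exp t" for t :: real by (simp add: exp_add[symmetric])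
 ultimately have "exp (2*t)*laplacian u (exp t *\<^sub>R e1)
   = exp t*partial 1 u (exp t *\<^sub>R e1) + partial 1 (partial 1 u) (exp t *\<^sub>R e1)*exp t*exp t"
  by (simp add: field_simps)
 then show ?thesis using DERIV_mult[OF DERIV_exp d] by simp
qed

lemma log_lims: "((\<lambda>t. u (exp t *\<^sub>R e1)) ---> u 0) at_bot"
 "((\<lambda>t. exp (- t)*(exp t*partial 1 u (exp t *\<^sub>R e1))) ---> 0) at_bot"
proof -
 have z: "((\<lambda>t. exp t *\<^sub>R e1) ---> 0 *\<^sub>R e1) at_bot"
  by (intro tendsto_intros exp_at_bot)
 have "isCont u 0" "isCont (partial 1 u) 0"
  using ck_cont by (auto simp: continuous_on_eq_continuous_at)
 then have "((\<lambda>t. u (exp t *\<^sub>R e1)) ---> u 0) at_bot" "((\<lambda>t. partial 1 u (exp t *\<^sub>R e1)) ---> partial 1 u 0) at_bot"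
  using z by (auto intro: isCont_tendsto_compose)
 then show "((\<lambda>t. u (exp t *\<^sub>R e1)) ---> u 0) at_bot"
  "((\<lambda>t. exp (- t)*(exp t*partial 1 u (exp t *\<^sub>R e1))) ---> 0) at_bot"
  by (simp_all add: partial_zero mult.assoc[symmetric] exp_minus)
qed

end

lemma ground_state_gs1:
 assumes "ground_state u W"
 shows "gs1 (\<lambda>t. u (exp t *\<^sub>R axis 1 1)) (\<lambda>t. exp t*partial 1 u (exp t *\<^sub>R axis 1 1))
  (\<lambda>t. W (exp t *\<^sub>R axis 1 1)) (\<lambda>t. exp t*partial 1 W (exp t *\<^sub>R axis 1 1)) (u 0)"
proof -
 have C: "Ck 2 u" "Ck 2 W" and lap: "\<And>x. laplacian u x = (W x - 1)*u x" "\<And>x. laplacian W x = (u x)^2"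
  and rad: "\<And>x y. norm x = norm y ==> u x = u y" "\<And>x y. norm x = norm y ==> W x = W y"
  and W0: "W 0 = 0" and pos: "\<And>x. u x > 0" and dec: "\<And>x y. norm x < norm y ==> u y < u x"
  and inf: "(u ---> 0) at_infinity"
  using assms unfolding ground_state_def by blast+
 have top: "((\<lambda>t. u (exp t *\<^sub>R axis 1 1)) ---> 0) at_top"
 proof (rule filterlim_compose[OF inf])
  have "filterlim (\<lambda>t. norm (exp t *\<^sub>R (axis 1 1 :: real^2))) at_top at_top"
   by (simp add: norm_axis_1 exp_at_top)
  then show "filterlim (\<lambda>t. exp t *\<^sub>R (axis 1 1 :: real^2)) at_infinity at_top"
   by (rule filterlim_norm_at_top_imp_at_infinity)
 qed
 have f1: "exp t*partial 1 u (exp t *\<^sub>R axis 1 1) <= 0" for t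
 proof (rule ccontr)
  assume "\<not> ?thesis"
  then have "exp t*partial 1 u (exp t *\<^sub>R axis 1 1) > 0" by simp
  from DERIV_pos_inc_right[OF log_deriv[OF C(1) rad(1), of t] this]
  obtain d where "d > 0" and d: "\<And>h. 0 < h ==> h < d ==> u (exp t *\<^sub>R axis 1 1) < u (exp (t + h) *\<^sub>R axis 1 1)" by blast
  have "u (exp (t + d/2) *\<^sub>R axis 1 1) < u (exp t *\<^sub>R axis 1 1)"
   using \<open>d > 0\<close> by (intro dec) (simp add: norm_axis_1)
  with d[of "d/2"] \<open>d > 0\<close> show False by simp
 qed
 show ?thesis
  unfolding gs1_def
 proof (intro conjI allI)
  fix t
  show "DERIV (\<lambda>t. exp t*partial 1 u (exp t *\<^sub>R axis 1 1)) t :> (W (exp t *\<^sub>R axis 1 1) - 1)*exp (2*t)*u (exp t *\<^sub>R axis 1 1)"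
   using log_deriv2[OF C(1) rad(1), of t] by (simp add: lap mult_ac)
  show "DERIV (\<lambda>t. exp t*partial 1 W (exp t *\<^sub>R axis 1 1)) t :> dens (\<lambda>t. u (exp t *\<^sub>R axis 1 1)) t"
   using log_deriv2[OF C(2) rad(2), of t] by (simp add: lap dens_def mult_ac)
 qed (use log_deriv[OF C(1) rad(1)] log_deriv[OF C(2) rad(2)] pos f1 top log_lims[OF C(1) rad(1)] log_lims[OF C(2) rad(2)] W0 in auto)
qed

text \<open>Comparison in both directions gives equal central values, and these determine the
  solution. This is what gives the definite description in \<open>u0\<close> its meaning, once
  existence is known.\<close>

lemma ground_state_unique:
 assumes a: "ground_state u W" and b: "ground_state v Y"
 shows "u = v" "W = Y"
proof -
 note ga = ground_state_gs1[OF a] and gb = ground_state_gs1[OF b]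
 have eq0: "u 0 = v 0"
  using gs1_central_value_le[OF ga gb] gs1_central_value_le[OF gb ga] by simp
 have rad: "\<And>x y. norm x = norm y ==> u x = u y \<and> W x = W y" "\<And>x y. norm x = norm y ==> v x = v y \<and> Y x = Y y"
  and W0: "W 0 = 0" "Y 0 = 0"
  using a b unfolding ground_state_def by blast+
 have "u x = v x \<and> W x = Y x" for x
 proof (cases "x = 0")
  case True then show ?thesis using eq0 W0 by simp
 next
  case False
  define t where "t = ln (norm x)"
  have n: "norm x = norm (exp t *\<^sub>R axis 1 1 :: real^2)" using False by (simp add: t_def norm_axis_1)
  show ?thesis
   using gs1_unique_profile[OF ga gb[folded eq0], of t] rad(1)[OF n] rad(2)[OF n] by simp
 qed
 then show "u = v" "W = Y" by auto
qed

section \<open>The sharp inequality for radial profiles\<close>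

lemma nn_integral_exp2_atMost: "(NN t. ennreal (2*pi*exp (2*t))*indicator {..a} t) = ennreal (pi*exp (2*a))"
proof -
 have "(NN t. ennreal (2*pi*exp (2*t))*indicator {..a} t)
   = ennreal \<bar>-1\<bar>*(NN x. ennreal (2*pi*exp (2*(0 + -1*x)))*indicator {..a} (0 + -1*x))"
  by (rule nn_integral_real_affine) auto
 also have "... = (NN x. ennreal (2*pi*exp (- 2*x))*indicator {- a..} x)"
  by (auto intro!: nn_integral_cong simp: indicator_def)
 also have "... = ennreal (0 - (- pi*exp (- 2*(- a))))"
 proof (rule nn_integral_FTC_atLeast)
  have "((\<lambda>x::real. exp (- (2*x))) ---> 0) at_top"
   by (intro filterlim_compose[OF exp_at_bot] filterlim_compose[OF filterlim_uminus_at_bot_at_top]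
     filterlim_tendsto_pos_mult_at_top[OF tendsto_const _ filterlim_ident]) simp
  from tendsto_mult_left[OF this, of "- pi"] show "((\<lambda>x. - pi*exp (- 2*x)) ---> 0) at_top" by simp
 qed (auto intro!: derivative_eq_intros)
 finally show ?thesis by simp
qed

text \<open>It suffices to compare half lines \<open>{..a}\<close>, whose preimage is the disc of
  radius \<open>exp a\<close> and area \<open>pi * exp (2 * a)\<close>. The origin, where
  \<open>ln 0 = 0\<close>, is a null set.\<close>

lemma distr_ln_norm:
 "distr lborel borel (\<lambda>x::real^2. ln (norm x)) = density lborel (\<lambda>t. ennreal (2*pi*exp (2*t)))"
proof (rule measure_eqI_generator_eq[where E = "range atMost" and \<Omega> = UNIV and A = "\<lambda>n. {..real n}"])
 show "Int_stable (range (atMost :: real => real set))"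
  unfolding Int_stable_def by (auto simp: min_def)
 show "sets (distr lborel borel (\<lambda>x::real^2. ln (norm x))) = sigma_sets UNIV (range atMost)"
  by (simp add: borel_eq_atMost[where 'a = real])
 show "sets (density lborel (\<lambda>t. ennreal (2*pi*exp (2*t)))) = sigma_sets UNIV (range atMost)"
  by (simp add: borel_eq_atMost[where 'a = real])
 show "(\<Union>n. {..real n}) = UNIV" using real_arch_simple by auto
 have em: "emeasure (distr lborel borel (\<lambda>x::real^2. ln (norm x))) {..a} = ennreal (pi*exp (2*a))" for a
 proof -
  have "emeasure (distr lborel borel (\<lambda>x::real^2. ln (norm x))) {..a} = emeasure lborel {x::real^2. ln (norm x) <= a}"
   by (subst emeasure_distr) (auto intro!: arg_cong[where f = "emeasure lborel"])
  also have "... = emeasure lborel (cball 0 (exp a) :: (real^2) set)"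
  proof (rule emeasure_eq_AE)
   show "AE x in lborel. (x \<in> {x::real^2. ln (norm x) <= a}) = (x \<in> cball 0 (exp a))"
    using AE_lborel_singleton[of "0::real^2"]
   proof eventually_elim
    case (elim x)
    then have "ln (norm x) <= a \<longleftrightarrow> norm x <= exp a" by (metis exp_le_cancel_iff exp_ln zero_less_norm_iff)
    then show ?case by simp
   qed
  qed auto
  also have "... = ennreal (pi*exp (2*a))"
  proof -
   have "unit_ball_vol (real DIM(real^2)) = pi" by (simp add: eval_unit_ball_vol)
   moreover have "exp a^DIM(real^2) = exp (2*a)" by (simp add: exp_double)
   moreover have "emeasure lborel (cball 0 (exp a) :: (real^2) set)
     = ennreal (unit_ball_vol (real DIM(real^2))*exp a^DIM(real^2))"
    by (rule emeasure_cball) simp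
   ultimately show ?thesis by simp
  qed
  finally show ?thesis .
 qed
 show "emeasure (distr lborel borel (\<lambda>x::real^2. ln (norm x))) X = emeasure (density lborel (\<lambda>t. ennreal (2*pi*exp (2*t)))) X"
  if "X \<in> range atMost" for X
  using that by (auto simp: em emeasure_density nn_integral_exp2_atMost)
 show "emeasure (distr lborel borel (\<lambda>x::real^2. ln (norm x))) {..real i} \<noteq> \<infinity>" for i
  by (simp add: em)
qed auto

lemma nn_integral_radial:
 fixes F :: "real => ennreal"
 assumes [measurable]: "F \<in> \<B>"
 shows "(NN x. F (ln (norm (x::real^2)))) = (NN t. ennreal (2*pi*exp (2*t))*F t)"
 using nn_integral_distr[of "\<lambda>x::real^2. ln (norm x)" lborel borel F]
 by (simp add: distr_ln_norm nn_integral_density)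

lemma integral_radial:
 fixes F :: "real => real"
 assumes [measurable]: "F \<in> \<B>"
 shows "(LBINT x. F (ln (norm (x::real^2)))) = 2*pi*(LBINT t. F t*exp (2*t))"
proof -
 have "(LBINT x. F (ln (norm (x::real^2)))) = integral\<^sup>L (distr lborel borel (\<lambda>x::real^2. ln (norm x))) F"
  by (rule integral_distr[symmetric]) auto
 also have "... = (LBINT t. (2*pi*exp (2*t)) *\<^sub>R F t)"
  unfolding distr_ln_norm by (rule integral_density) auto
 also have "... = (LBINT t. 2*pi*(F t*exp (2*t)))"
  by (intro Bochner_Integration.integral_cong) auto
 finally show ?thesis by simp
qed

lemma integrable_radial:
 fixes F :: "real => real"
 assumes [measurable]: "F \<in> \<B>"
 shows "integrable lborel (\<lambda>x::real^2. F (ln (norm x))) \<longleftrightarrow> integrable lborel (\<lambda>t. F t*exp (2*t))"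
proof -
 have "integrable lborel (\<lambda>x::real^2. F (ln (norm x))) \<longleftrightarrow> integrable (distr lborel borel (\<lambda>x::real^2. ln (norm x))) F"
  by (rule integrable_distr_eq[symmetric]) auto
 also have "... \<longleftrightarrow> integrable lborel (\<lambda>t. (2*pi*exp (2*t)) *\<^sub>R F t)"
  unfolding distr_ln_norm by (rule integrable_density) auto
 also have "(\<lambda>t. (2*pi*exp (2*t)) *\<^sub>R F t) = (\<lambda>t. 2*pi*(F t*exp (2*t)))" by auto
 also have "integrable lborel ... \<longleftrightarrow> integrable lborel (\<lambda>t. F t*exp (2*t))"
  by simp
 finally show ?thesis .
qed

lemma AE_nonzero: "AE x in lborel. (x::real^2) \<noteq> 0"
 by (rule AE_lborel_singleton)

text \<open>The limit profile, rescaled, is a ground state, hence equal to \<open>u0\<close> by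
  uniqueness; so existence is proved here as well. Then \<open>N_const = 8 * pi / mu\<close> and
  \<open>I_const\<close> is \<open>4 / mu\<close> times the shifted moment of \<open>g\<close>,
  which turns the left-hand side into \<open>mom (dens g) + mu / 4 - 1 / 4\<close>.\<close>

theorem profile_inequality:
 "N_const > 0" (is ?N)
 "adm f D ==> D > 0 ==> mass f > 0 ==>
  2*pi*((I_const + 1)/N_const - 1/(8*pi)) - ln (8*pi/N_const)/2
   <= BB (dens f) (dens f)/(mass f)^2 + ln (D/mass f)/2"
proof -
 obtain fs g w L0 C1 where "minseq fs g w L0 C1" using minseq_exists by blast
 then interpret minseq fs g w L0 C1 .
 define mu where "mu = 4*L0 + 1 - 4*w"
 obtain g1 where g: "\<And>t. DERIV g t :> g1 t"
  and g1: "\<And>t. DERIV g1 t :> (4*zpot g t - mu)*exp (2*t)*g t"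
  using g_ode unfolding mu_def by blast
 note Z = zpot_deriv[OF g_cont g_wint] and m = cmass_deriv[OF g_cont g_wint]
 obtain s0 where s0: "g s0 \<noteq> 0"
 proof (rule ccontr)
  assume "\<not> thesis"
  then have "\<And>t. dens g t = 0" using that by (auto simp: dens_def)
  then show False using g_mass by (simp add: mass_def)
 qed
 have cm1: "cmass g t <= 1" for t using cmass_zpot_nonneg(3)[OF g_cont g_wint] g_mass by simp
 obtain al where mu: "mu > 0" and gpos: "\<And>t. g t > 0" and g1neg: "\<And>t. g1 t < 0" and gtop: "(g ---> 0) at_top"
  and gbot: "(g ---> al) at_bot" and g1bot: "(g1 ---> 0) at_bot" and al: "al > 0" and glt: "\<And>t. g t < al"
  using ode_minimizer_profile[OF g g1 Z m g_nonneg cmass_zpot_nonneg(1)[OF g_cont g_wint] cm1 cmass_zpot_nonneg(2)[OF g_cont g_wint]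
   cmass_zpot_at_bot[OF g_cont g_wint] g_Holder g_bound s0] by blast
 \<comment> \<open>The shift with \<open>exp (2 * b) = 1 / mu\<close> normalises the constant in the
   equation to 1 and rescales the potential by \<open>4 / mu\<close>; the amplitude
   \<open>c = 2 / mu\<close> then gives \<open>F\<close> the matching density
   \<open>4 / mu * dens g\<close>.\<close>
 define b where "b = - ln mu/2"
 define c where "c = 2/mu"
 have c: "c > 0" using mu by (simp add: c_def)
 have eb: "exp (2*b) = 1/mu" using mu by (simp add: b_def exp_minus field_simps)
 define F where "F = (\<lambda>t. c*g (t + b))"
 define F1 where "F1 = (\<lambda>t. c*g1 (t + b))"
 define ZZ where "ZZ = (\<lambda>t. 4/mu*zpot g (t + b))"
 define mm where "mm = (\<lambda>t. 4/mu*cmass g (t + b))"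
 have sh: "DERIV (\<lambda>t. h (t + b)) t :> d" if "DERIV h (t + b) :> d" for h d t
  using DERIV_comp_add[of h d b t] that by (simp add: add.commute)
 have e2: "exp (2*(t + b)) = exp (2*t)/mu" for t
  using eb by (simp add: distrib_left exp_add)
 have dF: "DERIV F t :> F1 t" for t
  unfolding F_def F1_def by (intro DERIV_cmult sh g)
 have dF1: "DERIV F1 t :> (ZZ t - 1)*F t*exp (2*t)" for t
 proof -
  have "DERIV F1 t :> c*((4*zpot g (t + b) - mu)*exp (2*(t + b))*g (t + b))"
   unfolding F1_def by (intro DERIV_cmult sh g1)
  also have "c*((4*zpot g (t + b) - mu)*exp (2*(t + b))*g (t + b)) = (ZZ t - 1)*F t*exp (2*t)"
   unfolding e2 ZZ_def F_def using mu by (simp add: field_simps)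
  finally show ?thesis .
 qed
 have dZZ: "DERIV ZZ t :> mm t" for t
  unfolding ZZ_def mm_def by (intro DERIV_cmult sh Z)
 have densF: "dens F t = 4/mu*dens g (t + b)" for t
 proof -
  have "4/mu*dens g (t + b) = 4/mu*((g (t + b))^2*(exp (2*t)/mu))" by (simp only: dens_def e2)
  also have "... = dens F t" using mu by (simp add: dens_def F_def c_def power2_eq_square field_simps)
  finally show ?thesis by simp
 qed
 have dmm: "DERIV mm t :> (F t)\<^sup>2*exp (2*t)" for t
 proof -
  have "DERIV mm t :> 4/mu*dens g (t + b)"
   unfolding mm_def by (intro DERIV_cmult sh m)
  then show ?thesis using densF[of t] by (simp add: dens_def[of F])
 qed
 have sl: "filterlim (\<lambda>t. t + b) at_bot at_bot" "filterlim (\<lambda>t. t + b) at_top at_top"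
 proof -
  have "\<forall>\<^sub>F x in at_bot. x + b <= y" for y
   using eventually_le_at_bot[of "y - b"] by eventually_elim simp
  then show "filterlim (\<lambda>t. t + b) at_bot at_bot" by (simp add: filterlim_at_bot)
  have "\<forall>\<^sub>F x in at_top. y <= x + b" for y
   using eventually_ge_at_top[of "y - b"] by eventually_elim simp
  then show "filterlim (\<lambda>t. t + b) at_top at_top" by (simp add: filterlim_at_top)
 qed
 have Fbot: "(F ---> c*al) at_bot"
  unfolding F_def by (intro tendsto_mult_left filterlim_compose[OF gbot] sl)
 have F1bot: "(F1 ---> 0) at_bot"
  unfolding F1_def using tendsto_mult_left[OF filterlim_compose[OF g1bot sl(1)], of c] by simp
 have ZZbot: "(ZZ ---> 0) at_bot"
  unfolding ZZ_def using tendsto_mult_left[OF filterlim_compose[OF cmass_zpot_at_bot(2)[OF g_cont g_wint] sl(1)], of "4/mu"] by simp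
 have mmbot: "(mm ---> 0) at_bot"
  unfolding mm_def using tendsto_mult_left[OF filterlim_compose[OF cmass_zpot_at_bot(1)[OF g_cont g_wint] sl(1)], of "4/mu"] by simp
 have Ftop: "(F ---> 0) at_top"
  unfolding F_def using tendsto_mult_left[OF filterlim_compose[OF gtop sl(2)], of c] by simp
 have pl: "((\<lambda>t. (ZZ t - 1)*F t) ---> (0 - 1)*(c*al)) at_bot" by (intro tendsto_intros ZZbot Fbot)
 have pm: "((\<lambda>t. (F t)^2) ---> (c*al)^2) at_bot" by (intro tendsto_intros Fbot)
 have F1l: "((\<lambda>t. F1 t*exp (- 2*t)) ---> ((0 - 1)*(c*al))/2) at_bot"
  by (rule deriv_ratio_at_bot[OF dF1 pl F1bot])
 have mml: "((\<lambda>t. mm t*exp (- 2*t)) ---> (c*al)^2/2) at_bot"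
  by (rule deriv_ratio_at_bot[OF dmm pm mmbot])
 have ee: "x*exp (2*t)*exp (- 2*t) = x" for x t :: real by (simp add: exp_minus)
 have F2l: "((\<lambda>t. (ZZ t - 1)*F t*exp (2*t)*exp (- 2*t)) ---> 2*(((0 - 1)*(c*al))/2)) at_bot"
  unfolding ee using pl by simp
 have ml: "((\<lambda>t. (F t)^2*exp (2*t)*exp (- 2*t)) ---> 2*((c*al)^2/2)) at_bot"
  unfolding ee using pm by simp
 have Fc: "continuous_on UNIV F" by (rule DERIV_continuous_UNIV[OF dF])
 have ZZc: "continuous_on UNIV ZZ" by (rule DERIV_continuous_UNIV[OF dZZ])
 have F2c: "continuous_on UNIV (\<lambda>t. (ZZ t - 1)*F t*exp (2*t))" by (intro continuous_intros Fc ZZc)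
 have m2c: "continuous_on UNIV (\<lambda>t. (F t)^2*exp (2*t))" by (intro continuous_intros Fc)
 define u where "u = rad F (c*al)"
 define W where "W = rad ZZ 0"
 have Fpos: "F t > 0" for t using gpos c by (simp add: F_def)
 have Flt: "F t < c*al" for t using glt c by (simp add: F_def)
 have Fdec: "F t < F s" if "s < t" for s t
  using DERIV_neg_imp_decreasing[OF that, of F] dF g1neg c unfolding F1_def by (metis mult_pos_neg)
 have gs: "ground_state u W"
  unfolding ground_state_def
 proof (intro conjI allI impI)
  show "Ck 2 u" unfolding u_def by (rule rad_Ck2[OF dF dF1 F2c Fbot F1l F2l])
  show "Ck 2 W" unfolding W_def by (rule rad_Ck2[OF dZZ dmm m2c ZZbot mml ml])
  show "partial i W 0 = 0" for i unfolding W_def by (rule rad_partial_zero[OF dZZ dmm m2c ZZbot mml ml])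
  show "laplacian u x = (W x - 1)*u x" for x
   unfolding u_def W_def
   by (subst rad_laplacian[OF dF dF1 F2c Fbot F1l F2l]) (simp add: rad_def exp_minus)
  show "laplacian W x = (u x)^2" for x
   unfolding u_def W_def
   by (subst rad_laplacian[OF dZZ dmm m2c ZZbot mml ml]) (simp add: rad_def exp_minus)
  fix x y :: "real^2"
  show "u x = u y" "W x = W y" if "norm x = norm y"
   using that by (auto simp: u_def W_def rad_def)
  show "W 0 = 0" by (simp add: W_def rad_def)
  show "u x > 0" using Fpos c al by (simp add: u_def rad_def)
  show "u y < u x" if n: "norm x < norm y"
  proof (cases "x = 0")
   case True
   then show ?thesis using n Flt by (auto simp: u_def rad_def)
  next
   case False
   have "norm y > 0" using n norm_ge_zero[of x] by linarith
   moreover have "norm x > 0" using False by simp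
   ultimately have "ln (norm x) < ln (norm y)" using n by (simp only: ln_less_cancel_iff)
   moreover have "y \<noteq> 0" using \<open>norm y > 0\<close> by simp
   ultimately show ?thesis using False Fdec by (simp add: u_def rad_def)
  qed
 next
  have "filterlim (\<lambda>x::real^2. ln (norm x)) at_top at_infinity"
   by (rule filterlim_compose[OF ln_at_top filterlim_norm_at_top])
  from filterlim_compose[OF Ftop this]
  have "((\<lambda>x::real^2. F (ln (norm x))) ---> 0) at_infinity" .
  moreover have "\<forall>\<^sub>F x in at_infinity. F (ln (norm x)) = u x"
   unfolding eventually_at_infinity u_def rad_def by (intro exI[of _ 1]) auto
  ultimately show "(u ---> 0) at_infinity" by (rule Lim_transform_eventually)
 qed
 have "(THE p. ground_state (fst p) (snd p)) = (u, W)"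
 proof (rule the_equality)
  show "ground_state (fst (u, W)) (snd (u, W))" using gs by simp
  fix p assume p: "ground_state (fst p) (snd p)"
  show "p = (u, W)" using ground_state_unique[OF p gs] by (simp add: prod_eq_iff)
 qed
 then have u0: "u0 = u" by (simp add: u0_def)
 have [measurable]: "F \<in> \<B>" by (rule borel_measurable_continuous_onI[OF Fc])
 have um: "u \<in> \<B>"
  unfolding u_def by (intro borel_measurable_continuous_onI continuous_rad Fc Fbot)
 note [measurable] = um
 have N: "N_const = 8*pi/mu"
 proof -
  have "N_const = (LBINT x. (F (ln (norm (x::real^2))))^2)"
   unfolding N_const_def u0
  proof (rule integral_cong_AE)
   show "AE x in lborel. (u x)^2 = (F (ln (norm x)))^2"
    using AE_nonzero by eventually_elim (auto simp: u_def rad_def)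
  qed auto
  also have "... = 2*pi*(LBINT t. (F t)^2*exp (2*t))"
   by (rule integral_radial) simp
  also have "(LBINT t. (F t)^2*exp (2*t)) = (LBINT t. 4/mu*dens g (t + b))"
   using densF by (simp add: dens_def[of F])
  also have "... = 4/mu*mass g"
   using integral_shift_real[of "dens g" b] by (simp add: mass_def)
  finally show ?thesis using g_mass by simp
 qed
 have I: "I_const = 4/mu*(mom (dens g) - b)"
 proof -
  have "(LBINT x. ln (norm x)*(u0 x)^2) = (LBINT x. ln (norm x)*(F (ln (norm (x::real^2))))^2)"
   unfolding u0
  proof (rule integral_cong_AE)
   show "AE x in lborel. ln (norm x)*(u x)^2 = ln (norm x)*(F (ln (norm x)))^2"
    using AE_nonzero by eventually_elim (auto simp: u_def rad_def)
  qed auto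
  also have "... = 2*pi*(LBINT t. t*(F t)^2*exp (2*t))"
   by (rule integral_radial[of "\<lambda>t. t*(F t)^2"]) simp
  also have "(LBINT t. t*(F t)^2*exp (2*t)) = (LBINT t. 4/mu*((t + b - b)*dens g (t + b)))"
  proof (intro Bochner_Integration.integral_cong refl)
   fix t show "t*(F t)^2*exp (2*t) = 4/mu*((t + b - b)*dens g (t + b))"
    using densF[of t] by (simp add: dens_def[of F] mult_ac)
  qed
  also have "... = 4/mu*(LBINT t. (t + b - b)*dens g (t + b))" by simp
  also have "(LBINT t. (t + b - b)*dens g (t + b)) = (LBINT s. (s - b)*dens g s)"
   by (rule integral_shift_real[of "\<lambda>s. (s - b)*dens g s"])
  also have "... = mom (dens g) - b*mass g"
   unfolding mom_def mass_def using wint_integrable[OF g_wint] by (simp add: left_diff_distrib)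
  finally show ?thesis using g_mass by (simp add: I_const_def)
 qed
 show ?N unfolding N using mu by simp
 assume f: "adm f D" "D > 0" "mass f > 0"
 have "2*pi*((I_const + 1)/N_const - 1/(8*pi)) = mom (dens g) - b + mu/4 - 1/4"
  unfolding N I using mu by (simp add: field_simps)
 moreover have "ln (8*pi/N_const)/2 = - b" unfolding N b_def using mu by simp
 ultimately have "2*pi*((I_const + 1)/N_const - 1/(8*pi)) - ln (8*pi/N_const)/2 = mom (dens g) + mu/4 - 1/4"
  by simp
 \<comment> \<open>By the definition of \<open>mu\<close> the left side is
   \<open>L0 + mom (dens g) - w\<close>, so the inequality between the moments has just the right
   direction.\<close>
 also have "... <= L0"
 proof -
  have "mu/4 = L0 + 1/4 - w" by (simp add: mu_def field_simps)
  then show ?thesis using g_mom by linarith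
 qed
 also have "... <= BB (dens f) (dens f)/(mass f)^2 + ln (D/mass f)/2" by (rule minim[OF f])
 finally show "2*pi*((I_const + 1)/N_const - 1/(8*pi)) - ln (8*pi/N_const)/2
   <= BB (dens f) (dens f)/(mass f)^2 + ln (D/mass f)/2" .
qed

section \<open>Polarization\<close>

definition mir :: "real^2 => real => real^2 => real^2" where
 "mir n c z = z - (2*(z \<bullet> n - c)) *\<^sub>R n"

text \<open>Polarization in the line \<open>z \<bullet> n = c\<close>: of the two values at mirror
  points, the larger goes to the side \<open>z \<bullet> n < c\<close>, which contains the origin
  when \<open>c > 0\<close>.\<close>

definition pol :: "real^2 => real => (real^2 => real) => real^2 => real" where
 "pol n c w z = (if z \<bullet> n < c then max (w z) (w (mir n c z)) else min (w z) (w (mir n c z)))"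

lemma orthogonal_distr_lborel:
 fixes T :: "real^2 => real^2"
 assumes T: "orthogonal_transformation T"
 shows "distr lborel borel T = lborel"
proof (rule lborel_eqI[symmetric])
 have [measurable]: "T \<in> \<B>"
  using T by (intro borel_measurable_continuous_onI linear_continuous_on)
   (simp add: orthogonal_transformation_linear linear_conv_bounded_linear[symmetric])
 obtain S where S: "orthogonal_transformation S" "\<And>x. S (T x) = x" "\<And>x. T (S x) = x"
  using orthogonal_transformation_inv[OF T] orthogonal_transformation_bij[OF T]
  by (metis bij_inv_eq_iff)
 fix l u :: "real^2" assume lu: "\<And>b. b \<in> Basis ==> l \<bullet> b <= u \<bullet> b"
 have TS: "T -` box l u = S ` box l u" using S by (auto simp: image_iff) (metis S(2))
 have bl: "box l u \<in> lmeasurable" by simp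
 have m: "S ` box l u \<in> lmeasurable" by (rule measurable_orthogonal_image[OF S(1) bl])
 have "emeasure (distr lborel borel T) (box l u) = emeasure lborel (T -` box l u)"
  by (subst emeasure_distr) auto
 also have "... = emeasure lebesgue (S ` box l u)"
 proof -
  have "T -` box l u \<in> sets lborel" using measurable_sets[of T borel borel "box l u"] by auto
  then show ?thesis using TS by simp
 qed
 also have "... = ennreal (measure lebesgue (S ` box l u))"
  by (rule emeasure_eq_ennreal_measure) (use m in \<open>auto simp: fmeasurable_def\<close>)
 also have "... = ennreal (measure lebesgue (box l u))"
  by (simp only: measure_orthogonal_image[OF S(1) bl])
 also have "... = ennreal (\<Prod>b\<in>Basis. (u - l) \<bullet> b)"
 proof -
  have "ennreal (measure lebesgue (box l u)) = emeasure lebesgue (box l u)"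
   by (rule emeasure_eq_ennreal_measure[symmetric]) (use bl in \<open>auto simp: fmeasurable_def\<close>)
  then show ?thesis using emeasure_lborel_box[OF lu] by simp
 qed
 finally show "emeasure (distr lborel borel T) (box l u) = ennreal (\<Prod>b\<in>Basis. (u - l) \<bullet> b)" .
qed simp

context
 fixes n :: "real^2" and c :: real
 assumes n1: "norm n = 1"
begin

lemma nn1: "n \<bullet> n = 1" using n1 by (simp add: norm_eq_1)

lemma refl_inner: "mir n c z \<bullet> n = 2*c - z \<bullet> n"
 by (simp add: mir_def inner_diff_left nn1)

lemma refl_refl [simp]: "mir n c (mir n c z) = z"
proof -
 have "mir n c (mir n c z) = mir n c z - (2*(mir n c z \<bullet> n - c)) *\<^sub>R n" by (simp add: mir_def[of n c "mir n c z"])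
 also have "... = z" unfolding refl_inner by (simp add: mir_def algebra_simps)
 finally show ?thesis .
qed

lemma refl_fixed: "z \<bullet> n = c ==> mir n c z = z" by (simp add: mir_def)

lemma norm_add_unit: "(norm (v + k *\<^sub>R n))^2 = (norm v)^2 + 2*k*(v \<bullet> n) + k^2"
 unfolding power2_norm_eq_inner
 by (simp add: inner_add_left inner_add_right inner_commute nn1 power2_eq_square algebra_simps)

lemma norm_refl: "(norm (mir n c z))^2 = (norm z)^2 + 4*c*(c - z \<bullet> n)"
proof -
 have "mir n c z = z + (- (2*(z \<bullet> n - c))) *\<^sub>R n" by (simp add: mir_def algebra_simps)
 then have "(norm (mir n c z))^2 = (norm z)^2 + 2*(- (2*(z \<bullet> n - c)))*(z \<bullet> n) + (- (2*(z \<bullet> n - c)))^2"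
  by (simp only: norm_add_unit)
 then show ?thesis by (simp add: power2_eq_square algebra_simps)
qed

lemma dist_refl_refl: "norm (mir n c x - mir n c y) = norm (x - y)"
proof -
 have "mir n c x - mir n c y = (x - y) + (- (2*((x - y) \<bullet> n))) *\<^sub>R n"
  by (simp add: mir_def algebra_simps inner_diff_left)
 then have "(norm (mir n c x - mir n c y))^2 = (norm (x - y))^2 + 2*(- (2*((x - y) \<bullet> n)))*((x - y) \<bullet> n) + (- (2*((x - y) \<bullet> n)))^2"
  by (simp only: norm_add_unit)
 then have "(norm (mir n c x - mir n c y))^2 = (norm (x - y))^2" by (simp add: power2_eq_square)
 then show ?thesis by (rule power2_eq_imp_eq) auto
qed

lemma dist_refl_swap: "norm (mir n c x - y) = norm (x - mir n c y)"
 using dist_refl_refl[of x "mir n c y"] by simp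

lemma dist_refl_diff: "(norm (x - mir n c y))^2 - (norm (x - y))^2 = 4*(c - x \<bullet> n)*(c - y \<bullet> n)"
proof -
 have "x - mir n c y = (x - y) + (2*(y \<bullet> n - c)) *\<^sub>R n" by (simp add: mir_def)
 then have "(norm (x - mir n c y))^2 = (norm (x - y))^2 + 2*(2*(y \<bullet> n - c))*((x - y) \<bullet> n) + (2*(y \<bullet> n - c))^2"
  by (simp only: norm_add_unit)
 then show ?thesis by (simp add: power2_eq_square inner_diff_left algebra_simps)
qed

lemma dist_refl_same: "x \<bullet> n < c \<longleftrightarrow> y \<bullet> n < c ==> norm (x - y) <= norm (x - mir n c y)"
proof -
 assume "x \<bullet> n < c \<longleftrightarrow> y \<bullet> n < c"
 then have "0 <= 4*(c - x \<bullet> n)*(c - y \<bullet> n)" by (cases "x \<bullet> n < c") (auto simp: mult_nonpos_nonpos)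
 then have "(norm (x - y))^2 <= (norm (x - mir n c y))^2" using dist_refl_diff[of x y] by linarith
 then show ?thesis by (rule power2_le_imp_le) simp
qed

lemma dist_refl_opposite: "x \<bullet> n < c \<longleftrightarrow> \<not> y \<bullet> n < c ==> norm (x - mir n c y) <= norm (x - y)"
proof -
 assume "x \<bullet> n < c \<longleftrightarrow> \<not> y \<bullet> n < c"
 then have "4*(c - x \<bullet> n)*(c - y \<bullet> n) <= 0" by (cases "x \<bullet> n < c") (auto simp: mult_le_0_iff)
 then have "(norm (x - mir n c y))^2 <= (norm (x - y))^2" using dist_refl_diff[of x y] by linarith
 then show ?thesis by (rule power2_le_imp_le) simp
qed

lemma continuous_refl: "continuous_on A (mir n c)"
 unfolding mir_def by (intro continuous_intros)

lemma measurable_refl [measurable]: "mir n c \<in> \<B>"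
 by (intro borel_measurable_continuous_onI continuous_refl)

lemma distr_refl: "distr lborel borel (mir n c) = lborel"
proof -
 define T where "T = mir n 0"
 have "linear T" unfolding T_def mir_def
  by (intro linearI) (auto simp: inner_add_left algebra_simps)
 moreover have "norm (T z) = norm z" for z
 proof -
  have "T z = z + (- (2*(z \<bullet> n))) *\<^sub>R n" by (simp add: T_def mir_def)
  then have "(norm (T z))^2 = (norm z)^2 + 2*(- (2*(z \<bullet> n)))*(z \<bullet> n) + (- (2*(z \<bullet> n)))^2"
   by (simp only: norm_add_unit)
  then have "(norm (T z))^2 = (norm z)^2" by (simp add: power2_eq_square)
  then show ?thesis by (rule power2_eq_imp_eq) auto
 qed
 ultimately have o: "orthogonal_transformation T" by (simp add: orthogonal_transformation)
 have [measurable]: "T \<in> \<B>"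
  using o by (intro borel_measurable_continuous_onI linear_continuous_on)
   (simp add: orthogonal_transformation_linear linear_conv_bounded_linear[symmetric])
 have "mir n c = (\<lambda>z. (2*c) *\<^sub>R n + z) \<circ> T"
  by (auto simp: T_def mir_def algebra_simps)
 then have "distr lborel borel (mir n c) = distr (distr lborel borel T) borel (\<lambda>z. (2*c) *\<^sub>R n + z)"
  by (subst distr_distr) auto
 also have "... = distr lborel borel (\<lambda>z. (2*c) *\<^sub>R n + z)"
  by (simp add: orthogonal_distr_lborel[OF o])
 also have "... = lborel" using lborel_distr_plus[of "(2*c) *\<^sub>R n"] by simp
 finally show ?thesis .
qed

lemma integral_refl:
 fixes f :: "real^2 => real"
 assumes [measurable]: "f \<in> \<B>"
 shows "(LBINT z. f (mir n c z)) = (LBINT z. f z)"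
 using integral_distr[of "mir n c" lborel borel f] by (simp add: distr_refl)

lemma integrable_refl:
 fixes f :: "real^2 => real"
 assumes [measurable]: "f \<in> \<B>"
 shows "integrable lborel (\<lambda>z. f (mir n c z)) \<longleftrightarrow> integrable lborel f"
 using integrable_distr_eq[of "mir n c" lborel borel f] by (simp add: distr_refl)

lemma pol_pair:
 "pol n c w z = max (w z) (w (mir n c z)) \<and> pol n c w (mir n c z) = min (w z) (w (mir n c z)) \<or>
 pol n c w z = min (w z) (w (mir n c z)) \<and> pol n c w (mir n c z) = max (w z) (w (mir n c z))"
proof -
 consider "z \<bullet> n < c" | "z \<bullet> n = c" | "z \<bullet> n > c" by linarith
 then show ?thesis
 proof cases
  case 2
  then show ?thesis by (simp add: pol_def refl_fixed)
 qed (auto simp: pol_def refl_inner max.commute min.commute)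
qed

lemma pol_sum_square: "(pol n c w z)^2 + (pol n c w (mir n c z))^2 = (w z)^2 + (w (mir n c z))^2"
 using pol_pair[of w z] by (auto simp: max_def min_def)

lemma pol_of_square: "(\<And>z. w z >= 0) ==> pol n c (\<lambda>z. (w z)^2) z = (pol n c w z)^2"
 by (auto simp: pol_def max_def min_def abs_le_square_iff[symmetric] power_mono intro: power2_le_imp_le)

text \<open>For points on the same side this is stability of \<open>max\<close> and
  \<open>min\<close>. For points on opposite sides, mirroring one of them brings them closer, so all
  four differences of values are under control.\<close>

lemma pol_Lipschitz:
 assumes L: "\<And>x y. \<bar>w x - w y\<bar> <= L*norm (x - y)" and "L >= 0"
 shows "\<bar>pol n c w x - pol n c w y\<bar> <= L*norm (x - y)"
proof -
 have a: "\<bar>w x - w y\<bar> <= L*norm (x - y)" "\<bar>w (mir n c x) - w (mir n c y)\<bar> <= L*norm (x - y)"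
  using L[of x y] L[of "mir n c x" "mir n c y"] by (auto simp: dist_refl_refl)
 show ?thesis
 proof (cases "x \<bullet> n < c \<longleftrightarrow> y \<bullet> n < c")
  case True
  then show ?thesis using a by (auto simp: pol_def)
 next
  case False
  then have "norm (x - mir n c y) <= norm (x - y)" by (intro dist_refl_opposite) auto
  then have "L*norm (x - mir n c y) <= L*norm (x - y)" using \<open>L \<ge> 0\<close> by (rule mult_left_mono)
  then have "\<bar>w x - w (mir n c y)\<bar> <= L*norm (x - y)" "\<bar>w (mir n c x) - w y\<bar> <= L*norm (x - y)"
   using L[of x "mir n c y"] L[of "mir n c x" y] by (auto simp: dist_refl_swap)
  then show ?thesis using a False by (auto simp: pol_def)
 qed
qed

text \<open>A point on the side of the origin is mirrored farther away from the origin, so both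
  values in the maximum vanish; on the other side the minimum is taken with
  \<open>w z = 0\<close>.\<close>

lemma pol_support:
 assumes c: "c > 0" and s: "\<And>z. norm z > R ==> w z = 0" and nn: "\<And>z. w z >= 0" and z: "norm z > R"
 shows "pol n c w z = 0"
proof (cases "z \<bullet> n < c")
 case True
 then have "(norm (mir n c z))^2 >= (norm z)^2" unfolding norm_refl using c by simp
 then have "norm (mir n c z) >= norm z" by (rule power2_le_imp_le) simp
 then have "norm (mir n c z) > R" using z by linarith
 then show ?thesis using s[OF z] s[of "mir n c z"] by (simp add: pol_def)
next
 case False
 then show ?thesis using s[OF z] nn[of "mir n c z"] by (simp add: pol_def)
qed

text \<open>The sum of the four products is the same before and after polarization; only its
  division between the two distances changes. Polarization pairs the values in sorted order at the
  shorter distance, where the kernel is larger. Coincident points are excluded because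
  \<open>K\<close> is monotone on positive arguments only.\<close>

lemma pol_rearrangement_pointwise:
 fixes x y :: "real^2"
 assumes K: "\<And>r s. 0 < r ==> r <= s ==> K s <= K r" and "x \<noteq> y" "x \<noteq> mir n c y"
 shows "K (norm (x - y))*(w x*w y + w (mir n c x)*w (mir n c y))
    + K (norm (x - mir n c y))*(w x*w (mir n c y) + w (mir n c x)*w y)
   <= K (norm (x - y))*(pol n c w x*pol n c w y + pol n c w (mir n c x)*pol n c w (mir n c y))
    + K (norm (x - mir n c y))*(pol n c w x*pol n c w (mir n c y) + pol n c w (mir n c x)*pol n c w y)"
  (is "?l <= ?r")
proof -
 define k k' where "k = K (norm (x - y))" and "k' = K (norm (x - mir n c y))"
 define a a' b b' where "a = w x" and "a' = w (mir n c x)" and "b = w y" and "b' = w (mir n c y)"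
 define P P' Q Q' where "P = pol n c w x" and "P' = pol n c w (mir n c x)" and "Q = pol n c w y" and "Q' = pol n c w (mir n c y)"
 have PP: "P + P' = a + a'" "Q + Q' = b + b'"
  using pol_pair[of w x] pol_pair[of w y] unfolding P_def P'_def Q_def Q'_def a_def a'_def b_def b'_def by auto
 have "?r - ?l = (k*(P*Q + P'*Q') + k'*(P*Q' + P'*Q)) - (k*(a*b + a'*b') + k'*(a*b' + a'*b))"
  by (simp add: k_def k'_def a_def a'_def b_def b'_def P_def P'_def Q_def Q'_def)
 also have "P*Q' + P'*Q = (a + a')*(b + b') - (P*Q + P'*Q')"
  unfolding PP[symmetric] by (simp add: algebra_simps)
 also have "a*b' + a'*b = (a + a')*(b + b') - (a*b + a'*b')" by (simp add: algebra_simps)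
 finally have eq: "?r - ?l = (k - k')*((P*Q + P'*Q') - (a*b + a'*b'))" by (simp add: algebra_simps)
 have sort: "a*b + a'*b' <= max a a'*max b b' + min a a'*min b b'"
 proof -
  have "(max a a' - min a a')*(max b b' - min b b') >= 0" by (intro mult_nonneg_nonneg) auto
  then show ?thesis by (cases "a <= a'"; cases "b <= b'") (auto simp: algebra_simps)
 qed
 have sort': "max a a'*min b b' + min a a'*max b b' <= a*b + a'*b'"
 proof -
  have "(max a a' - min a a')*(max b b' - min b b') >= 0" by (intro mult_nonneg_nonneg) auto
  then show ?thesis by (cases "a <= a'"; cases "b <= b'") (auto simp: algebra_simps)
 qed
 have swap: "pol n c w (mir n c z) = (if z \<bullet> n < c then min (w z) (w (mir n c z)) else max (w z) (w (mir n c z)))" for z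
 proof -
  consider "z \<bullet> n < c" | "z \<bullet> n = c" | "z \<bullet> n > c" by linarith
  then show ?thesis
  proof cases
   case 1
   then have "\<not> mir n c z \<bullet> n < c" by (simp add: refl_inner)
   with 1 show ?thesis by (simp add: pol_def min.commute)
  next
   case 2
   then show ?thesis by (simp add: pol_def refl_fixed)
  next
   case 3
   then have "mir n c z \<bullet> n < c" by (simp add: refl_inner)
   with 3 show ?thesis by (simp add: pol_def max.commute)
  qed
 qed
 have "0 <= ?r - ?l"
 proof (cases "x \<bullet> n < c \<longleftrightarrow> y \<bullet> n < c")
  case True
  then have "norm (x - y) <= norm (x - mir n c y)" by (rule dist_refl_same)
  then have "k' <= k" unfolding k_def k'_def using assms by (intro K) auto
  moreover have "P*Q + P'*Q' = max a a'*max b b' + min a a'*min b b'"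
   using True unfolding P_def P'_def Q_def Q'_def swap by (auto simp: pol_def a_def a'_def b_def b'_def)
  ultimately show ?thesis unfolding eq using sort by simp
 next
  case False
  then have "norm (x - mir n c y) <= norm (x - y)" by (intro dist_refl_opposite) auto
  then have "k <= k'" unfolding k_def k'_def using assms by (intro K) auto
  moreover have "P*Q + P'*Q' = max a a'*min b b' + min a a'*max b b'"
   using False unfolding P_def P'_def Q_def Q'_def swap by (auto simp: pol_def a_def a'_def b_def b'_def)
  ultimately show ?thesis unfolding eq using sort' by (simp add: mult_nonpos_nonpos)
 qed
 then show ?thesis by simp
qed

lemma distr_pair_refl:
 "distr lborel2 (borel \<Otimes>\<^sub>M borel) (\<lambda>(x, y). (mir n c x, y)) = lborel \<Otimes>\<^sub>M (lborel :: (real^2) measure)"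
 "distr lborel2 (borel \<Otimes>\<^sub>M borel) (\<lambda>(x, y). (x, mir n c y)) = (lborel :: (real^2) measure) \<Otimes>\<^sub>M lborel"
proof -
 have id: "distr lborel borel (\<lambda>x::real^2. x) = lborel" by (rule distr_id2) simp
 have "distr lborel borel (mir n c) \<Otimes>\<^sub>M distr lborel borel (\<lambda>x::real^2. x) = distr lborel2 (borel \<Otimes>\<^sub>M borel) (\<lambda>(x, y). (mir n c x, y))"
  by (rule pair_measure_distr) (auto simp: id sigma_finite_lborel)
 then show "distr lborel2 (borel \<Otimes>\<^sub>M borel) (\<lambda>(x, y). (mir n c x, y)) = lborel \<Otimes>\<^sub>M (lborel :: (real^2) measure)"
  by (simp add: id distr_refl)
 have "distr lborel borel (\<lambda>x::real^2. x) \<Otimes>\<^sub>M distr lborel borel (mir n c) = distr lborel2 (borel \<Otimes>\<^sub>M borel) (\<lambda>(x, y). (x, mir n c y))"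
  by (rule pair_measure_distr) (auto simp: distr_refl sigma_finite_lborel)
 then show "distr lborel2 (borel \<Otimes>\<^sub>M borel) (\<lambda>(x, y). (x, mir n c y)) = (lborel :: (real^2) measure) \<Otimes>\<^sub>M lborel"
  by (simp add: id distr_refl)
qed

lemma pair_integral_refl:
 fixes f :: "(real^2) \<times> (real^2) => real"
 assumes f: "integrable lborel2 f"
 shows "integrable lborel2 (\<lambda>p. f (mir n c (fst p), snd p))"
  "(LINT p|lborel2. f (mir n c (fst p), snd p)) = (LINT p|lborel2. f p)"
  "integrable lborel2 (\<lambda>p. f (fst p, mir n c (snd p)))"
  "(LINT p|lborel2. f (fst p, mir n c (snd p))) = (LINT p|lborel2. f p)"
proof -
 have f': "f \<in> borel_measurable (borel \<Otimes>\<^sub>M borel)"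
  using borel_measurable_integrable[OF f] by (simp cong: measurable_cong_sets)
 have m1: "(\<lambda>(x, y). (mir n c x, y)) \<in> measurable lborel2 (borel \<Otimes>\<^sub>M (borel :: (real^2) measure))" by measurable
 have m2: "(\<lambda>(x, y). (x, mir n c y)) \<in> measurable lborel2 ((borel :: (real^2) measure) \<Otimes>\<^sub>M borel)" by measurable
 show "integrable lborel2 (\<lambda>p. f (mir n c (fst p), snd p))"
  using integrable_distr_eq[OF m1 f', unfolded distr_pair_refl] f by (simp add: case_prod_beta')
 show "(LINT p|lborel2. f (mir n c (fst p), snd p)) = (LINT p|lborel2. f p)"
  using integral_distr[OF m1 f', unfolded distr_pair_refl] by (simp add: case_prod_beta')
 show "integrable lborel2 (\<lambda>p. f (fst p, mir n c (snd p)))"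
  using integrable_distr_eq[OF m2 f', unfolded distr_pair_refl] f by (simp add: case_prod_beta')
 show "(LINT p|lborel2. f (fst p, mir n c (snd p))) = (LINT p|lborel2. f p)"
  using integral_distr[OF m2 f', unfolded distr_pair_refl] by (simp add: case_prod_beta')
qed

end

section \<open>Energies with decreasing kernels\<close>

definition Jker :: "(real => real) => (real^2 => real) => real" where
 "Jker K w = (LINT p|lborel2. K (norm (fst p - snd p))*(w (fst p)*w (snd p)))"

lemma AE_pair_neq:
 fixes h :: "real^2 => real^2"
 assumes [measurable]: "h \<in> \<B>"
 shows "AE p in lborel2. snd p \<noteq> h (fst p)"
proof (rule lborel_pair.AE_pair_measure)
 show "{x \<in> space lborel2. snd x \<noteq> h (fst x)} \<in> sets (lborel \<Otimes>\<^sub>M (lborel :: (real^2) measure))"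
  by measurable
 show "AE x in lborel. AE y in lborel. snd (x, y) \<noteq> h (fst (x, y))"
  using AE_lborel_singleton by auto
qed

text \<open>Summing the integrand over the four mirrored copies of a pair of points gives four times
  the energy, and this sum obeys the four-point inequality pointwise.\<close>

lemma Jker_pol:
 assumes n1: "norm n = 1"
  and K: "\<And>r s. 0 < r ==> r <= s ==> K s <= K r"
  and iw: "integrable lborel2 (\<lambda>p. K (norm (fst p - snd p))*(w (fst p)*w (snd p)))"
  and ip: "integrable lborel2 (\<lambda>p. K (norm (fst p - snd p))*(pol n c w (fst p)*pol n c w (snd p)))"
 shows "Jker K w <= Jker K (pol n c w)"
proof -
 note pr = pair_integral_refl[OF n1, where c = c]
 define G where "G = (\<lambda>w (p :: (real^2) \<times> (real^2)). K (norm (fst p - snd p))*(w (fst p)*w (snd p) + w (mir n c (fst p))*w (mir n c (snd p)))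
    + K (norm (fst p - mir n c (snd p)))*(w (fst p)*w (mir n c (snd p)) + w (mir n c (fst p))*w (snd p)))"
 have four: "integrable lborel2 (G w) \<and> (LINT p|lborel2. G w p) = 4*Jker K w"
  if i: "integrable lborel2 (\<lambda>p. K (norm (fst p - snd p))*(w (fst p)*w (snd p)))" for w
 proof -
  define f where "f = (\<lambda>p. K (norm (fst p - snd p))*(w (fst p)*w (snd p)))"
  have f: "integrable lborel2 f" unfolding f_def by (rule i)
  have G: "G w = (\<lambda>p. f p + f (mir n c (fst p), snd p) + f (fst p, mir n c (snd p)) + f (mir n c (fst p), mir n c (snd p)))"
   by (rule ext) (simp add: G_def f_def refl_refl[OF n1] dist_refl_swap[OF n1] algebra_simps)
  have i2: "integrable lborel2 (\<lambda>p. f (mir n c (fst p), mir n c (snd p)))"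
   and e2: "(LINT p|lborel2. f (mir n c (fst p), mir n c (snd p))) = (LINT p|lborel2. f p)"
   using pr(1)[OF pr(3)[OF f]] pr(2)[OF pr(3)[OF f]] pr(4)[OF f] by auto
  show ?thesis
   unfolding G using f pr[OF f] i2 e2 by (simp add: Jker_def f_def)
 qed
 have "(LINT p|lborel2. G w p) <= (LINT p|lborel2. G (pol n c w) p)"
 proof (rule integral_mono_AE)
  show "integrable lborel2 (G w)" "integrable lborel2 (G (pol n c w))"
   using four[OF iw] four[OF ip] by auto
  have a1: "AE p in lborel2. snd p \<noteq> (fst p :: real^2)" by (rule AE_pair_neq) simp
  have a2: "AE p in lborel2. snd p \<noteq> mir n c (fst p)" by (rule AE_pair_neq) (simp add: measurable_refl[OF n1])
  show "AE p in lborel2. G w p <= G (pol n c w) p"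
   using a1 a2
  proof eventually_elim
   case (elim p)
   then have "fst p \<noteq> mir n c (snd p)" using refl_refl[OF n1, of c "snd p"] by metis
   with elim show ?case unfolding G_def by (intro pol_rearrangement_pointwise[OF n1 K]) auto
  qed
 qed
 then show ?thesis using four[OF iw] four[OF ip] by simp
qed

definition nice :: "real => real => (real^2 => real) => bool" where
 "nice L R w \<longleftrightarrow> (\<forall>x. 0 <= w x) \<and> (\<forall>x y. \<bar>w x - w y\<bar> <= L*norm (x - y)) \<and> (\<forall>x. norm x > R \<longrightarrow> w x = 0)"

lemma nice_cont: assumes "nice L R w" shows "continuous_on UNIV w"
 unfolding continuous_on_eq_continuous_at[OF open_UNIV]
proof
 fix x :: "real^2"
 have "((\<lambda>y. L*norm (y - x)) ---> L*norm (x - x)) (at x)" by (intro tendsto_intros)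
 then have "((\<lambda>y. L*norm (y - x)) ---> 0) (at x)" by simp
 then have "((\<lambda>y. w y - w x) ---> 0) (at x)"
  by (rule Lim_null_comparison[rotated]) (use assms in \<open>auto simp: nice_def\<close>)
 then show "isCont w x" unfolding isCont_def by (simp add: LIM_zero_iff)
qed

lemma nice_measurable [measurable_dest]: "nice L R w ==> w \<in> \<B>"
 by (intro borel_measurable_continuous_onI nice_cont)

text \<open>Compare with a point of norm \<open>R + 1\<close>, where \<open>w\<close> vanishes and
  which is at distance at most \<open>2 * R + 1\<close> from the disc.\<close>

lemma nice_bound:
 assumes w: "nice L R w" and LR: "L >= 0" "R >= 0"
 shows "\<bar>w x\<bar> <= L*(2*R + 1)*indicator (cball 0 R) x"
proof (cases "norm x <= R")
 case True
 define z :: "real^2" where "z = (R + 1) *\<^sub>R axis 1 1"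
 have nz: "norm z = R + 1" using LR by (simp add: z_def norm_axis_1)
 then have "w z = 0" using w by (simp add: nice_def)
 then have "\<bar>w x\<bar> <= L*norm (x - z)" using w unfolding nice_def by (metis diff_zero)
 also have "... <= L*(2*R + 1)"
  using norm_triangle_ineq4[of x z] nz True LR by (intro mult_left_mono) auto
 finally show ?thesis using True by simp
next
 case False
 then show ?thesis using w by (simp add: nice_def)
qed

definition iball :: "real => real^2 => real" where "iball R = indicator (cball 0 R)"

lemma measurable_iball [measurable]: "iball R \<in> \<B>"
 unfolding iball_def by (intro borel_measurable_indicator borel_closed closed_cball)

lemma iball_nonneg: "iball R x >= 0" by (simp add: iball_def)

lemma integrable_iball: "integrable lborel (iball R)"
proof -
 have "emeasure lborel (cball 0 R :: (real^2) set) < \<infinity>" by (rule emeasure_bounded_finite) simp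
 then show ?thesis unfolding iball_def by (intro integrable_real_indicator) auto
qed

lemma integrable_iball_mult:
 fixes h :: "real^2 => real"
 assumes [measurable]: "h \<in> \<B>" and "\<And>x. \<bar>h x\<bar> <= C*iball R x"
 shows "integrable lborel h"
proof (rule Bochner_Integration.integrable_bound)
 show "integrable lborel (\<lambda>x. C*iball R x)" by (intro integrable_mult_right integrable_iball)
 show "AE x in lborel. norm (h x) <= norm (C*iball R x)" using assms(2) by (auto intro: order_trans[OF _ abs_ge_self])
qed simp

text \<open>In polar coordinates this is the integrability of \<open>|t| * exp (2 * t)\<close> at
  minus infinity.\<close>

lemma integrable_log_kernel:
 "integrable lborel (\<lambda>z::real^2. indicator {..A} (ln (norm z))*\<bar>ln (norm z)\<bar>)"
proof -
 have "integrable lborel (\<lambda>t. indicator {..A} t*\<bar>t\<bar>*exp (2*t) :: real)"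
 proof (rule Bochner_Integration.integrable_bound[OF dom_integrable[of A]])
  show "AE t in lborel. norm (indicator {..A} t*\<bar>t\<bar>*exp (2*t)) <= norm (indicator {..A} t*dom t)"
  proof (rule AE_I2)
   fix t :: real
   have "\<bar>t\<bar>*(1*exp (2*t)) <= (1 + \<bar>t\<bar>)*((8 + 2*\<bar>t\<bar>)*exp (2*t))"
    by (intro mult_mono) auto
   then have "\<bar>t\<bar>*exp (2*t) <= dom t" by (simp add: dom_def)
   moreover have "dom t >= 0" by (simp add: dom_def)
   ultimately show "norm (indicator {..A} t*\<bar>t\<bar>*exp (2*t)) <= norm (indicator {..A} t*dom t)"
    by (auto simp: indicator_def abs_mult)
  qed
 qed simp
 then show ?thesis
  using integrable_radial[of "\<lambda>t. indicator {..A} t*\<bar>t\<bar>"] by simp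
qed

lemma integrable_conv_iball:
 fixes k :: "real^2 => real"
 assumes k: "integrable lborel k"
 shows "integrable lborel2 (\<lambda>p. iball R (fst p)*k (fst p - snd p))"
proof -
 have [measurable]: "k \<in> \<B>" using borel_measurable_integrable[OF k] by simp
 have sh: "integrable lborel (\<lambda>y. k (x - y))" "(LBINT y. norm (k (x - y))) = (LBINT y. norm (k y))" for x
 proof -
  have d: "distr lborel borel (\<lambda>y::real^2. x - y) = lborel"
  proof -
   have o: "orthogonal_transformation (\<lambda>y::real^2. - y)" by (simp add: orthogonal_transformation_neg)
   have "distr lborel borel (\<lambda>y::real^2. x - y) = distr (distr lborel borel (\<lambda>y. - y)) borel (\<lambda>y. x + y)"
    by (subst distr_distr) (auto simp: o_def)
   then show ?thesis using orthogonal_distr_lborel[OF o] lborel_distr_plus[of x] by simp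
  qed
  show "integrable lborel (\<lambda>y. k (x - y))"
   using integrable_distr_eq[of "\<lambda>y::real^2. x - y" lborel borel k] k by (simp add: d)
  show "(LBINT y. norm (k (x - y))) = (LBINT y. norm (k y))"
   using integral_distr[of "\<lambda>y::real^2. x - y" lborel borel "\<lambda>y. norm (k y)"] by (simp add: d)
 qed
 show ?thesis
 proof (rule lborel_pair.Fubini_integrable)
  have "(LBINT y. norm (iball R (fst (x, y))*k (fst (x, y) - snd (x, y)))) = iball R x*(LBINT y. norm (k y))" for x
   using sh(2)[of x] iball_nonneg[of R x] by (simp add: abs_mult)
  then show "integrable lborel (\<lambda>x. LBINT y. norm (iball R (fst (x, y))*k (fst (x, y) - snd (x, y))))"
   using integrable_iball by simp
  show "AE x in lborel. integrable lborel (\<lambda>y. iball R (fst (x, y))*k (fst (x, y) - snd (x, y)))"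
   using sh(1) by simp
 qed simp
qed

text \<open>The common features of the two kernels of interest: \<open>- ln r\<close> for the
  logarithmic energy, and the indicator of \<open>r < e\<close>, which through
  \<open>EE_nice\<close> stands for the Dirichlet energy.\<close>

definition okker :: "(real => real) => bool" where
 "okker K \<longleftrightarrow> K \<in> borel_measurable borel \<and>
  (\<forall>R. integrable lborel2 (\<lambda>p. K (norm (fst p - snd p))*(iball R (fst p)*iball R (snd p)))) \<and>
  (\<forall>r s. 0 < r \<longrightarrow> r <= s \<longrightarrow> K s <= K r)"

lemma okker_ln: "okker (\<lambda>r. - ln r)"
 unfolding okker_def
proof (intro conjI allI impI)
 fix R :: real
 let ?k = "\<lambda>z::real^2. indicator {..ln (2*\<bar>R\<bar>)} (ln (norm z))*\<bar>ln (norm z)\<bar> :: real"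
 have i: "integrable lborel2 (\<lambda>p. iball R (fst p)*?k (fst p - snd p))"
  by (rule integrable_conv_iball[OF integrable_log_kernel])
 show "integrable lborel2 (\<lambda>p. - ln (norm (fst p - snd p))*(iball R (fst p)*iball R (snd p)))"
 proof (rule Bochner_Integration.integrable_bound[OF i])
  show "AE p in lborel2. norm (- ln (norm (fst p - snd p))*(iball R (fst p)*iball R (snd p)))
    <= norm (iball R (fst p)*?k (fst p - snd p))"
  proof (rule AE_I2)
   fix p :: "(real^2) \<times> (real^2)"
   show "norm (- ln (norm (fst p - snd p))*(iball R (fst p)*iball R (snd p))) <= norm (iball R (fst p)*?k (fst p - snd p))"
   proof (cases "fst p = snd p \<or> fst p \<notin> cball 0 R \<or> snd p \<notin> cball 0 R")
    case True
    then show ?thesis by (auto simp: iball_def)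
   next
    case False
    then have "norm (fst p - snd p) <= 2*\<bar>R\<bar>" using norm_triangle_ineq4[of "fst p" "snd p"] by auto
    moreover have "norm (fst p - snd p) > 0" using False by simp
    ultimately have "ln (norm (fst p - snd p)) <= ln (2*\<bar>R\<bar>)"
     by (subst ln_le_cancel_iff) linarith+
    then show ?thesis using False by (simp add: iball_def)
   qed
  qed
 qed simp
qed auto

lemma okker_ind: "okker (indicator {..<e})"
 unfolding okker_def
proof (intro conjI allI impI)
 fix R :: real
 have i: "integrable lborel2 (\<lambda>p. iball R (fst p)*iball (2*\<bar>R\<bar>) (fst p - snd p))"
  by (rule integrable_conv_iball[OF integrable_iball])
 show "integrable lborel2 (\<lambda>p. indicator {..<e} (norm (fst p - snd p))*(iball R (fst p)*iball R (snd p)) :: real)"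
 proof (rule Bochner_Integration.integrable_bound[OF i])
  show "AE p in lborel2. norm (indicator {..<e} (norm (fst p - snd p))*(iball R (fst p)*iball R (snd p)) :: real)
    <= norm (iball R (fst p)*iball (2*\<bar>R\<bar>) (fst p - snd p))"
  proof (rule AE_I2)
   fix p :: "(real^2) \<times> (real^2)"
   show "norm (indicator {..<e} (norm (fst p - snd p))*(iball R (fst p)*iball R (snd p)) :: real)
    <= norm (iball R (fst p)*iball (2*\<bar>R\<bar>) (fst p - snd p))"
    using norm_triangle_ineq4[of "fst p" "snd p"] by (auto simp: iball_def indicator_def)
  qed
 qed simp
qed (auto simp: indicator_def)

lemma Jker_integrable:
 assumes K: "okker K" and [measurable]: "h \<in> \<B>" and le: "\<And>x. \<bar>h x\<bar> <= C*iball R x"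
 shows "integrable lborel2 (\<lambda>p. K (norm (fst p - snd p))*(h (fst p)*h (snd p)))"
proof -
 have [measurable]: "K \<in> \<B>" using K by (simp add: okker_def)
 have i: "integrable lborel2 (\<lambda>p. C^2*(K (norm (fst p - snd p))*(iball R (fst p)*iball R (snd p))))"
  using K by (intro integrable_mult_right) (simp add: okker_def)
 show ?thesis
 proof (rule Bochner_Integration.integrable_bound[OF i])
  show "AE p in lborel2. norm (K (norm (fst p - snd p))*(h (fst p)*h (snd p)))
   <= norm (C^2*(K (norm (fst p - snd p))*(iball R (fst p)*iball R (snd p))))"
  proof (rule AE_I2)
   fix p :: "(real^2) \<times> (real^2)"
   have "\<bar>h (fst p)\<bar>*\<bar>h (snd p)\<bar> <= (C*iball R (fst p))*(C*iball R (snd p))"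
    using le[of "fst p"] le[of "snd p"] by (intro mult_mono) (auto intro: order_trans[OF abs_ge_zero])
   then have "\<bar>K (norm (fst p - snd p))\<bar>*(\<bar>h (fst p)\<bar>*\<bar>h (snd p)\<bar>) <= \<bar>K (norm (fst p - snd p))\<bar>*((C*iball R (fst p))*(C*iball R (snd p)))"
    by (rule mult_left_mono) simp
   moreover have "norm (C^2*(K (norm (fst p - snd p))*(iball R (fst p)*iball R (snd p))))
     = \<bar>K (norm (fst p - snd p))\<bar>*((C*iball R (fst p))*(C*iball R (snd p)))"
    by (simp add: abs_mult iball_nonneg) (simp add: power2_eq_square mult_ac)
   ultimately show "norm (K (norm (fst p - snd p))*(h (fst p)*h (snd p)))
   <= norm (C^2*(K (norm (fst p - snd p))*(iball R (fst p)*iball R (snd p))))"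
    by (simp only: real_norm_def abs_mult)
  qed
 qed simp
qed

lemma Jker_conv:
 assumes K: "okker K" and [measurable]: "\<And>n. h n \<in> \<B>" "h' \<in> \<B>"
  and le: "\<And>n x. \<bar>h n x\<bar> <= C*iball R x" and lim: "\<And>x. (\<lambda>n. h n x) ----> h' x"
 shows "(\<lambda>n. Jker K (h n)) ----> Jker K h'"
 unfolding Jker_def
proof (rule integral_dominated_convergence)
 have [measurable]: "K \<in> \<B>" using K by (simp add: okker_def)
 have i: "integrable lborel2 (\<lambda>p. C^2*(K (norm (fst p - snd p))*(iball R (fst p)*iball R (snd p))))"
  using K by (intro integrable_mult_right) (simp add: okker_def)
 then show "integrable lborel2 (\<lambda>p. \<bar>C\<^sup>2*(K (norm (fst p - snd p))*(iball R (fst p)*iball R (snd p)))\<bar>)"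
  by (rule integrable_abs)
 show "AE p in lborel2. (\<lambda>n. K (norm (fst p - snd p))*(h n (fst p)*h n (snd p))) ----> K (norm (fst p - snd p))*(h' (fst p)*h' (snd p))"
  by (intro AE_I2 tendsto_intros lim)
 show "AE p in lborel2. norm (K (norm (fst p - snd p))*(h n (fst p)*h n (snd p)))
   <= \<bar>C\<^sup>2*(K (norm (fst p - snd p))*(iball R (fst p)*iball R (snd p)))\<bar>" for n
 proof (rule AE_I2)
  fix p :: "(real^2) \<times> (real^2)"
  have "\<bar>h n (fst p)\<bar>*\<bar>h n (snd p)\<bar> <= (C*iball R (fst p))*(C*iball R (snd p))"
   using le[of n "fst p"] le[of n "snd p"] by (intro mult_mono) (auto intro: order_trans[OF abs_ge_zero])
  then have "\<bar>K (norm (fst p - snd p))\<bar>*(\<bar>h n (fst p)\<bar>*\<bar>h n (snd p)\<bar>) <= \<bar>K (norm (fst p - snd p))\<bar>*((C*iball R (fst p))*(C*iball R (snd p)))"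
   by (rule mult_left_mono) simp
  moreover have "\<bar>C\<^sup>2*(K (norm (fst p - snd p))*(iball R (fst p)*iball R (snd p)))\<bar>
    = \<bar>K (norm (fst p - snd p))\<bar>*((C*iball R (fst p))*(C*iball R (snd p)))"
   by (simp add: abs_mult iball_nonneg) (simp add: power2_eq_square mult_ac)
  ultimately show "norm (K (norm (fst p - snd p))*(h n (fst p)*h n (snd p)))
   <= \<bar>C\<^sup>2*(K (norm (fst p - snd p))*(iball R (fst p)*iball R (snd p)))\<bar>"
   by (simp only: real_norm_def abs_mult)
 qed
 show "(\<lambda>p. K (norm (fst p - snd p))*(h' (fst p)*h' (snd p))) \<in> borel_measurable lborel2"
  by measurable
 show "(\<lambda>p. K (norm (fst p - snd p))*(h n (fst p)*h n (snd p))) \<in> borel_measurable lborel2" for n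
  by measurable
qed

lemma pol_measurable: "norm n = 1 ==> w \<in> borel_measurable borel ==> pol n c w \<in> borel_measurable borel"
proof -
 assume [measurable]: "w \<in> \<B>" and "norm n = 1"
 note [measurable] = measurable_refl[OF \<open>norm n = 1\<close>, of c]
 show ?thesis unfolding pol_def[abs_def] by measurable
qed

lemma nice_pol:
 assumes n: "norm n = 1" and c: "c > 0" and w: "nice L R w" and L: "L >= 0"
 shows "nice L R (pol n c w)"
proof -
 have nn: "\<And>x. 0 <= w x" and li: "\<And>x y. \<bar>w x - w y\<bar> <= L*norm (x - y)" and su: "\<And>x. norm x > R ==> w x = 0"
  using w by (auto simp: nice_def)
 have "0 <= pol n c w x" for x using nn by (auto simp: pol_def le_max_iff_disj)
 then show ?thesis
  unfolding nice_def using pol_Lipschitz[OF n li L, of c] pol_support[OF n c, of R w] su nn by blast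
qed

text \<open>Defined by what polarization preserves or improves and not by sequences of
  polarizations, so that closedness under pointwise limits is immediate. At equal \<open>L^2\<close>
  norm, a larger indicator energy means a smaller nonlocal Dirichlet energy.\<close>

definition comp_class :: "real => real => (real^2 => real) => (real^2 => real) set" where
 "comp_class L R v = {w. nice L R w \<and> (LBINT z. (w z)^2) = (LBINT z. (v z)^2) \<and>
  (\<forall>e. Jker (indicator {..<e}) v <= Jker (indicator {..<e}) w) \<and>
  Jker (\<lambda>r. - ln r) (\<lambda>z. (v z)^2) <= Jker (\<lambda>r. - ln r) (\<lambda>z. (w z)^2)}"

text \<open>Minimising the second moment over a class stable under polarization forces radial monotonicity.\<close>

lemma symmetrize:
 assumes v: "nice L R v" and LR: "L >= 0" "R >= 0"
 obtains w where "w \<in> comp_class L R v" "\<And>x y. norm x = norm y ==> w x = w y"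
proof -
 define M where "M = L*(2*R + 1)"
 have M0: "M >= 0" using LR by (simp add: M_def)
 have bd: "\<bar>w x\<bar> <= M*iball R x" if "nice L R w" for w x
  using nice_bound[OF that LR] by (simp add: M_def iball_def)
 have bd2: "\<bar>(w x)\<^sup>2\<bar> <= M^2*iball R x" if "nice L R w" for w x
 proof -
  have "\<bar>w x\<bar>\<^sup>2 <= (M*iball R x)^2" using bd[OF that] by (intro power_mono) auto
  then show ?thesis by (cases "norm x <= R") (auto simp: power_mult_distrib iball_def)
 qed
 have bd3: "\<bar>(norm x)\<^sup>2*(w x)^2\<bar> <= (R^2*M^2)*iball R x" if "nice L R w" for w x
 proof (cases "norm x <= R")
  case True
  have "(norm x)^2*\<bar>(w x)\<^sup>2\<bar> <= R^2*(M^2*iball R x)"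
   using True bd2[OF that, of x] by (intro mult_mono power_mono) auto
  then show ?thesis by (simp add: abs_mult mult_ac)
 next
  case False
  then show ?thesis using that by (simp add: nice_def iball_def)
 qed
 define Phi where "Phi = (\<lambda>w::real^2 => real. LBINT z. (norm z)^2*(w z)^2)"
 have iPhi: "integrable lborel (\<lambda>z. (norm z)^2*(w z)^2)" if w: "nice L R w" for w
  using nice_measurable[OF w] bd3[OF w] by (intro integrable_iball_mult[where R = R]) auto
 have isq: "integrable lborel (\<lambda>z. (w z)^2)" if w: "nice L R w" for w
  using nice_measurable[OF w] bd2[OF w] by (intro integrable_iball_mult[where R = R]) auto
 define X where "X = Phi ` comp_class L R v"
 have vX: "v \<in> comp_class L R v" using v by (simp add: comp_class_def)
 have bdd: "bdd_below X" unfolding X_def Phi_def bdd_below_def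
  by (intro exI[of _ 0]) (auto intro!: integral_nonneg_AE)
 have "\<exists>w. w \<in> comp_class L R v \<and> Phi w < Inf X + 1/real (Suc n)" for n
  using cInf_lessD[of X "Inf X + 1/real (Suc n)"] vX unfolding X_def by auto
 then obtain ws where ws: "\<And>n. ws n \<in> comp_class L R v" "\<And>n. Phi (ws n) < Inf X + 1/real (Suc n)" by metis
 have wn: "nice L R (ws n)" for n using ws(1) by (simp add: comp_class_def)
 \<comment> \<open>The whole class shares one Lipschitz constant and one support radius, so
   Arzela-Ascoli yields a limit, and all integrals converge with a multiple of
   \<open>iball R\<close> as majorant.\<close>
 have "compact (cball (0::real^2) (R + 1))" by simp
 then obtain g k where g: "strict_mono (k :: nat => nat)"
  "\<And>e. 0 < e ==> \<exists>N. \<forall>n x. n >= N \<and> x \<in> cball 0 (R + 1) \<longrightarrow> norm (ws (k n) x - g x) < e"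
 proof (rule Arzela_Ascoli[where M = M and \<F> = ws])
  show "norm (ws n x) <= M" for n x
   using bd[OF wn, of n x] M0 by (cases "norm x <= R") (auto simp: iball_def)
  fix x :: "real^2" and e :: real assume e: "0 < e"
  show "\<exists>d>0. \<forall>n y. y \<in> cball 0 (R + 1) \<and> norm (x - y) < d \<longrightarrow> norm (ws n x - ws n y) < e"
  proof (intro exI[of _ "e/(L + 1)"] conjI allI impI)
   show "0 < e/(L + 1)" using e LR by simp
   fix n y assume "y \<in> cball 0 (R + 1) \<and> norm (x - y) < e/(L + 1)"
   then have "(L + 1)*norm (x - y) < e" using LR by (simp add: pos_less_divide_eq mult.commute)
   moreover have "\<bar>ws n x - ws n y\<bar> <= L*norm (x - y)" using wn[of n] by (simp add: nice_def)
   moreover have "L*norm (x - y) <= (L + 1)*norm (x - y)" by (intro mult_right_mono) auto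
   ultimately show "norm (ws n x - ws n y) < e" by simp
  qed
 qed auto
 define w where "w = (\<lambda>z. if norm z <= R + 1 then g z else 0)"
 have lim: "(\<lambda>n. ws (k n) x) ----> w x" for x
 proof (cases "norm x <= R + 1")
  case True
  show ?thesis
  proof (rule LIMSEQ_I)
   fix e :: real assume "0 < e"
   from g(2)[OF this] obtain N where N: "\<And>n x. n >= N ==> x \<in> cball 0 (R + 1) ==> norm (ws (k n) x - g x) < e" by blast
   show "\<exists>no. \<forall>n\<ge>no. norm (ws (k n) x - w x) < e"
    using N[of _ x] True by (intro exI[of _ N]) (auto simp: w_def)
  qed
 next
  case False
  then have "ws n x = 0" for n using wn[of n] by (simp add: nice_def)
  then show ?thesis using False by (simp add: w_def)
 qed
 have wnice: "nice L R w"
  unfolding nice_def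
 proof (intro conjI allI impI)
  show "0 <= w x" for x
   by (rule tendsto_lowerbound[OF lim]) (use wn in \<open>auto simp: nice_def\<close>)
  show "\<bar>w x - w y\<bar> <= L*norm (x - y)" for x y
   by (rule tendsto_upperbound[OF tendsto_rabs[OF tendsto_diff[OF lim lim]]]) (use wn in \<open>auto simp: nice_def\<close>)
  show "w x = 0" if "R < norm x" for x
  proof -
   have "(\<lambda>n. ws (k n) x) = (\<lambda>n. 0)" using wn that by (auto simp: nice_def)
   then show ?thesis using lim[of x] LIMSEQ_unique[of "\<lambda>n. 0::real" "w x" 0] by simp
  qed
 qed
 note [measurable] = nice_measurable[OF wn] nice_measurable[OF wnice]
 have lim2: "(\<lambda>n. (ws (k n) x)^2) ----> (w x)^2" for x by (intro tendsto_intros lim)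
 have dc: "(\<lambda>n. LBINT z. h n z) ----> (LBINT z. h' z)"
  if [measurable]: "\<And>n. h n \<in> \<B>" "h' \<in> \<B>"
   and "\<And>n x. \<bar>h n x\<bar> <= C*iball R x" "\<And>x. (\<lambda>n. h n x) ----> h' x" for h :: "nat => real^2 => real" and h' C
  by (rule integral_dominated_convergence[where w = "\<lambda>x. C*iball R x"])
   (use that in \<open>auto intro!: integrable_mult_right integrable_iball\<close>)
 have wcls: "w \<in> comp_class L R v"
  unfolding comp_class_def
 proof (intro CollectI conjI allI)
  show "nice L R w" by (rule wnice)
  have "(\<lambda>n. LBINT z. (ws (k n) z)^2) ----> (LBINT z. (w z)^2)"
   by (rule dc[where C = "M^2"]) (use bd2[OF wn] lim2 in auto)
  moreover have "(LBINT z. (ws (k n) z)^2) = (LBINT z. (v z)^2)" for n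
   using ws(1) by (simp add: comp_class_def)
  ultimately show "(LBINT z. (w z)^2) = (LBINT z. (v z)^2)"
   by (simp add: LIMSEQ_const_iff)
  show "Jker (indicator {..<e}) v <= Jker (indicator {..<e}) w" for e
  proof (rule tendsto_lowerbound)
   show "(\<lambda>n. Jker (indicator {..<e}) (ws (k n))) ----> Jker (indicator {..<e}) w"
    by (rule Jker_conv[OF okker_ind, where C = M and R = R]) (use bd[OF wn] lim in auto)
  qed (use ws(1) in \<open>auto simp: comp_class_def\<close>)
  show "Jker (\<lambda>r. - ln r) (\<lambda>z. (v z)^2) <= Jker (\<lambda>r. - ln r) (\<lambda>z. (w z)^2)"
  proof (rule tendsto_lowerbound)
   show "(\<lambda>n. Jker (\<lambda>r. - ln r) (\<lambda>z. (ws (k n) z)^2)) ----> Jker (\<lambda>r. - ln r) (\<lambda>z. (w z)^2)"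
    by (rule Jker_conv[OF okker_ln, where C = "M^2" and R = R]) (use bd2[OF wn] lim2 in auto)
  qed (use ws(1) in \<open>auto simp: comp_class_def\<close>)
 qed
 have Phile: "Phi w <= Inf X"
 proof (rule tendsto_le)
  show "(\<lambda>n. Phi (ws (k n))) ----> Phi w"
   unfolding Phi_def by (rule dc[where C = "R^2*M^2"]) (use bd3[OF wn] in \<open>auto intro!: tendsto_intros lim\<close>)
  have "(\<lambda>n. Inf X + 1/real (Suc n)) ----> Inf X + 0"
   by (intro tendsto_intros LIMSEQ_Suc[OF lim_const_over_n])
  from LIMSEQ_subseq_LIMSEQ[OF this g(1)]
  show "(\<lambda>n. Inf X + 1/real (Suc (k n))) ----> Inf X" by (simp add: o_def)
  show "\<forall>\<^sub>F n in sequentially. Phi (ws (k n)) <= Inf X + 1/real (Suc (k n))"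
   using ws(2) by (auto intro!: always_eventually less_imp_le)
 qed simp
 have key: "w y <= w x" if xy: "norm x < norm y" for x y
 proof -
  \<comment> \<open>\<open>n\<close> and \<open>c\<close> describe the perpendicular bisector of
    \<open>x\<close> and \<open>y\<close>, so the mirror image of \<open>x\<close> is
    \<open>y\<close>; since \<open>|x| < |y|\<close>, the origin lies on the side of
    \<open>x\<close>, that is \<open>c > 0\<close>.\<close>
  define n where "n = (1/norm (y - x)) *\<^sub>R (y - x)"
  define c where "c = ((norm y)^2 - (norm x)^2)/(2*norm (y - x))"
  have ne: "y \<noteq> x" using xy by auto
  then have d: "norm (y - x) > 0" by simp
  have n1: "norm n = 1" using ne by (simp add: n_def)
  have c: "c > 0" unfolding c_def using d xy by (auto intro!: divide_pos_pos simp: power_strict_mono)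
  have xn: "x \<bullet> n - c = - norm (y - x)/2"
  proof -
   have "x \<bullet> n = (x \<bullet> y - (norm x)^2)/norm (y - x)" by (simp add: n_def inner_diff_right power2_norm_eq_inner)
   then have "x \<bullet> n - c = (2*(x \<bullet> y - (norm x)^2) - ((norm y)^2 - (norm x)^2))/(2*norm (y - x))"
    using d by (simp add: c_def field_simps)
   also have "2*(x \<bullet> y - (norm x)^2) - ((norm y)^2 - (norm x)^2) = - (norm (y - x))\<^sup>2"
    unfolding power2_norm_eq_inner by (simp add: inner_diff_left inner_diff_right inner_commute)
   finally show ?thesis using d by (simp add: power2_eq_square)
  qed
  have mx: "mir n c x = y" unfolding mir_def xn using d by (simp add: n_def)
  have xH: "x \<bullet> n < c" using xn d by linarith
  define P where "P = pol n c w"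
  have Pn: "nice L R P" unfolding P_def by (rule nice_pol[OF n1 c wnice LR(1)])
  have w0: "\<And>z. w z >= 0" using wnice by (simp add: nice_def)
  have Psq: "(\<lambda>z. (P z)^2) = pol n c (\<lambda>z. (w z)^2)" unfolding P_def using pol_of_square[OF n1, of w c] w0 by auto
  note [measurable] = nice_measurable[OF Pn] measurable_refl[OF n1, of c]
  have Pcls: "P \<in> comp_class L R v"
   unfolding comp_class_def
  proof (intro CollectI conjI allI)
   show "nice L R P" by (rule Pn)
   have im: "integrable lborel (\<lambda>z. (u (mir n c z))^2)" "(LBINT z. (u (mir n c z))^2) = (LBINT z. (u z)^2)" if u: "nice L R u" for u
    using integrable_refl[OF n1, of "\<lambda>z. (u z)^2" c] integral_refl[OF n1, of "\<lambda>z. (u z)^2" c] nice_measurable[OF u] isq[OF u] by auto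
   have "2*(LBINT z. (P z)^2) = (LBINT z. (P z)^2 + (P (mir n c z))^2)"
    using isq[OF Pn] im[OF Pn] by simp
   also have "... = (LBINT z. (w z)^2 + (w (mir n c z))^2)"
    unfolding P_def using pol_sum_square[OF n1, of c w] by simp
   also have "... = 2*(LBINT z. (w z)^2)" using isq[OF wnice] im[OF wnice] by simp
   finally show "(LBINT z. (P z)^2) = (LBINT z. (v z)^2)"
    using wcls by (simp add: comp_class_def)
   show "Jker (indicator {..<e}) v <= Jker (indicator {..<e}) P" for e
   proof -
    have "Jker (indicator {..<e}) v <= Jker (indicator {..<e}) w" using wcls by (simp add: comp_class_def)
    also have "... <= Jker (indicator {..<e}) P"
     unfolding P_def
    proof (rule Jker_pol[OF n1])
     show "\<And>r s. 0 < r ==> r <= s ==> indicator {..<e} s <= (indicator {..<e} r :: real)" by (auto simp: indicator_def)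
    qed (use Jker_integrable[OF okker_ind _ bd[OF wnice]] Jker_integrable[OF okker_ind _ bd[OF Pn]] in \<open>auto simp: P_def[symmetric]\<close>)
    finally show ?thesis .
   qed
   have "Jker (\<lambda>r. - ln r) (\<lambda>z. (v z)^2) <= Jker (\<lambda>r. - ln r) (\<lambda>z. (w z)^2)" using wcls by (simp add: comp_class_def)
   also have "... <= Jker (\<lambda>r. - ln r) (pol n c (\<lambda>z. (w z)^2))"
   proof (rule Jker_pol[OF n1])
    show "\<And>r s. 0 < r ==> r <= s ==> - ln s <= - ln (r::real)" by simp
    show "integrable lborel2 (\<lambda>p. - ln (norm (fst p - snd p))*((w (fst p))^2*(w (snd p))^2))"
     by (rule Jker_integrable[OF okker_ln _ bd2[OF wnice]]) simp
    show "integrable lborel2 (\<lambda>p. - ln (norm (fst p - snd p))*(pol n c (\<lambda>z. (w z)^2) (fst p)*pol n c (\<lambda>z. (w z)^2) (snd p)))"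
     unfolding Psq[symmetric] by (rule Jker_integrable[OF okker_ln _ bd2[OF Pn]]) simp
   qed
   finally show "Jker (\<lambda>r. - ln r) (\<lambda>z. (v z)^2) <= Jker (\<lambda>r. - ln r) (\<lambda>z. (P z)^2)" by (simp add: Psq)
  qed
  then have "Phi w <= Phi P" using Phile cInf_lower[OF _ bdd, of "Phi P"] by (auto simp: X_def)
  \<comment> \<open>The symmetrised integrand of \<open>Phi w - Phi P\<close>. Its two factors
    always have the same sign, while minimality makes the integral nonpositive; by continuity
    \<open>h\<close> vanishes everywhere, in particular at \<open>x\<close>, so polarization changes
    nothing there.\<close>
  define h where "h = (\<lambda>z. ((norm z)^2 - (norm (mir n c z))^2)*((w z)^2 - (P z)^2))"
  have h0: "h z >= 0" for z
  proof (cases "z \<bullet> n < c")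
   case True
   then have "(norm z)^2 - (norm (mir n c z))^2 <= 0" unfolding norm_refl[OF n1] using c by simp
   moreover have "w z <= P z" using True by (simp add: P_def pol_def)
   then have "(w z)^2 - (P z)^2 <= 0" using w0 by (simp add: power_mono)
   ultimately show ?thesis unfolding h_def by (rule mult_nonpos_nonpos)
  next
   case False
   then have "(norm z)^2 - (norm (mir n c z))^2 >= 0" unfolding norm_refl[OF n1] using c by (simp add: mult_nonneg_nonpos)
   moreover have "P z <= w z" using False by (simp add: P_def pol_def)
   then have "(w z)^2 - (P z)^2 >= 0" using Pn by (simp add: power_mono nice_def)
   ultimately show ?thesis unfolding h_def by (rule mult_nonneg_nonneg)
  qed
  define r where "r = (\<lambda>z. (norm z)^2*((w z)^2 - (P z)^2))"
  have ir: "integrable lborel r"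
   unfolding r_def right_diff_distrib using iPhi[OF wnice] iPhi[OF Pn] by simp
  have [measurable]: "r \<in> \<B>" unfolding r_def by simp
  have Ir: "(LBINT z. r z) = Phi w - Phi P"
   unfolding r_def right_diff_distrib Phi_def using iPhi[OF wnice] iPhi[OF Pn] by simp
  have hr: "h z = r z + r (mir n c z)" for z
  proof -
   have eq: "(w (mir n c z))^2 - (P (mir n c z))^2 = - ((w z)^2 - (P z)^2)"
    unfolding P_def using pol_sum_square[OF n1, of c w z] by simp
   show ?thesis unfolding h_def r_def eq by (simp add: algebra_simps)
  qed
  have irm: "integrable lborel (\<lambda>z. r (mir n c z))" using integrable_refl[OF n1, of r c] ir by simp
  have ih: "integrable lborel h" unfolding hr[abs_def] using ir irm by simp
  have "(LBINT z. h z) = 2*(Phi w - Phi P)"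
   unfolding hr using ir irm integral_refl[OF n1, of r c] Ir by simp
  then have "(LBINT z. h z) <= 0" using \<open>Phi w \<le> Phi P\<close> by simp
  moreover have "(LBINT z. h z) >= 0" using h0 by (intro integral_nonneg_AE) simp
  ultimately have "(LBINT z. h z) = 0" by simp
  then have AE0: "AE z in lborel. h z = 0" using integral_nonneg_eq_0_iff_AE[OF ih] h0 by simp
  have hc: "continuous_on UNIV h"
   unfolding h_def by (intro continuous_intros nice_cont[OF wnice] nice_cont[OF Pn] continuous_refl[OF n1])
  have "h x = 0"
  proof (rule ccontr)
   assume "h x \<noteq> 0"
   have op: "open {z. h z \<noteq> 0}" using hc by (intro open_Collect_neq continuous_on_const)
   have "emeasure lborel {z. h z \<noteq> 0} = 0"
    using AE0 op by (subst (asm) AE_iff_measurable[where N = "{z. h z \<noteq> 0}"]) auto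
   moreover obtain e where e: "e > 0" "ball x e \<subseteq> {z. h z \<noteq> 0}"
    using op \<open>h x \<noteq> 0\<close> unfolding open_contains_ball by blast
   moreover have "emeasure lborel (ball x e) <= emeasure lborel {z. h z \<noteq> 0}"
    using e op by (intro emeasure_mono) auto
   moreover have "emeasure lborel (ball x e) > 0"
    using e by (subst emeasure_ball) (auto simp: ennreal_zero_less_mult_iff)
   ultimately show False by simp
  qed
  moreover have "(norm x)^2 - (norm (mir n c x))^2 \<noteq> 0" unfolding mx using xy by (simp add: power2_eq_iff_nonneg)
  ultimately have "(w x)^2 = (P x)^2" unfolding h_def by simp
  then have "w x = P x" using w0 Pn by (simp add: power2_eq_iff_nonneg nice_def)
  then show ?thesis using xH mx by (simp add: P_def pol_def)
 qed
 \<comment> \<open>The points \<open>(1 + d) y\<close> with \<open>d > 0\<close> lie strictly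
   outside the circle, so \<open>key\<close> compares them with \<open>x\<close>; then
   \<open>d\<close> tends to 0.\<close>
 have le: "w y <= w x" if xy: "norm x = norm y" for x y
 proof (cases "y = 0")
  case True
  then show ?thesis using xy by simp
 next
  case False
  have "((\<lambda>d. w ((1 + d) *\<^sub>R y)) ---> w ((1 + 0) *\<^sub>R y)) (at_right 0)"
   by (intro isCont_tendsto_compose[of _ w] tendsto_intros)
    (use nice_cont[OF wnice] in \<open>simp add: continuous_on_eq_continuous_at\<close>)
  then have lim: "((\<lambda>d. w ((1 + d) *\<^sub>R y)) ---> w y) (at_right 0)" by simp
  have "w ((1 + d) *\<^sub>R y) <= w x" if "d > 0" for d
   using False that xy by (intro key) (simp add: distrib_right)
  then have "\<forall>\<^sub>F d in at_right 0. w ((1 + d) *\<^sub>R y) <= w x"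
   by (simp add: eventually_at_right_less eventually_at_filter)
  then show ?thesis using lim by (intro tendsto_upperbound) auto
 qed
 show ?thesis
 proof (rule that[OF wcls])
  show "w x = w y" if "norm x = norm y" for x y using le[of x y] le[of y x] that by simp
 qed
qed

section \<open>Reduction to radial profiles\<close>

definition cx :: "real^2 => complex" where "cx x = Complex (x $ 1) (x $ 2)"

definition rot :: "real => real^2 => real^2" where
 "rot s x = (\<chi> i. if i = 1 then cos (2*pi * s)*x $ 1 - sin (2*pi * s)*x $ 2
          else sin (2*pi * s)*x $ 1 + cos (2*pi * s)*x $ 2)"

lemma norm_cx: "norm (cx x) = norm x"
 by (simp add: cx_def cmod_def norm_vec_def L2_set_def sum_2)

lemma cx_diff: "cx (x - y) = cx x - cx y"
 by (simp add: cx_def complex_eq_iff)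

lemma cx_rot: "cx (rot s x) = cis (2*pi * s)*cx x"
 by (simp add: cx_def rot_def complex_eq_iff)

lemma orthogonal_rot: "orthogonal_transformation (rot s)"
proof -
 have "linear (rot s)"
  by (rule linearI) (simp_all add: rot_def vec_eq_iff algebra_simps)
 moreover have "norm (rot s x) = norm x" for x
  using norm_cx[of "rot s x"] norm_cx[of x] by (simp add: cx_rot norm_mult)
 ultimately show ?thesis by (simp add: orthogonal_transformation)
qed

lemma norm_rot: "norm (rot s x) = norm x"
 using norm_cx[of "rot s x"] norm_cx[of x] by (simp add: cx_rot norm_mult)

lemma continuous_rot: "continuous_on UNIV (\<lambda>p. rot (fst p) (snd p))"
 unfolding rot_def
proof (rule continuous_on_vec_lambda)
 fix i :: 2
 show "continuous_on UNIV (\<lambda>p::real \<times> (real^2). if i = 1 then cos (2*pi*fst p) * snd p $ 1 - sin (2*pi*fst p) * snd p $ 2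
          else sin (2*pi*fst p) * snd p $ 1 + cos (2*pi*fst p) * snd p $ 2)"
  by (cases "i = 1") (auto intro!: continuous_intros)
qed

text \<open>The integrand is the real part of \<open>Ln (1 - q z)\<close>, holomorphic near the
  closed unit disc because \<open>|q| < 1\<close>; Cauchy's formula gives its mean over the unit
  circle as the value 0 at the centre.\<close>

lemma circle_mean_unit:
 assumes q: "cmod q < 1"
 shows "((\<lambda>s. ln (cmod (1 - q*cis (2*pi * s)))) has_integral 0) {0..1}"
proof -
 have Re_pos: "1 - q*z \<notin> \<real>\<^sub>\<le>\<^sub>0" if "z \<in> cball 0 1" for z
 proof -
  have "cmod (q*z) < 1"
   using that q by (simp add: norm_mult) (metis mult_left_le mult.commute norm_ge_zero order_le_less_trans)
  then have "Re (q*z) < 1" using complex_Re_le_cmod[of "q*z"] by linarith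
  then show ?thesis by (auto simp: complex_nonpos_Reals_iff)
 qed
 have hol: "(\<lambda>z. Ln (1 - q*z)) holomorphic_on cball 0 1"
  by (intro holomorphic_intros Re_pos) auto
 have "((\<lambda>u. Ln (1 - q*u)/(u - 0)) has_contour_integral (2 * of_real pi*\<i>*Ln (1 - q*0))) (circlepath 0 1)"
  by (rule Cauchy_integral_circlepath_simple[OF hol]) simp
 then have "((\<lambda>u. Ln (1 - q*u)/u) has_contour_integral 0) (circlepath 0 1)" by simp
 then have "((\<lambda>x. Ln (1 - q*exp (2 * of_real pi*\<i> * of_real x))/exp (2 * of_real pi*\<i> * of_real x)
   * (2 * of_real pi*\<i>*exp (2 * of_real pi*\<i> * of_real x))) has_integral 0) {0..1}"
  unfolding has_contour_integral
  by (rule has_integral_eq[rotated]) (subst vector_derivative_circlepath, simp add: circlepath)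
 then have "((\<lambda>x. (2 * of_real pi*\<i>)*Ln (1 - q*cis (2*pi*x))) has_integral 0) {0..1}"
  by (rule has_integral_eq[rotated]) (simp add: cis_conv_exp mult_ac)
 then have "((\<lambda>x. (1/(2 * of_real pi*\<i>))*((2 * of_real pi*\<i>)*Ln (1 - q*cis (2*pi*x)))) has_integral (1/(2 * of_real pi*\<i>))*0) {0..1}"
  by (rule has_integral_mult_right)
 then have "((\<lambda>x. Ln (1 - q*cis (2*pi*x))) has_integral 0) {0..1}" by simp
 then have "((\<lambda>x. Re (Ln (1 - q*cis (2*pi*x)))) has_integral Re 0) {0..1}"
  by (rule has_integral_Re)
 then have "((\<lambda>x. Re (Ln (1 - q*cis (2*pi*x)))) has_integral 0) {0..1}" by simp
 then show ?thesis
 proof (rule has_integral_eq[rotated])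
  fix x :: real assume "x \<in> {0..1}"
  have "1 - q*cis (2*pi*x) \<noteq> 0" using Re_pos[of "cis (2*pi*x)"] by auto
  then show "Re (Ln (1 - q*cis (2*pi*x))) = ln (cmod (1 - q*cis (2*pi*x)))" by (simp add: Re_Ln)
 qed
qed

text \<open>The larger of the two moduli is factored out, and what remains has mean 0.\<close>

lemma circle_mean:
 assumes x: "x \<noteq> 0" and y: "y \<noteq> 0" and ne: "norm x \<noteq> norm y"
 shows "(LBINT s. indicator {0..1} s*ln (norm (rot s x - y))) = max (ln (norm x)) (ln (norm y))"
proof -
 define X Y where "X = cx x" and "Y = cx y"
 have XY: "cmod X = norm x" "cmod Y = norm y" by (simp_all add: X_def Y_def norm_cx)
 have X0: "X \<noteq> 0" "Y \<noteq> 0" using x y XY by auto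
 have nrm: "norm (rot s x - y) = cmod (cis (2*pi * s)*X - Y)" for s
  using norm_cx[of "rot s x - y"] by (simp add: cx_diff cx_rot X_def Y_def)
 have nz: "norm (rot s x - y) \<noteq> 0" for s
 proof
  assume "norm (rot s x - y) = 0"
  then have "norm (rot s x) = norm y" by simp
  then show False using ne by (simp add: norm_rot)
 qed
 have hi: "((\<lambda>s. ln (norm (rot s x - y))) has_integral max (ln (norm x)) (ln (norm y))) {0..1}"
 proof (cases "norm y < norm x")
  case True
  \<comment> \<open>Factoring out the rotated point leaves the inverse rotation on
    \<open>Y / X\<close>; conjugation turns it into a forward rotation and keeps the
    modulus.\<close>
  define q where "q = cnj (Y/X)"
  have q: "cmod q < 1" using True x by (simp add: q_def norm_divide XY divide_less_eq_1)
  have "cmod (cis (2*pi * s)*X - Y) = norm x*cmod (1 - q*cis (2*pi * s))" for s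
  proof -
   have "cis (2*pi * s)*X - Y = cis (2*pi * s)*X*(1 - Y/X*cis (- (2*pi * s)))"
    using X0 by (simp add: algebra_simps cis_mult)
   then have "cmod (cis (2*pi * s)*X - Y) = norm x*cmod (1 - Y/X*cis (- (2*pi * s)))"
    by (simp add: norm_mult XY)
   also have "cmod (1 - Y/X*cis (- (2*pi * s))) = cmod (cnj (1 - Y/X*cis (- (2*pi * s))))" by (simp only: complex_mod_cnj)
   also have "cnj (1 - Y/X*cis (- (2*pi * s))) = 1 - q*cis (2*pi * s)" by (simp add: q_def cis_cnj)
   finally show ?thesis .
  qed
  then have "ln (norm (rot s x - y)) = ln (norm x) + ln (cmod (1 - q*cis (2*pi * s)))" for s
   using nz[of s] x unfolding nrm by (subst ln_mult_pos[symmetric]) (auto simp: zero_less_mult_iff)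
  moreover have "((\<lambda>s. ln (norm x) + ln (cmod (1 - q*cis (2*pi * s)))) has_integral (ln (norm x) + 0)) {0..1}"
   using has_integral_const_real[of "ln (norm x)" 0 1] circle_mean_unit[OF q] by (intro has_integral_add) auto
  moreover have "ln (norm y) <= ln (norm x)" using True y x by (subst ln_le_cancel_iff) auto
  ultimately show ?thesis by (simp add: max_def)
 next
  case False
  then have lt: "norm x < norm y" using ne by simp
  define q where "q = X/Y"
  have q: "cmod q < 1" using lt y by (simp add: q_def norm_divide XY divide_less_eq_1)
  have "cmod (cis (2*pi * s)*X - Y) = norm y*cmod (1 - q*cis (2*pi * s))" for s
  proof -
   have "cis (2*pi * s)*X - Y = - (Y*(1 - q*cis (2*pi * s)))" using X0 by (simp add: q_def algebra_simps)
   then show ?thesis by (simp add: norm_mult XY)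
  qed
  then have "ln (norm (rot s x - y)) = ln (norm y) + ln (cmod (1 - q*cis (2*pi * s)))" for s
   using nz[of s] y unfolding nrm by (subst ln_mult_pos[symmetric]) (auto simp: zero_less_mult_iff)
  moreover have "((\<lambda>s. ln (norm y) + ln (cmod (1 - q*cis (2*pi * s)))) has_integral (ln (norm y) + 0)) {0..1}"
   using has_integral_const_real[of "ln (norm y)" 0 1] circle_mean_unit[OF q] by (intro has_integral_add) auto
  moreover have "ln (norm x) <= ln (norm y)" using lt y x by (subst ln_le_cancel_iff) auto
  ultimately show ?thesis by (simp add: max_def)
 qed
 have rc: "continuous_on UNIV (\<lambda>s. rot s x)"
 proof -
  have "continuous_on UNIV (\<lambda>s::real. (s, x))" by (intro continuous_intros)
  from continuous_on_compose2[OF continuous_rot this] show ?thesis by simp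
 qed
 have c: "continuous_on {0..1} (\<lambda>s. ln (norm (rot s x - y)))"
  using nz by (intro continuous_intros continuous_on_subset[OF rc]) auto
 have "(LBINT s. indicator {0..1} s*ln (norm (rot s x - y))) = (LINT s:{0..1}|lborel. ln (norm (rot s x - y)))"
  by (simp add: set_lebesgue_integral_def)
 also have "... = integral {0..1} (\<lambda>s. ln (norm (rot s x - y)))"
  by (rule set_borel_integral_eq_integral(2)[OF borel_integrable_atLeastAtMost'[OF c]])
 also have "... = max (ln (norm x)) (ln (norm y))" by (rule integral_unique[OF hi])
 finally show ?thesis .
qed

lemma measurable_rot [measurable]: "(\<lambda>p. rot (fst p) (snd p)) \<in> borel_measurable (borel \<Otimes>\<^sub>M borel)"
 using borel_measurable_continuous_onI[OF continuous_rot] by (simp add: borel_prod)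

lemma AE_norm_neq: "AE x in lborel. norm (x::real^2) \<noteq> r"
proof -
 have "sphere (0::real^2) r \<in> null_sets lborel"
  using negligible_sphere[of "0::real^2" r] by (simp add: negligible_iff_null_sets null_sets_completion_iff)
 then have "AE x in lborel. x \<notin> sphere (0::real^2) r" by (rule AE_not_in)
 then show ?thesis by eventually_elim simp
qed

text \<open>The integral against a radial density is unchanged when \<open>x\<close> is rotated;
  averaging over all rotations and exchanging integrals replaces the kernel by its mean over
  circles. The circle \<open>|x| = |y|\<close>, not covered by \<open>circle_mean\<close>, is a null
  set.\<close>

lemma Newton:
 assumes r: "r \<in> \<B>" and le: "\<And>x. \<bar>r x\<bar> <= C*iball R x"
  and rad: "\<And>x y. norm x = norm y ==> r x = r y" and y: "y \<noteq> 0"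
 shows "(LBINT x. ln (norm (x - y))*r x) = (LBINT x. max (ln (norm x)) (ln (norm y))*r x)"
proof -
 note [measurable] = r
 define g where "g = (\<lambda>x. ln (norm (x - y))*r x)"
 have gm [measurable]: "g \<in> \<B>" unfolding g_def by measurable
 have ig: "integrable lborel g"
 proof -
  let ?A = "ln (\<bar>R\<bar> + norm y)"
  have "integrable lborel (\<lambda>x. C*(\<lambda>z::real^2. indicator {..?A} (ln (norm z))*\<bar>ln (norm z)\<bar>) (- y + x))"
  proof (rule integrable_mult_right)
   let ?k = "\<lambda>z::real^2. indicator {..?A} (ln (norm z))*\<bar>ln (norm z)\<bar> :: real"
   have [measurable]: "?k \<in> \<B>" by measurable
   have "integrable (distr lborel borel ((+) (- y))) ?k"
    unfolding lborel_distr_plus by (rule integrable_log_kernel)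
   then show "integrable lborel (\<lambda>x. ?k (- y + x))" by (subst (asm) integrable_distr_eq) auto
  qed
  then show ?thesis
  proof (rule Bochner_Integration.integrable_bound)
   show "AE x in lborel. norm (g x) <= norm (C*(\<lambda>z::real^2. indicator {..?A} (ln (norm z))*\<bar>ln (norm z)\<bar>) (- y + x))"
   proof (rule AE_I2)
    fix x :: "real^2"
    show "norm (g x) <= norm (C*(\<lambda>z::real^2. indicator {..?A} (ln (norm z))*\<bar>ln (norm z)\<bar>) (- y + x))"
    proof (cases "norm x <= R \<and> x \<noteq> y")
     case True
     then have "norm (x - y) <= \<bar>R\<bar> + norm y" using norm_triangle_ineq4[of x y] by linarith
     moreover have "norm (x - y) > 0" using True by simp
     ultimately have "ln (norm (x - y)) <= ?A" by (subst ln_le_cancel_iff) linarith+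
     moreover have "\<bar>r x\<bar> <= \<bar>C\<bar>" using le[of x] True by (simp add: iball_def)
     ultimately show ?thesis
      using mult_right_mono[of "\<bar>r x\<bar>" "\<bar>C\<bar>" "\<bar>ln (norm (x - y))\<bar>"] by (simp add: g_def abs_mult mult.commute)
    next
     case False
     then have "g x = 0" using le[of x] by (auto simp: g_def iball_def)
     then show ?thesis by simp
    qed
   qed
  qed simp
 qed
 define G where "G = (\<lambda>p::real \<times> (real^2). indicator {0..1} (fst p)*(ln (norm (rot (fst p) (snd p) - y))*r (snd p)) :: real)"
 have Gm [measurable]: "G \<in> borel_measurable lborel2" unfolding G_def by measurable
 have Grot: "G (s, x) = indicator {0..1} s*g (rot s x)" for s x
  using rad[of "rot s x" x] by (simp add: G_def g_def norm_rot)
 have rm: "rot s \<in> \<B>" for s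
  using measurable_Pair2[OF measurable_rot, of s] by simp
 have inv: "integrable lborel (\<lambda>x. g (rot s x))" "(LBINT x. g (rot s x)) = (LBINT x. g x)"
  "(LBINT x. norm (g (rot s x))) = (LBINT x. norm (g x))" for s
 proof -
  note d = orthogonal_distr_lborel[OF orthogonal_rot[of s]]
  note [measurable] = rm[of s]
  show "integrable lborel (\<lambda>x. g (rot s x))"
   using integrable_distr_eq[of "rot s" lborel borel g] ig by (simp add: d)
  show "(LBINT x. g (rot s x)) = (LBINT x. g x)"
   using integral_distr[of "rot s" lborel borel g] by (simp add: d)
  show "(LBINT x. norm (g (rot s x))) = (LBINT x. norm (g x))"
   using integral_distr[of "rot s" lborel borel "\<lambda>x. norm (g x)"] by (simp add: d)
 qed
 have i01: "integrable lborel (\<lambda>s::real. indicator {0..1} s*c :: real)" for c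
  by (intro integrable_mult_left integrable_real_indicator) (auto simp: emeasure_lborel_Icc_eq)
 have iG: "integrable lborel2 G"
 proof (rule lborel_pair.Fubini_integrable[OF Gm])
  have "(LBINT x. norm (G (s, x))) = indicator {0..1} s*(LBINT x. norm (g x))" for s
   using inv(3)[of s] by (simp add: Grot abs_mult)
  then show "integrable lborel (\<lambda>s. LBINT x. norm (G (s, x)))" using i01 by simp
  show "AE s in lborel. integrable lborel (\<lambda>x. G (s, x))" using inv(1) by (simp add: Grot)
 qed
 have "(LBINT x. g x) = (LBINT s. indicator {0..1::real} s*(LBINT x. g x))"
  by simp
 also have "... = (LBINT s. LBINT x. G (s, x))"
  using inv(2) by (simp add: Grot)
 also have "... = (LBINT x. LBINT s. G (s, x))"
  using lborel_pair.Fubini_integral[of "\<lambda>s x. G (s, x)"] iG by simp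
 also have "... = (LBINT x. max (ln (norm x)) (ln (norm y))*r x)"
 proof (rule integral_cong_AE)
  show "(\<lambda>x. LBINT s. G (s, x)) \<in> borel_measurable lborel"
   using lborel_pair.integrable_snd[of "\<lambda>s x. G (s, x)"] iG by (simp add: borel_measurable_integrable)
  show "(\<lambda>x. max (ln (norm x)) (ln (norm y))*r x) \<in> borel_measurable lborel" by measurable
  show "AE x in lborel. (LBINT s. G (s, x)) = max (ln (norm x)) (ln (norm y))*r x"
   using AE_norm_neq[of "norm y"] AE_nonzero
  proof eventually_elim
   case (elim x)
   have "(LBINT s. G (s, x)) = (LBINT s. (indicator {0..1} s*ln (norm (rot s x - y)))*r x)"
    by (simp add: G_def mult_ac)
   also have "... = (LBINT s. indicator {0..1} s*ln (norm (rot s x - y)))*r x"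
    by simp
   also have "... = max (ln (norm x)) (ln (norm y))*r x"
    using circle_mean[OF elim(2) y elim(1)] by simp
   finally show ?case .
  qed
 qed
 finally show ?thesis unfolding g_def .
qed

section \<open>The logarithmic profile of a radial function\<close>

definition unit1 :: "real^2" where "unit1 = axis 1 1"

definition prof :: "(real^2 => real) => real => real" where
 "prof w t = w (exp t *\<^sub>R unit1)"

lemma norm_unit1: "norm unit1 = 1" by (simp add: unit1_def norm_axis_1)

context
 fixes L R :: real and w :: "real^2 => real"
 assumes w: "nice L R w" and LR: "L >= 0" "R >= 0" and radial: "\<And>x y. norm x = norm y ==> w x = w y"
begin

lemma prof_cont: "continuous_on UNIV (prof w)"
 unfolding prof_def[abs_def]
 by (intro continuous_on_compose2[OF nice_cont[OF w]] continuous_intros) auto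

lemma prof_eq: "x \<noteq> 0 ==> w x = prof w (ln (norm x))"
 unfolding prof_def by (rule radial) (simp add: norm_unit1)

lemma prof_measurable [measurable]: "prof w \<in> \<B>"
 by (rule borel_measurable_continuous_onI[OF prof_cont])

lemma prof_wint: "wint (dens (prof w))"
 unfolding wint_def
proof
 show [measurable]: "dens (prof w) \<in> \<B>" by (rule dens_measurable[OF prof_cont])
 define M where "M = L*(2*R + 1)"
 define A where "A = ln (R + 1)"
 have i: "integrable lborel (\<lambda>t. M^2*(indicator {..A} t*dom t))"
  by (intro integrable_mult_right dom_integrable)
 show "integrable lborel (\<lambda>t. (1 + \<bar>t\<bar>)*dens (prof w) t)"
 proof (rule Bochner_Integration.integrable_bound[OF i])
  show "AE t in lborel. norm ((1 + \<bar>t\<bar>)*dens (prof w) t) <= norm (M^2*(indicator {..A} t*dom t))"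
  proof (rule AE_I2)
   fix t
   show "norm ((1 + \<bar>t\<bar>)*dens (prof w) t) <= norm (M^2*(indicator {..A} t*dom t))"
   proof (cases "t <= A")
    case True
    have "\<bar>w (exp t *\<^sub>R unit1)\<bar> <= M*indicator (cball 0 R) (exp t *\<^sub>R unit1)"
     using nice_bound[OF w LR] unfolding M_def .
    also have "... <= M" using LR by (simp add: M_def indicator_def)
    finally have "\<bar>prof w t\<bar>\<^sup>2 <= M^2" unfolding prof_def by (intro power_mono) auto
    then have "(1 + \<bar>t\<bar>)*((prof w t)^2*exp (2*t)) <= (1 + \<bar>t\<bar>)*(M^2*exp (2*t))"
     by (intro mult_left_mono mult_right_mono) auto
    also have "... <= M^2*dom t"
    proof -
     have "M^2*((1 + \<bar>t\<bar>)*(1*exp (2*t))) <= M^2*((1 + \<bar>t\<bar>)*((8 + 2*\<bar>t\<bar>)*exp (2*t)))"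
      by (intro mult_left_mono mult_right_mono) auto
     then show ?thesis by (simp add: dom_def mult_ac)
    qed
    finally have *: "(1 + \<bar>t\<bar>)*dens (prof w) t <= M^2*dom t" by (simp add: dens_def)
    have "0 <= (1 + \<bar>t\<bar>)*dens (prof w) t" by (simp add: dens_nonneg)
    with * True show ?thesis by simp
   next
    case False
    have Rp: "R + 1 > 0" using LR by simp
    have "R + 1 < exp t" using False Rp unfolding A_def by (metis exp_le_cancel_iff exp_ln not_le)
    then have "R < exp t" by simp
    then have "prof w t = 0" using w unfolding prof_def nice_def by (simp add: norm_unit1)
    then show ?thesis by (simp add: dens_def)
   qed
  qed
 qed simp
qed

lemma prof_mass: "(LBINT x. (w x)^2) = 2*pi*mass (prof w)"
proof -
 note [measurable] = nice_measurable[OF w]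
 have "(LBINT x. (w x)^2) = (LBINT x. (prof w (ln (norm (x::real^2))))^2)"
 proof (rule integral_cong_AE)
  show "AE x in lborel. (w x)^2 = (prof w (ln (norm x)))^2"
   using AE_nonzero by eventually_elim (simp add: prof_eq)
 qed auto
 also have "... = 2*pi*(LBINT t. (prof w t)^2*exp (2*t))"
  by (rule integral_radial) simp
 finally show ?thesis by (simp add: mass_def dens_def)
qed

text \<open>Newton's theorem in the inner variable, then polar coordinates in both; each angular
  integration contributes a factor \<open>2 * pi\<close>.\<close>

lemma prof_log: "Jker (\<lambda>r. - ln r) (\<lambda>z. (w z)^2) = - (2*pi)\<^sup>2*BB (dens (prof w)) (dens (prof w))"
proof -
 note [measurable] = nice_measurable[OF w]
 define M where "M = L*(2*R + 1)"
 have bd: "\<bar>(w x)\<^sup>2\<bar> <= M^2*iball R x" for x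
 proof -
  have "\<bar>w x\<bar>\<^sup>2 <= (M*iball R x)^2"
   using nice_bound[OF w LR, of x] by (intro power_mono) (auto simp: M_def iball_def)
  then show ?thesis by (cases "norm x <= R") (auto simp: power_mult_distrib iball_def)
 qed
 have i: "integrable lborel2 (\<lambda>p. - ln (norm (fst p - snd p))*((w (fst p))^2*(w (snd p))^2))"
  by (rule Jker_integrable[OF okker_ln _ bd]) simp
 have P: "(LBINT x. ln (norm (x - y))*(w x)^2) = 2*pi*pot (dens (prof w)) (ln (norm y))" if y: "y \<noteq> 0" for y
 proof -
  have "(LBINT x. ln (norm (x - y))*(w x)^2) = (LBINT x. max (ln (norm x)) (ln (norm y))*(w x)^2)"
  proof (rule Newton[OF _ bd _ y])
   show "(w a)^2 = (w b)^2" if "norm a = norm b" for a b using radial[OF that] by simp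
  qed simp
  also have "... = (LBINT x. max (ln (norm (x::real^2))) (ln (norm y))*(prof w (ln (norm x)))^2)"
  proof (rule integral_cong_AE)
   show "AE x in lborel. max (ln (norm x)) (ln (norm y))*(w x)^2 = max (ln (norm x)) (ln (norm y))*(prof w (ln (norm x)))^2"
    using AE_nonzero by eventually_elim (simp add: prof_eq)
  qed auto
  also have "... = 2*pi*(LBINT t. max t (ln (norm y))*(prof w t)^2*exp (2*t))"
   by (rule integral_radial[of "\<lambda>t. max t (ln (norm y))*(prof w t)^2"]) simp
  finally show ?thesis by (simp add: pot_def dens_def mult_ac)
 qed
 have potm [measurable]: "pot (dens (prof w)) \<in> \<B>"
  unfolding pot_def[abs_def] using dens_measurable[OF prof_cont] by measurable
 have "Jker (\<lambda>r. - ln r) (\<lambda>z. (w z)^2) = (LBINT y. LBINT x. - ln (norm (x - y))*((w x)^2*(w y)^2))"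
  unfolding Jker_def using lborel_pair.integral_snd[of "\<lambda>x y. - ln (norm (x - y))*((w x)^2*(w y)^2)"] i
  by (simp add: case_prod_beta')
 also have "... = (LBINT y. - (2*pi*pot (dens (prof w)) (ln (norm y)))*(prof w (ln (norm (y::real^2))))^2)"
 proof (rule integral_cong_AE)
  show "AE y in lborel. (LBINT x. - ln (norm (x - y))*((w x)^2*(w y)^2))
    = - (2*pi*pot (dens (prof w)) (ln (norm y)))*(prof w (ln (norm y)))^2"
   using AE_nonzero
  proof eventually_elim
   case (elim y)
   have "(LBINT x. - ln (norm (x - y))*((w x)^2*(w y)^2)) = (LBINT x. (ln (norm (x - y))*(w x)^2)*(- (w y)\<^sup>2))"
    by (intro Bochner_Integration.integral_cong) auto
   also have "... = (LBINT x. ln (norm (x - y))*(w x)^2)*(- (w y)\<^sup>2)" by (rule integral_mult_left_zero)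
   finally show ?case using P[OF elim] prof_eq[OF elim] by simp
  qed
 qed auto
 also have "... = 2*pi*(LBINT t. - (2*pi*pot (dens (prof w)) t)*(prof w t)^2*exp (2*t))"
  by (rule integral_radial[of "\<lambda>t. - (2*pi*pot (dens (prof w)) t)*(prof w t)^2"]) simp
 also have "(LBINT t. - (2*pi*pot (dens (prof w)) t)*(prof w t)^2*exp (2*t)) = (LBINT t. - (2*pi)*(pot (dens (prof w)) t*dens (prof w) t))"
  by (intro Bochner_Integration.integral_cong) (auto simp: dens_def)
 also have "... = - (2*pi)*BB (dens (prof w)) (dens (prof w))"
  unfolding BB_pot(1)[OF prof_wint prof_wint] by (rule integral_mult_right_zero)
 finally show ?thesis by (simp add: power2_eq_square)
qed

end

text \<open>A substitute for the Dirichlet energy (up to the factor \<open>c1 e^4\<close>, as \<open>e\<close> tends to 0) which is monotone under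
 polarization.\<close>

definition EE :: "real => (real^2 => 'a::real_normed_vector) => ennreal" where
 "EE e w = (NN x. NN y. ennreal (indicator {..<e} (norm (x - y))*(norm (w x - w y))^2))"

text \<open>The second moment of the unit disc in one coordinate, equal to \<open>pi / 4\<close>. It
  cancels between the upper bound \<open>mol_EE\<close> and the lower bound inside
  \<open>prof_Dir_le\<close>, so only its sign is established.\<close>

definition c1 :: real where
 "c1 = (LBINT k. indicator (ball 0 1) (k :: real^2)*(k $ 1)^2)"

lemma nn_integral_affine2:
 fixes F :: "real^2 => ennreal"
 assumes [measurable]: "F \<in> \<B>" and a: "a > 0"
 shows "(NN y. F y) = ennreal (a^2)*(NN k. F (t + a *\<^sub>R k))"
proof -
 have "(NN y. F y) = (\<integral>\<^sup>+y. F y \<partial>density (distr lborel borel (\<lambda>x. t + a *\<^sub>R x)) (\<lambda>_. ennreal (\<bar>a\<bar>^DIM(real^2))))"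
  using lborel_affine[of a t] a by simp
 also have "... = (NN y. ennreal (\<bar>a\<bar>^DIM(real^2))*F (t + a *\<^sub>R y))"
  by (simp add: nn_integral_density nn_integral_distr)
 also have "... = ennreal (a^2)*(NN k. F (t + a *\<^sub>R k))"
  using a by (simp add: nn_integral_cmult)
 finally show ?thesis .
qed

lemma EE_ball:
 fixes w :: "real^2 => 'a::{real_normed_vector, second_countable_topology}"
 assumes [measurable]: "w \<in> \<B>" and e: "e > 0"
 shows "EE e w = ennreal (e^2)*(NN x. NN k. ennreal (indicator (ball 0 1) k*(norm (w (x + e *\<^sub>R k) - w x))^2))"
proof -
 have [measurable]: "ball (0::real^2) 1 \<in> sets borel" by simp
 let ?F = "\<lambda>x y. ennreal (indicator {..<e} (norm (x - y))*(norm (w x - w y))^2)"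
 have "(NN y. ?F x y) = ennreal (e^2)*(NN k. ?F x (x + e *\<^sub>R k))" for x
  by (rule nn_integral_affine2[OF _ e]) measurable
 moreover have "?F x (x + e *\<^sub>R k) = ennreal (indicator (ball 0 1) k*(norm (w (x + e *\<^sub>R k) - w x))^2)" for x k
  using e by (simp add: indicator_def norm_minus_commute)
 ultimately show ?thesis unfolding EE_def by (simp add: nn_integral_cmult)
qed

lemma distr_reflect: "distr lborel borel (\<lambda>y::real^2. x - y) = lborel"
proof -
 have o: "orthogonal_transformation (\<lambda>y::real^2. - y)" by (simp add: orthogonal_transformation_neg)
 have "distr lborel borel (\<lambda>y::real^2. x - y) = distr (distr lborel borel (\<lambda>y. - y)) borel (\<lambda>y. x + y)"
  by (subst distr_distr) (auto simp: o_def)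
 then show ?thesis using orthogonal_distr_lborel[OF o] lborel_distr_plus[of x] by simp
qed

text \<open>Expanding the square, the diagonal terms depend on the \<open>L^2\<close> norm alone;
  only the cross term \<open>Jker\<close> depends on how the values are arranged.\<close>

lemma EE_nice:
 assumes v: "nice L R v" and LR: "L >= 0" "R >= 0"
 shows "EE e v = ennreal (2*(LBINT z. indicator {..<e} (norm (z::real^2)))*(LBINT x. (v x)^2)
   - 2*Jker (indicator {..<e}) v)"
proof -
 note [measurable] = nice_measurable[OF v]
 define M where "M = L*(2*R + 1)"
 define k where "k = (\<lambda>z::real^2. indicator {..<e} (norm z) :: real)"
 have [measurable]: "k \<in> \<B>" unfolding k_def by measurable
 have bd: "\<bar>v x\<bar> <= M*iball R x" for x using nice_bound[OF v LR] by (simp add: M_def iball_def)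
 have bd2: "(v x)^2 <= M^2*iball R x" for x
 proof -
  have "\<bar>v x\<bar>\<^sup>2 <= (M*iball R x)^2" using bd by (intro power_mono) auto
  then show ?thesis by (cases "norm x <= R") (auto simp: power_mult_distrib iball_def)
 qed
 have ik: "integrable lborel k"
  by (rule integrable_iball_mult[where R = e and C = 1]) (auto simp: k_def iball_def indicator_def)
 have kr: "integrable lborel (\<lambda>y. k (x - y))" "(LBINT y. k (x - y)) = (LBINT z. k z)" for x
  using integrable_distr_eq[of "\<lambda>y::real^2. x - y" lborel borel k] integral_distr[of "\<lambda>y::real^2. x - y" lborel borel k] ik
  by (auto simp: distr_reflect)
 have k0: "k z >= 0" for z by (simp add: k_def)
 have i0: "integrable lborel2 (\<lambda>p. M^2*(iball R (fst p)*k (fst p - snd p)))"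
  by (intro integrable_mult_right integrable_conv_iball ik)
 have i1: "integrable lborel2 (\<lambda>p. k (fst p - snd p)*(v (fst p))^2)"
 proof (rule Bochner_Integration.integrable_bound[OF i0])
  show "AE p in lborel2. norm (k (fst p - snd p)*(v (fst p))^2) <= norm (M^2*(iball R (fst p)*k (fst p - snd p)))"
  proof (rule AE_I2)
   fix p :: "(real^2) \<times> (real^2)"
   have "k (fst p - snd p)*(v (fst p))^2 <= k (fst p - snd p)*(M^2*iball R (fst p))"
    by (intro mult_left_mono bd2 k0)
   then show "norm (k (fst p - snd p)*(v (fst p))^2) <= norm (M^2*(iball R (fst p)*k (fst p - snd p)))"
    using k0[of "fst p - snd p"] iball_nonneg[of R "fst p"] by (simp add: abs_mult mult_ac)
  qed
 qed simp
 have kc: "k (x - y) = k (y - x)" for x y by (simp add: k_def norm_minus_commute)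
 have unit1: "(LINT p|lborel2. k (fst p - snd p)*(v (fst p))^2) = (LBINT z. k z)*(LBINT x. (v x)^2)"
 proof -
  have "(LINT p|lborel2. k (fst p - snd p)*(v (fst p))^2) = (LBINT x. LBINT y. k (x - y)*(v x)^2)"
   by (subst lborel_pair.integral_fst'[symmetric, OF i1]) simp
  also have "... = (LBINT x. (LBINT z. k z)*(v x)^2)" by (simp add: kr(2))
  finally show ?thesis by simp
 qed
 have i2: "integrable lborel2 (\<lambda>p. k (fst p - snd p)*(v (snd p))^2)"
  using lborel_pair.integrable_product_swap[OF i1] by (simp add: case_prod_beta' kc)
 have e2: "(LINT p|lborel2. k (fst p - snd p)*(v (snd p))^2) = (LBINT z. k z)*(LBINT x. (v x)^2)"
 proof -
  have "(LINT p|lborel2. k (fst p - snd p)*(v (snd p))^2)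
    = (LINT p|lborel2. (case p of (x, y) => (\<lambda>p. k (fst p - snd p)*(v (fst p))^2) (y, x)))"
   by (intro Bochner_Integration.integral_cong) (auto simp: kc)
  also have "... = (LINT p|lborel2. k (fst p - snd p)*(v (fst p))^2)"
   by (rule lborel_pair.integral_product_swap) (rule borel_measurable_integrable[OF i1])
  finally show ?thesis using unit1 by simp
 qed
 have i3: "integrable lborel2 (\<lambda>p. k (fst p - snd p)*(v (fst p) * v (snd p)))"
  unfolding k_def by (rule Jker_integrable[OF okker_ind _ bd]) simp
 define F where "F = (\<lambda>p. k (fst p - snd p)*(v (fst p) - v (snd p))^2)"
 have F: "F = (\<lambda>p. k (fst p - snd p)*(v (fst p))^2 + k (fst p - snd p)*(v (snd p))^2 - 2*(k (fst p - snd p)*(v (fst p) * v (snd p))))"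
  by (auto simp: F_def power2_eq_square algebra_simps)
 have iF: "integrable lborel2 F" unfolding F using i1 i2 i3 by simp
 have IF: "(LINT p|lborel2. F p) = 2*(LBINT z. k z)*(LBINT x. (v x)^2) - 2*Jker (indicator {..<e}) v"
  unfolding F using i1 i2 i3 unit1 e2 by (simp add: Jker_def k_def)
 have "EE e v = (NN x. NN y. ennreal (F (x, y)))"
  by (simp add: EE_def F_def k_def)
 also have "... = (\<integral>\<^sup>+p. ennreal (F p) \<partial>lborel2)"
  using borel_measurable_integrable[OF iF] by (intro lborel.nn_integral_fst) simp
 also have "... = ennreal (LINT p|lborel2. F p)"
  by (rule nn_integral_eq_integral[OF iF]) (simp add: F_def k0)
 finally show ?thesis unfolding IF by (simp add: k_def)
qed

lemma EE_comp_class: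
 assumes v: "nice L R v" and LR: "L >= 0" "R >= 0" and w: "w \<in> comp_class L R v"
 shows "EE e w <= EE e v"
proof -
 have wn: "nice L R w" and eq: "(LBINT x. (w x)^2) = (LBINT x. (v x)^2)"
  and J: "Jker (indicator {..<e}) v <= Jker (indicator {..<e}) w"
  using w by (auto simp: comp_class_def)
 show ?thesis unfolding EE_nice[OF v LR] EE_nice[OF wn LR] eq using J by (intro ennreal_leI) simp
qed

text \<open>Isotropy of the disc: the reflection \<open>S\<close> of the first coordinate kills the
  mixed moment, and the exchange \<open>P\<close> of the coordinates equates the two pure
  ones.\<close>

lemma ball_quadratic:
 fixes a b :: complex
 shows "integrable lborel (\<lambda>k::real^2. indicator (ball 0 1) k*(cmod (of_real (k $ 1)*a + of_real (k $ 2)*b))^2)"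
  "(LBINT k. indicator (ball 0 1) (k::real^2)*(cmod (of_real (k $ 1)*a + of_real (k $ 2)*b))^2)
   = c1*((cmod a)^2 + (cmod b)^2)"
proof -
 define B where "B = (\<lambda>k::real^2. indicator (ball 0 1) k :: real)"
 have [measurable]: "B \<in> \<B>" unfolding B_def by (intro borel_measurable_indicator) simp
 have [measurable]: "(\<lambda>k::real^2. k $ i) \<in> \<B>" for i
  by (intro borel_measurable_continuous_onI continuous_intros)
 have comp: "\<bar>k $ i\<bar> <= 1" if "k \<in> ball 0 1" for k :: "real^2" and i
  using component_le_norm_cart[of k i] that by simp
 have ij: "integrable lborel (\<lambda>k. B k*(k $ i*k $ j))" for i j
 proof (rule integrable_iball_mult[where C = 1 and R = 1])
  fix k :: "real^2"
  show "\<bar>B k*(k $ i*k $ j)\<bar> <= 1*iball 1 k"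
  proof (cases "k \<in> ball 0 1")
   case True
   then have "\<bar>k $ i\<bar>*\<bar>k $ j\<bar> <= 1*1" by (intro mult_mono comp) auto
   then show ?thesis using True by (simp add: B_def iball_def abs_mult)
  qed (simp add: B_def iball_def)
 qed simp
 have inv: "(LBINT k. h (T k)) = (LBINT k. h k)"
  if T: "orthogonal_transformation T" and h: "h \<in> \<B>" for T :: "real^2 => real^2" and h :: "real^2 => real"
 proof -
  have "T \<in> \<B>"
   using T by (intro borel_measurable_continuous_onI linear_continuous_on)
    (simp add: orthogonal_transformation_linear linear_conv_bounded_linear[symmetric])
  then show ?thesis
   using integral_distr[of T lborel borel h] h by (simp add: orthogonal_distr_lborel[OF T])
 qed
 define S where "S = (\<lambda>k::real^2. (\<chi> i. if i = 1 then - k $ 1 else k $ 2) :: real^2)"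
 define P where "P = (\<lambda>k::real^2. (\<chi> i. if i = 1 then k $ 2 else k $ 1) :: real^2)"
 have S: "orthogonal_transformation S"
 proof -
  have "linear S" by (rule linearI) (simp_all add: S_def vec_eq_iff)
  moreover have "norm (S k) = norm k" for k by (simp add: S_def norm_vec_def L2_set_def sum_2)
  ultimately show ?thesis by (simp add: orthogonal_transformation)
 qed
 have P: "orthogonal_transformation P"
 proof -
  have "linear P" by (rule linearI) (simp_all add: P_def vec_eq_iff)
  moreover have "norm (P k) = norm k" for k by (simp add: P_def norm_vec_def L2_set_def sum_2 add.commute)
  ultimately show ?thesis by (simp add: orthogonal_transformation)
 qed
 have nS: "norm (S k) = norm k" "norm (P k) = norm k" for k
  using S P by (auto simp: orthogonal_transformation)
 have BS: "B (S k) = B k" "B (P k) = B k" for k by (simp_all add: B_def indicator_def nS)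
 have c11: "(LBINT k. B k*(k $ 1*k $ 1)) = c1" by (simp add: c1_def B_def power2_eq_square)
 have c22: "(LBINT k. B k*(k $ 2*k $ 2)) = c1"
 proof -
  have "(LBINT k. B (P k)*(P k $ 1*P k $ 1)) = (LBINT k. B k*(k $ 1*k $ 1))"
   by (rule inv[OF P, of "\<lambda>k. B k*(k $ 1*k $ 1)"]) simp
  then show ?thesis unfolding BS by (simp add: P_def c11)
 qed
 have c12: "(LBINT k. B k*(k $ 1*k $ 2)) = 0"
 proof -
  have "(LBINT k. B (S k)*(S k $ 1*S k $ 2)) = (LBINT k. B k*(k $ 1*k $ 2))"
   by (rule inv[OF S, of "\<lambda>k. B k*(k $ 1*k $ 2)"]) simp
  then show ?thesis unfolding BS by (simp add: S_def)
 qed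
 have eq: "(\<lambda>k::real^2. indicator (ball 0 1) k*(cmod (of_real (k $ 1)*a + of_real (k $ 2)*b))^2)
  = (\<lambda>k. (cmod a)^2*(B k*(k $ 1*k $ 1)) + 2*Re (a*cnj b)*(B k*(k $ 1*k $ 2)) + (cmod b)^2*(B k*(k $ 2*k $ 2)))"
 proof
  fix k :: "real^2"
  have "(cmod (of_real (k $ 1)*a + of_real (k $ 2)*b))^2
   = (cmod a)^2*(k $ 1*k $ 1) + 2*Re (a*cnj b)*(k $ 1*k $ 2) + (cmod b)^2*(k $ 2*k $ 2)"
   unfolding cmod_power2 by (simp add: power2_eq_square algebra_simps)
  then show "indicator (ball 0 1) k*(cmod (of_real (k $ 1)*a + of_real (k $ 2)*b))^2
  = (cmod a)^2*(B k*(k $ 1*k $ 1)) + 2*Re (a*cnj b)*(B k*(k $ 1*k $ 2)) + (cmod b)^2*(B k*(k $ 2*k $ 2))"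
   by (simp add: B_def algebra_simps)
 qed
 show "integrable lborel (\<lambda>k::real^2. indicator (ball 0 1) k*(cmod (of_real (k $ 1)*a + of_real (k $ 2)*b))^2)"
  unfolding eq using ij by simp
 show "(LBINT k. indicator (ball 0 1) (k::real^2)*(cmod (of_real (k $ 1)*a + of_real (k $ 2)*b))^2)
   = c1*((cmod a)^2 + (cmod b)^2)"
 proof -
  have "(LBINT k. (cmod a)^2*(B k*(k $ 1*k $ 1)) + 2*Re (a*cnj b)*(B k*(k $ 1*k $ 2)) + (cmod b)^2*(B k*(k $ 2*k $ 2)))
   = (cmod a)^2*c1 + 2*Re (a*cnj b)*0 + (cmod b)^2*c1"
   unfolding c11[symmetric] c12[symmetric] using ij c11 c22 by simp
  then show ?thesis unfolding eq by (simp add: distrib_left mult.commute)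
 qed
qed

lemma c1_pos: "c1 > 0"
proof -
 have i: "integrable lborel (\<lambda>k::real^2. indicator (ball 0 1) k*(k $ 1)^2 :: real)"
  using ball_quadratic(1)[of 1 0] by (simp add: norm_mult)
 have "c1 \<noteq> 0"
 proof
  assume "c1 = 0"
  then have "AE k in lborel. indicator (ball 0 1) (k::real^2)*(k $ 1)^2 = (0::real)"
   unfolding c1_def by (subst (asm) integral_nonneg_eq_0_iff_AE[OF i]) auto
  then have ae: "AE k in lborel. \<not> (k \<in> ball 0 1 \<and> (k::real^2) $ 1 \<noteq> 0)" by eventually_elim auto
  define O' where "O' = {k::real^2. k \<in> ball 0 1 \<and> k $ 1 \<noteq> 0}"
  have "O' = ball 0 1 \<inter> {k. k $ 1 \<noteq> 0}" by (auto simp: O'_def)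
  then have op: "open O'"
   by (auto intro!: open_Int open_Collect_neq continuous_intros)
  have "emeasure lborel O' = 0"
   using ae op unfolding O'_def by (subst (asm) AE_iff_measurable) auto
  moreover have "(1/2) *\<^sub>R axis 1 1 \<in> O'" by (simp add: O'_def norm_axis_1)
  then obtain d where d: "d > 0" "ball ((1/2) *\<^sub>R axis 1 1) d \<subseteq> O'" using op unfolding open_contains_ball by blast
  moreover have "emeasure lborel (ball ((1/2) *\<^sub>R axis 1 1 :: real^2) d) <= emeasure lborel O'"
   using d op by (intro emeasure_mono) auto
  moreover have "emeasure lborel (ball ((1/2) *\<^sub>R axis 1 1 :: real^2) d) > 0"
   using d by (subst emeasure_ball) (auto simp: ennreal_zero_less_mult_iff)
  ultimately show False by simp
 qed
 moreover have "c1 >= 0" unfolding c1_def by (intro integral_nonneg_AE) simp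
 ultimately show ?thesis by simp
qed

lemma radial_direction_deriv:
 fixes x k :: "real^2"
 assumes F: "\<And>t. DERIV F t :> F1 t" and x: "x \<noteq> 0"
 shows "DERIV (\<lambda>s. rad F al (x + s *\<^sub>R k)) 0 :> F1 (ln (norm x))*((x \<bullet> k)/(norm x)^2)"
proof -
 define N where "N = (norm x)^2"
 have N: "N > 0" using x by (simp add: N_def)
 have lnN: "ln N/2 = ln (norm x)" using x by (simp add: N_def ln_realpow)
 have nrm: "(norm (x + s *\<^sub>R k))^2 = N + 2 * s*(x \<bullet> k) + s^2*(norm k)^2" for s
  unfolding N_def power2_norm_eq_inner
  by (simp add: inner_add_left inner_add_right inner_commute power2_eq_square algebra_simps)
 have 1: "DERIV (\<lambda>s. ln (N + 2 * s*(x \<bullet> k) + s^2*(norm k)^2)/2) 0 :> (x \<bullet> k)/N"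
  using N by (auto intro!: derivative_eq_intros)
 have "DERIV F (ln (N + 2*0*(x \<bullet> k) + 0^2*(norm k)^2)/2) :> F1 (ln (norm x))"
  using F[of "ln (norm x)"] by (simp add: lnN)
 from DERIV_chain'[OF 1 this]
 have d: "DERIV (\<lambda>s. F (ln (N + 2 * s*(x \<bullet> k) + s^2*(norm k)^2)/2)) 0 :> F1 (ln (norm x))*((x \<bullet> k)/N)" .
 have dp: "norm x/(norm k + 1) > 0" using x by (simp add: add_nonneg_pos)
 show ?thesis
  unfolding N_def[symmetric]
 proof (rule has_field_derivative_transform_within[OF d dp])
  fix s :: real assume s: "dist s 0 < norm x/(norm k + 1)"
  have ne: "x + s *\<^sub>R k \<noteq> 0"
  proof
   assume "x + s *\<^sub>R k = 0"
   then have "x = - (s *\<^sub>R k)" by (simp add: add_eq_0_iff2)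
   then have "norm x = \<bar>s\<bar>*norm k" by simp
   moreover have "\<bar>s\<bar>*(norm k + 1) < norm x" using s by (simp add: pos_less_divide_eq add_nonneg_pos)
   moreover have "\<bar>s\<bar>*norm k <= \<bar>s\<bar>*(norm k + 1)" by (intro mult_left_mono) auto
   ultimately show False by linarith
  qed
  then have "ln (N + 2 * s*(x \<bullet> k) + s^2*(norm k)^2)/2 = ln (norm (x + s *\<^sub>R k))"
   unfolding nrm[symmetric] by (simp add: ln_realpow)
  then show "F (ln (N + 2 * s*(x \<bullet> k) + s^2*(norm k)^2)/2) = rad F al (x + s *\<^sub>R k)"
   using ne by (simp add: rad_def)
 qed simp
qed

text \<open>Averaging over the dilations \<open>1 \<le> e\<^sup>s \<le> e\<^sup>h\<close> smooths a radial function in the logarithmic variable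
 without increasing the nonlocal energies, which are scale invariant.\<close>

lemma prof_Dir_le:
 assumes w: "nice L R w" and radial: "\<And>x y. norm x = norm y ==> w x = w y"
  and T: "\<And>e. e > 0 ==> EE e w <= ennreal (c1*e^4*T)" and T0: "T >= 0"
 shows "Dir_le (prof w) (T/(2*pi))"
 unfolding Dir_le_def
proof (intro allI impI)
 fix h :: real assume h: "h > 0"
 define f where "f = prof w"
 note [measurable] = nice_measurable[OF w]
 have [measurable]: "ball (0::real^2) 1 \<in> sets borel" by simp
 have fc: "continuous_on UNIV f"
  unfolding f_def prof_def[abs_def]
  by (intro continuous_on_compose2[OF nice_cont[OF w]] continuous_intros) auto
 have feq: "w x = f (ln (norm x))" if "x \<noteq> 0" for x
  unfolding f_def prof_def by (rule radial) (use that in \<open>simp add: norm_unit1\<close>)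
 have [measurable]: "f \<in> \<B>" by (rule borel_measurable_continuous_onI[OF fc])
 obtain A where A: "\<And>x. DERIV A x :> f x" using antiderivative_real[OF fc] by blast
 \<comment> \<open>The mean of \<open>f\<close> over \<open>[t, t + h]\<close> is differentiable,
   and its derivative is the difference quotient of \<open>f\<close> with step \<open>h\<close>. An
   ordinary Dirichlet bound for \<open>F\<close> is therefore the required bound at this
   step.\<close>
 define F where "F = (\<lambda>t. (A (t + h) - A t)/h)"
 define F1 where "F1 = (\<lambda>t. (f (t + h) - f t)/h)"
 have dF: "DERIV F t :> F1 t" for t
  unfolding F_def F1_def using DERIV_comp_add[of A "f (h + t)" h t] A h
  by (auto intro!: derivative_eq_intros simp: add.commute)
 have Fc: "continuous_on UNIV F" by (rule DERIV_continuous_UNIV[OF dF])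
 have [measurable]: "F \<in> \<B>" by (rule borel_measurable_continuous_onI[OF Fc])
 have [measurable]: "F1 \<in> \<B>" unfolding F1_def by measurable
 define wh where "wh = rad F 0"
 have whm [measurable]: "wh \<in> \<B>" unfolding wh_def rad_def[abs_def] by measurable
 \<comment> \<open>For a radial function the dilation by \<open>exp s\<close> is the shift by
   \<open>s\<close> in \<open>t\<close>, so \<open>wh x - wh y\<close> is the mean over
   \<open>s\<close> in \<open>[0, h]\<close> of differences of \<open>w\<close> at dilated points;
   Cauchy-Schwarz in \<open>s\<close> does the rest.\<close>
 have jensen: "ennreal ((wh x - wh y)^2) <= (NN s. ennreal (1/h)*(indicator {0..h} s*ennreal ((w (exp s *\<^sub>R x) - w (exp s *\<^sub>R y))^2)))"
  if x: "x \<noteq> 0" and y: "y \<noteq> 0" for x y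
 proof -
  define a b where "a = ln (norm x)" and "b = ln (norm y)"
  define G where "G = (\<lambda>s. f (a + s) - f (b + s))"
  have Gc: "continuous_on UNIV G" unfolding G_def
   by (intro continuous_intros continuous_on_compose2[OF fc]) auto
  have Geq: "w (exp s *\<^sub>R x) - w (exp s *\<^sub>R y) = G s" for s
   using x y by (simp add: feq G_def a_def b_def ln_mult add.commute)
  have "(G has_integral (A (a + h) - A (b + h)) - (A (a + 0) - A (b + 0))) {0..h}"
  proof (rule fundamental_theorem_of_calculus)
   fix s
   have "DERIV (\<lambda>s. A (a + s) - A (b + s)) s :> G s"
    unfolding G_def by (intro DERIV_diff DERIV_comp_add A)
   then show "((\<lambda>s. A (a + s) - A (b + s)) has_vector_derivative G s) (at s within {0..h})"
    by (simp add: has_real_derivative_iff_has_vector_derivative has_vector_derivative_at_within)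
  qed (use h in simp)
  then have I: "integral {0..h} G = h*(wh x - wh y)"
   using h x y by (simp add: integral_unique wh_def rad_def F_def a_def b_def field_simps)
  have "(h*(wh x - wh y))^2 <= (h - 0)*integral {0..h} (\<lambda>s. (G s)^2)"
   unfolding I[symmetric] by (rule square_integral_le) (use h Gc in \<open>auto intro: continuous_on_subset\<close>)
  then have "h*(h*(wh x - wh y)^2) <= h*integral {0..h} (\<lambda>s. (G s)^2)"
   by (simp add: power2_eq_square mult_ac)
  then have "h*(wh x - wh y)^2 <= integral {0..h} (\<lambda>s. (G s)^2)"
   using h by (simp only: mult_le_cancel_left_pos)
  then have le: "(wh x - wh y)^2 <= (1/h)*integral {0..h} (\<lambda>s. (G s)^2)"
   using h by (simp add: field_simps)
  have c2: "continuous_on {0..h} (\<lambda>s. (G s)^2)" by (intro continuous_intros continuous_on_subset[OF Gc]) auto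
  have si: "set_integrable lborel {0..h} (\<lambda>s. (G s)^2)" by (rule borel_integrable_atLeastAtMost'[OF c2])
  have "ennreal (integral {0..h} (\<lambda>s. (G s)^2)) = ennreal (LINT s:{0..h}|lborel. (G s)^2)"
   by (simp only: set_borel_integral_eq_integral(2)[OF si])
  also have "... = (NN s. ennreal (indicator {0..h} s *\<^sub>R (G s)\<^sup>2))"
   using si unfolding set_lebesgue_integral_def set_integrable_def
   by (intro nn_integral_eq_integral[symmetric]) auto
  also have "... = (NN s. indicator {0..h} s*ennreal ((G s)^2))"
   by (intro nn_integral_cong) (auto simp: indicator_def)
  finally have eq: "ennreal (integral {0..h} (\<lambda>s. (G s)^2)) = (NN s. indicator {0..h} s*ennreal ((G s)^2))" .
  have [measurable]: "G \<in> \<B>" by (rule borel_measurable_continuous_onI[OF Gc])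
  have "ennreal ((wh x - wh y)^2) <= ennreal ((1/h)*integral {0..h} (\<lambda>s. (G s)^2))" using le by (rule ennreal_leI)
  also have "... = ennreal (1/h)*(NN s. indicator {0..h} s*ennreal ((G s)^2))"
   using h eq by (subst ennreal_mult') auto
  also have "... = (NN s. ennreal (1/h)*(indicator {0..h} s*ennreal ((G s)^2)))"
   by (rule nn_integral_cmult[symmetric]) simp
  finally show ?thesis by (simp only: Geq)
 qed
 \<comment> \<open>Scale invariance: dilating both variables by \<open>a\<close> costs
   \<open>a^4\<close>, which the bound \<open>c1 * (a * e)^4 * T\<close> at the step
   \<open>a * e\<close> supplies.\<close>
 have dil: "(NN x. NN y. ennreal (indicator {..<e} (norm (x - y))*(w (exp s *\<^sub>R x) - w (exp s *\<^sub>R y))^2))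
   <= ennreal (c1*e^4*T)" if e: "e > 0" for s e
 proof -
  define a where "a = exp s"
  have a: "a > 0" by (simp add: a_def)
  define H where "H = (\<lambda>x y::real^2. ennreal (indicator {..<a*e} (norm (x - y))*(w x - w y)^2))"
  have [measurable]: "(\<lambda>p. H (fst p) (snd p)) \<in> borel_measurable (borel \<Otimes>\<^sub>M borel)" unfolding H_def by measurable
  have Hm: "(\<lambda>y. H x y) \<in> \<B>" for x unfolding H_def by measurable
  have Hm2: "(\<lambda>x. NN y. H x y) \<in> \<B>" unfolding H_def by measurable
  have "H (a *\<^sub>R x) (a *\<^sub>R y) = ennreal (indicator {..<e} (norm (x - y))*(w (exp s *\<^sub>R x) - w (exp s *\<^sub>R y))^2)" for x y
  proof -
   have "norm (a *\<^sub>R x - a *\<^sub>R y) = a*norm (x - y)" using a by (simp add: scaleR_diff_right[symmetric])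
   then show ?thesis using a by (simp add: H_def a_def indicator_def)
  qed
  then have "ennreal (a^2)*(ennreal (a^2)*(NN x. NN y. ennreal (indicator {..<e} (norm (x - y))*(w (exp s *\<^sub>R x) - w (exp s *\<^sub>R y))^2)))
   = ennreal (a^2)*(NN x. ennreal (a^2)*(NN y. H (0 + a *\<^sub>R x) (0 + a *\<^sub>R y)))"
   by (subst nn_integral_cmult) (simp_all add: H_def)
  also have "... = ennreal (a^2)*(NN x. (NN y. H (0 + a *\<^sub>R x) y))"
   by (simp only: nn_integral_affine2[OF Hm a, of _ 0, symmetric])
  also have "... = (NN x. NN y. H x y)"
   by (simp only: nn_integral_affine2[OF Hm2 a, of 0, symmetric])
  also have "... = EE (a*e) w" by (simp add: EE_def H_def)
  also have "... <= ennreal (c1*(a*e)^4*T)" by (rule T) (use a e in simp)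
  also have "... = ennreal (a^2)*(ennreal (a^2)*ennreal (c1*e^4*T))"
   by (simp add: ennreal_mult'[symmetric] power2_eq_square power4_eq_xxxx mult_ac)
  finally show ?thesis
   using a by (simp add: ennreal_mult_le_mult_iff mult.assoc)
 qed
 have EEwh: "EE e wh <= ennreal (c1*e^4*T)" if e: "e > 0" for e
 proof -
  define k where "k = (\<lambda>x y::real^2. ennreal (indicator {..<e} (norm (x - y))))"
  define Q where "Q = (\<lambda>s (x::real^2) (y::real^2). ennreal (1/h)*(indicator {0..h} s*(k x y*ennreal ((w (exp s *\<^sub>R x) - w (exp s *\<^sub>R y))^2))))"
  have [measurable]: "(\<lambda>p. Q (snd (snd p)) (fst p) (fst (snd p))) \<in> borel_measurable (borel \<Otimes>\<^sub>M borel \<Otimes>\<^sub>M borel)"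
   unfolding Q_def k_def by measurable
  have "EE e wh <= (NN x. NN y. NN s. Q s x y)"
   unfolding EE_def
  proof (rule nn_integral_mono_AE)
   show "AE x in lborel. (NN y. ennreal (indicator {..<e} (norm (x - y))*(norm (wh x - wh y))^2)) <= (NN y. NN s. Q s x y)"
    using AE_nonzero
   proof eventually_elim
    case (elim x)
    show ?case
    proof (rule nn_integral_mono_AE)
     show "AE y in lborel. ennreal (indicator {..<e} (norm (x - y))*(norm (wh x - wh y))^2) <= (NN s. Q s x y)"
      using AE_nonzero
     proof eventually_elim
      case (elim y)
      have "ennreal (indicator {..<e} (norm (x - y))*(norm (wh x - wh y))^2) = k x y*ennreal ((wh x - wh y)^2)"
       by (simp add: k_def ennreal_mult')
      also have "... <= k x y*(NN s. ennreal (1/h)*(indicator {0..h} s*ennreal ((w (exp s *\<^sub>R x) - w (exp s *\<^sub>R y))^2)))"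
       by (intro mult_left_mono jensen \<open>x \<noteq> 0\<close> elim) simp
      also have "... = (NN s. k x y*(ennreal (1/h)*(indicator {0..h} s*ennreal ((w (exp s *\<^sub>R x) - w (exp s *\<^sub>R y))^2))))"
       by (rule nn_integral_cmult[symmetric]) measurable
      also have "... = (NN s. Q s x y)" by (simp add: Q_def mult_ac)
      finally show ?case .
     qed
    qed
   qed
  qed
  also have "... = (NN x. NN s. NN y. Q s x y)"
  proof (rule nn_integral_cong)
   fix x
   have "(\<lambda>(y, s). Q s x y) \<in> borel_measurable lborel2" unfolding Q_def k_def by measurable
   then show "(NN y. NN s. Q s x y) = (NN s. NN y. Q s x y)"
    by (rule lborel_pair.Fubini'[symmetric])
  qed
  also have "... = (NN s. NN x. NN y. Q s x y)"
  proof -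
   have "(\<lambda>(x, s). NN y. Q s x y) \<in> borel_measurable lborel2"
    unfolding Q_def k_def by measurable
   then show ?thesis by (rule lborel_pair.Fubini'[symmetric])
  qed
  also have "... <= (NN s. ennreal (1/h)*(indicator {0..h} s*ennreal (c1*e^4*T)))"
  proof (rule nn_integral_mono)
   fix s
   have "(NN x. NN y. Q s x y) = ennreal (1/h)*(indicator {0..h} s*(NN x. NN y. (k x y*ennreal ((w (exp s *\<^sub>R x) - w (exp s *\<^sub>R y))^2))))"
    unfolding Q_def k_def by (simp add: nn_integral_cmult)
   also have "... <= ennreal (1/h)*(indicator {0..h} s*ennreal (c1*e^4*T))"
    using dil[OF e, of s] by (intro mult_left_mono) (auto simp: k_def ennreal_mult')
   finally show "(NN x. NN y. Q s x y) <= ennreal (1/h)*(indicator {0..h} s*ennreal (c1*e^4*T))" .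
  qed
  also have "... = (NN s. (ennreal (1/h)*ennreal (c1*e^4*T))*indicator {0..h} s)"
   by (intro nn_integral_cong) (simp add: mult_ac)
  also have "... = (ennreal (1/h)*ennreal (c1*e^4*T))*ennreal h"
   using h by (subst nn_integral_cmult_indicator) (auto simp: emeasure_lborel_Icc_eq)
  also have "... = ennreal (c1*e^4*T)"
   using h by (simp add: ennreal_mult'[symmetric] ennreal_mult''[symmetric] mult_ac)
  finally show ?thesis .
 qed
 have quot: "(NN x. NN k. ennreal (indicator (ball 0 1) k*((wh (x + e *\<^sub>R k) - wh x)/e)^2)) <= ennreal (c1*T)"
  if e: "e > 0" for e
 proof -
  have "ennreal (indicator (ball 0 1) k*(norm (wh (x + e *\<^sub>R k) - wh x))^2)
    = ennreal (e^2)*ennreal (indicator (ball 0 1) k*((wh (x + e *\<^sub>R k) - wh x)/e)^2)" for x k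
   using e by (simp add: ennreal_mult'[symmetric] power_divide)
  then have eq: "EE e wh = ennreal (e^2)*(ennreal (e^2)*(NN x. NN k. ennreal (indicator (ball 0 1) k*((wh (x + e *\<^sub>R k) - wh x)/e)^2)))"
   unfolding EE_ball[OF whm e] by (simp add: nn_integral_cmult)
  have "EE e wh <= ennreal (c1*e^4*T)" by (rule EEwh[OF e])
  also have "... = ennreal (e^2)*(ennreal (e^2)*ennreal (c1*T))"
   by (simp only: ennreal_mult'[symmetric] zero_le_power2) (simp add: power2_eq_square power4_eq_xxxx mult_ac)
  finally show ?thesis unfolding eq using e by (simp add: ennreal_mult_le_mult_iff)
 qed
 \<comment> \<open>The pointwise limit of the rescaled squared difference quotients as the step
   tends to 0; Fatou then transfers the bound to this genuine directional derivative of
   \<open>wh\<close>.\<close>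
 define D where "D = (\<lambda>x k::real^2. indicator (ball 0 1) k*(F1 (ln (norm x))*((x \<bullet> k)/(norm x)^2))^2 :: real)"
 define E where "E = (\<lambda>n x k. ennreal (indicator (ball 0 1) k*((wh (x + (1/real (Suc n)) *\<^sub>R k) - wh x)/(1/real (Suc n)))^2))"
 have lim: "(\<lambda>n. E n x k) ----> ennreal (D x k)" if x: "x \<noteq> 0" for x k
 proof -
  have "((\<lambda>s. (wh (x + s *\<^sub>R k) - wh x) / s) ---> F1 (ln (norm x))*((x \<bullet> k)/(norm x)^2)) (at 0)"
   using radial_direction_deriv[OF dF x, of 0 k] unfolding DERIV_def wh_def by simp
  moreover have "filterlim (\<lambda>n. 1/real (Suc n)) (at 0) sequentially"
   unfolding filterlim_at using LIMSEQ_Suc[OF lim_const_over_n[of 1]] by auto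
  ultimately have "(\<lambda>n. (wh (x + (1/real (Suc n)) *\<^sub>R k) - wh x)/(1/real (Suc n))) ----> F1 (ln (norm x))*((x \<bullet> k)/(norm x)^2)"
   by (rule filterlim_compose)
  then show ?thesis unfolding E_def D_def by (intro tendsto_ennrealI tendsto_intros)
 qed
 have "(NN x. NN k. ennreal (D x k)) = (NN x. NN k. liminf (\<lambda>n. E n x k))"
 proof (rule nn_integral_cong_AE)
  show "AE x in lborel. (NN k. ennreal (D x k)) = (NN k. liminf (\<lambda>n. E n x k))"
   using AE_nonzero by eventually_elim (intro nn_integral_cong lim_imp_Liminf[symmetric] lim, auto)
 qed
 also have "... <= (NN x. liminf (\<lambda>n. NN k. E n x k))"
 proof (intro nn_integral_mono nn_integral_liminf)
  show "(\<lambda>k. E n x k) \<in> borel_measurable lborel" for n x unfolding E_def by measurable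
 qed
 also have "... <= liminf (\<lambda>n. NN x. NN k. E n x k)"
 proof (rule nn_integral_liminf)
  show "(\<lambda>x. NN k. E n x k) \<in> borel_measurable lborel" for n unfolding E_def by measurable
 qed
 also have "... <= ennreal (c1*T)"
 proof (rule liminf_le_const_ennreal)
  show "(NN x. NN k. E n x k) <= ennreal (c1*T)" for n
   unfolding E_def by (rule quot) simp
 qed
 finally have le: "(NN x. NN k. ennreal (D x k)) <= ennreal (c1*T)" .
 \<comment> \<open>The disc average of \<open>(x \<bullet> k)^2\<close> is
   \<open>c1 * |x|^2\<close>, so one power of \<open>|x|^2\<close> survives in the denominator;
   polar coordinates cancel it.\<close>
 have inner: "(NN k. ennreal (D x k)) = ennreal (c1*((F1 (ln (norm x)))^2*exp (- 2*ln (norm x))))" if x: "x \<noteq> 0" for x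
 proof -
  let ?q = "\<lambda>k::real^2. indicator (ball 0 1) k*(cmod (of_real (k $ 1) * of_real (x $ 1) + of_real (k $ 2) * of_real (x $ 2)))^2 :: real"
  define al where "al = (F1 (ln (norm x)))^2/(norm x)^4"
  have Dq: "D x k = al*?q k" for k
  proof -
   have "cmod (of_real (k $ 1) * of_real (x $ 1) + of_real (k $ 2) * of_real (x $ 2)) = \<bar>x \<bullet> k\<bar>"
   proof -
    have "of_real (k $ 1) * of_real (x $ 1) + of_real (k $ 2) * of_real (x $ 2) = complex_of_real (x \<bullet> k)"
     by (simp add: inner_vec_def sum_2 mult.commute)
    then show ?thesis by (simp only: norm_of_real)
   qed
   then show ?thesis unfolding D_def al_def
    by (simp add: power_mult_distrib power_divide power2_eq_square power4_eq_xxxx mult_ac)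
  qed
  have iq: "integrable lborel (\<lambda>k. al*?q k)"
   by (rule integrable_mult_right) (rule ball_quadratic(1))
  have "(NN k. ennreal (D x k)) = ennreal (LBINT k. al*?q k)"
   unfolding Dq by (rule nn_integral_eq_integral[OF iq]) (auto simp: al_def)
  also have "(LBINT k. al*?q k) = al*(c1*((cmod (of_real (x $ 1)))^2 + (cmod (of_real (x $ 2)))^2))"
   by (simp only: integral_mult_right_zero ball_quadratic(2))
  also have "(cmod (of_real (x $ 1)))^2 + (cmod (of_real (x $ 2)))^2 = (norm x)^2"
   by (simp add: norm_vec_def L2_set_def sum_2)
  also have "al*(c1*(norm x)^2) = c1*((F1 (ln (norm x)))^2*exp (- 2*ln (norm x)))"
  proof -
   have "exp (- 2*ln (norm x)) = 1/(norm x)^2"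
    using x by (simp add: exp_minus exp_double inverse_eq_divide)
   then show ?thesis using x unfolding al_def by (simp add: power2_eq_square power4_eq_xxxx)
  qed
  finally show ?thesis .
 qed
 have "ennreal c1*((NN t. ennreal (2*pi)*ennreal ((F1 t)^2))) = (NN t. ennreal (2*pi*exp (2*t))*ennreal (c1*((F1 t)^2*exp (- 2*t))))"
 proof -
  have "ennreal (2*pi*exp (2*t))*ennreal (c1*((F1 t)^2*exp (- 2*t))) = ennreal c1*(ennreal (2*pi)*ennreal ((F1 t)^2))" for t
   using c1_pos by (simp add: ennreal_mult'[symmetric] ennreal_mult''[symmetric] exp_minus field_simps)
  then show ?thesis by (simp only:) (rule nn_integral_cmult[symmetric], measurable)
 qed
 also have "... = (NN x. ennreal (c1*((F1 (ln (norm (x::real^2))))^2*exp (- 2*ln (norm x)))))"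
  by (rule nn_integral_radial[of "\<lambda>t. ennreal (c1*((F1 t)^2*exp (- 2*t)))", symmetric]) measurable
 also have "... = (NN x. NN k. ennreal (D x k))"
 proof (rule nn_integral_cong_AE)
  show "AE x in lborel. ennreal (c1*((F1 (ln (norm x)))^2*exp (- 2*ln (norm x)))) = (NN k. ennreal (D x k))"
   using AE_nonzero by eventually_elim (erule inner[symmetric])
 qed
 also note le
 also have "ennreal (c1*T) = ennreal c1*ennreal T" using c1_pos by (simp add: ennreal_mult')
 finally have "(NN t. ennreal (2*pi)*ennreal ((F1 t)^2)) <= ennreal T"
  using c1_pos by (simp add: ennreal_mult_le_mult_iff)
 then have fin: "ennreal (2*pi)*(NN t. ennreal ((F1 t)^2)) <= ennreal T"
  by (subst (asm) nn_integral_cmult) auto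
 have "(NN t. ennreal ((f (t + h) - f t)^2)) = (NN t. ennreal (h^2)*ennreal ((F1 t)^2))"
  using h by (intro nn_integral_cong) (simp add: F1_def ennreal_mult'[symmetric] power_divide)
 also have "... = ennreal (h^2)*(NN t. ennreal ((F1 t)^2))"
  by (rule nn_integral_cmult) measurable
 also have "... = ennreal (h^2/(2*pi))*(ennreal (2*pi)*(NN t. ennreal ((F1 t)^2)))"
  by (simp add: mult.assoc[symmetric] ennreal_mult'[symmetric])
 also have "... <= ennreal (h^2/(2*pi))*ennreal T" by (intro mult_left_mono fin) simp
 also have "... = ennreal (T/(2*pi)*h^2)" by (subst ennreal_mult'[symmetric]) (auto simp: mult_ac)
 finally show "(NN t. ennreal ((prof w (t + h) - prof w t)^2)) <= ennreal (T/(2*pi)*h^2)" unfolding f_def .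
qed

text \<open>Symmetrisation raises the left side and keeps \<open>lam\<close> and the bound
  \<open>T\<close>. The profile of the symmetrised function has Dirichlet bound
  \<open>T / (2 * pi)\<close> and mass \<open>lam / (2 * pi)\<close>, so the angular factors cancel
  in the logarithm.\<close>

theorem nice_inequality:
 assumes v: "nice L R v" and LR: "L >= 0" "R >= 0"
  and lam: "lam = (LBINT x. (v x)^2)" "lam > 0"
  and T: "\<And>e. e > 0 ==> EE e v <= ennreal (c1*e^4*T)" and T0: "T > 0"
 shows "Jker (\<lambda>r. - ln r) (\<lambda>z. (v z)^2) <=
  lam^2*(ln (8*pi*T/(N_const*lam))/2 - 2*pi*((I_const + 1)/N_const - 1/(8*pi)))"
proof -
 obtain w where w: "w \<in> comp_class L R v" and radial: "\<And>x y. norm x = norm y ==> w x = w y"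
  using symmetrize[OF v LR] by blast
 have wn: "nice L R w" and eq: "(LBINT x. (w x)^2) = lam"
  and J: "Jker (\<lambda>r. - ln r) (\<lambda>z. (v z)^2) <= Jker (\<lambda>r. - ln r) (\<lambda>z. (w z)^2)"
  using w lam by (auto simp: comp_class_def)
 have Tw: "EE e w <= ennreal (c1*e^4*T)" if "e > 0" for e
  using EE_comp_class[OF v LR w, of e] T[OF that] by (rule order_trans)
 define f where "f = prof w"
 have fD: "Dir_le f (T/(2*pi))" unfolding f_def
  by (rule prof_Dir_le[OF wn radial Tw]) (use T0 in auto)
 have adm: "adm f (T/(2*pi))"
  unfolding adm_def f_def using prof_cont[OF wn LR radial] prof_wint[OF wn LR radial] fD f_def by auto
 have m: "mass f = lam/(2*pi)" using prof_mass[OF wn LR radial] eq by (simp add: f_def)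
 have mp: "mass f > 0" using m lam by simp
 have JB: "Jker (\<lambda>r. - ln r) (\<lambda>z. (w z)^2) = - (2*pi)\<^sup>2*BB (dens f) (dens f)"
  unfolding f_def by (rule prof_log[OF wn LR radial])
 define c where "c = 2*pi*((I_const + 1)/N_const - 1/(8*pi))"
 have "c - ln (8*pi/N_const)/2 <= BB (dens f) (dens f)/(mass f)^2 + ln (T/(2*pi)/mass f)/2"
  unfolding c_def by (rule profile_inequality(2)[OF adm _ mp]) (use T0 in simp)
 also have "T/(2*pi)/mass f = T/lam" unfolding m using lam by simp
 also have "BB (dens f) (dens f)/(mass f)^2 = - (Jker (\<lambda>r. - ln r) (\<lambda>z. (w z)^2)/lam^2)"
  unfolding m JB using lam by (simp add: power_divide field_simps)
 finally have "Jker (\<lambda>r. - ln r) (\<lambda>z. (w z)^2)/lam^2 <= (ln (T/lam) + ln (8*pi/N_const))/2 - c" by (simp add: field_simps)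
 also have "ln (T/lam) + ln (8*pi/N_const) = ln (8*pi*T/(N_const*lam))"
  using T0 lam profile_inequality(1) by (subst ln_mult_pos[symmetric]) (auto simp: mult_ac)
 finally have "Jker (\<lambda>r. - ln r) (\<lambda>z. (w z)^2) <= lam^2*(ln (8*pi*T/(N_const*lam))/2 - c)"
  using lam by (simp add: pos_divide_le_eq mult.commute)
 with J show ?thesis unfolding c_def by linarith
qed

section \<open>Mollification\<close>

text \<open>With \<open>y = 1 / (1 - s^2)\<close> these are polynomials times
  \<open>y^k * exp (- y)\<close>, extended by 0. Varying polynomial and exponent gives a family
  closed under differentiation; \<open>P = 1\<close>, \<open>k = 0\<close> is the usual
  bump.\<close>

definition bmp :: "real poly => nat => real => real" where
 "bmp P k s = (if \<bar>s\<bar> < 1 then poly P s*(1/(1 - s^2))^k*exp (- (1/(1 - s^2))) else 0)"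

text \<open>\<open>exp y\<close> exceeds \<open>y^(k + 2) / (k + 2)!\<close>, so the exponential
  leaves two powers of \<open>1 - s^2\<close> to spare. Vanishing to second order at
  \<open>s = 1\<close> and \<open>s = -1\<close> is what makes the derivative exist and vanish
  there.\<close>

lemma bmp_bound_quadratic: "\<exists>C\<ge>0. \<forall>s. \<bar>bmp P k s\<bar> <= C*(1 - s^2)^2"
proof -
 have "compact (poly P ` {-1..1})" by (intro compact_continuous_image continuous_intros) auto
 then obtain B where B: "\<And>s. s \<in> {-1..1} ==> \<bar>poly P s\<bar> <= B"
  using compact_imp_bounded[THEN bounded_pos[THEN iffD1]] by (metis imageI real_norm_def)
 have B0: "B >= 0" using B[of 0] by (auto intro: order_trans[OF abs_ge_zero])
 have "\<bar>bmp P k s\<bar> <= (B*fact (k + 2))*(1 - s^2)^2" for s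
 proof (cases "\<bar>s\<bar> < 1")
  case True
  then have pos: "1 - s^2 > 0" by (simp add: abs_square_less_1)
  define y where "y = 1/(1 - s^2)"
  have y: "y > 0" using pos by (simp add: y_def)
  have "y^(k + 2)/fact (k + 2) <= exp y"
  proof -
   have "(\<Sum>i\<in>{k + 2}. y^i/fact i) <= (\<Sum>i. y^i/fact i)"
    using y summable_exp[of y] by (intro sum_le_suminf) (auto simp: divide_inverse mult.commute)
   then show ?thesis by (simp add: exp_def scaleR_conv_of_real divide_inverse mult.commute)
  qed
  then have "y^(k + 2) <= exp y*fact (k + 2)" by (simp only: pos_divide_le_eq fact_gt_zero)
  then have "y^(k + 2)*exp (- y) <= exp y*fact (k + 2)*exp (- y)" by (intro mult_right_mono) auto
  also have "exp y*fact (k + 2)*exp (- y) = fact (k + 2)*(exp y*exp (- y))" by (simp only: mult_ac)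
  also have "exp y*exp (- y) = 1" by (rule exp_minus_inverse)
  finally have "y^(k + 2)*exp (- y) <= fact (k + 2)" by (simp only: mult_1_right)
  then have "(y^k*exp (- y))*y^2 <= fact (k + 2)" by (simp add: power_add power2_eq_square mult_ac)
  then have le: "y^k*exp (- y) <= fact (k + 2)*(1 - s^2)^2"
   using pos unfolding y_def by (simp add: power_divide pos_divide_le_eq mult_ac)
  have "\<bar>bmp P k s\<bar> = \<bar>poly P s\<bar>*(y^k*exp (- y))"
   using True y by (simp add: bmp_def y_def[symmetric] abs_mult)
  also have "... <= B*(fact (k + 2)*(1 - s^2)^2)"
  proof (rule mult_mono[OF _ le B0])
   show "\<bar>poly P s\<bar> <= B" by (rule B) (use True in \<open>auto simp: abs_less_iff\<close>)
   show "0 <= y^k*exp (- y)" using y by simp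
  qed
  finally show ?thesis by (simp add: mult.assoc)
 next
  case False
  then show ?thesis using B0 by (simp add: bmp_def)
 qed
 then show ?thesis using B0 by (intro exI[of _ "B*fact (k + 2)"]) auto
qed

lemma bmp_deriv: "\<exists>Q. \<forall>s. DERIV (bmp P k) s :> bmp Q (k + 2) s"
proof -
 define u where "u = [:1, 0, -1::real:]"
 have pu: "poly u s = 1 - s^2" for s by (simp add: u_def power2_eq_square)
 \<comment> \<open>The product rule with \<open>y' = 2 * s * y^2\<close>, everything written over
   the common power \<open>y^(k + 2)\<close> by means of \<open>y * (1 - s^2) = 1\<close>.\<close>
 define Q where "Q = pderiv P*u^2 + smult (2*real k) ([:0, 1:]*P*u) - smult 2 ([:0, 1:]*P)"
 have pQ: "poly Q s = poly (pderiv P) s*(1 - s^2)^2 + 2*real k*(s*poly P s*(1 - s^2)) - 2*(s*poly P s)" for s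
  by (simp add: Q_def pu)
 have "DERIV (bmp P k) s :> bmp Q (k + 2) s" for s
 proof -
  consider "\<bar>s\<bar> < 1" | "\<bar>s\<bar> > 1" | "\<bar>s\<bar> = 1" by linarith
  then show ?thesis
  proof cases
   case 1
   then have pos: "1 - s^2 > 0" by (simp add: abs_square_less_1)
   define y where "y = 1/(1 - s^2)"
   have dy: "DERIV (\<lambda>s. 1/(1 - s^2)) s :> 2 * s*y^2"
    using pos by (auto intro!: derivative_eq_intros simp: y_def power2_eq_square field_simps)
   have d1: "DERIV (\<lambda>s. (1/(1 - s^2))^k) s :> real k*y^(k - 1)*(2 * s*y^2)"
    using DERIV_power[OF dy, of k] by (simp add: y_def mult_ac)
   have d2: "DERIV (\<lambda>s. exp (- (1/(1 - s^2)))) s :> exp (- y)*(- (2 * s*y^2))"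
    using DERIV_chain'[OF DERIV_minus[OF dy] DERIV_exp] by (simp add: y_def)
   have "((\<lambda>s. poly P s*(1/(1 - s^2))^k*exp (- (1/(1 - s^2)))) has_real_derivative
    ((poly (pderiv P) s*y^k + real k*y^(k - 1)*(2 * s*y^2)*poly P s)*exp (- y) + exp (- y)*(- (2 * s*y^2))*(poly P s*y^k))) (at s)"
    using DERIV_mult[OF DERIV_mult[OF poly_DERIV d1] d2] by (simp add: y_def)
   also have "((poly (pderiv P) s*y^k + real k*y^(k - 1)*(2 * s*y^2)*poly P s)*exp (- y) + exp (- y)*(- (2 * s*y^2))*(poly P s*y^k))
     = bmp Q (k + 2) s"
   proof -
    have yu: "y*(1 - s^2) = 1" using pos by (simp add: y_def)
    have k1: "real k*y^(k - 1)*y^2 = real k*y^(k + 2)*(1 - s^2)"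
    proof (cases k)
     case (Suc j)
     have "y^(k + 2)*(1 - s^2) = y^j*y^2*(y*(1 - s^2))" by (simp add: Suc power_add power2_eq_square mult_ac)
     also have "... = y^(k - 1)*y^2" unfolding yu by (simp add: Suc)
     finally show ?thesis by (simp only: mult.assoc)
    qed simp
    have k2: "y^k = y^(k + 2)*(1 - s^2)^2"
    proof -
     have "y^(k + 2)*(1 - s^2)^2 = y^k*(y*(1 - s^2))*(y*(1 - s^2))" by (simp add: power_add power2_eq_square mult_ac)
     then show ?thesis using yu by simp
    qed
    have "bmp Q (k + 2) s = poly Q s*y^(k + 2)*exp (- y)" using 1 by (simp add: bmp_def y_def)
    also have "... = (poly (pderiv P) s*(y^(k + 2)*(1 - s^2)^2) + 2 * s*poly P s*(real k*y^(k + 2)*(1 - s^2)) - 2 * s*poly P s*y^(k + 2))*exp (- y)"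
     unfolding pQ by (simp add: algebra_simps)
    also have "... = (poly (pderiv P) s*y^k + 2 * s*poly P s*(real k*y^(k - 1)*y^2) - 2 * s*poly P s*y^(k + 2))*exp (- y)"
     unfolding k1 k2[symmetric] ..
    also have "y^(k + 2) = y^k*y^2" by (simp add: power_add power2_eq_square)
    finally show ?thesis by (simp add: algebra_simps)
   qed
   finally have d: "DERIV (\<lambda>s. poly P s*(1/(1 - s^2))^k*exp (- (1/(1 - s^2)))) s :> bmp Q (k + 2) s" .
   show ?thesis
    by (rule has_field_derivative_transform_within[OF d, where d = "1 - \<bar>s\<bar>"])
     (use 1 in \<open>auto simp: bmp_def dist_real_def\<close>)
  next
   case 2
   have "DERIV (\<lambda>s. 0) s :> 0" by simp
   then have "DERIV (bmp P k) s :> 0"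
    by (rule has_field_derivative_transform_within[where d = "\<bar>s\<bar> - 1"]) (use 2 in \<open>auto simp: bmp_def dist_real_def\<close>)
   then show ?thesis using 2 by (simp add: bmp_def)
  next
   case 3
   obtain C where C: "C >= 0" "\<And>s. \<bar>bmp P k s\<bar> <= C*(1 - s^2)^2" using bmp_bound_quadratic by blast
   have z: "bmp P k s = 0" using 3 by (simp add: bmp_def)
   have "DERIV (bmp P k) s :> 0"
    unfolding DERIV_def
   proof (rule Lim_null_comparison)
    have "((\<lambda>h. C*(2 * s + h)^2*\<bar>h\<bar>) ---> C*(2 * s + 0)^2*\<bar>0\<bar>) (at 0)" by (intro tendsto_intros)
    then show "((\<lambda>h. C*(2 * s + h)^2*\<bar>h\<bar>) ---> 0) (at 0)" by simp
    show "\<forall>\<^sub>F h in at 0. norm ((bmp P k (s + h) - bmp P k s)/h) <= C*(2 * s + h)^2*\<bar>h\<bar>"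
     unfolding eventually_at_filter
    proof (rule always_eventually, intro allI impI)
     fix h :: real assume h: "h \<noteq> 0"
     have "s^2 = 1" using 3 by (simp add: abs_square_eq_1)
     then have "1 - (s + h)^2 = - h*(2 * s + h)" by (simp add: power2_eq_square algebra_simps)
     then have "\<bar>bmp P k (s + h)\<bar> <= C*(2 * s + h)^2*\<bar>h\<bar>*\<bar>h\<bar>"
      using C(2)[of "s + h"] by (simp add: power_mult_distrib power2_eq_square mult_ac)
     then show "norm ((bmp P k (s + h) - bmp P k s)/h) <= C*(2 * s + h)^2*\<bar>h\<bar>"
      using h by (simp add: z pos_divide_le_eq)
    qed
   qed
   then show ?thesis using 3 by (simp add: bmp_def)
  qed
 qed
 then show ?thesis by blast
qed

lemma bmp_cont: "continuous_on UNIV (bmp P k)"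
 using bmp_deriv[of P k] DERIV_continuous_UNIV by blast

lemma bmp_smult: "bmp (smult c P) k s = c*bmp P k s" by (simp add: bmp_def)

text \<open>Products of one-dimensional bumps in the two coordinates, centred at \<open>z\<close>
  with scale \<open>d\<close>. The family is closed under partial derivatives, so smoothness follows
  by induction on the list of derivatives.\<close>

definition pf :: "real => real^2 => real poly => nat => real poly => nat => real^2 => real" where
 "pf d z P j Q k y = bmp P j ((y $ 1 - z $ 1)/d)*bmp Q k ((y $ 2 - z $ 2)/d)"

lemma pf_cont: "continuous_on UNIV (pf d z P j Q k)"
 unfolding pf_def[abs_def] divide_inverse
 by (intro continuous_intros continuous_on_compose2[OF bmp_cont]) auto

lemma bmp_affine_deriv:
 assumes "\<And>s. DERIV (bmp P j) s :> bmp P' (j + 2) s"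
 shows "DERIV (\<lambda>t. bmp P j ((x + t)/d)) 0 :> bmp (smult (1/d) P') (j + 2) (x/d)"
proof -
 have "DERIV (\<lambda>t. (x + t)/d) 0 :> 1/d"
  unfolding divide_inverse by (auto intro!: derivative_eq_intros)
 from DERIV_chain'[OF this, of "bmp P j" "bmp P' (j + 2) ((x + 0)/d)"] assms show ?thesis
  by (simp add: bmp_smult)
qed

lemma pf_partial:
 "\<exists>P' j' Q' k'. \<forall>y. DERIV (\<lambda>t. pf d z P j Q k (y + t *\<^sub>R axis i 1)) 0 :> pf d z P' j' Q' k' y"
proof (cases "i = 1")
 case True
 obtain P' where P': "\<And>s. DERIV (bmp P j) s :> bmp P' (j + 2) s" using bmp_deriv by blast
 have "DERIV (\<lambda>t. pf d z P j Q k (y + t *\<^sub>R axis i 1)) 0 :> pf d z (smult (1/d) P') (j + 2) Q k y" for y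
 proof -
  have "(\<lambda>t. pf d z P j Q k (y + t *\<^sub>R axis i 1)) = (\<lambda>t. bmp P j ((y $ 1 - z $ 1 + t)/d)*bmp Q k ((y $ 2 - z $ 2)/d))"
   unfolding True by (auto simp: pf_def axis_def algebra_simps)
  then show ?thesis
   using DERIV_cmult_right[OF bmp_affine_deriv[OF P', of "y $ 1 - z $ 1" d], of "bmp Q k ((y $ 2 - z $ 2)/d)"]
   by (simp add: pf_def)
 qed
 then show ?thesis by blast
next
 case False
 then have i2: "i = 2" using exhaust_2 by blast
 obtain Q' where Q': "\<And>s. DERIV (bmp Q k) s :> bmp Q' (k + 2) s" using bmp_deriv by blast
 have "DERIV (\<lambda>t. pf d z P j Q k (y + t *\<^sub>R axis i 1)) 0 :> pf d z P j (smult (1/d) Q') (k + 2) y" for y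
 proof -
  have "(\<lambda>t. pf d z P j Q k (y + t *\<^sub>R axis i 1)) = (\<lambda>t. bmp P j ((y $ 1 - z $ 1)/d)*bmp Q k ((y $ 2 - z $ 2 + t)/d))"
   unfolding i2 by (auto simp: pf_def axis_def algebra_simps)
  then show ?thesis
   using DERIV_cmult[OF bmp_affine_deriv[OF Q', of "y $ 2 - z $ 2" d], of "bmp P j ((y $ 1 - z $ 1)/d)"]
   by (simp add: pf_def)
 qed
 then show ?thesis by blast
qed

lemma pf_foldr: "\<exists>P' j' Q' k'. foldr partial js (pf d z P j Q k) = pf d z P' j' Q' k'"
proof (induction js)
 case (Cons i js)
 then obtain P' j' Q' k' where eq: "foldr partial js (pf d z P j Q k) = pf d z P' j' Q' k'" by blast
 obtain P2 j2 Q2 k2 where d: "\<And>y. DERIV (\<lambda>t. pf d z P' j' Q' k' (y + t *\<^sub>R axis i 1)) 0 :> pf d z P2 j2 Q2 k2 y"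
  using pf_partial by blast
 have "partial i (pf d z P' j' Q' k') = pf d z P2 j2 Q2 k2"
  unfolding partial_def using d by (auto intro!: DERIV_imp_deriv)
 then show ?case using eq by auto
qed auto

lemma pf_test_function:
 assumes d: "d > 0"
 shows "test_function (pf d z P j Q k)"
 unfolding test_function_def smooth_def Ck_def
proof (intro conjI allI impI)
 fix js :: "2 list"
 show "continuous_on UNIV (foldr partial js (pf d z P j Q k))"
  using pf_foldr[of js d z P j Q k] pf_cont by metis
 fix i x
 obtain P' j' Q' k' where "foldr partial js (pf d z P j Q k) = pf d z P' j' Q' k'" using pf_foldr by blast
 then show "(\<lambda>t. foldr partial js (pf d z P j Q k) (x + t *\<^sub>R axis i 1)) differentiable at 0"
  using pf_partial[of d z P' j' Q' k' i] by (auto simp: real_differentiable_def)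
next
 show "\<exists>R. \<forall>x. norm x > R \<longrightarrow> pf d z P j Q k x = 0"
 proof (intro exI[of _ "norm z + 2*d"] allI impI)
  fix x :: "real^2" assume x: "norm z + 2*d < norm x"
  have "norm x <= norm z + norm (x - z)" using norm_triangle_ineq[of z "x - z"] by simp
  then have "2*d < norm (x - z)" using x by linarith
  also have "norm (x - z) <= \<bar>x $ 1 - z $ 1\<bar> + \<bar>x $ 2 - z $ 2\<bar>"
   using norm_le_l1_cart[of "x - z"] by (simp add: sum_2)
  finally have "d <= \<bar>x $ 1 - z $ 1\<bar> \<or> d <= \<bar>x $ 2 - z $ 2\<bar>" by linarith
  then have "1 <= \<bar>(x $ 1 - z $ 1)/d\<bar> \<or> 1 <= \<bar>(x $ 2 - z $ 2)/d\<bar>"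
   using d by (auto simp: abs_divide)
  then show "pf d z P j Q k x = 0" by (auto simp: pf_def bmp_def)
 qed
qed

lemma le_1_plus_square: "(t::real) <= 1 + t^2"
proof -
 have "0 <= (t - 1/2)^2" by simp
 then show ?thesis by (simp add: power2_diff power2_eq_square field_simps)
qed

text \<open>A weight of total mass at most 1 is enough: putting 1 for the mass only enlarges the
  expanded variance. If the right side is infinite there is nothing to prove.\<close>

lemma jensen_square:
 fixes G :: "'a => complex"
 assumes [measurable]: "G \<in> borel_measurable M" and W: "integrable M W" "\<And>x. 0 <= W x" "(LINT x|M. W x) <= 1"
 shows "ennreal ((cmod (LINT x|M. G x * of_real (W x)))^2) <= (\<integral>\<^sup>+x. ennreal ((cmod (G x))^2*W x) \<partial>M)"
proof (cases "(\<integral>\<^sup>+x. ennreal ((cmod (G x))^2*W x) \<partial>M) = \<infinity>")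
 case False
 have [measurable]: "W \<in> borel_measurable M" using W by auto
 have i2: "integrable M (\<lambda>x. (cmod (G x))^2*W x)"
  using False W(2) by (intro integrableI_nonneg) (auto simp: top.not_eq_extremum)
 have i1: "integrable M (\<lambda>x. cmod (G x)*W x)"
 proof (rule Bochner_Integration.integrable_bound)
  show "integrable M (\<lambda>x. W x + (cmod (G x))^2*W x)" by (intro Bochner_Integration.integrable_add W i2)
  have "cmod (G x)*W x <= (1 + (cmod (G x))^2)*W x" for x
   by (intro mult_right_mono W le_1_plus_square)
  then show "AE x in M. norm (cmod (G x)*W x) <= norm (W x + (cmod (G x))^2*W x)"
   using W(2) by (simp add: abs_mult distrib_right)
 qed measurable
 define b where "b = (LINT x|M. cmod (G x)*W x)"
 have "0 <= (LINT x|M. (cmod (G x) - b)^2*W x)" using W(2) by (intro integral_nonneg_AE) auto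
 also have "... = (LINT x|M. (cmod (G x))^2*W x - 2*b*(cmod (G x)*W x) + b^2*W x)"
  by (simp add: power2_diff algebra_simps)
 also have "... = (LINT x|M. (cmod (G x))^2*W x) - 2*b*b + b^2*(LINT x|M. W x)"
  using i1 i2 W(1) by (simp add: b_def)
 also have "... <= (LINT x|M. (cmod (G x))^2*W x) - 2*b*b + b^2*1"
  by (intro add_left_mono mult_left_mono W(3)) simp
 finally have le: "b^2 <= (LINT x|M. (cmod (G x))^2*W x)" by (simp add: power2_eq_square)
 have "cmod (LINT x|M. G x * of_real (W x)) <= (LINT x|M. norm (G x * of_real (W x)))" by (rule integral_norm_bound)
 also have "... = b" using W(2) by (simp add: b_def norm_mult)
 finally have "(cmod (LINT x|M. G x * of_real (W x)))^2 <= b^2" by (intro power_mono) auto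
 with le have "(cmod (LINT x|M. G x * of_real (W x)))^2 <= (LINT x|M. (cmod (G x))^2*W x)" by linarith
 then have "ennreal ((cmod (LINT x|M. G x * of_real (W x)))^2) <= ennreal (LINT x|M. (cmod (G x))^2*W x)" by (rule ennreal_leI)
 also have "... = (\<integral>\<^sup>+x. ennreal ((cmod (G x))^2*W x) \<partial>M)"
  using W(2) by (intro nn_integral_eq_integral[symmetric] i2) auto
 finally show ?thesis .
qed simp

lemma continuous_support_bound:
 fixes h :: "real^2 => real"
 assumes c: "continuous_on UNIV h" and s: "\<And>x. norm x > r ==> h x = 0"
 obtains B where "B >= 0" "\<And>x. \<bar>h x\<bar> <= B*iball r x"
proof -
 have "bounded (h ` cball 0 r)"
  by (intro compact_imp_bounded compact_continuous_image continuous_on_subset[OF c]) auto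
 then obtain B where B: "B > 0" "\<forall>x\<in>cball 0 r. norm (h x) <= B"
  unfolding bounded_pos by (auto simp del: mem_cball)
 have "\<bar>h x\<bar> <= B*iball r x" for x
  using B s[of x] by (cases "norm x <= r") (auto simp: iball_def)
 then show ?thesis using that[of B] B(1) by simp
qed

text \<open>The derivative is carried along in two forms: along segments, for writing increments as
  integrals, and as \<open>partial\<close> of shifted copies, which is the form in which
  \<open>weak_gradient\<close> tests.\<close>

locale mollifier =
 fixes r :: real and \<phi> :: "real^2 => real" and \<phi>' :: "2 => real^2 => real"
 assumes r: "r > 0" and phi_nonneg: "0 <= \<phi> x" and phi_cont: "continuous_on UNIV \<phi>"
  and phi_supp: "norm x > r ==> \<phi> x = 0" and phi_int: "(LBINT x. \<phi> x) = 1"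
  and dphi_cont: "continuous_on UNIV (\<phi>' i)" and dphi_supp: "norm x > r ==> \<phi>' i x = 0"
  and phi_deriv: "DERIV (\<lambda>s. \<phi> (x + s *\<^sub>R k)) s :> (\<Sum>i\<in>UNIV. k $ i*\<phi>' i (x + s *\<^sub>R k))"
  and phi_test: "test_function (\<lambda>y. \<phi> (y - z))" and phi_partial: "partial i (\<lambda>y. \<phi> (y - z)) y = \<phi>' i (y - z)"

lemma mollifier_exists:
 assumes r: "r > 0"
 shows "\<exists>\<phi> \<phi>'. mollifier r \<phi> \<phi>'"
proof -
 \<comment> \<open>The product bump lives on the square \<open>|x1|, |x2| < d\<close>, and
   \<open>|x| <= |x1| + |x2|\<close> puts it inside the disc of radius
   \<open>2 * d = r\<close>.\<close>
 define d where "d = r/2"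
 have d: "d > 0" using r by (simp add: d_def)
 define b where "b = bmp 1 0"
 have b_nonneg: "b s >= 0" for s by (simp add: b_def bmp_def)
 have b_supp: "b s = 0" if "\<bar>s\<bar> >= 1" for s using that by (simp add: b_def bmp_def)
 have b0: "b s > 0" if "\<bar>s\<bar> < 1" for s using that by (simp add: b_def bmp_def)
 obtain P where P: "\<And>s. DERIV b s :> bmp P 2 s" using bmp_deriv[of 1 0] unfolding b_def add_0 by blast
 define b' where "b' = bmp P 2"
 have b'_supp: "b' s = 0" if "\<bar>s\<bar> >= 1" for s using that by (simp add: b'_def bmp_def)
 define h where "h = (\<lambda>x::real^2. b (x $ 1/d)*b (x $ 2/d))"
 have hpf: "h (y - z) = pf d z 1 0 1 0 y" for y z by (simp add: h_def pf_def b_def)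
 have far: "1 <= \<bar>x $ 1/d\<bar> \<or> 1 <= \<bar>x $ 2/d\<bar>" if "norm x > r" for x :: "real^2"
 proof -
  have "2*d < norm x" using that by (simp add: d_def)
  also have "norm x <= \<bar>x $ 1\<bar> + \<bar>x $ 2\<bar>" using norm_le_l1_cart[of x] by (simp add: sum_2)
  finally have "d <= \<bar>x $ 1\<bar> \<or> d <= \<bar>x $ 2\<bar>" by linarith
  then show ?thesis using d by (auto simp: abs_divide)
 qed
 have h_supp: "h x = 0" if "norm x > r" for x using far[OF that] b_supp by (auto simp: h_def)
 have h_nonneg: "h x >= 0" for x by (simp add: h_def b_nonneg)
 have h_cont: "continuous_on UNIV h" using pf_cont[of d 0 1 0 1 0] hpf[of _ 0] by (simp add: fun_eq_iff[symmetric])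
 have [measurable]: "h \<in> \<B>" by (rule borel_measurable_continuous_onI[OF h_cont])
 obtain B where B: "\<And>x. \<bar>h x\<bar> <= B*iball r x" using continuous_support_bound[OF h_cont h_supp] by blast
 have h_int: "integrable lborel h" by (rule integrable_iball_mult[OF _ B]) measurable
 define c where "c = (LBINT x. h x)"
 have "c \<noteq> 0"
 proof
  assume "c = 0"
  then have "AE x in lborel. h x = 0"
   unfolding c_def by (subst (asm) integral_nonneg_eq_0_iff_AE[OF h_int]) (use h_nonneg in auto)
  moreover have "x \<notin> ball 0 d" if "h x = 0" for x :: "real^2"
  proof
   assume "x \<in> ball 0 d"
   then have "\<bar>x $ 1\<bar> < d" "\<bar>x $ 2\<bar> < d" using component_le_norm_cart[of x] by (auto intro: le_less_trans)
   then have "h x > 0" unfolding h_def using d by (intro mult_pos_pos b0) (auto simp: abs_divide)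
   then show False using that by simp
  qed
  ultimately have "AE x in lborel. x \<notin> ball 0 (d::real) \<inter> (UNIV :: (real^2) set)" by auto
  then have "emeasure lborel (ball 0 d :: (real^2) set) = 0"
   by (subst (asm) AE_iff_measurable[OF _ refl]) (auto simp: ball_def)
  then show False using content_ball_pos[OF d, of "0::real^2"] by (simp add: measure_def)
 qed
 moreover have "c >= 0" unfolding c_def using h_nonneg by (intro integral_nonneg_AE) auto
 ultimately have c: "c > 0" by simp
 define \<phi> where "\<phi> = (\<lambda>x. h x/c)"
 define \<phi>' where "\<phi>' = (\<lambda>i::2. \<lambda>x::real^2. (if i = 1 then b' (x $ 1/d)*b (x $ 2/d) else b (x $ 1/d)*b' (x $ 2/d))/(c*d))"
 have pfs: "(\<lambda>y. \<phi> (y - z)) = pf d z [:1/c:] 0 1 0" for z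
  by (auto simp: \<phi>_def hpf pf_def bmp_def)
 have deriv: "DERIV (\<lambda>s. \<phi> (x + s *\<^sub>R k)) s :> (\<Sum>i\<in>UNIV. k $ i*\<phi>' i (x + s *\<^sub>R k))" for x k s
 proof -
  have D: "DERIV (\<lambda>s. b ((x + s *\<^sub>R k) $ i/d)) s :> b' ((x + s *\<^sub>R k) $ i/d)*(k $ i/d)" for i
  proof -
   have "DERIV (\<lambda>s. (x + s *\<^sub>R k) $ i/d) s :> k $ i/d"
    unfolding vector_add_component vector_scaleR_component divide_inverse by (auto intro!: derivative_eq_intros)
   from DERIV_chain'[OF this P] show ?thesis by (simp add: b'_def mult.commute)
  qed
  have "DERIV (\<lambda>s. \<phi> (x + s *\<^sub>R k)) s :> (b' ((x + s *\<^sub>R k) $ 1/d)*(k $ 1/d)*b ((x + s *\<^sub>R k) $ 2/d)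
   + b' ((x + s *\<^sub>R k) $ 2/d)*(k $ 2/d)*b ((x + s *\<^sub>R k) $ 1/d))/c"
   unfolding \<phi>_def h_def by (intro DERIV_cdivide DERIV_mult D)
  also have "(b' ((x + s *\<^sub>R k) $ 1/d)*(k $ 1/d)*b ((x + s *\<^sub>R k) $ 2/d)
   + b' ((x + s *\<^sub>R k) $ 2/d)*(k $ 2/d)*b ((x + s *\<^sub>R k) $ 1/d))/c = (\<Sum>i\<in>UNIV. k $ i*\<phi>' i (x + s *\<^sub>R k))"
   using c d unfolding \<phi>'_def sum_2 by (simp add: field_simps)
  finally show ?thesis .
 qed
 have bc: "continuous_on UNIV (\<lambda>x::real^2. b (x $ i/d))" "continuous_on UNIV (\<lambda>x::real^2. b' (x $ i/d))" for i
  unfolding b_def b'_def using d by (intro continuous_on_compose2[OF bmp_cont] continuous_intros; simp)+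
 have "mollifier r \<phi> \<phi>'"
 proof
  show "0 <= \<phi> x" for x using c h_nonneg by (simp add: \<phi>_def)
  show "continuous_on UNIV \<phi>" unfolding \<phi>_def using c by (intro continuous_intros h_cont) auto
  show "\<phi> x = 0" if "norm x > r" for x using h_supp[OF that] by (simp add: \<phi>_def)
  show "(LBINT x. \<phi> x) = 1" using c by (simp add: \<phi>_def c_def[symmetric])
  show "continuous_on UNIV (\<phi>' i)" for i
   unfolding \<phi>'_def using c d by (cases "i = 1") (simp, intro continuous_intros bc; simp)+
  show "\<phi>' i x = 0" if "norm x > r" for x i using far[OF that] b_supp b'_supp by (auto simp: \<phi>'_def)
  show "test_function (\<lambda>y. \<phi> (y - z))" for z unfolding pfs by (rule pf_test_function[OF d])
  show "partial i (\<lambda>y. \<phi> (y - z)) y = \<phi>' i (y - z)" for i z y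
  proof -
   have "(\<Sum>j\<in>UNIV. axis i 1 $ j*\<phi>' j (y - z + 0 *\<^sub>R axis i 1)) = \<phi>' i (y - z)"
   proof -
    have "(\<Sum>j\<in>UNIV. axis i 1 $ j*\<phi>' j (y - z + 0 *\<^sub>R axis i 1)) = (\<Sum>j\<in>UNIV. if j = i then \<phi>' i (y - z) else 0)"
     by (intro sum.cong) (auto simp: axis_def)
    then show ?thesis by simp
   qed
   with deriv[of "y - z" "axis i 1" 0] show ?thesis
    unfolding partial_def by (intro DERIV_imp_deriv) (simp add: algebra_simps)
  qed
 qed (use r deriv in auto)
 then show ?thesis by blast
qed


lemma integrable_prod_mult:
 fixes a :: "'a::euclidean_space => real" and b :: "'b::euclidean_space => real"
 assumes a: "integrable lborel a" and b: "integrable lborel b"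
 shows "integrable lborel2 (\<lambda>p. a (fst p)*b (snd p))"
proof (rule lborel_pair.Fubini_integrable)
 have [measurable]: "a \<in> \<B>" "b \<in> \<B>" using a b by auto
 show "(\<lambda>p. a (fst p)*b (snd p)) \<in> borel_measurable lborel2" by measurable
 have "integrable lborel (\<lambda>x. \<bar>a x\<bar>*(LBINT y. \<bar>b y\<bar>))"
  by (intro integrable_mult_left integrable_abs a)
 then show "integrable lborel (\<lambda>x. LBINT y. norm (a (fst (x, y))*b (snd (x, y))))"
  by (simp add: abs_mult)
qed (use b in auto)

text \<open>Convolution with the reflected kernel, so that the shifted \<open>\<phi>\<close> appears
  directly as a test function in \<open>y\<close>.\<close>

definition mol :: "(real^2 => real) => (real^2 => complex) => real^2 => complex" where
 "mol \<phi> u z = (LBINT y. u y * of_real (\<phi> (y - z)))"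

lemma mol_measurable [measurable]:
 assumes [measurable]: "\<phi> \<in> \<B>" "u \<in> \<B>"
 shows "mol \<phi> u \<in> \<B>"
 unfolding mol_def by measurable

lemma integrable_iball_L2:
 fixes u :: "real^2 => complex"
 assumes [measurable]: "u \<in> \<B>" and u: "integrable lborel (\<lambda>x. (cmod (u x))^2)"
 shows "integrable lborel (\<lambda>x. iball R x*cmod (u x))"
proof (rule Bochner_Integration.integrable_bound)
 show "integrable lborel (\<lambda>x. iball R x + (cmod (u x))^2)" by (intro Bochner_Integration.integrable_add u integrable_iball)
 show "AE x in lborel. norm (iball R x*cmod (u x)) <= norm (iball R x + (cmod (u x))^2)"
  using le_1_plus_square by (auto simp: iball_def indicator_def)
qed measurable

lemma integrable_L2_mult:
 fixes u :: "real^2 => complex"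
 assumes [measurable]: "u \<in> \<B>" "h \<in> \<B>"
  and u: "integrable lborel (\<lambda>x. (cmod (u x))^2)" and h: "\<And>x. \<bar>h x\<bar> <= C*iball R x"
 shows "integrable lborel (\<lambda>x. u x * of_real (h x))"
proof (rule Bochner_Integration.integrable_bound)
 show "integrable lborel (\<lambda>x. C*(iball R x*cmod (u x)))" by (intro integrable_mult_right integrable_iball_L2 u) measurable
 have "cmod (u x)*\<bar>h x\<bar> <= cmod (u x)*(C*iball R x)" for x by (intro mult_left_mono h) simp
 then show "AE x in lborel. norm (u x * of_real (h x)) <= norm (C*(iball R x*cmod (u x)))"
  by (auto simp: norm_mult mult_ac intro: order_trans[OF _ abs_ge_self])
qed measurable

lemma iball_shift: "norm z <= s ==> iball r (y - z) <= iball (r + s) y"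
 using norm_triangle_ineq[of "y - z" z] by (auto simp: iball_def indicator_def)

context mollifier
begin

lemma phi_measurable [measurable]: "\<phi> \<in> \<B>" "\<phi>' i \<in> \<B>"
 by (intro borel_measurable_continuous_onI phi_cont dphi_cont)+

lemma phi_bound: obtains B where "B >= 0" "\<And>x. \<bar>\<phi> x\<bar> <= B*iball r x"
 using continuous_support_bound[OF phi_cont phi_supp] by blast

lemma dphi_bound: obtains B where "B >= 0" "\<And>x. \<bar>\<phi>' i x\<bar> <= B*iball r x"
 using continuous_support_bound[OF dphi_cont dphi_supp] by blast

lemma phi_shift_bound:
 "\<exists>B\<ge>0. \<forall>z y s. norm z <= s \<longrightarrow> \<bar>\<phi> (y - z)\<bar> <= B*iball (r + s) y"
proof -
 obtain B where B: "B >= 0" "\<And>x. \<bar>\<phi> x\<bar> <= B*iball r x" using phi_bound by blast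
 have "\<bar>\<phi> (y - z)\<bar> <= B*iball (r + s) y" if "norm z <= s" for z y s
  using order_trans[OF B(2)[of "y - z"] mult_left_mono[OF iball_shift[OF that] B(1)]] .
 then show ?thesis using B(1) by blast
qed

lemma dphi_shift_bound:
 "\<exists>B\<ge>0. \<forall>z y s. norm z <= s \<longrightarrow> \<bar>\<phi>' i (y - z)\<bar> <= B*iball (r + s) y"
proof -
 obtain B where B: "B >= 0" "\<And>x. \<bar>\<phi>' i x\<bar> <= B*iball r x" using dphi_bound by blast
 have "\<bar>\<phi>' i (y - z)\<bar> <= B*iball (r + s) y" if "norm z <= s" for z y s
  using order_trans[OF B(2)[of "y - z"] mult_left_mono[OF iball_shift[OF that] B(1)]] .
 then show ?thesis using B(1) by blast
qed

lemma phi_integrable: "integrable lborel \<phi>"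
proof -
 obtain B where "\<And>x. \<bar>\<phi> x\<bar> <= B*iball r x" using phi_bound by blast
 then show ?thesis by (rule integrable_iball_mult[rotated]) measurable
qed

lemma phi_nn: "(NN z. ennreal (\<phi> z)) = 1"
 using nn_integral_eq_integral[OF phi_integrable] phi_nonneg phi_int by simp

lemma phi_nn_reflect: "(NN z. ennreal (\<phi> (a - z))) = 1"
proof -
 have "(NN z. ennreal (\<phi> (a - z))) = (\<integral>\<^sup>+z. ennreal (\<phi> z) \<partial>distr lborel borel (\<lambda>z. a - z))"
  by (subst nn_integral_distr) auto
 then show ?thesis by (simp add: distr_reflect phi_nn)
qed

lemma phi_nn_shift: "(NN y. ennreal (\<phi> (y - a))) = 1"
proof -
 have "(NN y. ennreal (\<phi> (y - a))) = (\<integral>\<^sup>+y. ennreal (\<phi> y) \<partial>distr lborel borel ((+) (- a)))"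
  by (subst nn_integral_distr) auto
 then show ?thesis by (simp add: lborel_distr_plus phi_nn)
qed

lemma phi_shift_integrable: "integrable lborel (\<lambda>y. \<phi> (y - a))" "(LBINT y. \<phi> (y - a)) = 1"
proof -
 show i: "integrable lborel (\<lambda>y. \<phi> (y - a))"
  using phi_nn_shift[of a] phi_nonneg by (intro integrableI_nonneg) auto
 have "ennreal (LBINT y. \<phi> (y - a)) = ennreal 1"
  using nn_integral_eq_integral[OF i] phi_nonneg phi_nn_shift[of a] by simp
 then show "(LBINT y. \<phi> (y - a)) = 1" using phi_nonneg by (subst (asm) ennreal_inj) (auto intro: integral_nonneg_AE)
qed

lemma phi_segment:
 "(LBINT s. (\<Sum>i\<in>UNIV. k $ i*\<phi>' i (y - z - s *\<^sub>R k))*indicator {0..1} s) = \<phi> (y - z) - \<phi> (y - z - k)"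
proof -
 have "DERIV (\<lambda>s. - \<phi> (y - z - s *\<^sub>R k)) s :> (\<Sum>i\<in>UNIV. k $ i*\<phi>' i (y - z - s *\<^sub>R k))" for s
  using DERIV_minus[OF phi_deriv[where x = "y - z" and k = "- k" and s = s]] by (simp add: sum_negf)
 moreover have "isCont (\<lambda>s. \<Sum>i\<in>UNIV. k $ i*\<phi>' i (y - z - s *\<^sub>R k)) s" for s
 proof -
  have "continuous_on UNIV (\<lambda>s. \<Sum>i\<in>UNIV. k $ i*\<phi>' i (y - z - s *\<^sub>R k))"
   by (intro continuous_intros continuous_on_compose2[OF dphi_cont]) auto
  then show ?thesis by (simp add: continuous_on_eq_continuous_at)
 qed
 ultimately show ?thesis
  by (subst integral_FTC_Icc_real[where F = "\<lambda>s. - \<phi> (y - z - s *\<^sub>R k)"]) auto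
qed

lemma segment_integrable:
 fixes w :: "real^2 => complex"
 assumes [measurable]: "w \<in> \<B>" "h \<in> \<B>"
  and w: "integrable lborel (\<lambda>x. (cmod (w x))^2)"
  and h: "B >= 0" "\<And>z y s. norm z <= s ==> \<bar>h (y - z)\<bar> <= B*iball (r + s) y"
 shows "integrable lborel2 (\<lambda>(s, y). w y * of_real (indicator {0..1} s*h (y - (z + s *\<^sub>R k))))"
proof (rule Bochner_Integration.integrable_bound)
 let ?R = "r + (norm z + norm k)"
 show "integrable lborel2 (\<lambda>p. indicator {0..1::real} (fst p)*(B*(iball ?R (snd p)*cmod (w (snd p)))))"
  by (rule integrable_prod_mult[of "indicator {0..1}" "\<lambda>y. B*(iball ?R y*cmod (w y))"])
   (auto intro!: integrable_real_indicator integrable_mult_right integrable_iball_L2 w)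
 have "cmod (w y)*(indicator {0..1} s*\<bar>h (y - (z + s *\<^sub>R k))\<bar>) <= indicator {0..1} s*(B*(iball ?R y*cmod (w y)))" for s y
 proof (cases "s \<in> {0..1}")
  case True
  then have "norm (s *\<^sub>R k) <= norm k" by (simp add: mult_left_le_one_le)
  then have "norm (z + s *\<^sub>R k) <= norm z + norm k" using norm_triangle_ineq[of z "s *\<^sub>R k"] by linarith
  from mult_left_mono[OF h(2)[OF this, of y], of "cmod (w y)"] True show ?thesis by (simp add: mult_ac)
 qed simp
 then show "AE p in lborel2. norm (case p of (s, y) => w y * of_real (indicator {0..1} s*h (y - (z + s *\<^sub>R k))))
   <= norm (indicator {0..1::real} (fst p)*(B*(iball ?R (snd p)*cmod (w (snd p)))))"
  using h(1) by (intro AE_I2) (simp add: case_prod_beta' norm_mult abs_mult iball_nonneg)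
qed measurable

lemma mol_integrable:
 assumes [measurable]: "u \<in> \<B>" and u: "integrable lborel (\<lambda>x. (cmod (u x))^2)"
 shows "integrable lborel (\<lambda>y. u y * of_real (\<phi> (y - z)))" "integrable lborel (\<lambda>y. u y * of_real (\<phi>' i (y - z)))"
proof -
 obtain B where "B >= 0" and B: "\<And>z y s. norm z <= s ==> \<bar>\<phi> (y - z)\<bar> <= B*iball (r + s) y" using phi_shift_bound by blast
 show "integrable lborel (\<lambda>y. u y * of_real (\<phi> (y - z)))"
  by (rule integrable_L2_mult[OF _ _ u B[OF order_refl]]) measurable
 obtain B where "B >= 0" and B: "\<And>z y s. norm z <= s ==> \<bar>\<phi>' i (y - z)\<bar> <= B*iball (r + s) y" using dphi_shift_bound[of i] by blast
 show "integrable lborel (\<lambda>y. u y * of_real (\<phi>' i (y - z)))"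
  by (rule integrable_L2_mult[OF _ _ u B[OF order_refl]]) measurable
qed


text \<open>The increment of \<open>\<phi>\<close> is the integral of its derivative along the
  segment from \<open>z\<close> to \<open>z + k\<close>. After exchanging integrals, the weak
  gradient moves that derivative to \<open>u\<close> for each point of the segment, which leaves an
  average of the directional derivative of \<open>u\<close>.\<close>

lemma mol_difference:
 assumes [measurable]: "u \<in> \<B>" and u: "integrable lborel (\<lambda>x. (cmod (u x))^2)"
  and wg: "weak_gradient g u" and g: "\<And>i. integrable lborel (\<lambda>x. (cmod (g i x))^2)"
 shows "mol \<phi> u (z + k) - mol \<phi> u z = (LINT p|lborel2.
  (\<Sum>i\<in>UNIV. of_real (k $ i)*g i (snd p)) * of_real (indicator {0..1} (fst p)*\<phi> (snd p - (z + fst p *\<^sub>R k))))"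
proof -
 have [measurable]: "g i \<in> \<B>" for i using wg by (simp add: weak_gradient_def)
 define I where "I = (indicator {0..1} :: real => real)"
 have [measurable]: "I \<in> \<B>" by (simp add: I_def)
 define f where "f = (\<lambda>s y. \<Sum>i\<in>UNIV. of_real (- (k $ i))*(u y*complex_of_real (I s*\<phi>' i (y - (z + s *\<^sub>R k)))))"
 define G where "G = (\<lambda>s y. \<Sum>i\<in>UNIV. of_real (k $ i)*(g i y*complex_of_real (I s*\<phi> (y - (z + s *\<^sub>R k)))))"
 have fi: "integrable lborel2 (case_prod f)"
 proof -
  have "integrable lborel2 (\<lambda>(s, y). u y*complex_of_real (I s*\<phi>' i (y - (z + s *\<^sub>R k))))" for i
  proof -
   obtain B where B: "B >= 0" "\<And>z y s. norm z <= s ==> \<bar>\<phi>' i (y - z)\<bar> <= B*iball (r + s) y" using dphi_shift_bound[of i] by blast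
   show ?thesis unfolding I_def by (rule segment_integrable[OF _ _ u B]) auto
  qed
  then have "integrable lborel2 (\<lambda>p. \<Sum>i\<in>UNIV. of_real (- (k $ i))*(case p of (s, y) => u y*complex_of_real (I s*\<phi>' i (y - (z + s *\<^sub>R k)))))"
   by (intro Bochner_Integration.integrable_sum integrable_mult_right)
  then show ?thesis unfolding f_def case_prod_beta' .
 qed
 have Gi: "integrable lborel2 (case_prod G)"
 proof -
  obtain B where B: "B >= 0" "\<And>z y s. norm z <= s ==> \<bar>\<phi> (y - z)\<bar> <= B*iball (r + s) y" using phi_shift_bound by blast
  have "integrable lborel2 (\<lambda>(s, y). g i y*complex_of_real (I s*\<phi> (y - (z + s *\<^sub>R k))))" for i
   unfolding I_def by (rule segment_integrable[OF _ _ g B]) auto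
  then have "integrable lborel2 (\<lambda>p. \<Sum>i\<in>UNIV. of_real (k $ i)*(case p of (s, y) => g i y*complex_of_real (I s*\<phi> (y - (z + s *\<^sub>R k)))))"
   by (intro Bochner_Integration.integrable_sum integrable_mult_right)
  then show ?thesis unfolding G_def case_prod_beta' .
 qed
 have seg: "(LBINT s. f s y) = u y * of_real (\<phi> (y - (z + k)) - \<phi> (y - z))" for y
 proof -
  have "f s y = - u y*complex_of_real ((\<Sum>i\<in>UNIV. k $ i*\<phi>' i (y - z - s *\<^sub>R k))*indicator {0..1} s)" for s
   by (simp add: f_def I_def sum_distrib_left sum_distrib_right sum_negf algebra_simps)
  then have "(LBINT s. f s y) = - u y*complex_of_real (LBINT s. (\<Sum>i\<in>UNIV. k $ i*\<phi>' i (y - z - s *\<^sub>R k))*indicator {0..1} s)"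
   by (simp only: integral_mult_right_zero integral_complex_of_real)
  then show ?thesis unfolding phi_segment by (simp add: algebra_simps)
 qed
 have test: "(LBINT y. f s y) = (LBINT y. G s y)" for s
 proof -
  have wgi: "(LBINT y. u y*complex_of_real (\<phi>' i (y - (z + s *\<^sub>R k)))) = - (LBINT y. g i y*complex_of_real (\<phi> (y - (z + s *\<^sub>R k))))" for i
  proof -
   have "(LBINT y. u y*complex_of_real (partial i (\<lambda>y. \<phi> (y - (z + s *\<^sub>R k))) y)) = - (LBINT y. g i y*complex_of_real (\<phi> (y - (z + s *\<^sub>R k))))"
    using wg phi_test unfolding weak_gradient_def by blast
   then show ?thesis unfolding phi_partial .
  qed
  have "f s y = (\<Sum>i\<in>UNIV. of_real (- (k $ i)*I s)*(u y*complex_of_real (\<phi>' i (y - (z + s *\<^sub>R k)))))" for y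
   by (simp add: f_def mult_ac)
  then have "(LBINT y. f s y) = (\<Sum>i\<in>UNIV. of_real (- (k $ i)*I s)*(LBINT y. u y*complex_of_real (\<phi>' i (y - (z + s *\<^sub>R k)))))"
   by (simp only:) (subst Bochner_Integration.integral_sum, auto intro!: integrable_mult_right mol_integrable u)
  also have "... = (\<Sum>i\<in>UNIV. of_real (k $ i*I s)*(LBINT y. g i y*complex_of_real (\<phi> (y - (z + s *\<^sub>R k)))))"
   unfolding wgi by simp
  also have "... = (LBINT y. (\<Sum>i\<in>UNIV. of_real (k $ i*I s)*(g i y*complex_of_real (\<phi> (y - (z + s *\<^sub>R k))))))"
   by (subst Bochner_Integration.integral_sum) (auto intro!: integrable_mult_right mol_integrable g)
  also have "... = (LBINT y. G s y)" by (simp add: G_def mult_ac)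
  finally show ?thesis .
 qed
 have "mol \<phi> u (z + k) - mol \<phi> u z = (LBINT y. u y * of_real (\<phi> (y - (z + k))) - u y * of_real (\<phi> (y - z)))"
  unfolding mol_def by (intro Bochner_Integration.integral_diff[symmetric] mol_integrable u) measurable
 also have "... = (LBINT y. LBINT s. f s y)"
  unfolding seg by (simp add: algebra_simps)
 also have "... = (LBINT s. LBINT y. f s y)" by (rule lborel_pair.Fubini_integral[OF fi])
 also have "... = (LBINT s. LBINT y. G s y)" unfolding test ..
 also have "... = (LINT p|lborel2. case_prod G p)" by (rule lborel_pair.integral_fst[OF Gi])
 also have "... = (LINT p|lborel2.
  (\<Sum>i\<in>UNIV. of_real (k $ i)*g i (snd p)) * of_real (indicator {0..1} (fst p)*\<phi> (snd p - (z + fst p *\<^sub>R k))))"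
  by (simp add: G_def I_def case_prod_beta' sum_distrib_right mult.assoc)
 finally show ?thesis .
qed

text \<open>The weight \<open>W\<close> in \<open>mol_difference\<close> has total mass 1 in
  \<open>(s, y)\<close> for fixed \<open>z\<close>, so Jensen applies, and total mass 1 in
  \<open>(s, z)\<close> for fixed \<open>y\<close>, so integrating over \<open>z\<close> brings in
  no constant.\<close>

lemma mol_translation:
 assumes [measurable]: "u \<in> \<B>" and u: "integrable lborel (\<lambda>x. (cmod (u x))^2)"
  and wg: "weak_gradient g u" and g: "\<And>i. integrable lborel (\<lambda>x. (cmod (g i x))^2)"
 shows "(NN z. ennreal ((cmod (mol \<phi> u (z + k) - mol \<phi> u z))^2))
  <= (NN y. ennreal ((cmod (\<Sum>i\<in>UNIV. of_real (k $ i)*g i y))^2))"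
proof -
 have [measurable]: "g i \<in> \<B>" for i using wg by (simp add: weak_gradient_def)
 define I where "I = (indicator {0..1} :: real => real)"
 have [measurable]: "I \<in> \<B>" by (simp add: I_def)
 have I0: "I s >= 0" for s by (simp add: I_def)
 define G where "G = (\<lambda>y. \<Sum>i\<in>UNIV. of_real (k $ i)*g i y)"
 have [measurable]: "G \<in> \<B>" unfolding G_def by measurable
 define W where "W = (\<lambda>z s y. I s*\<phi> (y - (z + s *\<^sub>R k)))"
 have [measurable]: "(\<lambda>p. W z (fst p) (snd p)) \<in> borel_measurable (borel \<Otimes>\<^sub>M borel)" for z unfolding W_def by measurable
 have W0: "W z s y >= 0" for z s y by (simp add: W_def I0 phi_nonneg)
 have Wnn: "(\<integral>\<^sup>+p. ennreal (W z (fst p) (snd p)) \<partial>lborel2) = 1" for z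
 proof -
  have "(\<integral>\<^sup>+p. ennreal (W z (fst p) (snd p)) \<partial>lborel2) = (NN s. NN y. ennreal (W z s y))"
   by (subst lborel.nn_integral_fst[symmetric]) auto
  also have "... = (NN s. indicator {0..1::real} s)"
  proof (intro nn_integral_cong)
   fix s :: real
   have "(NN y. ennreal (W z s y)) = ennreal (I s)*(NN y. ennreal (\<phi> (y - (z + s *\<^sub>R k))))"
    unfolding W_def using I0 phi_nonneg by (subst nn_integral_cmult[symmetric]) (auto simp: ennreal_mult)
   then show "(NN y. ennreal (W z s y)) = indicator {0..1::real} s"
    unfolding phi_nn_shift by (simp add: I_def ennreal_indicator)
  qed
  also have "... = 1" by simp
  finally show ?thesis .
 qed
 have Wi: "integrable lborel2 (\<lambda>p. W z (fst p) (snd p))" for z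
  using Wnn[of z] W0 by (intro integrableI_nonneg) auto
 have W1: "(LINT p|lborel2. W z (fst p) (snd p)) <= 1" for z
  using nn_integral_eq_integral[OF Wi[of z]] W0 Wnn[of z] by (simp add: integral_nonneg_AE)
 have "ennreal ((cmod (mol \<phi> u (z + k) - mol \<phi> u z))^2) <= (NN s. NN y. ennreal ((cmod (G y))^2*W z s y))" for z
 proof -
  have "mol \<phi> u (z + k) - mol \<phi> u z = (LINT p|lborel2. G (snd p) * of_real (W z (fst p) (snd p)))"
   unfolding G_def W_def I_def by (rule mol_difference[OF assms(1) u wg g])
  then have "ennreal ((cmod (mol \<phi> u (z + k) - mol \<phi> u z))^2) <= (\<integral>\<^sup>+p. ennreal ((cmod (G (snd p)))^2*W z (fst p) (snd p)) \<partial>lborel2)"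
   by (simp only:) (rule jensen_square[OF _ Wi W0 W1], measurable)
  also have "... = (NN s. NN y. ennreal ((cmod (G y))^2*W z s y))"
   by (subst lborel.nn_integral_fst[symmetric]) auto
  finally show ?thesis .
 qed
 then have "(NN z. ennreal ((cmod (mol \<phi> u (z + k) - mol \<phi> u z))^2))
  <= (NN z. NN s. NN y. ennreal ((cmod (G y))^2*W z s y))" by (intro nn_integral_mono)
 also have "... = (NN s. NN z. NN y. ennreal ((cmod (G y))^2*W z s y))"
  unfolding W_def by (rule lborel_pair.Fubini') measurable
 also have "... = (NN s. NN y. NN z. ennreal ((cmod (G y))^2*W z s y))"
  unfolding W_def by (intro nn_integral_cong lborel_pair.Fubini') measurable
 also have "... = (NN s. NN y. indicator {0..1::real} s*ennreal ((cmod (G y))^2))"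
 proof (intro nn_integral_cong)
  fix s :: real and y :: "real^2"
  have "(NN z. ennreal ((cmod (G y))^2*W z s y)) = ennreal ((cmod (G y))^2*I s)*(NN z. ennreal (\<phi> ((y - s *\<^sub>R k) - z)))"
   unfolding W_def using I0 phi_nonneg by (subst nn_integral_cmult[symmetric]) (auto simp: ennreal_mult'[symmetric] mult.assoc algebra_simps)
  then show "(NN z. ennreal ((cmod (G y))^2*W z s y)) = indicator {0..1::real} s*ennreal ((cmod (G y))^2)"
   unfolding phi_nn_reflect by (simp add: I_def indicator_def)
 qed
 also have "... = (NN s. indicator {0..1::real} s*(NN y. ennreal ((cmod (G y))^2)))"
  by (intro nn_integral_cong nn_integral_cmult) measurable
 also have "... = (NN y. ennreal ((cmod (G y))^2))" by (subst nn_integral_multc) auto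
 finally show ?thesis unfolding G_def .
qed

end

context mollifier
begin

text \<open>For each direction \<open>k\<close> the translation bound has the squared directional
  derivative on the right; its mean over the unit disc is \<open>c1\<close> times the squared
  gradient, by \<open>ball_quadratic\<close>.\<close>

lemma mol_EE:
 assumes [measurable]: "u \<in> \<B>" and u: "integrable lborel (\<lambda>x. (cmod (u x))^2)"
  and wg: "weak_gradient g u" and g: "\<And>i. integrable lborel (\<lambda>x. (cmod (g i x))^2)" and e: "e > 0"
 shows "EE e (mol \<phi> u) <= ennreal (c1*e^4*(LBINT x. (\<Sum>i\<in>UNIV. (cmod (g i x))^2)))"
proof -
 have [measurable]: "g i \<in> \<B>" for i using wg by (simp add: weak_gradient_def)
 have [measurable]: "(\<lambda>k::real^2. k $ i) \<in> \<B>" for i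
  by (intro borel_measurable_continuous_onI continuous_intros)
 define B where "B = (\<lambda>k::real^2. indicator (ball 0 1) k :: real)"
 have [measurable]: "B \<in> \<B>" unfolding B_def by (intro borel_measurable_indicator) simp
 have B0: "B k >= 0" for k by (simp add: B_def)
 define w where "w = mol \<phi> u"
 have [measurable]: "w \<in> \<B>" unfolding w_def by measurable
 define G where "G = (\<lambda>k y. \<Sum>i\<in>UNIV. of_real (k $ i)*g i y :: complex)"
 define T where "T = (NN y. ennreal (c1*(\<Sum>i\<in>UNIV. (cmod (g i y))^2)))"
 have "EE e w = ennreal (e^2)*(NN x. NN k. ennreal (B k)*ennreal ((cmod (w (x + e *\<^sub>R k) - w x))^2))"
  unfolding ennreal_mult'[OF B0, symmetric] unfolding B_def by (rule EE_ball[OF _ e]) measurable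
 also have "(NN x. NN k. ennreal (B k)*ennreal ((cmod (w (x + e *\<^sub>R k) - w x))^2))
   = (NN k. NN x. ennreal (B k)*ennreal ((cmod (w (x + e *\<^sub>R k) - w x))^2))"
  by (rule lborel_pair.Fubini') measurable
 also have "... <= (NN k. ennreal (B k)*(ennreal (e^2)*(NN y. ennreal ((cmod (G k y))^2))))"
 proof (intro nn_integral_mono)
  fix k :: "real^2"
  have "(NN x. ennreal ((cmod (w (x + e *\<^sub>R k) - w x))^2)) <= (NN y. ennreal ((cmod (G (e *\<^sub>R k) y))^2))"
   unfolding w_def G_def by (rule mol_translation[OF assms(1) u wg g])
  also have "... = (NN y. ennreal (e^2)*ennreal ((cmod (G k y))^2))"
  proof -
   have "G (e *\<^sub>R k) y = of_real e*G k y" for y by (simp add: G_def sum_distrib_left mult.assoc)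
   then show ?thesis by (simp add: norm_mult power_mult_distrib ennreal_mult')
  qed
  also have "... = ennreal (e^2)*(NN y. ennreal ((cmod (G k y))^2))"
   unfolding G_def by (rule nn_integral_cmult) measurable
  finally have "ennreal (B k)*(NN x. ennreal ((cmod (w (x + e *\<^sub>R k) - w x))^2))
    <= ennreal (B k)*(ennreal (e^2)*(NN y. ennreal ((cmod (G k y))^2)))" by (rule mult_left_mono) simp
  then show "(NN x. ennreal (B k)*ennreal ((cmod (w (x + e *\<^sub>R k) - w x))^2))
    <= ennreal (B k)*(ennreal (e^2)*(NN y. ennreal ((cmod (G k y))^2)))"
   by (subst nn_integral_cmult) measurable
 qed
 also have "... = (NN k. ennreal (e^2)*(NN y. ennreal (B k*(cmod (G k y))^2)))"
 proof (intro nn_integral_cong)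
  fix k :: "real^2"
  have "(NN y. ennreal (B k*(cmod (G k y))^2)) = ennreal (B k)*(NN y. ennreal ((cmod (G k y))^2))"
   unfolding ennreal_mult'[OF B0] G_def by (rule nn_integral_cmult) measurable
  then show "ennreal (B k)*(ennreal (e^2)*(NN y. ennreal ((cmod (G k y))^2))) = ennreal (e^2)*(NN y. ennreal (B k*(cmod (G k y))^2))"
   by (simp add: mult_ac)
 qed
 also have "... = ennreal (e^2)*(NN k. (NN y. ennreal (B k*(cmod (G k y))^2)))"
  unfolding G_def by (rule nn_integral_cmult) measurable
 also have "(NN k. (NN y. ennreal (B k*(cmod (G k y))^2))) = (NN y. (NN k. ennreal (B k*(cmod (G k y))^2)))"
  unfolding G_def by (rule lborel_pair.Fubini') measurable
 also have "... = T" unfolding T_def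
 proof (intro nn_integral_cong)
  fix y
  have "(NN k. ennreal (B k*(cmod (G k y))^2)) = ennreal (LBINT k. B k*(cmod (G k y))^2)"
   unfolding B_def G_def sum_2 by (intro nn_integral_eq_integral ball_quadratic) auto
  also have "... = ennreal (c1*(\<Sum>i\<in>UNIV. (cmod (g i y))^2))"
   unfolding B_def G_def sum_2 ball_quadratic ..
  finally show "(NN k. ennreal (B k*(cmod (G k y))^2)) = ennreal (c1*(\<Sum>i\<in>UNIV. (cmod (g i y))^2))" .
 qed
 also have "T = ennreal (c1*(LBINT x. (\<Sum>i\<in>UNIV. (cmod (g i x))^2)))"
 proof -
  have "T = ennreal (LBINT x. c1*(\<Sum>i\<in>UNIV. (cmod (g i x))^2))"
   unfolding T_def using c1_pos
   by (intro nn_integral_eq_integral integrable_mult_right Bochner_Integration.integrable_sum g) (auto intro!: AE_I2 mult_nonneg_nonneg sum_nonneg)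
  then show ?thesis by simp
 qed
 finally have "EE e w <= ennreal (e^2)*(ennreal (e^2)*ennreal (c1*(LBINT x. (\<Sum>i\<in>UNIV. (cmod (g i x))^2))))"
  by (simp add: mult_left_mono)
 also have "... = ennreal (c1*e^4*(LBINT x. (\<Sum>i\<in>UNIV. (cmod (g i x))^2)))"
  by (simp add: ennreal_mult'[symmetric] power2_eq_square power4_eq_xxxx mult_ac)
 finally show ?thesis unfolding w_def .
qed

lemma mol_jensen:
 assumes [measurable]: "u \<in> \<B>"
 shows "ennreal ((cmod (mol \<phi> u z))^2) <= (NN y. ennreal ((cmod (u y))^2*\<phi> (y - z)))"
 unfolding mol_def by (rule jensen_square) (auto simp: phi_shift_integrable phi_nonneg)

text \<open>Mollification spreads the density over distance at most \<open>r\<close>, so a weight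
  may be moved onto \<open>u\<close> if it is replaced by one that dominates it within that
  distance.\<close>

lemma mol_conv_le:
 fixes a b :: "real^2 => ennreal"
 assumes [measurable]: "u \<in> \<B>" "a \<in> \<B>" "b \<in> \<B>"
  and ab: "\<And>x y. norm (y - x) <= r ==> a x <= b y"
 shows "(NN x. a x*ennreal ((cmod (mol \<phi> u x))^2)) <= (NN y. b y*ennreal ((cmod (u y))^2))"
proof -
 have "(NN x. a x*ennreal ((cmod (mol \<phi> u x))^2)) <= (NN x. a x*(NN y. ennreal ((cmod (u y))^2*\<phi> (y - x))))"
  by (intro nn_integral_mono mult_left_mono mol_jensen) auto
 also have "... = (NN x. (NN y. a x*ennreal ((cmod (u y))^2*\<phi> (y - x))))"
  by (intro nn_integral_cong nn_integral_cmult[symmetric]) measurable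
 also have "... <= (NN x. (NN y. (b y*ennreal ((cmod (u y))^2))*ennreal (\<phi> (y - x))))"
 proof (intro nn_integral_mono)
  fix x y :: "real^2"
  show "a x*ennreal ((cmod (u y))^2*\<phi> (y - x)) <= (b y*ennreal ((cmod (u y))^2))*ennreal (\<phi> (y - x))"
  proof (cases "norm (y - x) <= r")
   case True
   then show ?thesis using ab phi_nonneg by (simp add: ennreal_mult mult.assoc mult_right_mono)
  next
   case False
   then show ?thesis using phi_supp[of "y - x"] by simp
  qed
 qed
 also have "... = (NN y. (NN x. (b y*ennreal ((cmod (u y))^2))*ennreal (\<phi> (y - x))))"
  by (rule lborel_pair.Fubini') measurable
 also have "... = (NN y. b y*ennreal ((cmod (u y))^2))"
  by (intro nn_integral_cong, subst nn_integral_cmult) (auto simp: phi_nn_reflect)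
 finally show ?thesis .
qed

lemma phi_lipschitz: "\<exists>L\<ge>0. \<forall>x y. \<bar>\<phi> x - \<phi> y\<bar> <= L*norm (x - y)"
proof -
 have "\<forall>i. \<exists>B\<ge>0. \<forall>x. \<bar>\<phi>' i x\<bar> <= B"
 proof
  fix i
  obtain B where B: "B >= 0" "\<And>x. \<bar>\<phi>' i x\<bar> <= B*iball r x" using dphi_bound[of i] by blast
  have "\<bar>\<phi>' i x\<bar> <= B" for x using B(2)[of x] B(1) by (cases "norm x <= r") (auto simp: iball_def)
  then show "\<exists>B\<ge>0. \<forall>x. \<bar>\<phi>' i x\<bar> <= B" using B(1) by blast
 qed
 then obtain B where B: "\<And>i. B i >= 0" "\<And>i x. \<bar>\<phi>' i x\<bar> <= B i" by metis
 let ?L = "\<Sum>i\<in>UNIV. B i"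
 have "\<bar>\<phi> x - \<phi> y\<bar> <= ?L*norm (x - y)" for x y
 proof -
  let ?k = "x - y"
  have "\<exists>s::real. 0 < s \<and> s < 1 \<and> \<phi> (y + 1 *\<^sub>R ?k) - \<phi> (y + 0 *\<^sub>R ?k) = (1 - 0)*(\<Sum>i\<in>UNIV. ?k $ i*\<phi>' i (y + s *\<^sub>R ?k))"
   by (rule MVT2[where f = "\<lambda>s. \<phi> (y + s *\<^sub>R ?k)"]) (simp, rule phi_deriv)
  then obtain s where s: "\<phi> x - \<phi> y = (\<Sum>i\<in>UNIV. ?k $ i*\<phi>' i (y + s *\<^sub>R ?k))" by auto
  have "\<bar>\<phi> x - \<phi> y\<bar> <= (\<Sum>i\<in>UNIV. \<bar>?k $ i*\<phi>' i (y + s *\<^sub>R ?k)\<bar>)" unfolding s by (rule sum_abs)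
  also have "... <= (\<Sum>i\<in>UNIV. norm ?k*B i)"
   unfolding abs_mult by (intro sum_mono mult_mono B component_le_norm_cart) auto
  finally show ?thesis by (simp add: sum_distrib_right mult.commute)
 qed
 moreover have "?L >= 0" by (intro sum_nonneg B)
 ultimately show ?thesis by blast
qed

text \<open>The two kernels differ by at most \<open>L * |x - z|\<close> and live on two discs of
  radius \<open>r\<close>; there \<open>|u| <= 1 + |u|^2\<close> bounds the integral of
  \<open>|u|\<close> uniformly.\<close>

lemma mol_lipschitz:
 assumes [measurable]: "u \<in> \<B>" and u: "integrable lborel (\<lambda>x. (cmod (u x))^2)"
 shows "\<exists>L\<ge>0. \<forall>x y. cmod (mol \<phi> u x - mol \<phi> u y) <= L*norm (x - y)"
proof -
 obtain L where L: "L >= 0" "\<And>x y. \<bar>\<phi> x - \<phi> y\<bar> <= L*norm (x - y)" using phi_lipschitz by blast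
 define b where "b = (LBINT x. iball r x)"
 have shift: "integrable lborel (\<lambda>y. iball r (y - x))" "(LBINT y. iball r (y - x)) = b" for x
 proof -
  have eq: "lborel = distr lborel borel (\<lambda>y::real^2. y - x)" 
  proof -
   have "(\<lambda>y::real^2. y - x) = (+) (- x)" by auto
   then show ?thesis by (simp only: lborel_distr_plus)
  qed
  show "integrable lborel (\<lambda>y. iball r (y - x))"
   using integrable_iball[of r] by (subst (asm) eq, subst (asm) integrable_distr_eq) auto
  show "(LBINT y. iball r (y - x)) = b"
   unfolding b_def by (subst (2) eq, subst integral_distr) auto
 qed
 define K where "K = L*((LBINT x. (cmod (u x))^2) + (b + b))"
 have "cmod (mol \<phi> u x - mol \<phi> u z) <= K*norm (x - z)" for x z
 proof -
  let ?f = "\<lambda>y. u y * of_real (\<phi> (y - x)) - u y * of_real (\<phi> (y - z))"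
  have i: "integrable lborel ?f" by (intro Bochner_Integration.integrable_diff mol_integrable u) measurable
  have "mol \<phi> u x - mol \<phi> u z = (LBINT y. ?f y)"
   unfolding mol_def by (intro Bochner_Integration.integral_diff[symmetric] mol_integrable u) measurable
  then have "cmod (mol \<phi> u x - mol \<phi> u z) <= (LBINT y. norm (?f y))"
   by (simp only: integral_norm_bound)
  also have "... <= (LBINT y. L*norm (x - z)*((cmod (u y))^2 + (iball r (y - x) + iball r (y - z))))"
  proof (intro integral_mono integrable_norm i integrable_mult_right Bochner_Integration.integrable_add u shift)
   fix y
   have f: "norm (?f y) = cmod (u y)*\<bar>\<phi> (y - x) - \<phi> (y - z)\<bar>"
   proof -
    have "?f y = u y * of_real (\<phi> (y - x) - \<phi> (y - z))" by (simp add: algebra_simps)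
    then show ?thesis by (simp only: norm_mult norm_of_real)
   qed
   show "norm (?f y) <= L*norm (x - z)*((cmod (u y))^2 + (iball r (y - x) + iball r (y - z)))"
   proof (cases "norm (y - x) <= r \<or> norm (y - z) <= r")
    case True
    have l: "\<bar>\<phi> (y - x) - \<phi> (y - z)\<bar> <= L*norm (x - z)" using L(2)[of "y - x" "y - z"] by (simp add: norm_minus_commute)
    have "1 <= iball r (y - x) + iball r (y - z)" using True by (auto simp: iball_def indicator_def)
    then have m: "cmod (u y) <= (cmod (u y))^2 + (iball r (y - x) + iball r (y - z))" using le_1_plus_square[of "cmod (u y)"] by linarith
    show ?thesis unfolding f by (subst mult.commute) (rule mult_mono[OF l m], use L(1) in auto)
   next
    case False
    then show ?thesis unfolding f using L(1) phi_supp by (simp add: iball_nonneg)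
   qed
  qed
  also have "... = K*norm (x - z)"
   using u shift by (simp add: K_def)
  finally show ?thesis .
 qed
 moreover have "K >= 0" unfolding K_def b_def
  using L(1) iball_nonneg by (intro mult_nonneg_nonneg add_nonneg_nonneg integral_nonneg_AE) auto
 ultimately show ?thesis by blast
qed

text \<open>For \<open>z\<close> far out, \<open>ln (1 + |y|)\<close> is at least \<open>A\<close>
  on the support of the shifted \<open>\<phi>\<close>, so the local mean of \<open>|u|^2\<close> is
  at most \<open>B * La / A\<close>.\<close>

lemma mol_decay:
 assumes [measurable]: "u \<in> \<B>"
  and lg: "(NN x. ennreal (ln (1 + norm x)*(cmod (u x))^2)) < \<infinity>" and t: "t > 0"
 shows "\<exists>R\<ge>0. \<forall>z. norm z > R \<longrightarrow> cmod (mol \<phi> u z) <= t"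
proof -
 obtain B where B: "B >= 0" "\<And>x. \<bar>\<phi> x\<bar> <= B*iball r x" using phi_bound by blast
 have B': "\<phi> x <= B" for x using B(2)[of x] B(1) by (cases "norm x <= r") (auto simp: iball_def)
 obtain La where La: "La >= 0" "(NN x. ennreal (ln (1 + norm x)*(cmod (u x))^2)) = ennreal La"
  using lg by (cases "(NN x. ennreal (ln (1 + norm x)*(cmod (u x))^2))") auto
 \<comment> \<open>Chosen to give \<open>B * La <= A * t^2\<close>; the \<open>+ 1\<close> makes
   \<open>A\<close> positive.\<close>
 define A where "A = (B*La + 1)/t^2"
 have A: "A > 0" using B(1) La(1) t by (simp add: A_def add_nonneg_pos)
 have "cmod (mol \<phi> u z) <= t" if z: "norm z > r + exp A" for z
 proof -
  have "ennreal A*ennreal ((cmod (mol \<phi> u z))^2) <= ennreal A*(NN y. ennreal ((cmod (u y))^2*\<phi> (y - z)))"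
   by (intro mult_left_mono mol_jensen) auto
  also have "... = (NN y. ennreal (A*((cmod (u y))^2*\<phi> (y - z))))"
   using A by (subst nn_integral_cmult[symmetric]) (auto simp: ennreal_mult')
  also have "... <= (NN y. ennreal B*ennreal (ln (1 + norm y)*(cmod (u y))^2))"
  proof (intro nn_integral_mono)
   fix y
   have "A*((cmod (u y))^2*\<phi> (y - z)) <= B*(ln (1 + norm y)*(cmod (u y))^2)"
   proof (cases "norm (y - z) <= r")
    case True
    have "norm z <= norm y + norm (y - z)" using norm_triangle_ineq[of y "z - y"] by (simp add: norm_minus_commute)
    then have "exp A <= 1 + norm y" using True z by linarith
    then have "A <= ln (1 + norm y)" by (subst ln_ge_iff) (auto intro: add_pos_nonneg)
    then have "A*\<phi> (y - z) <= ln (1 + norm y)*B" using A B' phi_nonneg by (intro mult_mono) auto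
    from mult_right_mono[OF this, of "(cmod (u y))^2"] show ?thesis by (simp add: mult_ac)
   next
    case False
    then show ?thesis using phi_supp[of "y - z"] B(1) by simp
   qed
   then show "ennreal (A*((cmod (u y))^2*\<phi> (y - z))) <= ennreal B*ennreal (ln (1 + norm y)*(cmod (u y))^2)"
    using B(1) by (simp add: ennreal_mult'[symmetric] ennreal_leI)
  qed
  also have "... = ennreal B*ennreal La" using La(2) by (subst nn_integral_cmult) auto
  finally have "A*(cmod (mol \<phi> u z))^2 <= B*La"
   using A B(1) La(1) by (simp add: ennreal_mult'[symmetric])
  also have "... <= A*t^2" using t by (simp add: A_def)
  finally have "(cmod (mol \<phi> u z))^2 <= t^2" using A by simp
  then show ?thesis using t by (simp add: power2_le_iff_abs_le)
 qed
 moreover have "r + exp A >= 0" using r by (simp add: add_nonneg_nonneg)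
 ultimately show ?thesis by blast
qed

end

section \<open>Continuity of translations and convergence of mollifications\<close>

lemma nn_integral_lborel_shift:
 fixes F :: "real^2 => ennreal"
 assumes [measurable]: "F \<in> \<B>"
 shows "(NN x. F (x + a)) = (NN x. F x)"
proof -
 have "(NN x. F (x + a)) = (\<integral>\<^sup>+x. F x \<partial>distr lborel borel ((+) a))"
  by (subst nn_integral_distr) (auto simp: add.commute)
 then show ?thesis by (simp only: lborel_distr_plus)
qed

text \<open>Openness makes the integrand eventually 0 at every point of \<open>U\<close>. The other
  half of the symmetric difference is, after a translation, the same integral for
  \<open>- b\<close>.\<close>

lemma open_shift_tendsto:
 fixes U :: "(real^2) set"
 assumes U: "open U" and fin: "emeasure lborel U < \<infinity>" and b: "b ----> 0"
 shows "(\<lambda>n. NN x. indicator U x*(1 - indicator U (x + b n))) ----> 0"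
proof -
 have [measurable]: "U \<in> sets borel" using U by simp
 have "(\<lambda>n. NN x. indicator U x*(1 - indicator U (x + b n))) ----> (NN (x::real^2). 0)"
 proof (rule nn_integral_dominated_convergence[where w = "indicator U"])
  show "(NN x. indicator U x) < \<infinity>" using fin by simp
  show "AE x in lborel. indicator U x*(1 - indicator U (x + b n)) <= (indicator U x :: ennreal)" for n
   by (intro AE_I2) (auto simp: indicator_def)
  have "(\<lambda>n. indicator U x*(1 - indicator U (x + b n)) :: ennreal) ----> 0" for x
  proof (cases "x \<in> U")
   case True
   have "(\<lambda>n. x + b n) ----> x + 0" by (intro tendsto_intros b)
   then have "\<forall>\<^sub>F n in sequentially. x + b n \<in> U" using topological_tendstoD[OF _ U] True by auto
   then have "\<forall>\<^sub>F n in sequentially. indicator U x*(1 - indicator U (x + b n)) = (0::ennreal)"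
    by eventually_elim simp
   then show ?thesis by (rule tendsto_eventually)
  qed simp
  then show "AE x in lborel. (\<lambda>n. indicator U x*(1 - indicator U (x + b n)) :: ennreal) ----> 0" by simp
 qed measurable
 then show ?thesis by simp
qed

lemma open_shift_small:
 fixes U :: "(real^2) set"
 assumes U: "open U" and fin: "emeasure lborel U < \<infinity>" and e: "e > (0::real)"
 shows "\<exists>d>0. \<forall>a. norm a < d \<longrightarrow> (NN x. ennreal \<bar>indicator U (x + a) - indicator U x\<bar>) <= ennreal e"
proof (rule ccontr)
 assume "\<not> ?thesis"
 then have nt: "\<forall>d>0. \<exists>a. norm a < d \<and> \<not> (NN x. ennreal \<bar>indicator U (x + a) - indicator U x\<bar>) <= ennreal e" by blast
 have "\<forall>n::nat. \<exists>a. norm a < 1/Suc n \<and> \<not> (NN x. ennreal \<bar>indicator U (x + a) - indicator U x\<bar>) <= ennreal e"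
  by (intro allI nt[rule_format]) simp
 from choice[OF this] obtain a where "\<forall>n::nat. norm (a n) < 1/Suc n \<and> \<not> (NN x. ennreal \<bar>indicator U (x + a n) - indicator U x\<bar>) <= ennreal e" ..
 then have a: "norm (a n) < 1/Suc n"
  and big: "\<not> (NN x. ennreal \<bar>indicator U (x + a n) - indicator U x\<bar>) <= ennreal e" for n by blast+
 have [measurable]: "U \<in> sets borel" using U by simp
 have a0: "a ----> 0"
  by (rule Lim_null_comparison[OF always_eventually LIMSEQ_Suc[OF lim_1_over_n]]) (use a less_imp_le in auto)
 have "(NN x. ennreal \<bar>indicator U (x + a n) - indicator U x\<bar>)
  = (NN x. indicator U x*(1 - indicator U (x + a n))) + (NN x. indicator U x*(1 - indicator U (x + - a n)))" for n
 proof -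
  have "(NN x. ennreal \<bar>indicator U (x + a n) - indicator U x\<bar>)
   = (NN x. indicator U x*(1 - indicator U (x + a n)) + indicator U (x + a n)*(1 - indicator U (x + a n + - a n)))"
   by (intro nn_integral_cong) (auto simp: indicator_def)
  also have "... = (NN x. indicator U x*(1 - indicator U (x + a n))) + (NN x. indicator U (x + a n)*(1 - indicator U (x + a n + - a n)))"
   by (rule nn_integral_add) measurable
  also have "(NN x. indicator U (x + a n)*(1 - indicator U (x + a n + - a n))) = (NN x. indicator U x*(1 - indicator U (x + - a n)))"
   by (rule nn_integral_lborel_shift[of "\<lambda>x. indicator U x*(1 - indicator U (x + - a n))"]) measurable
  finally show ?thesis .
 qed
 moreover have "(\<lambda>n. (NN x. indicator U x*(1 - indicator U (x + a n))) + (NN x. indicator U x*(1 - indicator U (x + - a n)))) ----> 0 + 0"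
  using a0 tendsto_minus[OF a0] by (intro tendsto_add open_shift_tendsto U fin) auto
 ultimately have "(\<lambda>n. NN x. ennreal \<bar>indicator U (x + a n) - indicator U x\<bar>) ----> 0" by simp
 from order_tendstoD(2)[OF this, of "ennreal e"] e
 have "\<forall>\<^sub>F n in sequentially. (NN x. ennreal \<bar>indicator U (x + a n) - indicator U x\<bar>) < ennreal e" by simp
 then obtain n where "(NN x. ennreal \<bar>indicator U (x + a n) - indicator U x\<bar>) < ennreal e"
  unfolding eventually_sequentially by blast
 then show False using big[of n] by simp
qed

text \<open>Outer regularity gives an open superset \<open>U\<close>; the excess
  \<open>U - A\<close> enters twice, shifted and unshifted, hence the thirds of
  \<open>e\<close>.\<close>

lemma set_shift_small:
 fixes A :: "(real^2) set"
 assumes [measurable]: "A \<in> sets borel" and fin: "emeasure lborel A < \<infinity>" and e: "e > (0::real)"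
 shows "\<exists>d>0. \<forall>a. norm a < d \<longrightarrow> (NN x. ennreal \<bar>indicator A (x + a) - indicator A x\<bar>) <= ennreal e"
proof -
 have e3: "e/3 > 0" using e by simp
 obtain U where U: "open U" "A \<subseteq> U" "emeasure lborel (U - A) < ennreal (e/3)"
  using outer_regular_lborel[OF assms(1) e3] by blast
 have [measurable]: "U \<in> sets borel" using U by simp
 have "emeasure lborel U = emeasure lborel A + emeasure lborel (U - A)"
  using U(2) by (subst plus_emeasure) (auto simp: Un_absorb1)
 also have "... < \<infinity>" using fin less_trans[OF U(3) ennreal_less_top] by simp
 finally have "emeasure lborel U < \<infinity>" .
 then obtain d where d: "d > 0" "\<And>a. norm a < d ==> (NN x. ennreal \<bar>indicator U (x + a) - indicator U x\<bar>) <= ennreal (e/3)"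
  using open_shift_small[OF U(1) _ e3] by blast
 have "(NN x. ennreal \<bar>indicator A (x + a) - indicator A x\<bar>) <= ennreal e" if a: "norm a < d" for a
 proof -
  have "(NN x. ennreal \<bar>indicator A (x + a) - indicator A x\<bar>)
   <= (NN x. (ennreal \<bar>indicator U (x + a) - indicator U x\<bar> + indicator (U - A) (x + a)) + indicator (U - A) x)"
   using U(2) by (intro nn_integral_mono) (auto simp: indicator_def)
  also have "... = (NN x. ennreal \<bar>indicator U (x + a) - indicator U x\<bar>) + (NN x. indicator (U - A) (x + a)) + (NN x. indicator (U - A) x)"
   by (subst nn_integral_add, measurable, subst nn_integral_add, measurable)
  also have "(NN x. indicator (U - A) (x + a)) = (NN x. indicator (U - A) x)"
   by (rule nn_integral_lborel_shift) measurable
  also have "(NN x. indicator (U - A) x) = emeasure lborel (U - A)" by simp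
  also have "(NN x. ennreal \<bar>indicator U (x + a) - indicator U x\<bar>) + emeasure lborel (U - A) + emeasure lborel (U - A) <= ennreal (e/3) + ennreal (e/3) + ennreal (e/3)"
   using U(3) by (intro add_mono d(2) a less_imp_le)
  also have "... = ennreal e" using e by (simp add: ennreal_plus[symmetric] del: ennreal_plus)
  finally show ?thesis .
 qed
 then show ?thesis using d(1) by blast
qed

text \<open>Induction over integrable functions: multiples of indicators by
  \<open>set_shift_small\<close>, sums with \<open>e / 2\<close> each, and limits with thirds, since
  the integral of the approximation error is translation invariant.\<close>

lemma L1_shift_small:
 fixes h :: "real^2 => complex"
 assumes h: "integrable lborel h"
 shows "\<forall>e>0. \<exists>d>0. \<forall>a. norm a < d \<longrightarrow> (NN x. ennreal (cmod (h (x + a) - h x))) <= ennreal e"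
 using h
proof (induction rule: integrable_induct)
 case (base A c)
 show ?case
 proof (intro allI impI)
  fix e :: real assume e: "e > 0"
  define e' where "e' = e/(cmod c + 1)"
  have c1: "cmod c + 1 > 0" by (simp add: add_nonneg_pos)
  have e': "e' > 0" using e c1 by (simp add: e'_def)
  have [measurable]: "A \<in> sets borel" using base by simp
  obtain d where d: "d > 0" "\<And>a. norm a < d ==> (NN x. ennreal \<bar>indicator A (x + a) - indicator A x\<bar>) <= ennreal e'"
   using set_shift_small[OF _ _ e', of A] base by auto
  have "(NN x. ennreal (cmod (indicator A (x + a) *\<^sub>R c - indicator A x *\<^sub>R c))) <= ennreal e" if a: "norm a < d" for a
  proof -
   have "cmod (indicator A (x + a) *\<^sub>R c - indicator A x *\<^sub>R c) = cmod c*\<bar>indicator A (x + a) - indicator A x\<bar>" for x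
   proof -
    have "indicator A (x + a) *\<^sub>R c - indicator A x *\<^sub>R c = (indicator A (x + a) - indicator A x) *\<^sub>R c"
     by (rule scaleR_left_diff_distrib[symmetric])
    then show ?thesis by (simp only: norm_scaleR mult.commute)
   qed
   then have "(NN x. ennreal (cmod (indicator A (x + a) *\<^sub>R c - indicator A x *\<^sub>R c))) = (NN x. ennreal (cmod c)*ennreal \<bar>indicator A (x + a) - indicator A x\<bar>)"
    by (intro nn_integral_cong) (simp only: ennreal_mult'[OF norm_ge_zero])
   also have "... = ennreal (cmod c)*(NN x. ennreal \<bar>indicator A (x + a) - indicator A x\<bar>)"
    by (rule nn_integral_cmult) measurable
   also have "... <= ennreal (cmod c)*ennreal e'" by (intro mult_left_mono d a) simp
   also have "... = ennreal (cmod c*e')" by (simp add: ennreal_mult')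
   also have "... <= ennreal e" using e c1 unfolding e'_def by (intro ennreal_leI) (simp add: field_simps)
   finally show ?thesis .
  qed
  then show "\<exists>d>0. \<forall>a. norm a < d \<longrightarrow> (NN x. ennreal (cmod (indicator A (x + a) *\<^sub>R c - indicator A x *\<^sub>R c))) <= ennreal e"
   using d(1) by blast
 qed
next
 case (add f g)
 have [measurable]: "f \<in> \<B>" "g \<in> \<B>" using add by auto
 show ?case
 proof (intro allI impI)
  fix e :: real assume e: "e > 0"
  then have e2: "e/2 > 0" by simp
  obtain d1 where d1: "d1 > 0" "\<And>a. norm a < d1 ==> (NN x. ennreal (cmod (f (x + a) - f x))) <= ennreal (e/2)" using add.IH(1)[rule_format, OF e2] by blast
  obtain d2 where d2: "d2 > 0" "\<And>a. norm a < d2 ==> (NN x. ennreal (cmod (g (x + a) - g x))) <= ennreal (e/2)" using add.IH(2)[rule_format, OF e2] by blast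
  have "(NN x. ennreal (cmod (f (x + a) + g (x + a) - (f x + g x)))) <= ennreal e" if a: "norm a < min d1 d2" for a
  proof -
   have "cmod (f (x + a) + g (x + a) - (f x + g x)) <= cmod (f (x + a) - f x) + cmod (g (x + a) - g x)" for x
    using norm_triangle_ineq[of "f (x + a) - f x" "g (x + a) - g x"] by (simp add: algebra_simps)
   then have "(NN x. ennreal (cmod (f (x + a) + g (x + a) - (f x + g x)))) <= (NN x. ennreal (cmod (f (x + a) - f x)) + ennreal (cmod (g (x + a) - g x)))"
    by (intro nn_integral_mono) (simp add: ennreal_plus[symmetric] del: ennreal_plus)
   also have "... = (NN x. ennreal (cmod (f (x + a) - f x))) + (NN x. ennreal (cmod (g (x + a) - g x)))"
    by (rule nn_integral_add) measurable
   also have "... <= ennreal (e/2) + ennreal (e/2)" using a by (intro add_mono d1 d2) auto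
   also have "... = ennreal e" using e by (simp add: ennreal_plus[symmetric] del: ennreal_plus)
   finally show ?thesis .
  qed
  then show "\<exists>d>0. \<forall>a. norm a < d \<longrightarrow> (NN x. ennreal (cmod (f (x + a) + g (x + a) - (f x + g x)))) <= ennreal e"
   using d1(1) d2(1) by (intro exI[of _ "min d1 d2"]) auto
 qed
next
 case (lim f s)
 have [measurable]: "f \<in> \<B>" "\<And>i. s i \<in> \<B>" using lim by auto
 show ?case
 proof (intro allI impI)
  fix e :: real assume e: "e > 0"
  then have e3: "e/3 > 0" by simp
  have "(\<lambda>i. NN x. ennreal (cmod (s i x - f x))) ----> (NN (x::real^2). 0)"
  proof (rule nn_integral_dominated_convergence[where w = "\<lambda>x. ennreal (3*cmod (f x))"])
   have "integrable lborel (\<lambda>x. 3*cmod (f x))" using lim by (intro integrable_mult_right integrable_norm)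
   then show "(NN x. ennreal (3*cmod (f x))) < \<infinity>" by (subst nn_integral_eq_integral) auto
   show "AE x in lborel. ennreal (cmod (s i x - f x)) <= ennreal (3*cmod (f x))" for i
   proof (intro AE_I2 ennreal_leI)
    fix x
    show "cmod (s i x - f x) <= 3*cmod (f x)" using lim.hyps(3)[of x i] norm_triangle_ineq4[of "s i x" "f x"] by simp
   qed
   have "(\<lambda>i. ennreal (cmod (s i x - f x))) ----> ennreal (cmod (f x - f x))" for x
    using lim.hyps(2)[of x] by (intro tendsto_ennrealI tendsto_intros) auto
   then show "AE x in lborel. (\<lambda>i. ennreal (cmod (s i x - f x))) ----> 0" by simp
  qed measurable
  then have "(\<lambda>i. NN x. ennreal (cmod (s i x - f x))) ----> 0" by simp
  from order_tendstoD(2)[OF this, of "ennreal (e/3)"] e3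
  have "\<forall>\<^sub>F i in sequentially. (NN x. ennreal (cmod (s i x - f x))) < ennreal (e/3)" by simp
  then obtain i where i: "(NN x. ennreal (cmod (s i x - f x))) < ennreal (e/3)"
   unfolding eventually_sequentially by blast
  obtain d where d: "d > 0" "\<And>a. norm a < d ==> (NN x. ennreal (cmod (s i (x + a) - s i x))) <= ennreal (e/3)" using lim.IH[of i, rule_format, OF e3] by blast
  have "(NN x. ennreal (cmod (f (x + a) - f x))) <= ennreal e" if a: "norm a < d" for a
  proof -
   have "cmod (f (x + a) - f x) <= cmod (s i (x + a) - f (x + a)) + cmod (s i (x + a) - s i x) + cmod (s i x - f x)" for x
    using norm_triangle_ineq[of "f (x + a) - s i (x + a)" "(s i (x + a) - s i x) + (s i x - f x)"] norm_triangle_ineq[of "s i (x + a) - s i x" "s i x - f x"]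
    by (simp add: norm_minus_commute algebra_simps)
   then have "(NN x. ennreal (cmod (f (x + a) - f x)))
    <= (NN x. ennreal (cmod (s i (x + a) - f (x + a))) + ennreal (cmod (s i (x + a) - s i x)) + ennreal (cmod (s i x - f x)))"
    by (intro nn_integral_mono) (simp add: ennreal_plus[symmetric] del: ennreal_plus)
   also have "... = (NN x. ennreal (cmod (s i (x + a) - f (x + a)))) + (NN x. ennreal (cmod (s i (x + a) - s i x))) + (NN x. ennreal (cmod (s i x - f x)))"
    by (subst nn_integral_add, measurable, subst nn_integral_add, measurable)
   also have "(NN x. ennreal (cmod (s i (x + a) - f (x + a)))) = (NN x. ennreal (cmod (s i x - f x)))"
    by (rule nn_integral_lborel_shift[of "\<lambda>x. ennreal (cmod (s i x - f x))"]) measurable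
   also have "(NN x. ennreal (cmod (s i x - f x))) + (NN x. ennreal (cmod (s i (x + a) - s i x))) + (NN x. ennreal (cmod (s i x - f x)))
     <= ennreal (e/3) + ennreal (e/3) + ennreal (e/3)"
    using i by (intro add_mono d(2) a less_imp_le)
   also have "... = ennreal e" using e by (simp add: ennreal_plus[symmetric] del: ennreal_plus)
   finally show ?thesis .
  qed
  then show "\<exists>d>0. \<forall>a. norm a < d \<longrightarrow> (NN x. ennreal (cmod (f (x + a) - f x))) <= ennreal e" using d(1) by blast
 qed
qed

lemma (in mollifier) mol_L1:
 assumes h: "integrable lborel h"
  and e: "\<And>k. norm k <= r ==> (NN x. ennreal (cmod (h (x + k) - h x))) <= ennreal e"
 shows "(NN z. ennreal (cmod (mol \<phi> h z - h z))) <= ennreal e"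
proof -
 have [measurable]: "h \<in> \<B>" using h by auto
 obtain B where B: "B >= 0" "\<And>x. \<bar>\<phi> x\<bar> <= B*iball r x" using phi_bound by blast
 have B': "\<bar>\<phi> x\<bar> <= B" for x using B(2)[of x] B(1) by (cases "norm x <= r") (auto simp: iball_def)
 have hi: "integrable lborel (\<lambda>y. h y * of_real (\<phi> (y - z)))" for z
 proof (rule Bochner_Integration.integrable_bound)
  show "integrable lborel (\<lambda>y. B*norm (h y))" by (intro integrable_mult_right integrable_norm h)
  have "cmod (h y)*\<bar>\<phi> (y - z)\<bar> <= cmod (h y)*B" for y by (intro mult_left_mono B') simp
  then show "AE y in lborel. norm (h y * of_real (\<phi> (y - z))) <= norm (B*norm (h y))"
   using B(1) by (simp add: norm_mult mult.commute)
 qed measurable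
 have "ennreal (cmod (mol \<phi> h z - h z)) <= (NN k. ennreal (cmod (h (k + z) - h z)*\<phi> k))" for z
 proof -
  have zi: "integrable lborel (\<lambda>y. h z * of_real (\<phi> (y - z)))"
   by (intro integrable_mult_right integrable_of_real phi_shift_integrable)
  have "h z = (LBINT y. h z * of_real (\<phi> (y - z)))"
   by (simp add: phi_shift_integrable)
  then have "mol \<phi> h z - h z = (LBINT y. h y * of_real (\<phi> (y - z)) - h z * of_real (\<phi> (y - z)))"
   unfolding mol_def by (subst Bochner_Integration.integral_diff[OF hi zi]) simp
  then have "ennreal (cmod (mol \<phi> h z - h z)) <= (NN y. ennreal (cmod (h y * of_real (\<phi> (y - z)) - h z * of_real (\<phi> (y - z)))))"
   by (simp only:) (intro integral_norm_bound_ennreal Bochner_Integration.integrable_diff hi zi)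
  also have "... = (NN y. ennreal (cmod (h y - h z)*\<phi> (y - z)))"
   using phi_nonneg by (simp add: left_diff_distrib[symmetric] norm_mult del: left_diff_distrib)
  also have "... = (NN k. ennreal (cmod (h (k + z) - h z)*\<phi> (k + z - z)))"
   by (rule nn_integral_lborel_shift[symmetric, of "\<lambda>y. ennreal (cmod (h y - h z)*\<phi> (y - z))"]) measurable
  finally show ?thesis by simp
 qed
 then have "(NN z. ennreal (cmod (mol \<phi> h z - h z))) <= (NN z. NN k. ennreal (cmod (h (k + z) - h z)*\<phi> k))"
  by (intro nn_integral_mono)
 also have "... = (NN k. NN z. ennreal (cmod (h (k + z) - h z)*\<phi> k))"
  by (rule lborel_pair.Fubini') measurable
 also have "... <= (NN k. ennreal e*ennreal (\<phi> k))"
 proof (intro nn_integral_mono)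
  fix k
  have "(NN z. ennreal (cmod (h (k + z) - h z)*\<phi> k)) = (NN z. ennreal (cmod (h (z + k) - h z)))*ennreal (\<phi> k)"
   using phi_nonneg by (subst nn_integral_multc[symmetric]) (auto simp: ennreal_mult add.commute)
  also have "... <= ennreal e*ennreal (\<phi> k)"
  proof (cases "norm k <= r")
   case True
   then show ?thesis by (intro mult_right_mono e) auto
  qed (use phi_supp[of k] in simp)
  finally show "(NN z. ennreal (cmod (h (k + z) - h z)*\<phi> k)) <= ennreal e*ennreal (\<phi> k)" .
 qed
 also have "... = ennreal e" by (subst nn_integral_cmult) (auto simp: phi_nn)
 finally show ?thesis .
qed

text \<open>Continuity of translations is known in \<open>L^1\<close>, whereas \<open>u\<close> is
  in \<open>L^2\<close>. Cutting \<open>u\<close> at radius \<open>R + 1\<close> makes it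
  integrable, and for \<open>r <= 1\<close> the mollification inside radius \<open>R\<close> does
  not see the cut.\<close>

lemma (in mollifier) mol_localize:
 assumes "norm z <= R" "r <= 1"
 shows "mol \<phi> (\<lambda>y. u y * of_real (iball (R + 1) y)) z = mol \<phi> u z"
 unfolding mol_def
proof (intro Bochner_Integration.integral_cong)
 fix y
 show "u y * of_real (iball (R + 1) y) * of_real (\<phi> (y - z)) = u y * of_real (\<phi> (y - z))"
 proof (cases "norm (y - z) <= r")
  case True
  then have "norm y <= R + 1" using assms norm_triangle_ineq[of z "y - z"] by simp
  then show ?thesis by (simp add: iball_def)
 qed (use phi_supp[of "y - z"] in simp)
qed simp

lemma mol_local_approx:
 assumes [measurable]: "u \<in> \<B>" and u: "integrable lborel (\<lambda>x. (cmod (u x))^2)" and e: "e > 0"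
 shows "\<exists>r \<phi> \<phi>'. mollifier r \<phi> \<phi>' \<and> r < e \<and> (NN z. ennreal (norm (of_real (iball R z)*(mol \<phi> u z - u z)))) <= ennreal e"
proof -
 define h where "h = (\<lambda>y. u y*complex_of_real (iball (R + 1) y))"
 have [measurable]: "h \<in> \<B>" unfolding h_def by measurable
 have hi: "integrable lborel h" unfolding h_def
  by (rule integrable_L2_mult[OF _ _ u, of _ 1 "R + 1"]) (auto simp: iball_nonneg)
 obtain d where d: "d > 0" "\<forall>a. norm a < d \<longrightarrow> (NN x. ennreal (cmod (h (x + a) - h x))) <= ennreal e"
  using L1_shift_small[OF hi, rule_format, OF e] by blast
 define r where "r = min (min (d/2) (e/2)) 1"
 have rr: "r > 0" "r < d" "r < e" "r <= 1" using d(1) e by (auto simp: r_def min_def)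
 obtain \<phi> \<phi>' where m: "mollifier r \<phi> \<phi>'" using mollifier_exists[OF rr(1)] by blast
 interpret mollifier r \<phi> \<phi>' by (rule m)
 have "(NN z. ennreal (norm (of_real (iball R z)*(mol \<phi> u z - u z)))) <= (NN z. ennreal (cmod (mol \<phi> h z - h z)))"
 proof (intro nn_integral_mono ennreal_leI)
  fix z
  show "norm (of_real (iball R z)*(mol \<phi> u z - u z)) <= cmod (mol \<phi> h z - h z)"
  proof (cases "norm z <= R")
   case True
   have "mol \<phi> h z = mol \<phi> u z" unfolding h_def by (rule mol_localize[OF True rr(4)])
   moreover have "h z = u z" using True by (simp add: h_def iball_def)
   ultimately show ?thesis using True by (simp add: iball_def)
  qed (simp add: iball_def)
 qed
 also have "... <= ennreal e" using d(2) rr by (intro mol_L1 hi) auto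
 finally show ?thesis using m rr(3) by blast
qed

text \<open>The \<open>n\<close>-th mollifier is close to \<open>u\<close> within
  \<open>1 / (n + 1)\<close> in \<open>L^1\<close> of the disc of radius \<open>n\<close>. A
  subsequence of the localised errors tends to 0 almost everywhere, and every point is eventually
  inside the discs.\<close>

lemma mollifier_sequence:
 assumes [measurable]: "u \<in> \<B>" and u: "integrable lborel (\<lambda>x. (cmod (u x))^2)"
 shows "\<exists>r \<phi> \<phi>'. (\<forall>n::nat. mollifier (r n) (\<phi> n) (\<phi>' n)) \<and> r ----> 0 \<and> (AE x in lborel. (\<lambda>n. mol (\<phi> n) u x) ----> u x)"
proof -
 have "\<forall>n::nat. \<exists>q. mollifier (fst q) (fst (snd q)) (snd (snd q)) \<and> fst q < 1/Suc n
  \<and> (NN z. ennreal (norm (of_real (iball n z)*(mol (fst (snd q)) u z - u z)))) <= ennreal (1/Suc n)"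
 proof
  fix n :: nat
  have "1/real (Suc n) > 0" by simp
  from mol_local_approx[OF assms(1) u this, of n] obtain r \<phi> \<phi>' where
   "mollifier r \<phi> \<phi>' \<and> r < 1/Suc n \<and> (NN z. ennreal (norm (of_real (iball n z)*(mol \<phi> u z - u z)))) <= ennreal (1/Suc n)"
   by blast
  then show "\<exists>q. mollifier (fst q) (fst (snd q)) (snd (snd q)) \<and> fst q < 1/Suc n
  \<and> (NN z. ennreal (norm (of_real (iball n z)*(mol (fst (snd q)) u z - u z)))) <= ennreal (1/Suc n)"
   by (intro exI[of _ "(r, \<phi>, \<phi>')"]) simp
 qed
 from choice[OF this] obtain q where q: "\<forall>n::nat. mollifier (fst (q n)) (fst (snd (q n))) (snd (snd (q n))) \<and> fst (q n) < 1/Suc n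
  \<and> (NN z. ennreal (norm (of_real (iball n z)*(mol (fst (snd (q n))) u z - u z)))) <= ennreal (1/Suc n)" ..
 define r where "r = (\<lambda>n. fst (q n))"
 define \<phi> where "\<phi> = (\<lambda>n. fst (snd (q n)))"
 define \<phi>' where "\<phi>' = (\<lambda>n. snd (snd (q n)))"
 define F where "F = (\<lambda>n::nat. \<lambda>z. complex_of_real (iball n z)*(mol (\<phi> n) u z - u z))"
 have m: "mollifier (r n) (\<phi> n) (\<phi>' n)" and rn: "r n < 1/Suc n"
  and small: "(NN z. ennreal (norm (F n z))) <= ennreal (1/Suc n)" for n
  using q[rule_format, of n] by (auto simp: r_def \<phi>_def \<phi>'_def F_def)
 have lim1: "(\<lambda>n. 1/real (Suc n)) ----> 0" by (rule LIMSEQ_Suc[OF lim_1_over_n])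
 have "r n > 0" for n using mollifier.r[OF m] .
 then have r0: "r ----> 0"
  by (intro tendsto_sandwich[OF _ _ tendsto_const lim1]) (use rn less_imp_le in \<open>auto intro!: always_eventually\<close>)
 have [measurable]: "\<phi> n \<in> \<B>" for n by (rule mollifier.phi_measurable(1)[OF m])
 have [measurable]: "F n \<in> \<B>" for n unfolding F_def by measurable
 have Fi: "integrable lborel (F n)" for n
  by (rule integrableI_bounded) (use le_less_trans[OF small ennreal_less_top] in auto)
 have "(\<lambda>n. LBINT x. norm (F n x)) ----> 0"
 proof (rule tendsto_sandwich[OF _ _ tendsto_const lim1]; rule always_eventually, rule allI)
  fix n
  show "0 <= (LBINT x. norm (F n x))" by (rule integral_nonneg_AE) simp
  have eq: "ennreal (LBINT x. norm (F n x)) = (NN z. ennreal (norm (F n z)))"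
   by (intro nn_integral_eq_integral[symmetric] integrable_norm Fi) simp
  show "(LBINT x. norm (F n x)) <= 1/real (Suc n)"
   using small[of n] unfolding eq[symmetric] by (subst (asm) ennreal_le_iff) auto
 qed
 from tendsto_L1_AE_subseq[OF Fi this] obtain s where s: "strict_mono s" "AE x in lborel. (\<lambda>n. F (s n) x) ----> 0" by blast
 have "(\<lambda>n. mol (\<phi> (s n)) u x) ----> u x" if x: "(\<lambda>n. F (s n) x) ----> 0" for x
 proof -
  obtain K :: nat where K: "norm x <= real K" using real_arch_simple by blast
  have "\<forall>\<^sub>F n in sequentially. F (s n) x = mol (\<phi> (s n)) u x - u x"
   unfolding eventually_sequentially
  proof (intro exI[of _ K] allI impI)
   fix n assume "K <= n"
   then have "K <= s n" using seq_suble[OF s(1), of n] by simp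
   then have "norm x <= real (s n)" using K by linarith
   then show "F (s n) x = mol (\<phi> (s n)) u x - u x" by (simp add: F_def iball_def)
  qed
  with x have "(\<lambda>n. mol (\<phi> (s n)) u x - u x) ----> 0" by (rule Lim_transform_eventually)
  then show ?thesis by (simp add: LIM_zero_iff)
 qed
 with s(2) have "AE x in lborel. (\<lambda>n. mol (\<phi> (s n)) u x) ----> u x" by auto
 moreover have "(\<lambda>n. r (s n)) ----> 0" using LIMSEQ_subseq_LIMSEQ[OF r0 s(1)] by (simp add: o_def)
 ultimately show ?thesis using m
  by (intro exI[of _ "\<lambda>n. r (s n)"] exI[of _ "\<lambda>n. \<phi> (s n)"] exI[of _ "\<lambda>n. \<phi>' (s n)"]) auto
qed

section \<open>The inequality in the energy space\<close>

lemma ln_1_plus_dist_le: "ln (1 + norm (x - y)) <= ln (1 + norm x) + ln (1 + norm y)" for x y :: "'a::real_normed_vector"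
proof -
 have p: "1 + norm x > 0" "1 + norm y > 0" by (simp_all add: add_pos_nonneg)
 have "norm (x - y) <= norm x + norm y" by (rule norm_triangle_ineq4)
 moreover have "0 <= norm x*norm y" by simp
 ultimately have "1 + norm (x - y) <= (1 + norm x)*(1 + norm y)" unfolding distrib_left distrib_right mult_1_left mult_1_right by linarith
 then have "ln (1 + norm (x - y)) <= ln ((1 + norm x)*(1 + norm y))"
  by (subst ln_le_cancel_iff) (auto simp: add_pos_nonneg p)
 also have "... = ln (1 + norm x) + ln (1 + norm y)" using p by (intro ln_mult_pos)
 finally show ?thesis .
qed

lemma ln_1_plus_add_le: "ln (1 + a + b) <= ln (1 + a) + b" if "a >= 0" "b >= 0" for a b :: real
proof -
 have "ln (1 + a + b) - ln (1 + a) = ln ((1 + a + b)/(1 + a))" using that by (subst ln_div) auto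
 also have "... = ln (1 + b/(1 + a))" using that by (simp add: field_simps)
 also have "... <= b/(1 + a)" using that by (intro ln_add_one_self_le_self) auto
 also have "... <= b/1" using that by (intro divide_left_mono) auto
 finally show ?thesis by simp
qed

lemma log_energy_plus:
 fixes \<rho> :: "real^2 => real"
 assumes r0: "\<And>x. \<rho> x >= 0" and ri: "integrable lborel \<rho>" and rl: "integrable lborel (\<lambda>x. ln (1 + norm x)*\<rho> x)"
 shows "integrable lborel2 (\<lambda>p. ln (1 + norm (fst p - snd p))*(\<rho> (fst p)*\<rho> (snd p)))"
proof (rule Bochner_Integration.integrable_bound)
 have [measurable]: "\<rho> \<in> \<B>" using ri by auto
 show "integrable lborel2 (\<lambda>p. (ln (1 + norm (fst p))*\<rho> (fst p))*\<rho> (snd p) + \<rho> (fst p)*(ln (1 + norm (snd p))*\<rho> (snd p)))"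
  by (intro Bochner_Integration.integrable_add integrable_prod_mult[OF rl ri] integrable_prod_mult[OF ri rl])
 have "ln (1 + norm (x - y))*(\<rho> x*\<rho> y) <= (ln (1 + norm x)*\<rho> x)*\<rho> y + \<rho> x*(ln (1 + norm y)*\<rho> y)" for x y
  using mult_right_mono[OF ln_1_plus_dist_le[of x y], of "\<rho> x*\<rho> y"] r0 by (simp add: algebra_simps)
 then show "AE p in lborel2. norm (ln (1 + norm (fst p - snd p))*(\<rho> (fst p)*\<rho> (snd p)))
   <= norm ((ln (1 + norm (fst p))*\<rho> (fst p))*\<rho> (snd p) + \<rho> (fst p)*(ln (1 + norm (snd p))*\<rho> (snd p)))"
  using r0 by (intro AE_I2) (simp add: abs_mult)
 show "(\<lambda>p. ln (1 + norm (fst p - snd p))*(\<rho> (fst p)*\<rho> (snd p))) \<in> borel_measurable lborel2" by measurable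
qed

lemma integral_prod_self:
 fixes \<rho> :: "real^2 => real"
 assumes ri: "integrable lborel \<rho>"
 shows "(LINT p|lborel2. \<rho> (fst p)*\<rho> (snd p)) = (LBINT x. \<rho> x)^2"
 using lborel_pair.integral_fst'[OF integrable_prod_mult[OF ri ri]] by (simp add: power2_eq_square)

text \<open>The two variables are mollified one after the other. Each moves by at most
  \<open>r\<close>, so the kernel becomes at most \<open>ln (1 + |x - y| + 2 * r)\<close>, and the
  slope of \<open>ln\<close> beyond 1 is at most 1.\<close>

lemma (in mollifier) log_energy_mol_le:
 assumes [measurable]: "u \<in> \<B>" and u: "integrable lborel (\<lambda>x. (cmod (u x))^2)"
  and lu: "integrable lborel (\<lambda>x. ln (1 + norm x)*(cmod (u x))^2)"
 shows "(\<integral>\<^sup>+p. ennreal (ln (1 + norm (fst p - snd p))*((cmod (mol \<phi> u (fst p)))^2*(cmod (mol \<phi> u (snd p)))^2)) \<partial>lborel2)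
  <= ennreal ((LINT p|lborel2. ln (1 + norm (fst p - snd p))*((cmod (u (fst p)))^2*(cmod (u (snd p)))^2)) + 2*r*(LBINT x. (cmod (u x))^2)^2)"
proof -
 define m where "m = (\<lambda>x. ennreal ((cmod (mol \<phi> u x))^2))"
 define \<rho> where "\<rho> = (\<lambda>x. (cmod (u x))^2)"
 have [measurable]: "m \<in> \<B>" "\<rho> \<in> \<B>" unfolding m_def \<rho>_def by measurable
 have r0: "\<rho> x >= 0" for x by (simp add: \<rho>_def)
 define b where "b = (\<lambda>s x. NN y. ennreal (ln (1 + norm (x - y) + s))*ennreal (\<rho> y))"
 have [measurable]: "b s \<in> \<B>" for s unfolding b_def by measurable
 have "(\<integral>\<^sup>+p. ennreal (ln (1 + norm (fst p - snd p))*((cmod (mol \<phi> u (fst p)))^2*(cmod (mol \<phi> u (snd p)))^2)) \<partial>lborel2)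
  = (NN x. NN y. ennreal (ln (1 + norm (x - y))*((cmod (mol \<phi> u x))^2*(cmod (mol \<phi> u y))^2)))"
  by (subst lborel.nn_integral_fst[symmetric]) auto
 also have "... = (NN x. (NN y. ennreal (ln (1 + norm (x - y)))*m y)*m x)"
 proof (intro nn_integral_cong)
  fix x :: "real^2"
  have "ennreal (ln (1 + norm (x - y))*((cmod (mol \<phi> u x))^2*(cmod (mol \<phi> u y))^2)) = ennreal (ln (1 + norm (x - y)))*m y*m x" for y
   unfolding m_def by (simp add: ennreal_mult''[symmetric] mult_ac)
  then show "(NN y. ennreal (ln (1 + norm (x - y))*((cmod (mol \<phi> u x))^2*(cmod (mol \<phi> u y))^2))) = (NN y. ennreal (ln (1 + norm (x - y)))*m y)*m x"
   by (simp only:) (rule nn_integral_multc, measurable)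
 qed
 also have "... <= (NN x. b r x*m x)"
 proof (intro nn_integral_mono mult_right_mono)
  fix x :: "real^2"
  show "(NN y. ennreal (ln (1 + norm (x - y)))*m y) <= b r x"
   unfolding b_def m_def \<rho>_def
  proof (rule mol_conv_le)
   fix z y :: "real^2" assume "norm (y - z) <= r"
   then have "norm (x - z) <= norm (x - y) + r" using norm_triangle_ineq[of "x - y" "y - z"] by simp
   then show "ennreal (ln (1 + norm (x - z))) <= ennreal (ln (1 + norm (x - y) + r))"
    using r norm_ge_zero[of "x - z"] norm_ge_zero[of "x - y"] by (intro ennreal_leI) (subst ln_le_cancel_iff; linarith)
  qed measurable
 qed simp
 also have "... <= (NN x. b (2*r) x*ennreal (\<rho> x))"
  unfolding m_def \<rho>_def
 proof (rule mol_conv_le)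
  fix x y :: "real^2" assume xy: "norm (y - x) <= r"
  show "b r x <= b (2*r) y" unfolding b_def
  proof (intro nn_integral_mono mult_right_mono)
   fix z :: "real^2"
   have "norm (x - z) <= norm (y - z) + r" using xy norm_triangle_ineq[of "x - y" "y - z"] by (simp add: norm_minus_commute)
   then show "ennreal (ln (1 + norm (x - z) + r)) <= ennreal (ln (1 + norm (y - z) + 2*r))"
    using r norm_ge_zero[of "x - z"] norm_ge_zero[of "y - z"] by (intro ennreal_leI) (subst ln_le_cancel_iff; linarith)
  qed simp
 qed measurable
 also have "... = (NN x. (NN y. ennreal (ln (1 + norm (x - y) + 2*r))*ennreal (\<rho> y)*ennreal (\<rho> x)))"
  unfolding b_def by (intro nn_integral_cong nn_integral_multc[symmetric]) measurable
 also have "... <= (NN x. (NN y. ennreal (ln (1 + norm (x - y))*(\<rho> x*\<rho> y) + 2*r*(\<rho> x*\<rho> y))))"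
 proof (intro nn_integral_mono)
  fix x y :: "real^2"
  have "ln (1 + norm (x - y) + 2*r)*(\<rho> y*\<rho> x) <= (ln (1 + norm (x - y)) + 2*r)*(\<rho> y*\<rho> x)"
   using r r0 by (intro mult_right_mono ln_1_plus_add_le) auto
  then show "ennreal (ln (1 + norm (x - y) + 2*r))*ennreal (\<rho> y)*ennreal (\<rho> x) <= ennreal (ln (1 + norm (x - y))*(\<rho> x*\<rho> y) + 2*r*(\<rho> x*\<rho> y))"
   by (simp only: ennreal_mult''[OF r0, symmetric] mult.assoc) (intro ennreal_leI, simp add: algebra_simps)
 qed
 also have "... = (\<integral>\<^sup>+p. ennreal (ln (1 + norm (fst p - snd p))*(\<rho> (fst p)*\<rho> (snd p)) + 2*r*(\<rho> (fst p)*\<rho> (snd p))) \<partial>lborel2)"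
  by (subst lborel.nn_integral_fst[symmetric]) auto
 also have "... = ennreal (LINT p|lborel2. ln (1 + norm (fst p - snd p))*(\<rho> (fst p)*\<rho> (snd p)) + 2*r*(\<rho> (fst p)*\<rho> (snd p)))"
  using r r0 u lu unfolding \<rho>_def
  by (intro nn_integral_eq_integral Bochner_Integration.integrable_add integrable_mult_right log_energy_plus integrable_prod_mult[of "\<lambda>x. (cmod (u x))^2" "\<lambda>x. (cmod (u x))^2"]) auto
 also have "(LINT p|lborel2. ln (1 + norm (fst p - snd p))*(\<rho> (fst p)*\<rho> (snd p)) + 2*r*(\<rho> (fst p)*\<rho> (snd p)))
  = (LINT p|lborel2. ln (1 + norm (fst p - snd p))*(\<rho> (fst p)*\<rho> (snd p))) + 2*r*(LBINT x. \<rho> x)^2"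
  using u lu r0 unfolding \<rho>_def
  by (subst Bochner_Integration.integral_add)
   (auto intro!: log_energy_plus integrable_mult_right integrable_prod_mult[of "\<lambda>x. (cmod (u x))^2" "\<lambda>x. (cmod (u x))^2"] simp: integral_prod_self[of "\<lambda>x. (cmod (u x))^2"])
 finally show ?thesis unfolding \<rho>_def .
qed

text \<open>Writes the sign-changing kernel as a difference of two nonnegative ones: a singular
  part, to which Fatou applies, and a part of logarithmic growth, integrable by the weight in the
  energy space.\<close>

lemma ln_split: "ln (1 + 1/d) = - ln d + ln (1 + d)" if "d > 0" for d :: real
proof -
 have "1 + 1/d = (1 + d)/d" using that by (simp add: field_simps)
 then show ?thesis using that by (simp add: ln_div)
qed


text \<open>\<open>v\<close> is a contraction of \<open>mol \<phi> u\<close>, so its nonlocal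
  Dirichlet energies are no larger, and by \<open>mol_decay\<close> its support is bounded; hence
  the inequality for nice functions applies. Adding the part \<open>ln (1 + |x - y|)\<close>,
  bounded by that of the untruncated \<open>u\<close>, turns the kernel \<open>- ln |x - y|\<close>
  into the singular nonnegative one.\<close>

lemma (in mollifier) truncated_inequality:
 assumes [measurable]: "u \<in> \<B>" and u: "integrable lborel (\<lambda>x. (cmod (u x))^2)"
  and lu: "integrable lborel (\<lambda>x. ln (1 + norm x)*(cmod (u x))^2)"
  and wg: "weak_gradient g u" and g: "\<And>i. integrable lborel (\<lambda>x. (cmod (g i x))^2)"
  and t: "t > 0" and T: "(LBINT x. (\<Sum>i\<in>UNIV. (cmod (g i x))^2)) <= T" "T > 0"
  and v: "v = (\<lambda>x. max 0 (cmod (mol \<phi> u x) - t))" and lam: "lam = (LBINT x. (v x)^2)" "lam > 0"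
  and X: "X = (LINT p|lborel2. ln (1 + norm (fst p - snd p))*((cmod (u (fst p)))^2*(cmod (u (snd p)))^2))
    + 2*r*(LBINT x. (cmod (u x))^2)^2
    + lam^2*(ln (8*pi*T/(N_const*lam))/2 - 2*pi*((I_const + 1)/N_const - 1/(8*pi)))"
 shows "(\<integral>\<^sup>+p. ennreal (ln (1 + 1/norm (fst p - snd p))*((v (fst p))^2*(v (snd p))^2)) \<partial>lborel2) <= ennreal X"
  and "0 <= X"
proof -
 define w where "w = mol \<phi> u"
 have [measurable]: "w \<in> \<B>" unfolding w_def by measurable
 have vw: "v x = max 0 (cmod (w x) - t)" for x by (simp add: v w_def)
 have [measurable]: "v \<in> \<B>" unfolding vw[abs_def] by measurable
 have v0: "v x >= 0" for x by (simp add: vw)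
 have vdiff: "\<bar>v x - v y\<bar> <= cmod (w x - w y)" for x y
  using norm_triangle_ineq2[of "w x" "w y"] norm_triangle_ineq2[of "w y" "w x"] by (auto simp: vw norm_minus_commute max_def)
 have v_le: "(v x)^2 <= (cmod (w x))^2" for x using t by (intro power_mono) (auto simp: vw)
 have lg: "(NN x. ennreal (ln (1 + norm x)*(cmod (u x))^2)) < \<infinity>"
  using lu by (subst nn_integral_eq_integral) auto
 obtain L where L: "L >= 0" "\<And>x y. cmod (w x - w y) <= L*norm (x - y)" using mol_lipschitz[OF assms(1) u] unfolding w_def by blast
 obtain R where R: "R >= 0" "\<And>z. norm z > R ==> cmod (w z) <= t" using mol_decay[OF assms(1) lg t] unfolding w_def by blast
 have nice: "nice L R v" unfolding nice_def
  using v0 order_trans[OF vdiff L(2)] R(2) by (auto simp: vw)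
 have EE: "EE e v <= ennreal (c1*e^4*T)" if e: "e > 0" for e
 proof -
  have "EE e v <= EE e w" unfolding EE_def
  proof (intro nn_integral_mono ennreal_leI mult_left_mono power_mono)
   fix x y show "norm (v x - v y) <= norm (w x - w y)" using vdiff by simp
  qed auto
  also have "... <= ennreal (c1*e^4*(LBINT x. (\<Sum>i\<in>UNIV. (cmod (g i x))^2)))"
   unfolding w_def by (rule mol_EE[OF assms(1) u wg g e])
  also have "... <= ennreal (c1*e^4*T)"
   using c1_pos e by (intro ennreal_leI mult_left_mono T) auto
  finally show ?thesis .
 qed
 define fN where "fN = (\<lambda>p::(real^2)\<times>(real^2). - ln (norm (fst p - snd p))*((v (fst p))^2*(v (snd p))^2))"
 define fP where "fP = (\<lambda>p::(real^2)\<times>(real^2). ln (1 + norm (fst p - snd p))*((v (fst p))^2*(v (snd p))^2))"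
 define fS where "fS = (\<lambda>p::(real^2)\<times>(real^2). ln (1 + 1/norm (fst p - snd p))*((v (fst p))^2*(v (snd p))^2))"
 have [measurable]: "fN \<in> borel_measurable (borel \<Otimes>\<^sub>M borel)" "fP \<in> borel_measurable (borel \<Otimes>\<^sub>M borel)" "fS \<in> borel_measurable (borel \<Otimes>\<^sub>M borel)"
  unfolding fN_def fP_def fS_def by measurable
 have J: "(LINT p|lborel2. fN p) <= lam^2*(ln (8*pi*T/(N_const*lam))/2 - 2*pi*((I_const + 1)/N_const - 1/(8*pi)))"
  using nice_inequality[OF nice L(1) R(1) lam EE T(2)] unfolding Jker_def fN_def .
 have iN: "integrable lborel2 fN"
 proof -
  have "\<bar>(v x)\<^sup>2\<bar> <= (L*(2*R + 1))^2*iball R x" for x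
  proof -
   have "\<bar>v x\<bar>\<^sup>2 <= (L*(2*R + 1)*indicator (cball 0 R) x)^2" by (rule power_mono[OF nice_bound[OF nice L(1) R(1)] abs_ge_zero])
   then show ?thesis by (auto simp: iball_def indicator_def)
  qed
  then show ?thesis unfolding fN_def by (intro Jker_integrable[OF okker_ln, of "\<lambda>x. (v x)^2"]) measurable
 qed
 define Y where "Y = (LINT p|lborel2. ln (1 + norm (fst p - snd p))*((cmod (u (fst p)))^2*(cmod (u (snd p)))^2))
    + 2*r*(LBINT x. (cmod (u x))^2)^2"
 have Y0: "Y >= 0" unfolding Y_def using r by (intro add_nonneg_nonneg integral_nonneg_AE) auto
 have P0: "fP p >= 0" and S0: "fS p >= 0" for p by (auto simp: fP_def fS_def)
 have nP: "(\<integral>\<^sup>+p. ennreal (fP p) \<partial>lborel2) <= ennreal Y"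
 proof -
  have "(\<integral>\<^sup>+p. ennreal (fP p) \<partial>lborel2) <= (\<integral>\<^sup>+p. ennreal (ln (1 + norm (fst p - snd p))*((cmod (w (fst p)))^2*(cmod (w (snd p)))^2)) \<partial>lborel2)"
   unfolding fP_def by (intro nn_integral_mono ennreal_leI mult_left_mono mult_mono v_le) auto
  also have "... <= ennreal Y" unfolding w_def Y_def by (rule log_energy_mol_le[OF assms(1) u lu])
  finally show ?thesis .
 qed
 have iP: "integrable lborel2 fP"
  using le_less_trans[OF nP ennreal_less_top] P0 by (intro integrableI_nonneg) auto
 have PY: "(LINT p|lborel2. fP p) <= Y"
  using nP nn_integral_eq_integral[OF iP] P0 Y0 by simp
 have "AE p in lborel2. snd p \<noteq> (fst p :: real^2)" by (rule AE_pair_neq[of "\<lambda>x. x"]) simp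
 then have ae: "AE p in lborel2. fN p + fP p = fS p"
 proof eventually_elim
  case (elim p)
  then have "norm (fst p - snd p) > 0" by auto
  then show ?case unfolding fN_def fP_def fS_def by (simp add: ln_split algebra_simps)
 qed
 have iS: "integrable lborel2 fS"
  by (rule integrable_cong_AE_imp[OF Bochner_Integration.integrable_add[OF iN iP] _ ae]) measurable
 have "(LINT p|lborel2. fS p) = (LINT p|lborel2. fN p + fP p)"
  by (rule integral_cong_AE) (use ae in \<open>auto elim: eventually_mono\<close>)
 also have "... = (LINT p|lborel2. fN p) + (LINT p|lborel2. fP p)"
  by (rule Bochner_Integration.integral_add[OF iN iP])
 also have "... <= X" using J PY unfolding X Y_def by linarith
 finally have SX: "(LINT p|lborel2. fS p) <= X" .
 have "(\<integral>\<^sup>+p. ennreal (fS p) \<partial>lborel2) = ennreal (LINT p|lborel2. fS p)"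
  using S0 by (intro nn_integral_eq_integral iS) auto
 also have "... <= ennreal X" by (rule ennreal_leI[OF SX])
 finally show "(\<integral>\<^sup>+p. ennreal (ln (1 + 1/norm (fst p - snd p))*((v (fst p))^2*(v (snd p))^2)) \<partial>lborel2) <= ennreal X"
  unfolding fS_def .
 have "0 <= (LINT p|lborel2. fS p)" using S0 by (intro integral_nonneg_AE) auto
 then show "0 <= X" using SX by linarith
qed

lemma AE_pair_fst_snd:
 fixes P :: "real^2 => bool"
 assumes "AE x in lborel. P x"
 shows "AE p in lborel \<Otimes>\<^sub>M (lborel :: (real^2) measure). P (fst p)" "AE p in (lborel :: (real^2) measure) \<Otimes>\<^sub>M lborel. P (snd p)"
proof -
 obtain N where N: "N \<in> null_sets lborel" "{x. \<not> P x} \<subseteq> N"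
  using assms by (auto simp: eventually_ae_filter)
 have [measurable]: "N \<in> sets borel" using N(1) by auto
 have ae: "AE x in lborel. x \<notin> N" using AE_not_in[OF N(1)] .
 have "AE p in lborel \<Otimes>\<^sub>M (lborel :: (real^2) measure). fst p \<notin> N"
  by (rule lborel_pair.AE_pair_measure, measurable) (use ae in auto)
 then show "AE p in lborel \<Otimes>\<^sub>M (lborel :: (real^2) measure). P (fst p)" by eventually_elim (use N(2) in auto)
 have "AE p in (lborel :: (real^2) measure) \<Otimes>\<^sub>M lborel. snd p \<notin> N"
  by (rule lborel_pair.AE_pair_measure, measurable) (use ae in auto)
 then show "AE p in (lborel :: (real^2) measure) \<Otimes>\<^sub>M lborel. P (snd p)" by eventually_elim (use N(2) in auto)
qed

text \<open>\<open>T\<close> is an upper bound for the Dirichlet integral rather than its value, so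
  that it can be varied when that integral might vanish. The claim \<open>0 <= X\<close> is recorded
  separately because \<open>ennreal X\<close> hides the sign.\<close>

theorem log_energy_inequality:
 fixes u :: "real^2 => complex"
 assumes [measurable]: "u \<in> \<B>" and u: "integrable lborel (\<lambda>x. (cmod (u x))^2)"
  and lu: "integrable lborel (\<lambda>x. ln (1 + norm x)*(cmod (u x))^2)"
  and wg: "weak_gradient g u" and g: "\<And>i. integrable lborel (\<lambda>x. (cmod (g i x))^2)"
  and T: "(LBINT x. (\<Sum>i\<in>UNIV. (cmod (g i x))^2)) <= T" "T > 0"
  and lam: "lam = (LBINT x. (cmod (u x))^2)" "lam > 0"
  and X: "X = (LINT p|lborel2. ln (1 + norm (fst p - snd p))*((cmod (u (fst p)))^2*(cmod (u (snd p)))^2))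
    + lam^2*(ln (8*pi*T/(N_const*lam))/2 - 2*pi*((I_const + 1)/N_const - 1/(8*pi)))"
 shows "(\<integral>\<^sup>+p. ennreal (ln (1 + 1/norm (fst p - snd p))*((cmod (u (fst p)))^2*(cmod (u (snd p)))^2)) \<partial>lborel2) <= ennreal X"
  and "0 <= X"
proof -
 have N: "N_const > 0" using profile_inequality by blast
 obtain r \<phi> \<phi>' where m: "\<And>n::nat. mollifier (r n) (\<phi> n) (\<phi>' n)" and r0: "r ----> 0"
  and conv: "AE x in lborel. (\<lambda>n. mol (\<phi> n) u x) ----> u x"
  using mollifier_sequence[OF assms(1) u] by blast
 define v where "v = (\<lambda>n::nat. \<lambda>x. max 0 (cmod (mol (\<phi> n) u x) - 1/Suc n))"
 have [measurable]: "\<phi> n \<in> \<B>" for n by (rule mollifier.phi_measurable(1)[OF m])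
 have [measurable]: "v n \<in> \<B>" for n unfolding v_def by measurable
 have vconv: "(\<lambda>n. v n x) ----> cmod (u x)" if "(\<lambda>n. mol (\<phi> n) u x) ----> u x" for x
 proof -
  have "(\<lambda>n. max 0 (cmod (mol (\<phi> n) u x) - 1/Suc n)) ----> max 0 (cmod (u x) - 0)"
   by (intro tendsto_max tendsto_diff tendsto_norm tendsto_const that LIMSEQ_Suc[OF lim_1_over_n])
  then show ?thesis by (simp add: v_def)
 qed
 define L where "L = (\<lambda>n. LBINT x. (v n x)^2)"
 have nL: "(NN x. ennreal ((v n x)^2)) <= ennreal lam" for n
 proof -
  have "(NN x. ennreal ((v n x)^2)) <= (NN x. 1*ennreal ((cmod (mol (\<phi> n) u x))^2))"
  proof (intro nn_integral_mono)
   fix x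
   have "(v n x)^2 <= (cmod (mol (\<phi> n) u x))^2" by (intro power_mono) (auto simp: v_def)
   then show "ennreal ((v n x)^2) <= 1*ennreal ((cmod (mol (\<phi> n) u x))^2)" by (simp add: ennreal_leI)
  qed
  also have "... <= (NN x. 1*ennreal ((cmod (u x))^2))" by (rule mollifier.mol_conv_le[OF m]) auto
  also have "... = ennreal lam" unfolding lam using u by (simp add: nn_integral_eq_integral)
  finally show ?thesis .
 qed
 have vi: "integrable lborel (\<lambda>x. (v n x)^2)" for n
  using le_less_trans[OF nL ennreal_less_top] by (intro integrableI_nonneg) auto
 have eL: "(NN x. ennreal ((v n x)^2)) = ennreal (L n)" for n
  unfolding L_def by (intro nn_integral_eq_integral vi) auto
 have L_le: "L n <= lam" for n using nL[of n] lam(2) unfolding eL by simp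
 have "ennreal lam = (NN x. ennreal ((cmod (u x))^2))" unfolding lam using u by (simp add: nn_integral_eq_integral)
 also have "... = (NN x. liminf (\<lambda>n. ennreal ((v n x)^2)))"
 proof (rule nn_integral_cong_AE)
  show "AE x in lborel. ennreal ((cmod (u x))^2) = liminf (\<lambda>n. ennreal ((v n x)^2))"
   using conv
  proof eventually_elim
   case (elim x)
   show ?case by (intro lim_imp_Liminf[symmetric] tendsto_ennrealI tendsto_power vconv elim) simp
  qed
 qed
 also have "... <= liminf (\<lambda>n. ennreal (L n))"
  unfolding eL[symmetric] by (rule nn_integral_liminf) measurable
 finally have Linf: "ennreal lam <= liminf (\<lambda>n. ennreal (L n))" .
 \<comment> \<open>Fatou bounds the limit inferior from below; that mollification and truncation do
   not raise the \<open>L^2\<close> norm bounds every \<open>L n\<close> from above.\<close>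
 have Lconv: "L ----> lam"
 proof -
  have "limsup (\<lambda>n. ennreal (L n)) <= ennreal lam"
   by (rule Limsup_bounded) (auto intro!: always_eventually ennreal_leI L_le)
  then have "(\<lambda>n. ennreal (L n)) ----> ennreal lam"
   using Linf Liminf_le_Limsup[of sequentially "\<lambda>n. ennreal (L n)"] by (intro Liminf_eq_Limsup antisym) auto
  moreover have "\<forall>\<^sub>F n in sequentially. 0 <= L n" by (rule always_eventually) (simp add: L_def integral_nonneg_AE)
  ultimately show ?thesis using lam(2) tendsto_ennreal_iff[of L sequentially lam] by simp
 qed
 define A where "A = (LINT p|lborel2. ln (1 + norm (fst p - snd p))*((cmod (u (fst p)))^2*(cmod (u (snd p)))^2))"
 define c where "c = 2*pi*((I_const + 1)/N_const - 1/(8*pi))"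
 define Y where "Y = (\<lambda>n. A + 2*r n*lam^2 + (L n)^2*(ln (8*pi*T/(N_const*L n))/2 - c))"
 have Yconv: "Y ----> X"
 proof -
  have "(\<lambda>n. A + 2*r n*lam^2 + (L n)^2*(ln (8*pi*T/(N_const*L n))/2 - c)) ----> A + 2*0*lam^2 + lam^2*(ln (8*pi*T/(N_const*lam))/2 - c)"
   using N lam(2) T(2) by (intro tendsto_intros r0 Lconv) auto
  then show ?thesis unfolding Y_def X A_def c_def by simp
 qed
 have Lpos: "\<forall>\<^sub>F n in sequentially. L n > 0" using order_tendstoD(1)[OF Lconv lam(2)] .
 define S where "S = (\<lambda>n. \<integral>\<^sup>+p. ennreal (ln (1 + 1/norm (fst p - snd p))*((v n (fst p))^2*(v n (snd p))^2)) \<partial>lborel2)"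
 have ev: "\<forall>\<^sub>F n in sequentially. S n <= ennreal (Y n) \<and> 0 <= Y n"
  using Lpos
 proof eventually_elim
  case (elim n)
  have n: "1/real (Suc n) > 0" by simp
  have vn: "v n = (\<lambda>x. max 0 (cmod (mol (\<phi> n) u x) - 1/Suc n))" by (simp add: v_def)
  have Ln: "L n = (LBINT x. (v n x)^2)" by (simp add: L_def)
  have Yn: "Y n = (LINT p|lborel2. ln (1 + norm (fst p - snd p))*((cmod (u (fst p)))^2*(cmod (u (snd p)))^2))
    + 2*r n*(LBINT x. (cmod (u x))^2)^2
    + (L n)^2*(ln (8*pi*T/(N_const*L n))/2 - 2*pi*((I_const + 1)/N_const - 1/(8*pi)))"
   unfolding Y_def A_def c_def lam(1) ..
  show ?case unfolding S_def
   using mollifier.truncated_inequality[OF m assms(1) u lu wg g n T vn Ln elim Yn] by blast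
 qed
 show "0 <= X" by (rule tendsto_lowerbound[OF Yconv]) (use ev in \<open>auto elim: eventually_mono\<close>)
 have "(\<integral>\<^sup>+p. ennreal (ln (1 + 1/norm (fst p - snd p))*((cmod (u (fst p)))^2*(cmod (u (snd p)))^2)) \<partial>lborel2)
  = (\<integral>\<^sup>+p. liminf (\<lambda>n. ennreal (ln (1 + 1/norm (fst p - snd p))*((v n (fst p))^2*(v n (snd p))^2))) \<partial>lborel2)"
 proof (rule nn_integral_cong_AE)
  have "AE p in lborel \<Otimes>\<^sub>M (lborel :: (real^2) measure). (\<lambda>n. mol (\<phi> n) u (fst p)) ----> u (fst p)"
   by (rule AE_pair_fst_snd(1)[OF conv])
  moreover have "AE p in (lborel :: (real^2) measure) \<Otimes>\<^sub>M lborel. (\<lambda>n. mol (\<phi> n) u (snd p)) ----> u (snd p)"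
   by (rule AE_pair_fst_snd(2)[OF conv])
  ultimately show "AE p in lborel2. ennreal (ln (1 + 1/norm (fst p - snd p))*((cmod (u (fst p)))^2*(cmod (u (snd p)))^2))
    = liminf (\<lambda>n. ennreal (ln (1 + 1/norm (fst p - snd p))*((v n (fst p))^2*(v n (snd p))^2)))"
  proof eventually_elim
   case (elim p)
   show ?case by (intro lim_imp_Liminf[symmetric] tendsto_ennrealI tendsto_mult tendsto_const tendsto_power vconv elim) simp
  qed
 qed
 also have "... <= liminf S" unfolding S_def by (rule nn_integral_liminf) measurable
 also have "... <= liminf (\<lambda>n. ennreal (Y n))" by (rule Liminf_mono) (use ev in \<open>auto elim: eventually_mono\<close>)
 also have "... = ennreal X" by (intro lim_imp_Liminf tendsto_ennrealI Yconv) simp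
 finally show "(\<integral>\<^sup>+p. ennreal (ln (1 + 1/norm (fst p - snd p))*((cmod (u (fst p)))^2*(cmod (u (snd p)))^2)) \<partial>lborel2) <= ennreal X" .
qed

theorem theorem4p1:
  fixes u :: "real^2 \<Rightarrow> complex" and g :: "2 \<Rightarrow> real^2 \<Rightarrow> complex"
  assumes meas: "u \<in> borel_measurable lborel"
    and grad: "weak_gradient g u"
    and fin: "(\<integral>\<^sup>+ x. ennreal ((\<Sum>i\<in>UNIV. (cmod (g i x))\<^sup>2) + (cmod (u x))\<^sup>2
                 + ln (1 + norm x) * (cmod (u x))\<^sup>2) \<partial>lborel) < \<infinity>"
    and nonzero: "\<not> (AE x in lborel. u x = 0)"
  shows "let lam = (LINT x|lborel. (cmod (u x))\<^sup>2);
             T = (LINT x|lborel. (\<Sum>i\<in>UNIV. (cmod (g i x))\<^sup>2));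
             V = (1 / (2 * pi)) * (LINT x|lborel. LINT y|lborel.
                    ln (norm (x - y)) * (cmod (u x))\<^sup>2 * (cmod (u y))\<^sup>2)
         in - V \<le> lam\<^sup>2 / (4 * pi) * ln (8 * pi * T / (N_const * lam))
                   - ((I_const + 1) / N_const - 1 / (8 * pi)) * lam\<^sup>2"
proof -
 have N: "N_const > 0" using profile_inequality by blast
 have [measurable]: "u \<in> \<B>" using meas by simp
 have [measurable]: "g i \<in> \<B>" for i using grad by (simp add: weak_gradient_def)
 define D where "D = (\<lambda>x. (\<Sum>i\<in>UNIV. (cmod (g i x))^2) + (cmod (u x))^2 + ln (1 + norm x)*(cmod (u x))^2)"
 have [measurable]: "D \<in> \<B>" unfolding D_def by measurable
 have D0: "D x >= 0" for x unfolding D_def by (intro add_nonneg_nonneg sum_nonneg mult_nonneg_nonneg) auto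
 have iD: "integrable lborel D" 
 proof (rule integrableI_nonneg)
  show "(NN x. ennreal (D x)) < \<infinity>" using fin by (simp add: D_def)
 qed (use D0 in auto)
 have ln0: "0 <= ln (1 + norm x)*(cmod (u x))^2" for x by simp
 have gs0: "0 <= (\<Sum>i\<in>UNIV. (cmod (g i x))^2)" for x by (intro sum_nonneg) simp
 have u: "integrable lborel (\<lambda>x. (cmod (u x))^2)"
  using ln0 gs0 D0 by (intro Bochner_Integration.integrable_bound[OF iD]) (auto simp: D_def)
 have lu: "integrable lborel (\<lambda>x. ln (1 + norm x)*(cmod (u x))^2)"
  using ln0 gs0 D0 by (intro Bochner_Integration.integrable_bound[OF iD]) (auto simp: D_def abs_mult)
 have g: "integrable lborel (\<lambda>x. (cmod (g i x))^2)" for i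
 proof (rule Bochner_Integration.integrable_bound[OF iD])
  have "(cmod (g i x))^2 <= D x" for x
  proof -
   have "(cmod (g i x))^2 <= (\<Sum>i\<in>UNIV. (cmod (g i x))^2)" by (rule member_le_sum) auto
   then show ?thesis unfolding D_def using ln0[of x] zero_le_power2[of "cmod (u x)"] by linarith
  qed
  then show "AE x in lborel. norm ((cmod (g i x))^2) <= norm (D x)" using D0 by simp
 qed measurable
 define lam where "lam = (LBINT x. (cmod (u x))^2)"
 define T where "T = (LBINT x. (\<Sum>i\<in>UNIV. (cmod (g i x))^2))"
 have "lam \<noteq> 0"
 proof
  assume "lam = 0"
  then have "AE x in lborel. (cmod (u x))^2 = 0"
   unfolding lam_def by (subst (asm) integral_nonneg_eq_0_iff_AE[OF u]) auto
  then show False using nonzero by simp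
 qed
 moreover have "lam >= 0" unfolding lam_def by (intro integral_nonneg_AE) simp
 ultimately have lam: "lam > 0" by simp
 have T0: "T >= 0" unfolding T_def using gs0 by (intro integral_nonneg_AE) auto
 define q where "q = (\<lambda>p. (cmod (u (fst p)))^2*(cmod (u (snd p)))^2)"
 have [measurable]: "q \<in> borel_measurable (borel \<Otimes>\<^sub>M borel)" unfolding q_def by measurable
 have q0: "q p >= 0" for p by (simp add: q_def)
 define A where "A = (LINT p|lborel2. ln (1 + norm (fst p - snd p))*q p)"
 define c where "c = (I_const + 1)/N_const - 1/(8*pi)"
 have main: "(\<integral>\<^sup>+p. ennreal (ln (1 + 1/norm (fst p - snd p))*q p) \<partial>lborel2) <= ennreal (A + lam^2*(ln (8*pi*t/(N_const*lam))/2 - 2*pi*c))"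
  "0 <= A + lam^2*(ln (8*pi*t/(N_const*lam))/2 - 2*pi*c)" if "T <= t" "t > 0" for t
  unfolding q_def A_def c_def
  using log_energy_inequality[OF _ u lu grad g that[unfolded T_def] lam_def lam refl] by simp_all
 have "T \<noteq> 0"
 proof
  assume "T = 0"
  \<comment> \<open>If the Dirichlet integral were 0, every positive number would be an admissible
    bound. This one makes the bracket equal to \<open>- A / lam^2 - 1\<close>, so the quantity that
    must be nonnegative would be \<open>- lam^2\<close>.\<close>
  define t where "t = N_const*lam/(8*pi)*exp (2*(2*pi*c - A/lam^2 - 1))"
  have t: "t > 0" using N lam by (simp add: t_def)
  have "8*pi*t/(N_const*lam) = exp (2*(2*pi*c - A/lam^2 - 1))" using N lam by (simp add: t_def)
  then have "ln (8*pi*t/(N_const*lam))/2 - 2*pi*c = - A/lam^2 - 1" by (simp only: ln_exp) (simp add: field_simps)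
  then have "0 <= A + lam^2*(- A/lam^2 - 1)" using main(2)[of t] t \<open>T = 0\<close> by simp
  then show False using lam by (simp add: right_diff_distrib)
 qed
 then have T: "T > 0" using T0 by simp
 define X where "X = A + lam^2*(ln (8*pi*T/(N_const*lam))/2 - 2*pi*c)"
 define fS where "fS = (\<lambda>p. ln (1 + 1/norm (fst p - snd p))*q p)"
 define fP where "fP = (\<lambda>p. ln (1 + norm (fst p - snd p))*q p)"
 have [measurable]: "fS \<in> borel_measurable (borel \<Otimes>\<^sub>M borel)" "fP \<in> borel_measurable (borel \<Otimes>\<^sub>M borel)" unfolding fS_def fP_def by measurable
 have S0: "fS p >= 0" for p by (simp add: fS_def q0)
 have nS: "(\<integral>\<^sup>+p. ennreal (fS p) \<partial>lborel2) <= ennreal X" unfolding fS_def X_def by (rule main(1)[OF order_refl T])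
 have X0: "X >= 0" unfolding X_def by (rule main(2)[OF order_refl T])
 have iS: "integrable lborel2 fS"
  using le_less_trans[OF nS ennreal_less_top] S0 by (intro integrableI_nonneg) auto
 have SX: "(LINT p|lborel2. fS p) <= X"
  using nS nn_integral_eq_integral[OF iS] S0 X0 by simp
 have iP: "integrable lborel2 fP" unfolding fP_def q_def by (rule log_energy_plus[OF _ u lu]) simp
 define fV where "fV = (\<lambda>p. ln (norm (fst p - snd p))*(cmod (u (fst p)))^2*(cmod (u (snd p)))^2)"
 have [measurable]: "fV \<in> borel_measurable (borel \<Otimes>\<^sub>M borel)" unfolding fV_def by measurable
 have "AE p in lborel2. snd p \<noteq> (fst p :: real^2)" by (rule AE_pair_neq[of "\<lambda>x. x"]) simp
 then have ae: "AE p in lborel2. fP p - fS p = fV p"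
 proof eventually_elim
  case (elim p)
  then have "norm (fst p - snd p) > 0" by auto
  then show ?case unfolding fV_def fP_def fS_def q_def by (simp add: ln_split algebra_simps)
 qed
 \<comment> \<open>Joint integrability makes the iterated integral in \<open>V\<close> a genuine
   one, equal to the integral over the product. On the diagonal, where \<open>ln 0 = 0\<close> would
   break the splitting, only a null set is affected.\<close>
 have iV: "integrable lborel2 fV"
  by (rule integrable_cong_AE_imp[OF Bochner_Integration.integrable_diff[OF iP iS] _ ae]) measurable
 have "(LBINT x. LBINT y. ln (norm (x - y))*(cmod (u x))^2*(cmod (u y))^2) = (LINT p|lborel2. fV p)"
  using lborel_pair.integral_fst'[OF iV] by (simp add: fV_def)
 also have "... = (LINT p|lborel2. fP p - fS p)"
  by (rule integral_cong_AE) (use ae in \<open>auto elim: eventually_mono\<close>)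
 also have "... = A - (LINT p|lborel2. fS p)"
  using Bochner_Integration.integral_diff[OF iP iS] by (simp add: A_def fP_def)
 finally have V: "(LBINT x. LBINT y. ln (norm (x - y))*(cmod (u x))^2*(cmod (u y))^2) >= A - X" using SX by simp
 have "- (1/(2*pi)*(LBINT x. LBINT y. ln (norm (x - y))*(cmod (u x))^2*(cmod (u y))^2)) <= - (1/(2*pi)*(A - X))"
  using V by (intro le_imp_neg_le mult_left_mono) auto
 also have "... = lam^2/(4*pi)*ln (8*pi*T/(N_const*lam)) - c*lam^2"
  unfolding X_def by (simp add: field_simps)
 finally show ?thesis unfolding Let_def lam_def T_def c_def .
qed

end
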